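(* Let $X$ be a diffeological space and $G$ a diffeological group. Then the nerve $N\mathsf{Prin}_G^{\infty}(X)$ of the category of $G$-principal $\infty$-bundles on $X$ and the nerve $N\mathsf{DiffPrin}_G(X)$ of the category of diffeological principal $G$-bundles on $X$ are weakly homotopy equivalent: $$N\mathsf{Prin}_G^{\infty}(X)\simeq N\mathsf{DiffPrin}_G(X).$$
   Context: Diffeology. A cartesian space is a smooth manifold diffeomorphic to $\mathbb{R}^n$ for some $n\ge 0$; $\mathsf{Cart}$ is the category of cartesian spaces and smooth maps. A good open cover of a manifold is an open cover $\{U_i\}$ by cartesian spaces all of whose finite non-empty intersections are cartesian spaces. A diffeological space is a set $X$ with a collection of functions $p:U\to X$, $U\in\mathsf{Cart}$, called plots, such that (1) every map $\mathbb{R}^0\to X$ is a plot; (2) if $p:U\to X$ is a plot and $f:V\to U$ is smooth, then $pf$ is a plot; (3) if $\{U_i\subseteq U\}$ is a good open cover of a cartesian space $U$ and $p:U\to X$ is a function such that $p|_{U_i}$ is a plot for every $i$, then $p$ is a plot. A function $f:X\to Y$ between diffeological spaces is smooth if $fp$ is a plot of $Y$ for every plot $p$ of $X$; a diffeomorphism is an isomorphism for smooth maps. Limits are formed on underlying sets, a function from a cartesian space into a limit being a plot iff all its components are. A subduction is a surjective smooth map $\pi:P\to X$ such that for every plot $p:U\to X$ there are a good open cover $\{U_i\subseteq U\}$ and plots $p_i:U_i\to P$ with $\pi p_i=p|_{U_i}$. A diffeological group is a group with a diffeology for which multiplication and inversion are smooth. Diffeological principal bundles. A diffeological principal $G$-bundle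 over $X$ is a subduction $\pi:P\to X$, with $P$ carrying a smooth right $G$-action, such that $(p,g)\mapsto(p,p\cdot g)$ is a diffeomorphism $P\times G\to P\times_X P$. Morphisms are $G$-equivariant smooth maps over $X$. This gives the category $\mathsf{DiffPrin}_G(X)$ (a groupoid). Principal $\infty$-bundles. A simplicial presheaf is a functor $\mathsf{Cart}^{op}\to\mathsf{sSet}$. A diffeological space $X$ is regarded as the discrete simplicial presheaf sending $U$ to the discrete simplicial set on the set of plots $U\to X$; a diffeological group thereby becomes a presheaf of (discrete) simplicial groups. A map $f:A\to Y$ of simplicial presheaves is a local fibration if for every $U\in\mathsf{Cart}$ there exists a good open cover $\{U_i\subseteq U\}$ such that, for every member $U_i$ of the cover and every commutative square from a horn inclusion $\Lambda^n_k\hookrightarrow\Delta^n$ to $A(U)\to Y(U)$, the composite square to $A(U_i)\to Y(U_i)$ obtained by restriction has a lift $\Delta^n\to A(U_i)$. It is a local weak equivalence if, with $R$ a fibrant replacement functor on $\mathsf{sSet}$ applied objectwise, for every $U\in\mathsf{Cart}$ there exists a good open cover $\{U_i\subseteq U\}$ such that, for every member $U_i$ of the cover and every commutative square from $\partial\Delta^n\hookrightarrow\Delta^n$ to $RA(U)\to RY(U)$, there is a map $\Delta^n\to RA(U_i)$ for which, in the composite square to $RA(U_i)\to RY(U_i)$, the upper left triangle commutes strictly and the lower right triangle commutes up to a homotopy relative to $\partial\Delta^n$. Let $G$ be a presheaf of simplicial groups acting on a simplicial presheaf $P$ by $\rho:P\times G\to P$. A map $\pi:P\to X$ of simplicial presheaves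 is a $G$-principal $\infty$-bundle if: (1) $\pi$ is a local fibration; (2) the action of $G$ on $P$ is fiberwise, $\pi\rho(p,g)=\pi(p)$; (3) the map $P\times G\to P\times_X P$, $(p,g)\mapsto(p,\rho(p,g))$, is a local weak equivalence. Morphisms are $G$-equivariant maps commuting with the projections to $X$; the resulting category is $\mathsf{Prin}^{\infty}_G(X)$.
   Formalization: Local fibrations also lift against the empty horn in dimension 0 (local surjectivity on vertices); otherwise the empty presheaf is an initial principal ∞-bundle and the claim fails (X a point, G=Z/2). Bundles are taken in a universe closed under sets of plots. *)

theory Defs
  imports "HOL-Analysis.Analysis" "HOL-Homology.Homology" "HOL-Algebra.Group"
begin

text \<open>
  Conventions.  Arrows are extensional functions (\<^term>\<open>undefined\<close> off their domain), so that
  equality of arrows is equality on the domain.  Composition is \<^const>\<open>compose\<close> from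
  \<^theory>\<open>HOL-Library.FuncSet\<close>.
\<close>


section \<open>Smooth manifolds and cartesian spaces\<close>

type_synonym point = "nat \<Rightarrow> real"

text \<open>
  \<open>\<real>\<^sup>n\<close> is \<^term>\<open>Euclidean_space n\<close>, whose points are the sequences vanishing from index \<open>n\<close> on.
  A real function on an open subset of it is \<open>C\<^sup>k\<close> if all its partial derivatives of order
  at most \<open>k\<close> exist and are continuous.
\<close>

primrec C_diff :: "nat \<Rightarrow> nat \<Rightarrow> point set \<Rightarrow> (point \<Rightarrow> real) \<Rightarrow> bool" where
  "C_diff 0 n S f \<longleftrightarrow> continuous_map (subtopology (Euclidean_space n) S) euclideanreal f"
| "C_diff (Suc k) n S f \<longleftrightarrow>
     continuous_map (subtopology (Euclidean_space n) S) euclideanreal f \<and>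
     (\<forall>i<n. \<exists>f'. (\<forall>x\<in>S. ((\<lambda>t. f (x(i := t))) has_real_derivative f' x) (at (x i))) \<and>
                 C_diff k n S f')"

definition smooth_on :: "nat \<Rightarrow> point set \<Rightarrow> nat \<Rightarrow> (point \<Rightarrow> point) \<Rightarrow> bool" where
  "smooth_on n S m f \<longleftrightarrow>
     f ` S \<subseteq> topspace (Euclidean_space m) \<and> (\<forall>j<m. \<forall>k. C_diff k n S (\<lambda>x. f x j))"

text \<open>
  A chart is a pair of its domain and a coordinate function (only whose values on the domain
  matter).  Every smooth manifold has at most continuum many points, so up to renaming of
  points nothing is lost by taking them in the type \<^typ>\<open>point\<close>; the manifold structure is
  unrelated to the structure of that type.
\<close>

type_synonym chart = "point set \<times> (point \<Rightarrow> point)"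

datatype manifold = Manifold (points: "point set") (mdim: nat) (atlas: "chart set")

definition is_chart :: "nat \<Rightarrow> point set \<Rightarrow> chart \<Rightarrow> bool" where
  "is_chart n M c \<longleftrightarrow>
     fst c \<subseteq> M \<and> inj_on (snd c) (fst c) \<and> openin (Euclidean_space n) (snd c ` fst c)"

definition transition :: "chart \<Rightarrow> chart \<Rightarrow> point \<Rightarrow> point" where
  "transition c d = snd d \<circ> inv_into (fst c) (snd c)"

definition compatible :: "nat \<Rightarrow> chart \<Rightarrow> chart \<Rightarrow> bool" where
  "compatible n c d \<longleftrightarrow>
     (let W = fst c \<inter> fst d in
        openin (Euclidean_space n) (snd c ` W) \<and> openin (Euclidean_space n) (snd d ` W) \<and>
        smooth_on n (snd c ` W) n (transition c d) \<and>
        smooth_on n (snd d ` W) n (transition d c))"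

definition smooth_structure :: "manifold \<Rightarrow> bool" where
  "smooth_structure M \<longleftrightarrow>
     (\<forall>c\<in>atlas M. is_chart (mdim M) (points M) c) \<and>
     (\<forall>c\<in>atlas M. \<forall>d\<in>atlas M. compatible (mdim M) c d) \<and>
     (\<Union>c\<in>atlas M. fst c) = points M \<and>
     (\<forall>c. is_chart (mdim M) (points M) c \<and> (\<forall>d\<in>atlas M. compatible (mdim M) c d) \<longrightarrow> c \<in> atlas M)"

definition smooth_map :: "manifold \<Rightarrow> manifold \<Rightarrow> (point \<Rightarrow> point) \<Rightarrow> bool" where
  "smooth_map M N f \<longleftrightarrow>
     f \<in> points M \<rightarrow>\<^sub>E points N \<and>
     (\<forall>c\<in>atlas M. \<forall>d\<in>atlas N.
        let W = {x \<in> fst c. f x \<in> fst d} in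
          openin (Euclidean_space (mdim M)) (snd c ` W) \<and>
          smooth_on (mdim M) (snd c ` W) (mdim N) (snd d \<circ> f \<circ> inv_into (fst c) (snd c)))"

definition diffeomorphism :: "manifold \<Rightarrow> manifold \<Rightarrow> (point \<Rightarrow> point) \<Rightarrow> bool" where
  "diffeomorphism M N f \<longleftrightarrow>
     smooth_map M N f \<and> bij_betw f (points M) (points N) \<and>
     smooth_map N M (restrict (inv_into (points M) f) (points N))"

text \<open>\<open>\<real>\<^sup>n\<close> with the maximal atlas containing the identity chart.\<close>

definition Rn :: "nat \<Rightarrow> manifold" where
  "Rn n = Manifold (topspace (Euclidean_space n)) n
     {c. is_chart n (topspace (Euclidean_space n)) c \<and>
         compatible n c (topspace (Euclidean_space n), id)}"

text \<open>The Hausdorff and countability axioms for manifolds follow from being diffeomorphic to \<open>\<real>\<^sup>n\<close>.\<close>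

definition Cart :: "manifold set" where
  "Cart = {M. smooth_structure M \<and> (\<exists>f. diffeomorphism M (Rn (mdim M)) f)}"

definition cart_hom :: "manifold \<Rightarrow> manifold \<Rightarrow> (point \<Rightarrow> point) set" where
  "cart_hom V U = {f. V \<in> Cart \<and> U \<in> Cart \<and> smooth_map V U f}"

definition open_subset :: "manifold \<Rightarrow> point set \<Rightarrow> bool" where
  "open_subset M S \<longleftrightarrow>
     S \<subseteq> points M \<and> (\<forall>c\<in>atlas M. openin (Euclidean_space (mdim M)) (snd c ` (fst c \<inter> S)))"

definition open_sub :: "manifold \<Rightarrow> point set \<Rightarrow> manifold" where
  "open_sub M S = Manifold S (mdim M) {c \<in> atlas M. fst c \<subseteq> S}"

definition good_open_cover :: "manifold \<Rightarrow> point set set \<Rightarrow> bool" where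
  "good_open_cover M \<U> \<longleftrightarrow>
     \<Union>\<U> = points M \<and>
     (\<forall>S\<in>\<U>. open_subset M S \<and> open_sub M S \<in> Cart) \<and>
     (\<forall>F. F \<subseteq> \<U> \<and> finite F \<and> F \<noteq> {} \<and> \<Inter>F \<noteq> {} \<longrightarrow> open_sub M (\<Inter>F) \<in> Cart)"

definition incl :: "point set \<Rightarrow> point \<Rightarrow> point" where
  "incl S = (\<lambda>x\<in>S. x)"


section \<open>Diffeological spaces and groups\<close>

record 'a diffspace = "'a partial_object" +
  plots :: "manifold \<Rightarrow> (point \<Rightarrow> 'a) set"

definition diffeological_space :: "'a diffspace \<Rightarrow> bool" where
  "diffeological_space X \<longleftrightarrow>
     (\<forall>U. \<forall>p\<in>plots X U. U \<in> Cart \<and> p \<in> points U \<rightarrow>\<^sub>E carrier X) \<and>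
     points (Rn 0) \<rightarrow>\<^sub>E carrier X \<subseteq> plots X (Rn 0) \<and>
     (\<forall>V U. \<forall>p\<in>plots X U. \<forall>f\<in>cart_hom V U. compose (points V) p f \<in> plots X V) \<and>
     (\<forall>U\<in>Cart. \<forall>\<U>. \<forall>p \<in> points U \<rightarrow>\<^sub>E carrier X.
        good_open_cover U \<U> \<and> (\<forall>S\<in>\<U>. restrict p S \<in> plots X (open_sub U S)) \<longrightarrow> p \<in> plots X U)"

definition dsmooth :: "'a diffspace \<Rightarrow> 'b diffspace \<Rightarrow> ('a \<Rightarrow> 'b) \<Rightarrow> bool" where
  "dsmooth X Y f \<longleftrightarrow>
     f \<in> carrier X \<rightarrow>\<^sub>E carrier Y \<and> (\<forall>U. \<forall>p\<in>plots X U. compose (points U) f p \<in> plots Y U)"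

definition diffeo :: "'a diffspace \<Rightarrow> 'b diffspace \<Rightarrow> ('a \<Rightarrow> 'b) \<Rightarrow> bool" where
  "diffeo X Y f \<longleftrightarrow>
     dsmooth X Y f \<and> bij_betw f (carrier X) (carrier Y) \<and>
     dsmooth Y X (restrict (inv_into (carrier X) f) (carrier Y))"

definition dprod :: "'a diffspace \<Rightarrow> 'b diffspace \<Rightarrow> ('a \<times> 'b) diffspace" where
  "dprod X Y = \<lparr>carrier = carrier X \<times> carrier Y,
     plots = (\<lambda>U. {p \<in> points U \<rightarrow>\<^sub>E carrier X \<times> carrier Y.
                     compose (points U) fst p \<in> plots X U \<and> compose (points U) snd p \<in> plots Y U})\<rparr>"

definition dfibre_prod :: "'a diffspace \<Rightarrow> ('a \<Rightarrow> 'b) \<Rightarrow> ('a \<times> 'a) diffspace" where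
  "dfibre_prod P \<pi> = \<lparr>carrier = {(p, q). p \<in> carrier P \<and> q \<in> carrier P \<and> \<pi> p = \<pi> q},
     plots = (\<lambda>U. {r \<in> points U \<rightarrow>\<^sub>E {(p, q). p \<in> carrier P \<and> q \<in> carrier P \<and> \<pi> p = \<pi> q}.
                     compose (points U) fst r \<in> plots P U \<and> compose (points U) snd r \<in> plots P U})\<rparr>"

definition subduction :: "'a diffspace \<Rightarrow> 'b diffspace \<Rightarrow> ('a \<Rightarrow> 'b) \<Rightarrow> bool" where
  "subduction P X \<pi> \<longleftrightarrow>
     dsmooth P X \<pi> \<and> \<pi> ` carrier P = carrier X \<and>
     (\<forall>U. \<forall>p\<in>plots X U. \<exists>\<U>. good_open_cover U \<U> \<and>
        (\<forall>S\<in>\<U>. \<exists>q\<in>plots P (open_sub U S). compose S \<pi> q = restrict p S))"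

record 'a dgroup = "'a monoid" +
  gplots :: "manifold \<Rightarrow> (point \<Rightarrow> 'a) set"

definition dspace :: "'a dgroup \<Rightarrow> 'a diffspace" where
  "dspace G = \<lparr>carrier = carrier G, plots = gplots G\<rparr>"

definition diffeological_group :: "'a dgroup \<Rightarrow> bool" where
  "diffeological_group G \<longleftrightarrow>
     group G \<and> diffeological_space (dspace G) \<and>
     dsmooth (dprod (dspace G) (dspace G)) (dspace G)
       (\<lambda>(g, h) \<in> carrier G \<times> carrier G. g \<otimes>\<^bsub>G\<^esub> h) \<and>
     dsmooth (dspace G) (dspace G) (\<lambda>g\<in>carrier G. inv\<^bsub>G\<^esub> g)"


section \<open>Categories\<close>

text \<open>\<open>Comp C a b c g f\<close> is the composite of \<open>f\<close> from \<open>a\<close> to \<open>b\<close> with \<open>g\<close> from \<open>b\<close> to \<open>c\<close>.\<close>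

record ('o, 'm) cat =
  Ob :: "'o set"
  Mor :: "'o \<Rightarrow> 'o \<Rightarrow> 'm set"
  Comp :: "'o \<Rightarrow> 'o \<Rightarrow> 'o \<Rightarrow> 'm \<Rightarrow> 'm \<Rightarrow> 'm"
  Ident :: "'o \<Rightarrow> 'm"


section \<open>Diffeological principal bundles\<close>

record ('p, 'g, 'x) dbundle =
  dtotal :: "'p diffspace"
  dproj :: "'p \<Rightarrow> 'x"
  dact :: "'p \<times> 'g \<Rightarrow> 'p"

definition diff_principal_bundle :: "'x diffspace \<Rightarrow> 'g dgroup \<Rightarrow> ('p, 'g, 'x) dbundle \<Rightarrow> bool" where
  "diff_principal_bundle X G E \<longleftrightarrow>
     (let P = dtotal E; \<pi> = dproj E; \<rho> = dact E in
        diffeological_space P \<and> subduction P X \<pi> \<and>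
        dsmooth (dprod P (dspace G)) P \<rho> \<and>
        (\<forall>p\<in>carrier P. \<rho> (p, \<one>\<^bsub>G\<^esub>) = p) \<and>
        (\<forall>p\<in>carrier P. \<forall>g\<in>carrier G. \<forall>h\<in>carrier G. \<rho> (\<rho> (p, g), h) = \<rho> (p, g \<otimes>\<^bsub>G\<^esub> h)) \<and>
        diffeo (dprod P (dspace G)) (dfibre_prod P \<pi>)
          (\<lambda>(p, g) \<in> carrier P \<times> carrier G. (p, \<rho> (p, g))))"

definition DiffPrin :: "'x diffspace \<Rightarrow> 'g dgroup \<Rightarrow> (('p, 'g, 'x) dbundle, 'p \<Rightarrow> 'p) cat" where
  "DiffPrin X G = \<lparr>
     Ob = {E. diff_principal_bundle X G E},
     Mor = (\<lambda>E E'. {f. dsmooth (dtotal E) (dtotal E') f \<and>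
        (\<forall>p\<in>carrier (dtotal E). dproj E' (f p) = dproj E p) \<and>
        (\<forall>p\<in>carrier (dtotal E). \<forall>g\<in>carrier G. f (dact E (p, g)) = dact E' (f p, g))}),
     Comp = (\<lambda>E E' E'' g f. compose (carrier (dtotal E)) g f),
     Ident = (\<lambda>E. \<lambda>p\<in>carrier (dtotal E). p)\<rparr>"


section \<open>Simplicial sets\<close>

text \<open>Monotone maps from \<open>[m]\<close> to \<open>[n]\<close>.\<close>

definition Delta :: "nat \<Rightarrow> nat \<Rightarrow> (nat \<Rightarrow> nat) set" where
  "Delta m n = {\<alpha> \<in> {..m} \<rightarrow>\<^sub>E {..n}. mono_on {..m} \<alpha>}"

text \<open>\<open>sop K m n \<alpha>\<close> is the structure map from \<open>n\<close>-simplices to \<open>m\<close>-simplices induced by \<open>\<alpha> \<in> Delta m n\<close>.\<close>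

record 'a sset =
  cells :: "nat \<Rightarrow> 'a set"
  sop :: "nat \<Rightarrow> nat \<Rightarrow> (nat \<Rightarrow> nat) \<Rightarrow> 'a \<Rightarrow> 'a"

definition simplicial_set :: "'a sset \<Rightarrow> bool" where
  "simplicial_set K \<longleftrightarrow>
     (\<forall>m n. sop K m n \<in> Delta m n \<rightarrow>\<^sub>E (cells K n \<rightarrow>\<^sub>E cells K m)) \<and>
     (\<forall>n. \<forall>x\<in>cells K n. sop K n n (\<lambda>i\<in>{..n}. i) x = x) \<and>
     (\<forall>k m n. \<forall>\<alpha>\<in>Delta k m. \<forall>\<beta>\<in>Delta m n. \<forall>x\<in>cells K n.
        sop K k n (compose {..k} \<beta> \<alpha>) x = sop K k m \<alpha> (sop K m n \<beta> x))"

definition simplicial_map :: "'a sset \<Rightarrow> 'b sset \<Rightarrow> (nat \<Rightarrow> 'a \<Rightarrow> 'b) \<Rightarrow> bool" where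
  "simplicial_map K L \<phi> \<longleftrightarrow>
     (\<forall>n. \<phi> n \<in> cells K n \<rightarrow>\<^sub>E cells L n) \<and>
     (\<forall>m n. \<forall>\<alpha>\<in>Delta m n. \<forall>x\<in>cells K n. \<phi> m (sop K m n \<alpha> x) = sop L m n \<alpha> (\<phi> n x))"

definition sid :: "'a sset \<Rightarrow> nat \<Rightarrow> 'a \<Rightarrow> 'a" where
  "sid K = (\<lambda>n. \<lambda>x\<in>cells K n. x)"

definition scomp :: "'a sset \<Rightarrow> (nat \<Rightarrow> 'b \<Rightarrow> 'c) \<Rightarrow> (nat \<Rightarrow> 'a \<Rightarrow> 'b) \<Rightarrow> nat \<Rightarrow> 'a \<Rightarrow> 'c" where
  "scomp K \<psi> \<phi> = (\<lambda>n. compose (cells K n) (\<psi> n) (\<phi> n))"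

definition srestrict :: "'a sset \<Rightarrow> (nat \<Rightarrow> 'a \<Rightarrow> 'b) \<Rightarrow> nat \<Rightarrow> 'a \<Rightarrow> 'b" where
  "srestrict K \<phi> = (\<lambda>n. restrict (\<phi> n) (cells K n))"

definition sset_of :: "(nat \<Rightarrow> 'a set) \<Rightarrow> (nat \<Rightarrow> nat \<Rightarrow> (nat \<Rightarrow> nat) \<Rightarrow> 'a \<Rightarrow> 'a) \<Rightarrow> 'a sset" where
  "sset_of C s = \<lparr>cells = C, sop = (\<lambda>m n. \<lambda>\<alpha>\<in>Delta m n. restrict (s m n \<alpha>) (C n))\<rparr>"

definition sdiscrete :: "'a set \<Rightarrow> 'a sset" where
  "sdiscrete A = sset_of (\<lambda>n. A) (\<lambda>m n \<alpha> x. x)"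

definition sprod :: "'a sset \<Rightarrow> 'b sset \<Rightarrow> ('a \<times> 'b) sset" where
  "sprod K L = sset_of (\<lambda>n. cells K n \<times> cells L n) (\<lambda>m n \<alpha> (x, y). (sop K m n \<alpha> x, sop L m n \<alpha> y))"

definition sfibre_prod :: "'a sset \<Rightarrow> (nat \<Rightarrow> 'a \<Rightarrow> 'b) \<Rightarrow> ('a \<times> 'a) sset" where
  "sfibre_prod K \<phi> =
     sset_of (\<lambda>n. {(x, y). x \<in> cells K n \<and> y \<in> cells K n \<and> \<phi> n x = \<phi> n y})
       (\<lambda>m n \<alpha> (x, y). (sop K m n \<alpha> x, sop K m n \<alpha> y))"

definition std_simplex :: "nat \<Rightarrow> (nat \<Rightarrow> nat) sset" where
  "std_simplex n = sset_of (\<lambda>m. Delta m n) (\<lambda>k m \<alpha> \<beta>. compose {..k} \<beta> \<alpha>)"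

definition boundary :: "nat \<Rightarrow> (nat \<Rightarrow> nat) sset" where
  "boundary n = sset_of (\<lambda>m. {\<beta> \<in> Delta m n. \<exists>i\<le>n. i \<notin> \<beta> ` {..m}}) (\<lambda>k m \<alpha> \<beta>. compose {..k} \<beta> \<alpha>)"

text \<open>
  The horn is the union of the faces of the standard simplex opposite to the vertices
  \<open>i \<noteq> k\<close>.  For \<open>n = 0\<close> there are none, and the horn is empty.
\<close>

definition horn :: "nat \<Rightarrow> nat \<Rightarrow> (nat \<Rightarrow> nat) sset" where
  "horn n k =
     sset_of (\<lambda>m. {\<beta> \<in> Delta m n. \<exists>i\<le>n. i \<noteq> k \<and> i \<notin> \<beta> ` {..m}}) (\<lambda>k m \<alpha> \<beta>. compose {..k} \<beta> \<alpha>)"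

text \<open>The \<open>n\<close>-simplices of the nerve of \<open>C\<close> are the functors from the poset \<open>[n]\<close> to \<open>C\<close>.\<close>

definition nerve :: "('o, 'm) cat \<Rightarrow> ((nat \<Rightarrow> 'o) \<times> (nat \<times> nat \<Rightarrow> 'm)) sset" where
  "nerve C = sset_of
     (\<lambda>n. {(x, u). x \<in> {..n} \<rightarrow>\<^sub>E Ob C \<and>
        u \<in> (\<Pi>\<^sub>E (i, j) \<in> {(i, j). i \<le> j \<and> j \<le> n}. Mor C (x i) (x j)) \<and>
        (\<forall>i\<le>n. u (i, i) = Ident C (x i)) \<and>
        (\<forall>i j k. i \<le> j \<and> j \<le> k \<and> k \<le> n \<longrightarrow>
           u (i, k) = Comp C (x i) (x j) (x k) (u (j, k)) (u (i, j)))})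
     (\<lambda>m n \<alpha> (x, u). (compose {..m} x \<alpha>, \<lambda>(i, j) \<in> {(i, j). i \<le> j \<and> j \<le> m}. u (\<alpha> i, \<alpha> j)))"


section \<open>Geometric realization\<close>

definition quotient_topology :: "'a topology \<Rightarrow> ('a \<times> 'a) set \<Rightarrow> 'a set topology" where
  "quotient_topology X r =
     topology (\<lambda>V. V \<subseteq> topspace X // r \<and> openin X {x \<in> topspace X. r `` {x} \<in> V})"

lemma istopology_quotient:
  "istopology (\<lambda>V. V \<subseteq> topspace X // r \<and> openin X {x \<in> topspace X. r `` {x} \<in> V})"
proof -
  have int: "{x \<in> topspace X. r `` {x} \<in> S \<inter> T} =
      {x \<in> topspace X. r `` {x} \<in> S} \<inter> {x \<in> topspace X. r `` {x} \<in> T}" for S T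
    by auto
  have un: "{x \<in> topspace X. r `` {x} \<in> \<Union>\<K>} = (\<Union>K\<in>\<K>. {x \<in> topspace X. r `` {x} \<in> K})" for \<K>
    by auto
  show ?thesis
    unfolding istopology_def int un by (auto intro!: openin_Union)
qed

lemma openin_quotient_topology:
  "openin (quotient_topology X r) V \<longleftrightarrow>
     V \<subseteq> topspace X // r \<and> openin X {x \<in> topspace X. r `` {x} \<in> V}"
  unfolding quotient_topology_def
  by (subst topology_inverse') (rule istopology_quotient, rule refl)

text \<open>The affine map of topological simplices induced by a map \<open>\<alpha>\<close> of vertices.\<close>

definition affine_map :: "nat \<Rightarrow> (nat \<Rightarrow> nat) \<Rightarrow> (nat \<Rightarrow> real) \<Rightarrow> nat \<Rightarrow> real" where
  "affine_map m \<alpha> t = (\<lambda>j. \<Sum>i | i \<le> m \<and> \<alpha> i = j. t i)"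

type_synonym 'a rpoint = "(nat \<times> 'a) \<times> (nat \<Rightarrow> real)"

definition simplex_sum :: "'a sset \<Rightarrow> 'a rpoint topology" where
  "simplex_sum K = sum_topology (\<lambda>(n, x). subtopology (powertop_real UNIV) (standard_simplex n))
     {(n, x). x \<in> cells K n}"

definition glue :: "'a sset \<Rightarrow> ('a rpoint \<times> 'a rpoint) set" where
  "glue K = {(((m, sop K m n \<alpha> x), t), ((n, x), affine_map m \<alpha> t)) | m n \<alpha> x t.
     \<alpha> \<in> Delta m n \<and> x \<in> cells K n \<and> t \<in> standard_simplex m}"

definition glue_equiv :: "'a sset \<Rightarrow> ('a rpoint \<times> 'a rpoint) set" where
  "glue_equiv K = (glue K \<union> (glue K)\<inverse>)\<^sup>*"

definition realization :: "'a sset \<Rightarrow> 'a rpoint set topology" where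
  "realization K = quotient_topology (simplex_sum K) (glue_equiv K)"

text \<open>The map of realizations induced by \<open>\<phi>\<close>: the class of \<open>((n, x), t)\<close> goes to that of \<open>((n, \<phi> n x), t)\<close>.\<close>

definition realization_map ::
  "'b sset \<Rightarrow> (nat \<Rightarrow> 'a \<Rightarrow> 'b) \<Rightarrow> 'a rpoint set \<Rightarrow> 'b rpoint set" where
  "realization_map L \<phi> c = glue_equiv L `` ((\<lambda>((n, x), t). ((n, \<phi> n x), t)) ` c)"

definition sing :: "'a topology \<Rightarrow> ((nat \<Rightarrow> real) \<Rightarrow> 'a) sset" where
  "sing X = sset_of (\<lambda>n. singular_simplex_set n X)
     (\<lambda>m n \<alpha> f. \<lambda>t\<in>standard_simplex m. f (affine_map m \<alpha> t))"


section \<open>Weak homotopy equivalences\<close>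

definition cube :: "nat \<Rightarrow> (nat \<Rightarrow> real) topology" where
  "cube n = subtopology (Euclidean_space n) {x. \<forall>i<n. 0 \<le> x i \<and> x i \<le> 1}"

definition cube_boundary :: "nat \<Rightarrow> (nat \<Rightarrow> real) set" where
  "cube_boundary n = {x \<in> topspace (cube n). \<exists>i<n. x i = 0 \<or> x i = 1}"

definition sphere_maps :: "nat \<Rightarrow> 'a topology \<Rightarrow> 'a \<Rightarrow> ((nat \<Rightarrow> real) \<Rightarrow> 'a) set" where
  "sphere_maps n X x = {p. continuous_map (cube n) X p \<and> (\<forall>t\<in>cube_boundary n. p t = x)}"

definition sphere_homotopic ::
  "nat \<Rightarrow> 'a topology \<Rightarrow> 'a \<Rightarrow> (((nat \<Rightarrow> real) \<Rightarrow> 'a) \<times> ((nat \<Rightarrow> real) \<Rightarrow> 'a)) set" where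
  "sphere_homotopic n X x =
     {(p, q). homotopic_with (\<lambda>h. \<forall>t\<in>cube_boundary n. h t = x) (cube n) X p q}"

definition homotopy_group :: "nat \<Rightarrow> 'a topology \<Rightarrow> 'a \<Rightarrow> ((nat \<Rightarrow> real) \<Rightarrow> 'a) set set" where
  "homotopy_group n X x = sphere_maps n X x // sphere_homotopic n X x"

definition weak_homotopy_equivalence :: "'a topology \<Rightarrow> 'b topology \<Rightarrow> ('a \<Rightarrow> 'b) \<Rightarrow> bool" where
  "weak_homotopy_equivalence X Y f \<longleftrightarrow>
     continuous_map X Y f \<and>
     bij_betw (\<lambda>c. \<Union>x\<in>c. path_component_of_set Y (f x)) (path_components_of X) (path_components_of Y) \<and>
     (\<forall>n\<ge>1. \<forall>x\<in>topspace X.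
        bij_betw (\<lambda>c. \<Union>p\<in>c. sphere_homotopic n Y (f x) `` {f \<circ> p})
          (homotopy_group n X x) (homotopy_group n Y (f x)))"

definition sset_weak_equivalence :: "'a sset \<Rightarrow> 'b sset \<Rightarrow> (nat \<Rightarrow> 'a \<Rightarrow> 'b) \<Rightarrow> bool" where
  "sset_weak_equivalence K L \<phi> \<longleftrightarrow>
     simplicial_set K \<and> simplicial_set L \<and> simplicial_map K L \<phi> \<and>
     weak_homotopy_equivalence (realization K) (realization L) (realization_map L \<phi>)"

definition sset_copy :: "('a \<Rightarrow> 'b) \<Rightarrow> 'a sset \<Rightarrow> 'b sset" where
  "sset_copy \<iota> K = sset_of (\<lambda>n. \<iota> ` cells K n) (\<lambda>m n \<alpha> y. \<iota> (sop K m n \<alpha> (inv_into UNIV \<iota> y)))"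

text \<open>
  Two simplicial sets are weakly homotopy equivalent if they are connected by a zigzag of
  weak equivalences.  The two ends are first moved into a common type by the injections of the
  disjoint sum.
\<close>

definition weakly_homotopy_equivalent :: "'a sset \<Rightarrow> 'b sset \<Rightarrow> bool" where
  "weakly_homotopy_equivalent K L \<longleftrightarrow>
     simplicial_set K \<and> simplicial_set L \<and>
     equivclp (\<lambda>M N :: ('a + 'b) sset. \<exists>\<phi>. sset_weak_equivalence M N \<phi>)
       (sset_copy Inl K) (sset_copy Inr L)"


section \<open>Simplicial presheaves\<close>

text \<open>\<open>res A V U f\<close> is the simplicial map from \<open>val A U\<close> to \<open>val A V\<close> induced by \<open>f \<in> cart_hom V U\<close>.\<close>

record 'a spsh =
  val :: "manifold \<Rightarrow> 'a sset"
  res :: "manifold \<Rightarrow> manifold \<Rightarrow> (point \<Rightarrow> point) \<Rightarrow> nat \<Rightarrow> 'a \<Rightarrow> 'a"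

definition simplicial_presheaf :: "'a spsh \<Rightarrow> bool" where
  "simplicial_presheaf A \<longleftrightarrow>
     val A \<in> extensional Cart \<and> (\<forall>U\<in>Cart. simplicial_set (val A U)) \<and>
     (\<forall>V U. res A V U \<in> extensional (cart_hom V U)) \<and>
     (\<forall>V U. \<forall>f\<in>cart_hom V U. simplicial_map (val A U) (val A V) (res A V U f)) \<and>
     (\<forall>U\<in>Cart. res A U U (\<lambda>x\<in>points U. x) = sid (val A U)) \<and>
     (\<forall>W V U. \<forall>g\<in>cart_hom W V. \<forall>f\<in>cart_hom V U.
        res A W U (compose (points W) f g) = scomp (val A U) (res A W V g) (res A V U f))"

definition psh_map :: "'a spsh \<Rightarrow> 'b spsh \<Rightarrow> (manifold \<Rightarrow> nat \<Rightarrow> 'a \<Rightarrow> 'b) \<Rightarrow> bool" where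
  "psh_map A B \<phi> \<longleftrightarrow>
     \<phi> \<in> extensional Cart \<and> (\<forall>U\<in>Cart. simplicial_map (val A U) (val B U) (\<phi> U)) \<and>
     (\<forall>V U. \<forall>f\<in>cart_hom V U.
        scomp (val A U) (\<phi> V) (res A V U f) = scomp (val A U) (res B V U f) (\<phi> U))"

definition spsh_of ::
  "(manifold \<Rightarrow> 'a sset) \<Rightarrow> (manifold \<Rightarrow> manifold \<Rightarrow> (point \<Rightarrow> point) \<Rightarrow> nat \<Rightarrow> 'a \<Rightarrow> 'a) \<Rightarrow> 'a spsh" where
  "spsh_of K r = \<lparr>val = restrict K Cart, res = (\<lambda>V U. \<lambda>f\<in>cart_hom V U. srestrict (K U) (r V U f))\<rparr>"

definition psh_prod :: "'a spsh \<Rightarrow> 'b spsh \<Rightarrow> ('a \<times> 'b) spsh" where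
  "psh_prod A B = spsh_of (\<lambda>U. sprod (val A U) (val B U))
     (\<lambda>V U f n (x, y). (res A V U f n x, res B V U f n y))"

definition psh_fibre_prod :: "'a spsh \<Rightarrow> (manifold \<Rightarrow> nat \<Rightarrow> 'a \<Rightarrow> 'b) \<Rightarrow> ('a \<times> 'a) spsh" where
  "psh_fibre_prod A \<phi> = spsh_of (\<lambda>U. sfibre_prod (val A U) (\<phi> U))
     (\<lambda>V U f n (x, y). (res A V U f n x, res A V U f n y))"

definition psh_discrete :: "'x diffspace \<Rightarrow> (point \<Rightarrow> 'x) spsh" where
  "psh_discrete X = spsh_of (\<lambda>U. sdiscrete (plots X U)) (\<lambda>V U f n p. compose (points V) p f)"

text \<open>
  In the next definition all \<open>n\<close> and \<open>k \<le> n\<close> are allowed.  For \<open>n = 0\<close> the horn is empty, and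
  the lifting condition says that the map is locally surjective on vertices.  Without this
  case the empty presheaf would be a principal bundle over every base; being an initial object
  among the principal \<open>\<infinity>\<close>-bundles, it would make the nerve of their category contractible.
\<close>

definition local_fibration ::
  "'a spsh \<Rightarrow> 'b spsh \<Rightarrow> (manifold \<Rightarrow> nat \<Rightarrow> 'a \<Rightarrow> 'b) \<Rightarrow> bool" where
  "local_fibration A Y f \<longleftrightarrow>
     psh_map A Y f \<and>
     (\<forall>U\<in>Cart. \<exists>\<U>. good_open_cover U \<U> \<and>
       (\<forall>S\<in>\<U>. let V = open_sub U S in
         \<forall>n k a y. k \<le> n \<and>
           simplicial_map (horn n k) (val A U) a \<and> simplicial_map (std_simplex n) (val Y U) y \<and>
           scomp (horn n k) (f U) a = srestrict (horn n k) y \<longrightarrow>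
           (\<exists>l. simplicial_map (std_simplex n) (val A V) l \<and>
              srestrict (horn n k) l = scomp (horn n k) (res A V U (incl S)) a \<and>
              scomp (std_simplex n) (f V) l = scomp (std_simplex n) (res Y V U (incl S)) y)))"

text \<open>The fibrant replacement functor: the singular complex of the geometric realization.\<close>

definition fib :: "'a sset \<Rightarrow> ((nat \<Rightarrow> real) \<Rightarrow> 'a rpoint set) sset" where
  "fib K = sing (realization K)"

definition fib_map :: "'a sset \<Rightarrow> 'b sset \<Rightarrow> (nat \<Rightarrow> 'a \<Rightarrow> 'b) \<Rightarrow>
    nat \<Rightarrow> ((nat \<Rightarrow> real) \<Rightarrow> 'a rpoint set) \<Rightarrow> ((nat \<Rightarrow> real) \<Rightarrow> 'b rpoint set)" where
  "fib_map K L \<phi> = srestrict (fib K) (\<lambda>n. simplex_map n (realization_map L \<phi>))"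

text \<open>Homotopy, relative to the boundary, of simplicial maps from the standard \<open>n\<close>-simplex to \<open>L\<close>.\<close>

definition homotopic_rel_boundary ::
  "nat \<Rightarrow> 'b sset \<Rightarrow> (nat \<Rightarrow> (nat \<Rightarrow> nat) \<Rightarrow> 'b) \<Rightarrow> (nat \<Rightarrow> (nat \<Rightarrow> nat) \<Rightarrow> 'b) \<Rightarrow> bool" where
  "homotopic_rel_boundary n L \<phi> \<psi> \<longleftrightarrow>
     (\<exists>H. simplicial_map (sprod (std_simplex n) (std_simplex 1)) L H \<and>
        (\<forall>m. \<forall>x\<in>cells (std_simplex n) m.
           H m (x, \<lambda>i\<in>{..m}. 0) = \<phi> m x \<and> H m (x, \<lambda>i\<in>{..m}. 1) = \<psi> m x) \<and>
        (\<forall>m. \<forall>x\<in>cells (boundary n) m. \<forall>s\<in>cells (std_simplex 1) m. H m (x, s) = \<phi> m x))"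

definition local_weak_equivalence ::
  "'a spsh \<Rightarrow> 'b spsh \<Rightarrow> (manifold \<Rightarrow> nat \<Rightarrow> 'a \<Rightarrow> 'b) \<Rightarrow> bool" where
  "local_weak_equivalence A Y f \<longleftrightarrow>
     psh_map A Y f \<and>
     (\<forall>U\<in>Cart. \<exists>\<U>. good_open_cover U \<U> \<and>
       (\<forall>S\<in>\<U>.
         let V = open_sub U S;
             fU = fib_map (val A U) (val Y U) (f U);
             fV = fib_map (val A V) (val Y V) (f V);
             rA = fib_map (val A U) (val A V) (res A V U (incl S));
             rY = fib_map (val Y U) (val Y V) (res Y V U (incl S))
         in
         \<forall>n a y.
           simplicial_map (boundary n) (fib (val A U)) a \<and>
           simplicial_map (std_simplex n) (fib (val Y U)) y \<and>
           scomp (boundary n) fU a = srestrict (boundary n) y \<longrightarrow>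
           (\<exists>l. simplicial_map (std_simplex n) (fib (val A V)) l \<and>
              srestrict (boundary n) l = scomp (boundary n) rA a \<and>
              homotopic_rel_boundary n (fib (val Y V))
                (scomp (std_simplex n) fV l) (scomp (std_simplex n) rY y))))"


section \<open>Principal \<open>\<infinity>\<close>-bundles\<close>

record 'g sgpsh =
  underlying :: "'g spsh"
  grp :: "manifold \<Rightarrow> nat \<Rightarrow> 'g monoid"

definition simplicial_group_presheaf :: "'g sgpsh \<Rightarrow> bool" where
  "simplicial_group_presheaf G \<longleftrightarrow>
     simplicial_presheaf (underlying G) \<and>
     (\<forall>U\<in>Cart. \<forall>n. group (grp G U n) \<and> carrier (grp G U n) = cells (val (underlying G) U) n) \<and>
     (\<forall>U\<in>Cart. \<forall>m n. \<forall>\<alpha>\<in>Delta m n. sop (val (underlying G) U) m n \<alpha> \<in> hom (grp G U n) (grp G U m)) \<and>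
     (\<forall>V U. \<forall>f\<in>cart_hom V U. \<forall>n. res (underlying G) V U f n \<in> hom (grp G U n) (grp G V n))"

definition group_discrete :: "'a dgroup \<Rightarrow> (point \<Rightarrow> 'a) sgpsh" where
  "group_discrete G = \<lparr>underlying = psh_discrete (dspace G),
     grp = (\<lambda>U n. \<lparr>carrier = gplots G U, mult = (\<lambda>a b. \<lambda>x\<in>points U. a x \<otimes>\<^bsub>G\<^esub> b x),
                   one = (\<lambda>x\<in>points U. \<one>\<^bsub>G\<^esub>)\<rparr>)\<rparr>"

record ('p, 'g, 'x) ibundle =
  itotal :: "'p spsh"
  iproj :: "manifold \<Rightarrow> nat \<Rightarrow> 'p \<Rightarrow> 'x"
  iact :: "manifold \<Rightarrow> nat \<Rightarrow> 'p \<times> 'g \<Rightarrow> 'p"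

definition psh_action ::
  "'g sgpsh \<Rightarrow> 'p spsh \<Rightarrow> (manifold \<Rightarrow> nat \<Rightarrow> 'p \<times> 'g \<Rightarrow> 'p) \<Rightarrow> bool" where
  "psh_action G P \<rho> \<longleftrightarrow>
     psh_map (psh_prod P (underlying G)) P \<rho> \<and>
     (\<forall>U\<in>Cart. \<forall>n. \<forall>p\<in>cells (val P U) n.
        \<rho> U n (p, \<one>\<^bsub>grp G U n\<^esub>) = p \<and>
        (\<forall>g\<in>carrier (grp G U n). \<forall>h\<in>carrier (grp G U n).
           \<rho> U n (\<rho> U n (p, g), h) = \<rho> U n (p, g \<otimes>\<^bsub>grp G U n\<^esub> h)))"

definition principal_inf_bundle :: "'x spsh \<Rightarrow> 'g sgpsh \<Rightarrow> ('p, 'g, 'x) ibundle \<Rightarrow> bool" where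
  "principal_inf_bundle X G E \<longleftrightarrow>
     (let P = itotal E; \<pi> = iproj E; \<rho> = iact E in
        simplicial_presheaf P \<and> psh_map P X \<pi> \<and> psh_action G P \<rho> \<and>
        local_fibration P X \<pi> \<and>
        (\<forall>U\<in>Cart. \<forall>n. \<forall>p\<in>cells (val P U) n. \<forall>g\<in>carrier (grp G U n). \<pi> U n (\<rho> U n (p, g)) = \<pi> U n p) \<and>
        local_weak_equivalence (psh_prod P (underlying G)) (psh_fibre_prod P \<pi>)
          (\<lambda>U\<in>Cart. srestrict (val (psh_prod P (underlying G)) U) (\<lambda>n (p, g). (p, \<rho> U n (p, g)))))"

definition PrinInf ::
  "'x spsh \<Rightarrow> 'g sgpsh \<Rightarrow> (('p, 'g, 'x) ibundle, manifold \<Rightarrow> nat \<Rightarrow> 'p \<Rightarrow> 'p) cat" where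
  "PrinInf X G = \<lparr>
     Ob = {E. principal_inf_bundle X G E},
     Mor = (\<lambda>E E'. {\<phi>. psh_map (itotal E) (itotal E') \<phi> \<and>
        (\<forall>U\<in>Cart. \<forall>n. \<forall>p\<in>cells (val (itotal E) U) n.
           iproj E' U n (\<phi> U n p) = iproj E U n p \<and>
           (\<forall>g\<in>carrier (grp G U n). \<phi> U n (iact E U n (p, g)) = iact E' U n (\<phi> U n p, g)))}),
     Comp = (\<lambda>E E' E'' \<psi> \<phi>. \<lambda>U\<in>Cart. scomp (val (itotal E) U) (\<psi> U) (\<phi> U)),
     Ident = (\<lambda>E. \<lambda>U\<in>Cart. sid (val (itotal E) U))\<rparr>"


section \<open>The universe\<close>

text \<open>
  As always, nerves of categories of bundles are formed relative to a universe.  Here it is a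
  type: all diffeological spaces have underlying sets in \<open>'u\<close>, and so have the simplicial
  presheaves serving as total spaces of principal \<open>\<infinity>\<close>-bundles their sets of simplices.  The
  closure property needed is that the sets of plots of a diffeological space in the universe
  belong to the universe again.  It holds e.g. for every type of the form \<^typ>\<open>point \<Rightarrow> 'w\<close>.
\<close>

definition closed_under_plots :: "'u itself \<Rightarrow> bool" where
  "closed_under_plots _ \<longleftrightarrow> (\<exists>e :: (point \<Rightarrow> 'u) \<Rightarrow> 'u. inj e)"

end

theory Submission
  imports Defs
begin

text \<open>
  Sending a diffeological principal bundle to the presheaf of its plots embeds the diffeological
  principal bundles as a full reflective subcategory of the principal \<open>\<infinity>\<close>-bundles.  The
  reflection of \<open>P\<close> is the set of path components of the simplicial set of sections of \<open>P\<close> over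
  a point; a function into it is a plot if it locally comes from a section of \<open>P\<close>.  Since the
  shear map is a local weak equivalence, it is locally a bijection on path components; this makes
  \<open>G\<close> act freely, transitively on the fibres, and with smooth differences.  The unit of a
  reflection is a natural transformation, hence a homotopy of nerves, so the nerve of a reflective
  subcategory is a strong deformation retract.

  The local fibration condition asks for one cover of \<open>U\<close> that serves all lifting problems
  simultaneously.  The presheaf of plots of a bundle satisfies it because every plot of \<open>X\<close> lifts
  globally to a plot of the bundle: two local lifts over overlapping boxes can be glued after one
  of them has been translated by a plot of \<open>G\<close>, and the translation extends from the overlap by
  precomposition with a smooth map into the overlap.
\<close>

text \<open>Weak equivalence is tested on homotopy groups of realizations, so the homotopy of nerves
  must be made topological. It is realized by hand: the prism over an n-simplex is cut into n + 1
  simplices whose images agree on common faces. A homotopy moving base points would bring in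
  change-of-base-point isomorphisms; with a reflector that is the identity on the subcategory, the
  homotopy fixes the image of the smaller nerve, and only base points there occur.

  Fibrant replacement is the singular complex of the realization, so a local weak equivalence speaks
  of paths in realizations. Only its cases n = 0 and n = 1 enter: they give surjectivity and
  injectivity on components. Paths are turned back into zigzags of edges by a component function on
  the realization with values in a discrete space.

  Both categories are relative to one type \<open>'u\<close>. An injection \<open>e\<close> encodes
  plots as elements of \<open>'u\<close>, and a chosen vertex stands for each path component, so
  that the reflection stays in that type.\<close>

section \<open>Strong deformation retracts and homotopy groups\<close>

lemma homotopic_with_sphere_trans:
  assumes "(p, q) \<in> sphere_homotopic n Y y" "(q, r) \<in> sphere_homotopic n Y y"
  shows "(p, r) \<in> sphere_homotopic n Y y"
  using assms homotopic_with_trans by (auto simp: sphere_homotopic_def) blast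

lemma sphere_homotopic_sym: "(p, q) \<in> sphere_homotopic n Y y \<Longrightarrow> (q, p) \<in> sphere_homotopic n Y y"
  by (auto simp: sphere_homotopic_def dest: homotopic_with_symD)

lemma sphere_homotopic_refl: "p \<in> sphere_maps n Y y \<Longrightarrow> (p, p) \<in> sphere_homotopic n Y y"
  by (auto simp: sphere_homotopic_def sphere_maps_def)

lemma sphere_homotopic_Image_eq:
  assumes pq: "(p, q) \<in> sphere_homotopic n Y y"
  shows "sphere_homotopic n Y y `` {q} = sphere_homotopic n Y y `` {p}"
  using homotopic_with_sphere_trans[OF pq] homotopic_with_sphere_trans[OF sphere_homotopic_sym[OF pq]]
  by auto

lemma sphere_homotopic_Image_eq_iff:
  assumes "p \<in> sphere_maps n Y y" "q \<in> sphere_maps n Y y"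
  shows "sphere_homotopic n Y y `` {p} = sphere_homotopic n Y y `` {q}
    \<longleftrightarrow> (p, q) \<in> sphere_homotopic n Y y"
proof
  assume "sphere_homotopic n Y y `` {p} = sphere_homotopic n Y y `` {q}"
  then show "(p, q) \<in> sphere_homotopic n Y y"
    using sphere_homotopic_refl[OF assms(2)] by blast
next
  assume pq: "(p, q) \<in> sphere_homotopic n Y y"
  show "sphere_homotopic n Y y `` {p} = sphere_homotopic n Y y `` {q}"
    by (rule sphere_homotopic_Image_eq[OF pq, symmetric])
qed

lemma sphere_homotopic_compose:
  assumes "(p, q) \<in> sphere_homotopic n Y y" "continuous_map Y Z g"
  shows "(g \<circ> p, g \<circ> q) \<in> sphere_homotopic n Z (g y)"
  using assms unfolding sphere_homotopic_def
  by (auto intro: homotopic_with_compose_continuous_map_left)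

lemma sphere_maps_compose:
  assumes "p \<in> sphere_maps n Y y" "continuous_map Y Z g"
  shows "g \<circ> p \<in> sphere_maps n Z (g y)"
  using assms by (auto simp: sphere_maps_def continuous_map_compose)

text \<open>Injectivity of the induced maps comes from \<open>f\<close> after \<open>g\<close> being
  the identity, surjectivity from \<open>h\<close>. Because \<open>h\<close> is stationary on the
  image of \<open>g\<close>, composing a sphere at \<open>g x\<close> with it never leaves the
  spheres at \<open>g x\<close>, so no change of base point arises.\<close>

lemma strong_deformation_retract_weak_homotopy_equivalence:
  assumes g: "continuous_map X Y g" and f: "continuous_map Y X f"
    and fg: "\<And>x. x \<in> topspace X \<Longrightarrow> f (g x) = x"
    and h: "continuous_map (prod_topology (top_of_set {0..1::real}) Y) Y h"
    and h0: "\<And>y. y \<in> topspace Y \<Longrightarrow> h (0, y) = y"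
    and h1: "\<And>y. y \<in> topspace Y \<Longrightarrow> h (1, y) = g (f y)"
    and hg: "\<And>x s. x \<in> topspace X \<Longrightarrow> s \<in> {0..1} \<Longrightarrow> h (s, g x) = g x"
  shows "weak_homotopy_equivalence X Y g"
  unfolding weak_homotopy_equivalence_def
proof (intro conjI allI impI ballI)
  show "continuous_map X Y g" by (rule g)
  have gX: "g x \<in> topspace Y" if "x \<in> topspace X" for x
    using g that by (auto simp: continuous_map_def)
  have fY: "f y \<in> topspace X" if "y \<in> topspace Y" for y
    using f that by (auto simp: continuous_map_def)
  have gpc: "path_component_of Y (g x) (g x')" if "path_component_of X x x'" for x x'
    using that g unfolding path_component_of_def by (metis pathin_compose comp_apply)
  have fpc: "path_component_of X (f x) (f x')" if "path_component_of Y x x'" for x x'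
    using that f unfolding path_component_of_def by (metis pathin_compose comp_apply)
  \<comment> \<open>Points joined by a path have images joined by a path, so the union defining the
    induced map consists of equal sets.\<close>
  have img: "(\<Union>x\<in>path_component_of_set X x. path_component_of_set Y (g x))
      = path_component_of_set Y (g x)" if "x \<in> topspace X" for x
    using gpc that path_component_of_refl path_component_of_trans by fastforce
  show "bij_betw (\<lambda>c. \<Union>x\<in>c. path_component_of_set Y (g x)) (path_components_of X) (path_components_of Y)"
    unfolding bij_betw_def
  proof
    show "inj_on (\<lambda>c. \<Union>x\<in>c. path_component_of_set Y (g x)) (path_components_of X)"
    proof (rule inj_onI)
      fix c d assume cd: "c \<in> path_components_of X" "d \<in> path_components_of X"
        and eq: "(\<Union>x\<in>c. path_component_of_set Y (g x)) = (\<Union>x\<in>d. path_component_of_set Y (g x))"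
      obtain x where x: "x \<in> topspace X" "c = path_component_of_set X x"
        using cd by (auto simp: path_components_of_def)
      obtain x' where x': "x' \<in> topspace X" "d = path_component_of_set X x'"
        using cd by (auto simp: path_components_of_def)
      have "path_component_of_set Y (g x) = path_component_of_set Y (g x')"
        using eq img x x' by simp
      then have "path_component_of Y (g x) (g x')"
        using gX[OF x'(1)] by (metis mem_Collect_eq path_component_of_refl)
      then have "path_component_of X x x'"
        using fpc fg x x' by metis
      then show "c = d"
        using x x' by (metis path_component_of_equiv)
    qed
    have "\<exists>x\<in>topspace X. path_component_of_set Y (g x) = path_component_of_set Y y"
      if y: "y \<in> topspace Y" for y
    proof -
      have "pathin Y (\<lambda>s. h (s, y))"
        unfolding pathin_def
        by (rule continuous_map_compose[OF _ h, unfolded o_def])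
          (auto intro!: continuous_map_pairedI simp: y)
      then have "path_component_of Y y (g (f y))"
        unfolding path_component_of_def using h0 h1 y by fastforce
      then show ?thesis
        using fY[OF y] by (metis path_component_of_equiv)
    qed
    then have surj: "path_component_of_set Y y \<in> (\<lambda>x. path_component_of_set Y (g x)) ` topspace X"
      if "y \<in> topspace Y" for y
      using that by (metis imageI)
    have "(\<lambda>c. \<Union>x\<in>c. path_component_of_set Y (g x)) ` path_components_of X
        = (\<lambda>x. path_component_of_set Y (g x)) ` topspace X"
      unfolding path_components_of_def image_image by (rule image_cong[OF refl img])
    also have "\<dots> = path_components_of Y"
      unfolding path_components_of_def by (intro equalityI image_subsetI imageI gX surj)
    finally show "(\<lambda>c. \<Union>x\<in>c. path_component_of_set Y (g x)) ` path_components_of X = path_components_of Y" .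
  qed
  fix n :: nat and x assume "n \<ge> 1" and x: "x \<in> topspace X"
  let ?E = "sphere_homotopic n Y (g x)" and ?D = "sphere_homotopic n X x"
  let ?F = "\<lambda>c. \<Union>p\<in>c. ?E `` {g \<circ> p}"
  have img: "?F (?D `` {p}) = ?E `` {g \<circ> p}" if p: "p \<in> sphere_maps n X x" for p
  proof -
    have "?E `` {g \<circ> q} = ?E `` {g \<circ> p}" if "(p, q) \<in> ?D" for q
      by (rule sphere_homotopic_Image_eq[OF sphere_homotopic_compose[OF that g]])
    then have "\<forall>q\<in>?D `` {p}. ?E `` {g \<circ> q} = ?E `` {g \<circ> p}"
      unfolding Image_singleton_iff by (intro ballI) (simp only: Image_singleton_iff)
    moreover have "p \<in> ?D `` {p}"
      unfolding Image_singleton_iff by (rule sphere_homotopic_refl[OF p])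
    ultimately show ?thesis by (intro UN_constant_eq)
  qed
  show "bij_betw ?F (homotopy_group n X x) (homotopy_group n Y (g x))"
    unfolding bij_betw_def
  proof
    show "inj_on ?F (homotopy_group n X x)"
    proof (rule inj_onI)
      fix c d assume cd: "c \<in> homotopy_group n X x" "d \<in> homotopy_group n X x"
        and eq: "?F c = ?F d"
      obtain p where p: "p \<in> sphere_maps n X x" "c = ?D `` {p}"
        using cd(1) unfolding homotopy_group_def by (rule quotientE)
      obtain q where q: "q \<in> sphere_maps n X x" "d = ?D `` {q}"
        using cd(2) unfolding homotopy_group_def by (rule quotientE)
      have "?E `` {g \<circ> p} = ?E `` {g \<circ> q}"
        using eq p q img by simp
      then have "(g \<circ> p, g \<circ> q) \<in> ?E"
        using sphere_homotopic_Image_eq_iff sphere_maps_compose p q g by metis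
      then have pq: "(f \<circ> (g \<circ> p), f \<circ> (g \<circ> q)) \<in> ?D"
        using sphere_homotopic_compose[OF _ f] fg x by metis
      \<comment> \<open>The two maps agree on the cube but possibly not outside it, where a sphere
        map is arbitrary; hence a constant homotopy instead of an equation.\<close>
      have *: "(r, f \<circ> (g \<circ> r)) \<in> ?D" if r: "r \<in> sphere_maps n X x" for r
      proof -
        have rr: "r t \<in> topspace X" if "t \<in> topspace (cube n)" for t
          using r that by (auto simp: sphere_maps_def continuous_map_def)
        have "homotopic_with (\<lambda>h. \<forall>t\<in>cube_boundary n. h t = x) (cube n) X r (f \<circ> (g \<circ> r))"
          by (rule homotopic_with_equal) (use r rr fg x in \<open>auto simp: sphere_maps_def cube_boundary_def\<close>)
        then show ?thesis by (simp add: sphere_homotopic_def)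
      qed
      have "(p, q) \<in> ?D"
        using homotopic_with_sphere_trans[OF homotopic_with_sphere_trans[OF *[OF p(1)] pq]
            sphere_homotopic_sym[OF *[OF q(1)]]] .
      then show "c = d"
        using p q sphere_homotopic_Image_eq_iff by metis
    qed
    have surj: "\<exists>p\<in>sphere_maps n X x. ?E `` {g \<circ> p} = ?E `` {q}"
      if q: "q \<in> sphere_maps n Y (g x)" for q
    proof -
      have p: "f \<circ> q \<in> sphere_maps n X x"
        using sphere_maps_compose[OF q f] fg x by simp
      have qc: "continuous_map (cube n) Y q" and qb: "\<And>t. t \<in> cube_boundary n \<Longrightarrow> q t = g x"
        using q by (auto simp: sphere_maps_def)
      have qY: "q t \<in> topspace Y" if "t \<in> topspace (cube n)" for t
        using qc that by (auto simp: continuous_map_def)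
      have "homotopic_with (\<lambda>h. \<forall>t\<in>cube_boundary n. h t = g x) (cube n) Y q (g \<circ> (f \<circ> q))"
      proof (subst homotopic_with)
        show "(\<forall>t\<in>cube_boundary n. h t = g x) \<longleftrightarrow> (\<forall>t\<in>cube_boundary n. k t = g x)"
          if "\<And>x. x \<in> topspace (cube n) \<Longrightarrow> h x = k x" for h k
          using that by (auto simp: cube_boundary_def)
        have "continuous_map (prod_topology (top_of_set {0..1::real}) (cube n)) Y (\<lambda>z. h (fst z, q (snd z)))"
          by (rule continuous_map_compose[OF _ h, unfolded o_def])
            (auto intro!: continuous_map_pairedI continuous_map_fst
              continuous_map_compose[OF continuous_map_snd qc, unfolded o_def])
        then show "\<exists>k. continuous_map (prod_topology (top_of_set {0..1::real}) (cube n)) Y k \<and>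
          (\<forall>x\<in>topspace (cube n). k (0, x) = q x) \<and>
          (\<forall>x\<in>topspace (cube n). k (1, x) = (g \<circ> (f \<circ> q)) x) \<and>
          (\<forall>t\<in>{0..1}. \<forall>ta\<in>cube_boundary n. k (t, ta) = g x)"
          by (intro exI[of _ "\<lambda>z. h (fst z, q (snd z))"]) (auto simp: qY h0 h1 hg x qb)
      qed
      then have "(q, g \<circ> (f \<circ> q)) \<in> ?E" by (simp add: sphere_homotopic_def)
      then show ?thesis
        using p q sphere_homotopic_Image_eq_iff sphere_maps_compose g by metis
    qed
    show "?F ` homotopy_group n X x = homotopy_group n Y (g x)"
    proof -
      have "?F ` homotopy_group n X x = (\<lambda>p. ?E `` {g \<circ> p}) ` sphere_maps n X x"
        unfolding homotopy_group_def quotient_def by (auto simp: img image_iff)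
      also have "\<dots> = (\<lambda>q. ?E `` {q}) ` sphere_maps n Y (g x)"
        using surj sphere_maps_compose[OF _ g] by (auto simp: image_iff) metis
      finally show ?thesis unfolding homotopy_group_def quotient_def by auto
    qed
  qed
qed

section \<open>Geometric realization\<close>

abbreviation top_simplex :: "nat \<Rightarrow> (nat \<Rightarrow> real) topology" where
  "top_simplex n \<equiv> subtopology (powertop_real UNIV) (standard_simplex n)"

text \<open>The point of the realization with barycentric coordinates \<open>t\<close> in the
  simplex \<open>x\<close>.\<close>

definition rpt :: "'a sset \<Rightarrow> nat \<Rightarrow> 'a \<Rightarrow> (nat \<Rightarrow> real) \<Rightarrow> 'a rpoint set" where
  "rpt K n x t = glue_equiv K `` {((n, x), t)}"

text \<open>The closure is reflexive on the whole type, so classes are equal exactly when their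
  members are related, with no condition of lying in \<open>simplex_sum\<close>.\<close>

lemma equiv_glue_equiv: "equiv UNIV (glue_equiv K)"
  unfolding glue_equiv_def
  by (intro equivI refl_rtrancl trans_rtrancl sym_rtrancl sym_Un_converse) auto

lemma Delta_le: "\<alpha> \<in> Delta m n \<Longrightarrow> i \<le> m \<Longrightarrow> \<alpha> i \<le> n"
  by (auto simp: Delta_def)

lemma Delta_mono: "\<alpha> \<in> Delta m n \<Longrightarrow> i \<le> j \<Longrightarrow> j \<le> m \<Longrightarrow> \<alpha> i \<le> \<alpha> j"
  by (auto simp: Delta_def mono_on_def)

lemma DeltaI:
  "(\<And>i. i \<le> m \<Longrightarrow> \<alpha> i \<le> n) \<Longrightarrow> (\<And>i j. i \<le> j \<Longrightarrow> j \<le> m \<Longrightarrow> \<alpha> i \<le> \<alpha> j) \<Longrightarrow>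
   restrict \<alpha> {..m} \<in> Delta m n"
  by (auto simp: Delta_def mono_on_def)

lemma Delta_id: "(\<lambda>i\<in>{..n}. i) \<in> Delta n n"
  by (rule DeltaI) auto

lemma Delta_compose: "\<alpha> \<in> Delta k m \<Longrightarrow> \<beta> \<in> Delta m n \<Longrightarrow> compose {..k} \<beta> \<alpha> \<in> Delta k n"
  by (auto simp: Delta_def mono_on_def compose_def PiE_iff)

lemma Delta_ext:
  "\<alpha> \<in> Delta m n \<Longrightarrow> \<beta> \<in> Delta m n' \<Longrightarrow> (\<And>i. i \<le> m \<Longrightarrow> \<alpha> i = \<beta> i) \<Longrightarrow> \<alpha> = \<beta>"
  by (rule extensionalityI[of _ "{..m}"]) (auto simp: Delta_def PiE_def)

lemma sum_affine_map:
  assumes "\<alpha> \<in> Delta m n" and that: "finite B"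
  shows "(\<Sum>j\<in>B. affine_map m \<alpha> t j) = (\<Sum>i | i \<le> m \<and> \<alpha> i \<in> B. t i)"
proof -
  have "(\<Sum>j\<in>B. affine_map m \<alpha> t j) = (\<Sum>j\<in>B. \<Sum>i\<in>{i \<in> {i. i \<le> m \<and> \<alpha> i \<in> B}. \<alpha> i = j}. t i)"
    unfolding affine_map_def by (intro sum.cong refl) auto
  also have "\<dots> = (\<Sum>i | i \<le> m \<and> \<alpha> i \<in> B. t i)"
    by (rule sum.group) (use that in auto)
  finally show ?thesis .
qed

lemma affine_map_in_simplex:
  assumes a: "\<alpha> \<in> Delta m n" and t: "t \<in> standard_simplex m"
  shows "affine_map m \<alpha> t \<in> standard_simplex n"
proof -
  have s: "sum (affine_map m \<alpha> t) {..n} = 1"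
  proof -
    have "{i. i \<le> m \<and> \<alpha> i \<in> {..n}} = {..m}" using a by (auto simp: Delta_le)
    then show ?thesis using t by (simp add: sum_affine_map[OF a] standard_simplex_def)
  qed
  have nn: "0 \<le> affine_map m \<alpha> t i" for i
    using t by (auto simp: affine_map_def standard_simplex_def intro!: sum_nonneg)
  have z: "affine_map m \<alpha> t i = 0" if "i > n" for i
    unfolding affine_map_def using a that by (intro sum.neutral) (auto dest: Delta_le)
  have "affine_map m \<alpha> t i \<le> 1" for i
  proof (cases "i \<le> n")
    case True
    then have "affine_map m \<alpha> t i \<le> sum (affine_map m \<alpha> t) {..n}"
      by (intro member_le_sum) (auto simp: nn)
    then show ?thesis using s by simp
  qed (simp add: z)
  then show ?thesis using s nn z by (auto simp: standard_simplex_def)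
qed

lemma affine_map_compose:
  assumes "\<alpha> \<in> Delta k m" "\<beta> \<in> Delta m n"
  shows "affine_map k (compose {..k} \<beta> \<alpha>) t = affine_map m \<beta> (affine_map k \<alpha> t)"
proof
  fix j
  have "affine_map m \<beta> (affine_map k \<alpha> t) j = (\<Sum>i\<in>{i. i \<le> m \<and> \<beta> i = j}. affine_map k \<alpha> t i)"
    by (simp add: affine_map_def)
  also have "\<dots> = (\<Sum>i | i \<le> k \<and> \<alpha> i \<in> {i. i \<le> m \<and> \<beta> i = j}. t i)"
    by (rule sum_affine_map[OF assms(1)]) auto
  also have "{i. i \<le> k \<and> \<alpha> i \<in> {i. i \<le> m \<and> \<beta> i = j}} = {i. i \<le> k \<and> compose {..k} \<beta> \<alpha> i = j}"
    using assms by (auto simp: compose_def Delta_le)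
  finally show "affine_map k (compose {..k} \<beta> \<alpha>) t j = affine_map m \<beta> (affine_map k \<alpha> t) j"
    by (simp add: affine_map_def)
qed

lemma continuous_map_affine: "\<alpha> \<in> Delta m n \<Longrightarrow> continuous_map (top_simplex m) (top_simplex n) (affine_map m \<alpha>)"
  unfolding continuous_map_in_subtopology
proof
  show "continuous_map (top_simplex m) (powertop_real UNIV) (affine_map m \<alpha>)"
    unfolding continuous_map_componentwise affine_map_def
    by (auto intro!: continuous_map_sum continuous_map_from_subtopology continuous_map_product_projection)
qed (auto simp: affine_map_in_simplex)

context
  fixes K :: "'a sset"
  assumes K: "simplicial_set K"
begin

lemma sop_cells: "\<alpha> \<in> Delta m n \<Longrightarrow> x \<in> cells K n \<Longrightarrow> sop K m n \<alpha> x \<in> cells K m"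
  using K by (fastforce simp: simplicial_set_def PiE_iff)

lemma sop_id: "x \<in> cells K n \<Longrightarrow> sop K n n (\<lambda>i\<in>{..n}. i) x = x"
  using K by (simp add: simplicial_set_def)

lemma sop_compose:
  "\<alpha> \<in> Delta k m \<Longrightarrow> \<beta> \<in> Delta m n \<Longrightarrow> x \<in> cells K n \<Longrightarrow>
   sop K k m \<alpha> (sop K m n \<beta> x) = sop K k n (compose {..k} \<beta> \<alpha>) x"
  using K by (simp add: simplicial_set_def)

lemma topspace_simplex_sum:
  "((n, x), t) \<in> topspace (simplex_sum K) \<longleftrightarrow> x \<in> cells K n \<and> t \<in> standard_simplex n"
  by (auto simp: simplex_sum_def)

lemma rpt_glue:
  "\<alpha> \<in> Delta m n \<Longrightarrow> x \<in> cells K n \<Longrightarrow> t \<in> standard_simplex m \<Longrightarrow>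
   rpt K m (sop K m n \<alpha> x) t = rpt K n x (affine_map m \<alpha> t)"
  unfolding rpt_def
  by (rule equiv_class_eq[OF equiv_glue_equiv]) (auto simp: glue_equiv_def glue_def intro!: r_into_rtrancl)

text \<open>Gluing relates points through zigzags of single identifications, so respecting the
  generators is enough. Functions on realizations are shown to be well defined in this way.\<close>

lemma glue_equiv_invariant:
  assumes "\<And>m n \<alpha> x t. \<alpha> \<in> Delta m n \<Longrightarrow> x \<in> cells K n \<Longrightarrow> t \<in> standard_simplex m \<Longrightarrow>
      \<Phi> ((m, sop K m n \<alpha> x), t) = \<Phi> ((n, x), affine_map m \<alpha> t)"
    and "(z, z') \<in> glue_equiv K"
  shows "\<Phi> z = \<Phi> z'"
  using assms(2) unfolding glue_equiv_def
proof (induct rule: rtrancl_induct)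
  case (step y z)
  have "\<Phi> a = \<Phi> b" if "(a, b) \<in> glue K" for a b
    using that assms(1) by (auto simp: glue_def)
  then show ?case using step by (metis Un_iff converse_iff)
qed simp

text \<open>The \<open>topspace\<close> of a quotient is its largest open set, so the point is that
  the set of all classes of points of \<open>simplex_sum\<close> is itself open.\<close>

lemma quotient_map_realization:
  "quotient_map (simplex_sum K) (realization K) (\<lambda>z. glue_equiv K `` {z})"
proof -
  have "topspace (simplex_sum K) // glue_equiv K
      \<subseteq> topspace (realization K)"
  proof (rule openin_subset)
    have "{x \<in> topspace (simplex_sum K). glue_equiv K `` {x} \<in> topspace (simplex_sum K) // glue_equiv K}
        = topspace (simplex_sum K)"
      by (auto simp: quotientI)
    then show "openin (realization K) (topspace (simplex_sum K) // glue_equiv K)"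
      by (simp add: realization_def openin_quotient_topology)
  qed
  moreover have "topspace (realization K) \<subseteq> topspace (simplex_sum K) // glue_equiv K"
    unfolding realization_def
    using openin_topspace[of "quotient_topology (simplex_sum K) (glue_equiv K)"]
    unfolding openin_quotient_topology by blast
  ultimately have "topspace (realization K) = topspace (simplex_sum K) // glue_equiv K" by blast
  moreover have "(\<lambda>z. glue_equiv K `` {z}) ` topspace (simplex_sum K) = topspace (simplex_sum K) // glue_equiv K"
    by (auto simp: quotient_def)
  ultimately show ?thesis
    by (simp add: quotient_map_def realization_def openin_quotient_topology)
qed

lemma rpt_in_topspace: "x \<in> cells K n \<Longrightarrow> t \<in> standard_simplex n \<Longrightarrow> rpt K n x t \<in> topspace (realization K)"
  using quotient_imp_surjective_map[OF quotient_map_realization] topspace_simplex_sum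
  unfolding rpt_def by fast

lemma realizationE:
  assumes "c \<in> topspace (realization K)"
  obtains n x t where "x \<in> cells K n" "t \<in> standard_simplex n" "c = rpt K n x t"
proof -
  obtain z where "z \<in> topspace (simplex_sum K)" "c = glue_equiv K `` {z}"
    using assms quotient_imp_surjective_map[OF quotient_map_realization] by (metis (no_types, lifting) imageE)
  moreover obtain n x t where "z = ((n, x), t)" by (metis surj_pair)
  ultimately show ?thesis
    using that topspace_simplex_sum unfolding rpt_def by blast
qed

lemma continuous_map_rpt:
  assumes x: "x \<in> cells K n"
  shows "continuous_map (top_simplex n) (realization K) (rpt K n x)"
proof -
  have "continuous_map (top_simplex n) (simplex_sum K) (\<lambda>t. ((n, x), t))"
    unfolding simplex_sum_def
    using continuous_map_component_injection[of "(n, x)" "{(n, x). x \<in> cells K n}"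
        "\<lambda>(n, x). top_simplex n"] x by auto
  from continuous_map_compose[OF this quotient_imp_continuous_map[OF quotient_map_realization]]
  show ?thesis by (simp add: o_def rpt_def[abs_def])
qed

lemma continuous_map_simplex_sum:
  assumes "\<And>n x. x \<in> cells K n \<Longrightarrow> continuous_map (top_simplex n) Y (\<lambda>t. f ((n, x), t))"
  shows "continuous_map (simplex_sum K) Y f"
  unfolding continuous_map_def
proof (intro conjI allI impI)
  show "f \<in> topspace (simplex_sum K) \<rightarrow> topspace Y"
  proof
    fix z assume z: "z \<in> topspace (simplex_sum K)"
    obtain n x t where "z = ((n, x), t)" by (metis surj_pair)
    then show "f z \<in> topspace Y"
      using z continuous_map_funspace[OF assms[of x n]] by (auto simp: topspace_simplex_sum Pi_iff)
  qed
  fix U assume U: "openin Y U"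
  show "openin (simplex_sum K) {z \<in> topspace (simplex_sum K). f z \<in> U}"
    unfolding simplex_sum_def openin_sum_topology
  proof (intro conjI ballI)
    fix i assume "i \<in> {(n, x). x \<in> cells K n}"
    then obtain n x where i: "i = (n, x)" "x \<in> cells K n" by auto
    have "{t. (i, t) \<in> {z \<in> topspace (sum_topology (\<lambda>(n, x). top_simplex n) {(n, x). x \<in> cells K n}). f z \<in> U}}
       = {t \<in> topspace (top_simplex n). f ((n, x), t) \<in> U}"
      using i by auto
    then show "openin (case i of (n, x) \<Rightarrow> top_simplex n)
        {t. (i, t) \<in> {z \<in> topspace (sum_topology (\<lambda>(n, x). top_simplex n) {(n, x). x \<in> cells K n}). f z \<in> U}}"
      using assms[OF i(2)] U i unfolding continuous_map_def by auto
  qed auto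
qed

end

lemma simplicial_map_cells: "simplicial_map K L \<phi> \<Longrightarrow> x \<in> cells K n \<Longrightarrow> \<phi> n x \<in> cells L n"
  by (auto simp: simplicial_map_def PiE_iff)

lemma simplicial_map_sop:
  "simplicial_map K L \<phi> \<Longrightarrow> \<alpha> \<in> Delta m n \<Longrightarrow> x \<in> cells K n \<Longrightarrow> \<phi> m (sop K m n \<alpha> x) = sop L m n \<alpha> (\<phi> n x)"
  by (auto simp: simplicial_map_def)

text \<open>\<open>realization_map\<close> collects the images of all representatives of a class;
  they fall into one class because \<open>\<phi>\<close> commutes with the structure maps.\<close>

lemma realization_map_rpt:
  assumes K: "simplicial_set K" and L: "simplicial_set L" and f: "simplicial_map K L \<phi>"
    and x: "x \<in> cells K n" and t: "t \<in> standard_simplex n"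
  shows "realization_map L \<phi> (rpt K n x t) = rpt L n (\<phi> n x) t"
proof -
  define \<Phi> where "\<Phi> z = glue_equiv L `` {(\<lambda>((n, x), t). ((n, \<phi> n x), t)) z}" for z :: "'a rpoint"
  have inv: "\<Phi> ((n, x), t) = \<Phi> z" if "(((n, x), t), z) \<in> glue_equiv K" for z
  proof (rule glue_equiv_invariant[OF K _ that, of \<Phi>])
    fix m n \<alpha> x t assume a: "\<alpha> \<in> Delta m n" "x \<in> cells K n" "t \<in> standard_simplex m"
    show "\<Phi> ((m, sop K m n \<alpha> x), t) = \<Phi> ((n, x), affine_map m \<alpha> t)"
      using rpt_glue[OF L a(1) simplicial_map_cells[OF f a(2)] a(3)]
      unfolding \<Phi>_def rpt_def prod.case simplicial_map_sop[OF f a(1,2)] .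
  qed
  have Un: "R `` (F ` A) = (\<Union>z\<in>A. R `` {F z})" for R :: "('b rpoint \<times> 'b rpoint) set" and F and A :: "'a rpoint set"
    by auto
  have "realization_map L \<phi> (rpt K n x t) = (\<Union>z\<in>rpt K n x t. \<Phi> z)"
    unfolding realization_map_def \<Phi>_def by (rule Un)
  also have "\<dots> = \<Phi> ((n, x), t)"
  proof (rule UN_constant_eq[of "((n, x), t)"], goal_cases)
    case 1
    show ?case
      unfolding rpt_def glue_equiv_def by (rule ImageI[OF rtrancl_refl singletonI])
  next
    case 2
    show ?case
    proof
    fix z assume "z \<in> rpt K n x t"
    then show "\<Phi> z = \<Phi> ((n, x), t)"
      unfolding rpt_def Image_singleton_iff by (rule inv[symmetric])
    qed
  qed
  finally show ?thesis unfolding \<Phi>_def rpt_def prod.case .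
qed

lemma continuous_map_realization_map:
  assumes K: "simplicial_set K" and L: "simplicial_set L" and f: "simplicial_map K L \<phi>"
  shows "continuous_map (realization K) (realization L) (realization_map L \<phi>)"
proof -
  have "continuous_map (simplex_sum K) (realization L)
      (realization_map L \<phi> \<circ> (\<lambda>z. glue_equiv K `` {z}))"
  proof (rule continuous_map_simplex_sum[OF K])
    fix n x assume x: "x \<in> cells K n"
    have "continuous_map (top_simplex n) (realization L) (rpt L n (\<phi> n x))"
      by (intro continuous_map_rpt[OF L] simplicial_map_cells[OF f x])
    then show "continuous_map (top_simplex n) (realization L)
        (\<lambda>t. (realization_map L \<phi> \<circ> (\<lambda>z. glue_equiv K `` {z})) ((n, x), t))"
      by (rule continuous_map_eq)
        (use realization_map_rpt[OF K L f x] in \<open>auto simp: rpt_def\<close>)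
  qed
  then show ?thesis
    using continuous_compose_quotient_map_eq[OF quotient_map_realization[OF K]] by blast
qed

section \<open>Simplicial homotopies\<close>

text \<open>Over a point with barycentric coordinates \<open>t\<close>, the vertical interval of the
  prism is cut at these cumulative sums.\<close>

definition cum :: "(nat \<Rightarrow> real) \<Rightarrow> nat \<Rightarrow> real" where
  "cum t k = sum t {..<k}"

text \<open>The \<open>n+1\<close> top-dimensional simplices of the prism over the \<open>n\<close>-simplex: the \<open>i\<close>-th one projects
  to the \<open>n\<close>-simplex by \<open>degen n i\<close> and to the interval by \<open>jump n i\<close>.\<close>

definition degen :: "nat \<Rightarrow> nat \<Rightarrow> nat \<Rightarrow> nat" where
  "degen n i = (\<lambda>j\<in>{..Suc n}. if j \<le> i then j else j - 1)"

definition jump :: "nat \<Rightarrow> nat \<Rightarrow> nat \<Rightarrow> nat" where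
  "jump n i = (\<lambda>j\<in>{..Suc n}. if j \<le> i then 0 else 1)"

definition coface :: "nat \<Rightarrow> nat \<Rightarrow> nat \<Rightarrow> nat" where
  "coface n i = (\<lambda>j\<in>{..n}. if j < i then j else Suc j)"

text \<open>The weight \<open>t\<close> read from vertex 0 upward until the mass \<open>r\<close> is
  used up: full weights below \<open>i\<close>, the remainder at \<open>i\<close>.\<close>

definition lower_weight :: "nat \<Rightarrow> (nat \<Rightarrow> real) \<Rightarrow> real \<Rightarrow> nat \<Rightarrow> real" where
  "lower_weight i t r j = (if j < i then t j else if j = i then r - cum t i else 0)"

text \<open>Barycentric coordinates, in the \<open>i\<close>-th simplex of the prism, of the point over \<open>t\<close> whose
  interval coordinates are \<open>(r, 1 - r)\<close>.  The point lies in this simplex if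
  \<open>cum t i \<le> r \<le> cum t (Suc i)\<close>.\<close>

definition prism_weight :: "nat \<Rightarrow> (nat \<Rightarrow> real) \<Rightarrow> real \<Rightarrow> nat \<Rightarrow> real" where
  "prism_weight i t r j =
     (if j \<le> i then lower_weight i t r j else t (j - 1) - lower_weight i t r (j - 1))"

lemma cum_simps [simp]: "cum t 0 = 0" "cum t (Suc k) = cum t k + t k"
  by (auto simp: cum_def)

lemma cum_mono: "t \<in> standard_simplex n \<Longrightarrow> k \<le> l \<Longrightarrow> cum t k \<le> cum t l"
  unfolding cum_def by (rule sum_mono2) (auto simp: standard_simplex_def)

lemma cum_top: "t \<in> standard_simplex n \<Longrightarrow> cum t (Suc n) = 1"
  by (simp add: standard_simplex_def cum_def lessThan_Suc_atMost)

lemma degen_Delta: "i \<le> n \<Longrightarrow> degen n i \<in> Delta (Suc n) n"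
  unfolding degen_def by (rule DeltaI) auto

lemma jump_Delta: "jump n i \<in> Delta (Suc n) 1"
  unfolding jump_def by (rule DeltaI) auto

lemma coface_Delta: "coface n i \<in> Delta n (Suc n)"
  unfolding coface_def by (rule DeltaI) auto

lemma sum_lower_weight: "i \<le> n \<Longrightarrow> sum (lower_weight i t r) {..n} = r"
proof (induct n)
  case 0 then show ?case by (simp add: lower_weight_def)
next
  case (Suc n)
  have "sum (lower_weight i t r) {..n} = sum t {..n}" if "n < i"
    using that by (intro sum.cong) (auto simp: lower_weight_def)
  then show ?case
    using Suc by (cases "i \<le> n") (auto simp: lower_weight_def cum_def lessThan_Suc_atMost not_le le_Suc_eq)
qed

text \<open>The vertex \<open>i\<close> is doubled in the i-th prism simplex: positions
  \<open>l \<le> i\<close> carry the lower part of \<open>t\<close>, positions \<open>Suc l\<close>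
  with \<open>l \<ge> i\<close> the rest. Splitting the sum there leaves sums indexed by the
  vertices of the original simplex.\<close>

lemma affine_prism:
  "i \<le> m \<Longrightarrow> affine_map (Suc m) \<beta> (prism_weight i t r) k =
    (\<Sum>l\<le>i. if \<beta> l = k then lower_weight i t r l else 0) +
    (\<Sum>l\<in>{i..m}. if \<beta> (Suc l) = k then t l - lower_weight i t r l else 0)"
proof -
  assume i: "i \<le> m"
  have "affine_map (Suc m) \<beta> (prism_weight i t r) k =
      (\<Sum>l\<le>Suc m. if \<beta> l = k then prism_weight i t r l else 0)"
    unfolding affine_map_def by (rule sum.mono_neutral_cong_left) auto
  also have "{..Suc m} = {..i} \<union> {Suc i..Suc m}" using i by auto
  also have "(\<Sum>l\<in>{..i} \<union> {Suc i..Suc m}. if \<beta> l = k then prism_weight i t r l else 0)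
     = (\<Sum>l\<le>i. if \<beta> l = k then prism_weight i t r l else 0)
     + (\<Sum>l\<in>{Suc i..Suc m}. if \<beta> l = k then prism_weight i t r l else 0)"
    by (rule sum.union_disjoint) auto
  also have "(\<Sum>l\<in>{Suc i..Suc m}. if \<beta> l = k then prism_weight i t r l else 0)
     = (\<Sum>l\<in>{i..m}. if \<beta> (Suc l) = k then prism_weight i t r (Suc l) else 0)"
    by (rule sum.shift_bounds_cl_Suc_ivl)
  also have "(\<Sum>l\<le>i. if \<beta> l = k then prism_weight i t r l else 0) =
      (\<Sum>l\<le>i. if \<beta> l = k then lower_weight i t r l else 0)"
    by (intro sum.cong) (auto simp: prism_weight_def)
  also have "(\<Sum>l\<in>{i..m}. if \<beta> (Suc l) = k then prism_weight i t r (Suc l) else 0) =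
      (\<Sum>l\<in>{i..m}. if \<beta> (Suc l) = k then t l - lower_weight i t r l else 0)"
    by (intro sum.cong) (auto simp: prism_weight_def)
  finally show ?thesis .
qed

lemma prism_weight_simplex:
  assumes t: "t \<in> standard_simplex n" and i: "i \<le> n" and r: "cum t i \<le> r" "r \<le> cum t (Suc i)"
  shows "prism_weight i t r \<in> standard_simplex (Suc n)"
proof -
  have nn: "0 \<le> prism_weight i t r j" for j
    using t r by (auto simp: prism_weight_def lower_weight_def standard_simplex_def)
  have s: "sum (prism_weight i t r) {..Suc n} = 1"
  proof -
    have "sum (prism_weight i t r) {..Suc n} = affine_map (Suc n) (\<lambda>l. 0) (prism_weight i t r) 0"
      by (simp add: affine_map_def atMost_def)
    also have "\<dots> = (\<Sum>l\<le>i. lower_weight i t r l) + (\<Sum>l\<in>{i..n}. t l - lower_weight i t r l)"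
      by (simp add: affine_prism[OF i])
    also have "(\<Sum>l\<in>{i..n}. t l - lower_weight i t r l) = (\<Sum>l\<le>n. t l - lower_weight i t r l)"
      by (rule sum.mono_neutral_left) (auto simp: lower_weight_def)
    also have "(\<Sum>l\<le>n. t l - lower_weight i t r l) = 1 - r"
      using t sum_lower_weight[OF i] by (simp add: sum_subtractf standard_simplex_def)
    finally show ?thesis by (simp add: sum_lower_weight)
  qed
  have z: "prism_weight i t r j = 0" if "j > Suc n" for j
    using that i t by (auto simp: prism_weight_def lower_weight_def standard_simplex_def)
  have "prism_weight i t r j \<le> 1" for j
  proof (cases "j \<le> Suc n")
    case True
    then have "prism_weight i t r j \<le> sum (prism_weight i t r) {..Suc n}"
      by (intro member_le_sum) (auto simp: nn)
    then show ?thesis using s by simp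
  qed (simp add: z)
  then show ?thesis using s nn z by (auto simp: standard_simplex_def)
qed

text \<open>The two copies of vertex \<open>i\<close> carry the two portions of \<open>t i\<close>,
  and \<open>degen\<close> adds them up again.\<close>

lemma affine_degen_prism:
  assumes t: "t \<in> standard_simplex n" and i: "i \<le> n"
  shows "affine_map (Suc n) (degen n i) (prism_weight i t r) = t"
proof
  fix k
  have "(\<Sum>l\<le>i. if degen n i l = k then lower_weight i t r l else 0) =
      (\<Sum>l\<le>i. if l = k then lower_weight i t r l else 0)"
    using i by (intro sum.cong) (auto simp: degen_def)
  moreover have "(\<Sum>l\<in>{i..n}. if degen n i (Suc l) = k then t l - lower_weight i t r l else 0) =
      (\<Sum>l\<in>{i..n}. if l = k then t l - lower_weight i t r l else 0)"
    using i by (intro sum.cong) (auto simp: degen_def)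
  ultimately show "affine_map (Suc n) (degen n i) (prism_weight i t r) k = t k"
    using t i unfolding affine_prism[OF i]
    by (auto simp: lower_weight_def standard_simplex_def)
qed

lemma prism_region_exists:
  assumes t: "t \<in> standard_simplex n" and r: "0 \<le> r" "r \<le> 1"
  shows "\<exists>i\<le>n. cum t i \<le> r \<and> r \<le> cum t (Suc i)"
proof -
  define i where "i = (LEAST i. r \<le> cum t (Suc i))"
  have n: "r \<le> cum t (Suc n)" using cum_top[OF t] r by simp
  have "r \<le> cum t (Suc i)" unfolding i_def by (rule LeastI[of _ n]) (rule n)
  moreover have "i \<le> n" unfolding i_def by (rule Least_le) (rule n)
  moreover have "cum t i \<le> r"
  proof (cases i)
    case (Suc k)
    then have "\<not> r \<le> cum t (Suc k)"
      unfolding i_def using not_less_Least[of k "\<lambda>i. r \<le> cum t (Suc i)"] by auto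
    then show ?thesis using Suc by simp
  qed (use r in simp)
  ultimately show ?thesis by blast
qed

lemma affine_coface:
  assumes t: "t \<in> standard_simplex n" and i: "i \<le> Suc n"
  shows "affine_map n (coface n i) t j = (if j < i then t j else if j = i then 0 else t (j - 1))"
proof -
  have *: "affine_map n (coface n i) t j = (\<Sum>l\<le>n. if coface n i l = j then t l else 0)"
    unfolding affine_map_def by (rule sum.mono_neutral_cong_left) auto
  consider "j < i" | "j = i" | "j > i" by linarith
  then show ?thesis
  proof cases
    case 1
    then have "(\<Sum>l\<le>n. if coface n i l = j then t l else 0) = (\<Sum>l\<le>n. if l = j then t l else 0)"
      by (intro sum.cong) (auto simp: coface_def)
    then show ?thesis using 1 i * t by (auto simp: standard_simplex_def)
  next
    case 2
    then have "(\<Sum>l\<le>n. if coface n i l = j then t l else 0) = 0"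
      by (intro sum.neutral) (auto simp: coface_def)
    then show ?thesis using 2 * by simp
  next
    case 3
    then have "(\<Sum>l\<le>n. if coface n i l = j then t l else 0) = (\<Sum>l\<le>n. if l = j - 1 then t l else 0)"
      by (intro sum.cong) (auto simp: coface_def)
    then show ?thesis using 3 i * t by (auto simp: standard_simplex_def)
  qed
qed

text \<open>Every point has a product neighbourhood whose second factor lies in one summand, so
  continuity may be tested simplex by simplex.\<close>

lemma continuous_map_prod_simplex_sum:
  assumes K: "simplicial_set K"
    and f: "\<And>n x. x \<in> cells K n \<Longrightarrow> continuous_map (prod_topology Z (top_simplex n)) Y (\<lambda>(s, t). f (s, ((n, x), t)))"
  shows "continuous_map (prod_topology Z (simplex_sum K)) Y f"
  unfolding continuous_map_def
proof (intro conjI allI impI)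
  show "f \<in> topspace (prod_topology Z (simplex_sum K)) \<rightarrow> topspace Y"
  proof
    fix z assume z: "z \<in> topspace (prod_topology Z (simplex_sum K))"
    obtain s n x t where "z = (s, ((n, x), t))" by (metis surj_pair)
    then show "f z \<in> topspace Y"
      using z continuous_map_funspace[OF f[of x n]] by (auto simp: topspace_simplex_sum[OF K] Pi_iff)
  qed
  fix U assume U: "openin Y U"
  show "openin (prod_topology Z (simplex_sum K)) {z \<in> topspace (prod_topology Z (simplex_sum K)). f z \<in> U}"
    unfolding openin_prod_topology_alt
  proof (intro allI impI)
    fix s y assume sy: "(s, y) \<in> {z \<in> topspace (prod_topology Z (simplex_sum K)). f z \<in> U}"
    obtain n x t where y: "y = ((n, x), t)" by (metis surj_pair)
    have x: "x \<in> cells K n" and t: "t \<in> standard_simplex n" and s: "s \<in> topspace Z"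
      using sy y by (auto simp: topspace_simplex_sum[OF K])
    have "openin (prod_topology Z (top_simplex n))
        {z \<in> topspace (prod_topology Z (top_simplex n)). (\<lambda>(s, t). f (s, ((n, x), t))) z \<in> U}"
      using f[OF x] U unfolding continuous_map_def by blast
    moreover have "(s, t) \<in> {z \<in> topspace (prod_topology Z (top_simplex n)). (\<lambda>(s, t). f (s, ((n, x), t))) z \<in> U}"
      using sy y s t by auto
    ultimately obtain A B where AB: "openin Z A" "openin (top_simplex n) B" "s \<in> A" "t \<in> B"
      "A \<times> B \<subseteq> {z \<in> topspace (prod_topology Z (top_simplex n)). (\<lambda>(s, t). f (s, ((n, x), t))) z \<in> U}"
      unfolding openin_prod_topology_alt by meson
    have Bs: "B \<subseteq> standard_simplex n" using openin_subset[OF AB(2)] by simp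
    have "openin (simplex_sum K) (Pair (n, x) ` B)"
      unfolding simplex_sum_def openin_sum_topology
    proof (intro conjI ballI)
      show "Pair (n, x) ` B \<subseteq> Sigma {(n, x). x \<in> cells K n} (topspace \<circ> (\<lambda>(n, x). top_simplex n))"
        using x Bs by auto
      fix i
      have "{t. (i, t) \<in> Pair (n, x) ` B} = (if i = (n, x) then B else {})" by auto
      then show "openin (case i of (n, x) \<Rightarrow> top_simplex n) {t. (i, t) \<in> Pair (n, x) ` B}"
        using AB(2) by auto
    qed
    moreover have "A \<times> Pair (n, x) ` B \<subseteq> {z \<in> topspace (prod_topology Z (simplex_sum K)). f z \<in> U}"
      using AB(5) x by (auto simp: topspace_simplex_sum[OF K])
    ultimately show "\<exists>A B. openin Z A \<and> openin (simplex_sum K) B \<and> s \<in> A \<and> y \<in> B \<and>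
        A \<times> B \<subseteq> {z \<in> topspace (prod_topology Z (simplex_sum K)). f z \<in> U}"
      using AB y by blast
  qed
qed

text \<open>A simplicial map from the product of \<open>K\<close> with the 1-simplex to
  \<open>L\<close>, curried: \<open>\<xi>\<close> is an n-simplex of the interval, and
  \<open>H_sop\<close> is compatibility with the structure maps of the product.\<close>

locale simplicial_homotopy =
  fixes K :: "'a sset" and L :: "'b sset" and H :: "nat \<Rightarrow> 'a \<Rightarrow> (nat \<Rightarrow> nat) \<Rightarrow> 'b"
  assumes K: "simplicial_set K" and L: "simplicial_set L"
    and H_cells: "\<And>n x \<xi>. x \<in> cells K n \<Longrightarrow> \<xi> \<in> Delta n 1 \<Longrightarrow> H n x \<xi> \<in> cells L n"
    and H_sop: "\<And>m n \<alpha> x \<xi>. \<alpha> \<in> Delta m n \<Longrightarrow> x \<in> cells K n \<Longrightarrow> \<xi> \<in> Delta n 1 \<Longrightarrow>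
      H m (sop K m n \<alpha> x) (compose {..m} \<xi> \<alpha>) = sop L m n \<alpha> (H n x \<xi>)"
begin

definition prism_cell :: "nat \<Rightarrow> 'a \<Rightarrow> nat \<Rightarrow> 'b" where
  "prism_cell n x i = H (Suc n) (sop K (Suc n) n (degen n i) x) (jump n i)"

definition prism_pt :: "nat \<Rightarrow> 'a \<Rightarrow> (nat \<Rightarrow> real) \<Rightarrow> real \<Rightarrow> nat \<Rightarrow> 'b rpoint set" where
  "prism_pt n x t r i = rpt L (Suc n) (prism_cell n x i) (prism_weight i t r)"

lemma prism_cell_cells: "x \<in> cells K n \<Longrightarrow> i \<le> n \<Longrightarrow> prism_cell n x i \<in> cells L (Suc n)"
  unfolding prism_cell_def by (intro H_cells sop_cells[OF K] degen_Delta jump_Delta)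

text \<open>A vanishing weight at \<open>l\<close> puts the point on the face opposite
  \<open>l\<close>. For \<open>l = i\<close> or \<open>l = Suc i\<close> this face projects
  identically to the n-simplex, so the value there is \<open>H\<close> at \<open>x\<close> itself
  with the restricted jump.\<close>

lemma prism_pt_face:
  assumes x: "x \<in> cells K n" and t: "t \<in> standard_simplex n" and i: "i \<le> n"
    and w: "\<And>j. prism_weight i t r j = (if j < l then t j else if j = l then 0 else t (j - 1))"
    and l: "l = i \<or> l = Suc i"
  shows "prism_pt n x t r i = rpt L n (H n x (compose {..n} (jump n i) (coface n l))) t"
proof -
  have l': "l \<le> Suc n" using l i by auto
  have id: "compose {..n} (degen n i) (coface n l) = (\<lambda>j\<in>{..n}. j)"
    using l by (auto simp: compose_def degen_def coface_def fun_eq_iff)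
  have "prism_pt n x t r i = rpt L (Suc n) (prism_cell n x i) (affine_map n (coface n l) t)"
    unfolding prism_pt_def
    by (rule arg_cong[where f = "rpt L (Suc n) (prism_cell n x i)"])
      (simp add: fun_eq_iff w affine_coface[OF t l'])
  also have "\<dots> = rpt L n (sop L n (Suc n) (coface n l) (prism_cell n x i)) t"
    by (rule rpt_glue[OF L coface_Delta prism_cell_cells[OF x i] t, symmetric])
  also have "sop L n (Suc n) (coface n l) (prism_cell n x i) =
      H n (sop K n (Suc n) (coface n l) (sop K (Suc n) n (degen n i) x)) (compose {..n} (jump n i) (coface n l))"
    unfolding prism_cell_def
    by (rule H_sop[OF coface_Delta sop_cells[OF K degen_Delta[OF i] x] jump_Delta, symmetric])
  also have "sop K n (Suc n) (coface n l) (sop K (Suc n) n (degen n i) x) = x"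
    by (simp add: sop_compose[OF K coface_Delta degen_Delta[OF i] x] id sop_id[OF K x])
  finally show ?thesis .
qed

text \<open>The point lies on the face opposite vertex \<open>Suc i\<close> of both prism simplices,
  and the two jumps agree on that face.\<close>

lemma prism_pt_adjacent:
  assumes x: "x \<in> cells K n" and t: "t \<in> standard_simplex n" and i: "Suc i \<le> n" and r: "r = cum t (Suc i)"
  shows "prism_pt n x t r i = prism_pt n x t r (Suc i)"
proof -
  have "prism_pt n x t r i = rpt L n (H n x (compose {..n} (jump n i) (coface n (Suc i)))) t"
  proof (rule prism_pt_face[OF x t])
    show "prism_weight i t r j = (if j < Suc i then t j else if j = Suc i then 0 else t (j - 1))" for j
      using r by (cases j i rule: linorder_cases) (auto simp: prism_weight_def lower_weight_def)
  qed (use i in auto)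
  also have "compose {..n} (jump n i) (coface n (Suc i)) = compose {..n} (jump n (Suc i)) (coface n (Suc i))"
    by (auto simp: compose_def jump_def coface_def fun_eq_iff)
  also have "rpt L n (H n x \<dots>) t = prism_pt n x t r (Suc i)"
    by (rule prism_pt_face[OF x t, symmetric]) (use i r in \<open>auto simp: prism_weight_def lower_weight_def\<close>)
  finally show ?thesis .
qed

text \<open>When \<open>i < j\<close>, the bounds force \<open>r\<close> to equal all cumulative
  sums from \<open>Suc i\<close> to \<open>j\<close>, so the point lies on every common face in
  between.\<close>

lemma prism_pt_unique:
  assumes x: "x \<in> cells K n" and t: "t \<in> standard_simplex n" and ij: "i \<le> j" "j \<le> n"
    and r: "r \<le> cum t (Suc i)" "cum t j \<le> r"
  shows "prism_pt n x t r i = prism_pt n x t r j"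
  using ij r
proof (induct j rule: dec_induct)
  case (step j)
  have "cum t (Suc i) \<le> cum t (Suc j)" by (rule cum_mono[OF t]) (use step in auto)
  then have *: "r = cum t (Suc j)" using step.prems by linarith
  have "cum t j \<le> r" using cum_mono[OF t, of j "Suc j"] * by simp
  then show ?case
    using step prism_pt_adjacent[OF x t _ *] by simp
qed simp

lemma prism_pt_unique':
  assumes x: "x \<in> cells K n" and t: "t \<in> standard_simplex n" and "i \<le> n" "j \<le> n"
    and "cum t i \<le> r" "r \<le> cum t (Suc i)" "cum t j \<le> r" "r \<le> cum t (Suc j)"
  shows "prism_pt n x t r i = prism_pt n x t r j"
  using prism_pt_unique[OF x t, of i j r] prism_pt_unique[OF x t, of j i r] assms
  by (metis nle_le)

text \<open>Time \<open>s\<close> has interval coordinates \<open>(1 - s, s)\<close>, which places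
  time 0 at vertex 0. The choice of a simplex containing the point is harmless by
  \<open>prism_pt_unique'\<close>.\<close>

definition prism_map :: "real \<times> 'a rpoint \<Rightarrow> 'b rpoint set" where
  "prism_map = (\<lambda>(s, ((n, x), t)). prism_pt n x t (1 - s)
     (SOME i. i \<le> n \<and> cum t i \<le> 1 - s \<and> 1 - s \<le> cum t (Suc i)))"

lemma prism_map_eq:
  assumes x: "x \<in> cells K n" and t: "t \<in> standard_simplex n" and s: "s \<in> {0..1}"
    and i: "i \<le> n" "cum t i \<le> 1 - s" "1 - s \<le> cum t (Suc i)"
  shows "prism_map (s, ((n, x), t)) = prism_pt n x t (1 - s) i"
proof -
  let ?P = "\<lambda>i. i \<le> n \<and> cum t i \<le> 1 - s \<and> 1 - s \<le> cum t (Suc i)"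
  have "?P (SOME i. ?P i)" by (rule someI[of ?P i]) (use i in auto)
  then show ?thesis
    unfolding prism_map_def prod.case by (intro prism_pt_unique'[OF x t]) (use i in auto)
qed

lemma continuous_map_prism:
  assumes x: "x \<in> cells K n"
  shows "continuous_map (prod_topology (top_of_set {0..1}) (top_simplex n)) (realization L)
    (\<lambda>(s, t). prism_map (s, ((n, x), t)))"
\<comment> \<open>The prism is covered by finitely many closed pieces, one for each simplex. The
  inequalities are written as differences lying in \<open>{..0}\<close> to exhibit the pieces as
  preimages of closed sets.\<close>
proof (rule pasting_lemma_closed[where I = "{..n}" and f = "\<lambda>i (s, t). prism_pt n x t (1 - s) i"
      and T = "\<lambda>i. {z \<in> topspace (prod_topology (top_of_set {0..1}) (top_simplex n)).
        cum (snd z) i - (1 - fst z) \<in> {..0} \<and> (1 - fst z) - cum (snd z) (Suc i) \<in> {..0}}"])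
  let ?X = "prod_topology (top_of_set {0..1::real}) (top_simplex n)"
  have coord: "continuous_map ?X euclideanreal (\<lambda>z. snd z i)" for i
  proof -
    have "continuous_map (top_simplex n) euclideanreal (\<lambda>t. t i)"
      by (intro continuous_map_from_subtopology continuous_map_product_projection) auto
    from continuous_map_compose[OF continuous_map_snd this] show ?thesis by (simp add: o_def)
  qed
  have cfst: "continuous_map ?X euclideanreal fst"
    using continuous_map_fst continuous_map_into_fulltopology by blast
  have ccum: "continuous_map ?X euclideanreal (\<lambda>z. cum (snd z) i)" for i
    unfolding cum_def by (intro continuous_map_sum coord) auto
  show "closedin ?X {z \<in> topspace ?X.
        cum (snd z) i - (1 - fst z) \<in> {..0} \<and> (1 - fst z) - cum (snd z) (Suc i) \<in> {..0}}" for i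
  proof -
    have "closedin ?X {z \<in> topspace ?X. cum (snd z) i - (1 - fst z) \<in> {..0}}"
      by (rule closedin_continuous_map_preimage[of _ euclideanreal])
        (intro continuous_intros ccum cfst | simp)+
    moreover have "closedin ?X {z \<in> topspace ?X. (1 - fst z) - cum (snd z) (Suc i) \<in> {..0}}"
      by (rule closedin_continuous_map_preimage[of _ euclideanreal])
        (intro continuous_intros ccum cfst | simp del: cum_simps)+
    ultimately have "closedin ?X ({z \<in> topspace ?X. cum (snd z) i - (1 - fst z) \<in> {..0}} \<inter>
        {z \<in> topspace ?X. (1 - fst z) - cum (snd z) (Suc i) \<in> {..0}})" by (rule closedin_Int)
    moreover have "{z \<in> topspace ?X. cum (snd z) i - (1 - fst z) \<in> {..0}} \<inter>
        {z \<in> topspace ?X. (1 - fst z) - cum (snd z) (Suc i) \<in> {..0}} =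
        {z \<in> topspace ?X. cum (snd z) i - (1 - fst z) \<in> {..0} \<and> (1 - fst z) - cum (snd z) (Suc i) \<in> {..0}}"
      by blast
    ultimately show ?thesis by simp
  qed
  show "continuous_map (subtopology ?X {z \<in> topspace ?X.
        cum (snd z) i - (1 - fst z) \<in> {..0} \<and> (1 - fst z) - cum (snd z) (Suc i) \<in> {..0}})
      (realization L) (\<lambda>(s, t). prism_pt n x t (1 - s) i)" if i: "i \<in> {..n}" for i
  proof -
    let ?S = "{z \<in> topspace ?X. cum (snd z) i - (1 - fst z) \<in> {..0} \<and> (1 - fst z) - cum (snd z) (Suc i) \<in> {..0}}"
    have lw: "continuous_map ?X euclideanreal (\<lambda>z. lower_weight i (snd z) (1 - fst z) j)" for j
      unfolding lower_weight_def
      by (cases "j < i"; cases "j = i") (auto intro!: continuous_intros ccum cfst coord)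
    have "continuous_map ?X euclideanreal (\<lambda>z. prism_weight i (snd z) (1 - fst z) j)" for j
      unfolding prism_weight_def
      by (cases "j \<le> i") (auto intro!: continuous_intros lw coord)
    then have "continuous_map (subtopology ?X ?S) (top_simplex (Suc n)) (\<lambda>z. prism_weight i (snd z) (1 - fst z))"
      unfolding continuous_map_in_subtopology continuous_map_componentwise
      using i by (auto intro!: continuous_map_from_subtopology prism_weight_simplex)
    from continuous_map_compose[OF this continuous_map_rpt[OF L prism_cell_cells[OF x]], of i] i
    show ?thesis by (simp add: o_def prism_pt_def case_prod_unfold)
  qed
  show "(\<lambda>(s, t). prism_pt n x t (1 - s) i) z = (\<lambda>(s, t). prism_pt n x t (1 - s) j) z"
    if "i \<in> {..n}" "j \<in> {..n}" "z \<in> topspace ?X \<inter>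
        {z \<in> topspace ?X. cum (snd z) i - (1 - fst z) \<in> {..0} \<and> (1 - fst z) - cum (snd z) (Suc i) \<in> {..0}} \<inter>
        {z \<in> topspace ?X. cum (snd z) j - (1 - fst z) \<in> {..0} \<and> (1 - fst z) - cum (snd z) (Suc j) \<in> {..0}}" for i j z
    using that prism_pt_unique'[OF x, of "snd z" i j "1 - fst z"] by (auto simp: case_prod_beta)
  show "\<exists>j. j \<in> {..n} \<and> z \<in> {z \<in> topspace ?X.
        cum (snd z) j - (1 - fst z) \<in> {..0} \<and> (1 - fst z) - cum (snd z) (Suc j) \<in> {..0}} \<and>
        (\<lambda>(s, t). prism_map (s, ((n, x), t))) z = (\<lambda>(s, t). prism_pt n x t (1 - s) j) z"
    if "z \<in> topspace ?X" for z
  proof -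
    obtain s t where z: "z = (s, t)" "s \<in> {0..1}" "t \<in> standard_simplex n" using \<open>z \<in> topspace ?X\<close> by auto
    obtain i where i: "i \<le> n" "cum t i \<le> 1 - s" "1 - s \<le> cum t (Suc i)"
      using prism_region_exists[OF z(3), of "1 - s"] z by auto
    then show ?thesis
      using prism_map_eq[OF x z(3,2) i] z by (intro exI[of _ i]) auto
  qed
qed simp

text \<open>The lower part of mass \<open>r\<close> commutes with pushing weights forward along a
  monotone map. Indices mapped below \<open>\<alpha> i\<close> are less than \<open>i\<close> and
  carry full weight; those mapped above it are greater than \<open>i\<close> and carry none. The
  coefficient at \<open>\<alpha> i\<close> follows because both sides have total mass
  \<open>r\<close>.\<close>

lemma affine_lower_weight:
  assumes a: "\<alpha> \<in> Delta m n" and i: "i \<le> m"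
  shows "(\<Sum>l\<le>m. if \<alpha> l = k then lower_weight i t r l else 0) = lower_weight (\<alpha> i) (affine_map m \<alpha> t) r k"
proof -
  let ?g = "\<lambda>k. \<Sum>l\<le>m. if \<alpha> l = k then lower_weight i t r l else 0"
  have aff: "affine_map m \<alpha> t k = (\<Sum>l\<le>m. if \<alpha> l = k then t l else 0)" for k
    unfolding affine_map_def by (rule sum.mono_neutral_cong_left) auto
  have lt: "?g k = affine_map m \<alpha> t k" if "k < \<alpha> i" for k
  proof -
    have "l < i" if "\<alpha> l = k" "l \<le> m" for l
      using Delta_mono[OF a, of i l] that \<open>k < \<alpha> i\<close> by (meson leI not_less)
    then show ?thesis unfolding aff by (intro sum.cong) (auto simp: lower_weight_def)
  qed
  have gt: "?g k = 0" if "k > \<alpha> i" for k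
  proof -
    have "i < l" if "\<alpha> l = k" "l \<le> m" for l
      using Delta_mono[OF a, of l i] that \<open>k > \<alpha> i\<close> i by (meson leI not_less)
    then show ?thesis by (intro sum.neutral) (force simp: lower_weight_def)
  qed
  have "(\<Sum>k\<le>\<alpha> i. ?g k) = (\<Sum>k\<le>n. ?g k)"
    using Delta_le[OF a i] by (intro sum.mono_neutral_left) (auto intro!: gt)
  also have "\<dots> = (\<Sum>l\<le>m. \<Sum>k\<le>n. if \<alpha> l = k then lower_weight i t r l else 0)"
    by (rule sum.swap)
  also have "\<dots> = sum (lower_weight i t r) {..m}"
    using Delta_le[OF a] by (intro sum.cong) auto
  finally have tot: "(\<Sum>k\<le>\<alpha> i. ?g k) = r" by (simp add: sum_lower_weight[OF i])
  moreover have "(\<Sum>k\<le>\<alpha> i. ?g k) = ?g (\<alpha> i) + (\<Sum>k<\<alpha> i. ?g k)"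
    by (simp add: lessThan_Suc_atMost[symmetric])
  moreover have "(\<Sum>k<\<alpha> i. ?g k) = cum (affine_map m \<alpha> t) (\<alpha> i)"
    unfolding cum_def by (intro sum.cong) (auto simp: lt)
  ultimately have "?g (\<alpha> i) = r - cum (affine_map m \<alpha> t) (\<alpha> i)" by linarith
  then show ?thesis
    using lt[of k] gt[of k] by (cases k "\<alpha> i" rule: linorder_cases) (auto simp: lower_weight_def)
qed

text \<open>The map of prisms given by \<open>\<alpha>\<close> and the identity of the interval
  sends the i-th simplex into the \<open>\<alpha> i\<close>-th one. There it is induced by a
  monotone \<open>\<beta>\<close>, and naturality of \<open>H\<close> along \<open>\<beta>\<close>
  identifies the two values.\<close>

lemma prism_glue:
  assumes a: "\<alpha> \<in> Delta m n" and x: "x \<in> cells K n" and t: "t \<in> standard_simplex m" and s: "s \<in> {0..1}"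
  shows "prism_map (s, ((m, sop K m n \<alpha> x), t)) = prism_map (s, ((n, x), affine_map m \<alpha> t))"
proof -
  define r where "r = 1 - s"
  obtain i where i: "i \<le> m" "cum t i \<le> r" "r \<le> cum t (Suc i)"
    using prism_region_exists[OF t, of r] s by (auto simp: r_def)
  define j where "j = \<alpha> i"
  have j: "j \<le> n" using Delta_le[OF a i(1)] by (simp add: j_def)
  have t': "affine_map m \<alpha> t \<in> standard_simplex n" by (rule affine_map_in_simplex[OF a t])
  have cumaff: "cum (affine_map m \<alpha> t) k = (\<Sum>l | l \<le> m \<and> \<alpha> l < k. t l)" for k
    unfolding cum_def by (subst sum_affine_map[OF a]) auto
  have tn: "0 \<le> t l" for l using t by (simp add: standard_simplex_def)
  have j1: "cum (affine_map m \<alpha> t) j \<le> r"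
  proof -
    have "{l. l \<le> m \<and> \<alpha> l < j} \<subseteq> {..<i}"
      using Delta_mono[OF a, of i] unfolding j_def by (auto simp: not_le[symmetric])
    then have "cum (affine_map m \<alpha> t) j \<le> cum t i"
      unfolding cumaff unfolding cum_def by (intro sum_mono2) (auto simp: tn)
    then show ?thesis using i by linarith
  qed
  have j2: "r \<le> cum (affine_map m \<alpha> t) (Suc j)"
  proof -
    have "{..<Suc i} \<subseteq> {l. l \<le> m \<and> \<alpha> l < Suc j}"
      using Delta_mono[OF a, of _ i] i(1) unfolding j_def by (auto simp: less_Suc_eq_le)
    then have "cum t (Suc i) \<le> cum (affine_map m \<alpha> t) (Suc j)"
      unfolding cumaff unfolding cum_def by (intro sum_mono2) (auto simp: tn)
    then show ?thesis using i by linarith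
  qed
  \<comment> \<open>Vertices of the lower copy are moved by \<open>\<alpha>\<close>; those of the
    upper copy are moved by \<open>\<alpha>\<close> and then shifted past the doubled vertex
    \<open>j\<close>.\<close>
  define \<beta> where "\<beta> = (\<lambda>l\<in>{..Suc m}. if l \<le> i then \<alpha> l else Suc (\<alpha> (l - 1)))"
  have \<beta>: "\<beta> \<in> Delta (Suc m) (Suc n)"
    unfolding \<beta>_def
  proof (rule DeltaI)
    fix k assume k: "k \<le> Suc m"
    show "(if k \<le> i then \<alpha> k else Suc (\<alpha> (k - 1))) \<le> Suc n"
      using Delta_le[OF a, of k] Delta_le[OF a, of "k - 1"] k i(1) by auto
  next
    fix k l assume kl: "k \<le> l" "l \<le> Suc m"
    have 1: "\<alpha> k \<le> \<alpha> l" if "l \<le> i" using Delta_mono[OF a, of k l] kl that i(1) by simp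
    have 2: "\<alpha> k \<le> \<alpha> (l - 1)" if "k \<le> i" "i < l" using Delta_mono[OF a, of k "l - 1"] kl that by simp
    have 3: "\<alpha> (k - 1) \<le> \<alpha> (l - 1)" using Delta_mono[OF a, of "k - 1" "l - 1"] kl by simp
    show "(if k \<le> i then \<alpha> k else Suc (\<alpha> (k - 1))) \<le> (if l \<le> i then \<alpha> l else Suc (\<alpha> (l - 1)))"
      using 1 2 3 kl by (simp add: le_SucI)
  qed
  have deg: "compose {..Suc m} (degen n j) \<beta> = compose {..Suc m} \<alpha> (degen m i)"
  proof
    fix k
    show "compose {..Suc m} (degen n j) \<beta> k = compose {..Suc m} \<alpha> (degen m i) k"
    proof (cases "k \<le> Suc m")
      case True
      have "\<alpha> k \<le> n" if "k \<le> i" using Delta_le[OF a] that i(1) by simp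
      moreover have "\<alpha> (k - 1) \<le> n" if "k > i" using Delta_le[OF a] that True by simp
      moreover have "\<alpha> k \<le> j" if "k \<le> i" using Delta_mono[OF a that i(1)] by (simp add: j_def)
      moreover have "j \<le> \<alpha> (k - 1)" if "k > i" using Delta_mono[OF a, of i "k - 1"] that True by (simp add: j_def)
      ultimately show ?thesis using True by (auto simp: compose_def degen_def \<beta>_def not_le)
    qed (simp add: compose_def)
  qed
  have jmp: "compose {..Suc m} (jump n j) \<beta> = jump m i"
  proof
    fix k
    show "compose {..Suc m} (jump n j) \<beta> k = jump m i k"
    proof (cases "k \<le> Suc m")
      case True
      have "\<alpha> k \<le> n" if "k \<le> i" using Delta_le[OF a] that i(1) by simp
      moreover have "\<alpha> (k - 1) \<le> n" if "k > i" using Delta_le[OF a] that True by simp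
      moreover have "\<alpha> k \<le> j" if "k \<le> i" using Delta_mono[OF a that i(1)] by (simp add: j_def)
      moreover have "j \<le> \<alpha> (k - 1)" if "k > i" using Delta_mono[OF a, of i "k - 1"] that True by (simp add: j_def)
      ultimately show ?thesis using True by (auto simp: compose_def jump_def \<beta>_def not_le)
    qed (simp add: compose_def jump_def)
  qed
  have cell: "prism_cell m (sop K m n \<alpha> x) i = sop L (Suc m) (Suc n) \<beta> (prism_cell n x j)"
  proof -
    have "prism_cell m (sop K m n \<alpha> x) i =
        H (Suc m) (sop K (Suc m) n (compose {..Suc m} (degen n j) \<beta>) x) (compose {..Suc m} (jump n j) \<beta>)"
      unfolding prism_cell_def deg jmp by (simp add: sop_compose[OF K degen_Delta[OF i(1)] a x])
    also have "sop K (Suc m) n (compose {..Suc m} (degen n j) \<beta>) x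
        = sop K (Suc m) (Suc n) \<beta> (sop K (Suc n) n (degen n j) x)"
      by (simp add: sop_compose[OF K \<beta> degen_Delta[OF j] x])
    also have "H (Suc m) \<dots> (compose {..Suc m} (jump n j) \<beta>) = sop L (Suc m) (Suc n) \<beta> (prism_cell n x j)"
      unfolding prism_cell_def by (rule H_sop[OF \<beta> sop_cells[OF K degen_Delta[OF j] x] jump_Delta])
    finally show ?thesis .
  qed
  have wt: "affine_map (Suc m) \<beta> (prism_weight i t r) = prism_weight j (affine_map m \<alpha> t) r"
  proof
    fix k
    let ?lw = "lower_weight i t r"
    have 1: "(\<Sum>l\<le>i. if \<beta> l = k then ?lw l else 0) =
        (if k \<le> j then lower_weight j (affine_map m \<alpha> t) r k else 0)"
    proof -
      have "(\<Sum>l\<le>i. if \<beta> l = k then ?lw l else 0) = (\<Sum>l\<le>i. if \<alpha> l = k then ?lw l else 0)"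
        using i(1) by (intro sum.cong) (auto simp: \<beta>_def)
      also have "\<dots> = (\<Sum>l\<le>m. if \<alpha> l = k then ?lw l else 0)"
        using i(1) by (intro sum.mono_neutral_left) (auto simp: lower_weight_def)
      also have "\<dots> = lower_weight j (affine_map m \<alpha> t) r k"
        using affine_lower_weight[OF a i(1)] by (simp add: j_def)
      finally show ?thesis by (simp add: lower_weight_def)
    qed
    have 2: "(\<Sum>l\<in>{i..m}. if \<beta> (Suc l) = k then t l - ?lw l else 0) =
        (if k \<le> j then 0 else affine_map m \<alpha> t (k - 1) - lower_weight j (affine_map m \<alpha> t) r (k - 1))"
    proof -
      have "(\<Sum>l\<in>{i..m}. if \<beta> (Suc l) = k then t l - ?lw l else 0) =
          (\<Sum>l\<in>{i..m}. if Suc (\<alpha> l) = k then t l - ?lw l else 0)"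
        using i(1) by (intro sum.cong) (auto simp: \<beta>_def)
      also have "\<dots> = (if k \<le> j then 0 else (\<Sum>l\<le>m. if \<alpha> l = k - 1 then t l - ?lw l else 0))"
      proof (cases "k \<le> j")
        case True
        then show ?thesis
          using Delta_mono[OF a, of i] by (auto simp: j_def intro!: sum.neutral) fastforce
      next
        case False
        then have "(\<Sum>l\<in>{i..m}. if Suc (\<alpha> l) = k then t l - ?lw l else 0)
            = (\<Sum>l\<in>{i..m}. if \<alpha> l = k - 1 then t l - ?lw l else 0)"
          by (intro sum.cong) auto
        also have "\<dots> = (\<Sum>l\<le>m. if \<alpha> l = k - 1 then t l - ?lw l else 0)"
          by (intro sum.mono_neutral_left) (auto simp: lower_weight_def)
        finally show ?thesis using False by simp
      qed
      also have "(\<Sum>l\<le>m. if \<alpha> l = k - 1 then t l - ?lw l else 0) =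
          (\<Sum>l\<le>m. if \<alpha> l = k - 1 then t l else 0) - (\<Sum>l\<le>m. if \<alpha> l = k - 1 then ?lw l else 0)"
        unfolding sum_subtractf[symmetric] by (intro sum.cong) auto
      also have "(\<Sum>l\<le>m. if \<alpha> l = k - 1 then ?lw l else 0) = lower_weight j (affine_map m \<alpha> t) r (k - 1)"
        using affine_lower_weight[OF a i(1)] by (simp add: j_def)
      also have "(\<Sum>l\<le>m. if \<alpha> l = k - 1 then t l else 0) = affine_map m \<alpha> t (k - 1)"
        unfolding affine_map_def by (rule sum.mono_neutral_cong_right) auto
      finally show ?thesis .
    qed
    show "affine_map (Suc m) \<beta> (prism_weight i t r) k = prism_weight j (affine_map m \<alpha> t) r k"
      unfolding affine_prism[OF i(1)] 1 2 by (simp add: prism_weight_def)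
  qed
  have "prism_map (s, ((m, sop K m n \<alpha> x), t)) = prism_pt m (sop K m n \<alpha> x) t r i"
    using prism_map_eq[OF sop_cells[OF K a x] t s i[unfolded r_def]] by (simp add: r_def)
  also have "\<dots> = rpt L (Suc n) (prism_cell n x j) (affine_map (Suc m) \<beta> (prism_weight i t r))"
    unfolding prism_pt_def cell
    by (rule rpt_glue[OF L \<beta> prism_cell_cells[OF x j] prism_weight_simplex[OF t i]])
  also have "\<dots> = prism_map (s, ((n, x), affine_map m \<alpha> t))"
    using prism_map_eq[OF x t' s j j1[unfolded r_def] j2[unfolded r_def]] wt by (simp add: prism_pt_def r_def)
  finally show ?thesis .
qed

lemma prism_map_0:
  assumes x: "x \<in> cells K n" and t: "t \<in> standard_simplex n"
  shows "prism_map (0, ((n, x), t)) = rpt L n (H n x (\<lambda>i\<in>{..n}. 0)) t"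
proof -
  have "prism_map (0, ((n, x), t)) = prism_pt n x t 1 n"
    using prism_map_eq[OF x t, of 0 n] cum_top[OF t] cum_mono[OF t, of n "Suc n"] by simp
  also have "\<dots> = rpt L n (H n x (compose {..n} (jump n n) (coface n (Suc n)))) t"
  proof (rule prism_pt_face[OF x t])
    show "prism_weight n t 1 j = (if j < Suc n then t j else if j = Suc n then 0 else t (j - 1))" for j
      using cum_top[OF t] t
      by (cases j n rule: linorder_cases) (auto simp: prism_weight_def lower_weight_def standard_simplex_def)
  qed auto
  also have "compose {..n} (jump n n) (coface n (Suc n)) = (\<lambda>i\<in>{..n}. 0)"
    by (auto simp: compose_def jump_def coface_def fun_eq_iff)
  finally show ?thesis .
qed

lemma prism_map_1:
  assumes x: "x \<in> cells K n" and t: "t \<in> standard_simplex n"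
  shows "prism_map (1, ((n, x), t)) = rpt L n (H n x (\<lambda>i\<in>{..n}. 1)) t"
proof -
  have "prism_map (1, ((n, x), t)) = prism_pt n x t 0 0"
    using prism_map_eq[OF x t, of 1 0] cum_mono[OF t, of 0 "Suc 0"] by simp
  also have "\<dots> = rpt L n (H n x (compose {..n} (jump n 0) (coface n 0))) t"
    by (rule prism_pt_face[OF x t]) (auto simp: prism_weight_def lower_weight_def)
  also have "compose {..n} (jump n 0) (coface n 0) = (\<lambda>i\<in>{..n}. 1)"
    by (auto simp: compose_def jump_def coface_def fun_eq_iff)
  finally show ?thesis .
qed

text \<open>Prism cells of \<open>x\<close> are values of \<open>H\<close> at degeneracies of
  \<open>x\<close>, which is why stationarity is assumed after every structure map. Projecting the
  prism weights by \<open>degen\<close> then gives back \<open>t\<close>.\<close>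

lemma prism_map_stationary:
  assumes x: "x \<in> cells K n" and t: "t \<in> standard_simplex n" and s: "s \<in> {0..1}" and y: "y \<in> cells L n"
    and st: "\<And>m \<alpha> \<xi>. \<alpha> \<in> Delta m n \<Longrightarrow> \<xi> \<in> Delta m 1 \<Longrightarrow> H m (sop K m n \<alpha> x) \<xi> = sop L m n \<alpha> y"
  shows "prism_map (s, ((n, x), t)) = rpt L n y t"
proof -
  obtain i where i: "i \<le> n" "cum t i \<le> 1 - s" "1 - s \<le> cum t (Suc i)"
    using prism_region_exists[OF t, of "1 - s"] s by auto
  have "prism_map (s, ((n, x), t)) = rpt L (Suc n) (sop L (Suc n) n (degen n i) y) (prism_weight i t (1 - s))"
    unfolding prism_map_eq[OF x t s i] prism_pt_def prism_cell_def st[OF degen_Delta[OF i(1)] jump_Delta] ..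
  also have "\<dots> = rpt L n y (affine_map (Suc n) (degen n i) (prism_weight i t (1 - s)))"
    by (rule rpt_glue[OF L degen_Delta[OF i(1)] y prism_weight_simplex[OF t i]])
  finally show ?thesis by (simp add: affine_degen_prism[OF t i(1)])
qed

text \<open>The interval is compact Hausdorff, so its product with the quotient map onto the
  realization is again a quotient map, and \<open>prism_map\<close> descends with continuity in both
  variables jointly.\<close>

lemma realization_homotopy:
  obtains h where
    "continuous_map (prod_topology (top_of_set {0..1}) (realization K)) (realization L) h"
    "\<And>s n x t. s \<in> {0..1} \<Longrightarrow> x \<in> cells K n \<Longrightarrow> t \<in> standard_simplex n \<Longrightarrow>
       h (s, rpt K n x t) = prism_map (s, ((n, x), t))"
proof -
  let ?I = "top_of_set {0..1::real}"
  let ?q = "\<lambda>(s::real, z). (s, glue_equiv K `` {z})"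
  have q: "quotient_map (prod_topology ?I (simplex_sum K)) (prod_topology ?I (realization K)) ?q"
  proof (rule quotient_map_prod_right[OF _ _ quotient_map_realization[OF K]])
    show "locally_compact_space ?I"
      by (intro compact_imp_locally_compact_space) (simp_all add: compact_space_subtopology)
    show "Hausdorff_space ?I \<or> regular_space ?I"
      by (simp add: Hausdorff_space_subtopology)
  qed
  have c: "continuous_map (prod_topology ?I (simplex_sum K)) (realization L) prism_map"
    by (rule continuous_map_prod_simplex_sum[OF K continuous_map_prism])
  have inv: "prism_map (s, z) = prism_map (s, z')" if "s \<in> {0..1}" "(z, z') \<in> glue_equiv K" for s z z'
    using glue_equiv_invariant[OF K prism_glue that(2), of "\<lambda>_. s"] glue_equiv_invariant[OF K _ that(2), of "\<lambda>z. prism_map (s, z)"]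
      prism_glue that(1) by blast
  obtain h where h: "continuous_map (prod_topology ?I (realization K)) (realization L) h"
    "\<And>z. z \<in> topspace (prod_topology ?I (simplex_sum K)) \<Longrightarrow> h (?q z) = prism_map z"
  proof (rule quotient_map_lift_exists[OF q c])
    fix y z assume yz: "y \<in> topspace (prod_topology ?I (simplex_sum K))"
      "z \<in> topspace (prod_topology ?I (simplex_sum K))" "?q y = ?q z"
    obtain s y' z' where *: "y = (s, y')" "z = (s, z')" "glue_equiv K `` {y'} = glue_equiv K `` {z'}"
      using yz(3) by (cases y, cases z) auto
    then have "(y', z') \<in> glue_equiv K"
      using eq_equiv_class[OF _ equiv_glue_equiv] by blast
    then show "prism_map y = prism_map z"
      using * inv yz by auto
  qed blast
  show ?thesis
    by (rule that[OF h(1)]) (use h(2) in \<open>force simp: rpt_def topspace_simplex_sum[OF K]\<close>)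
qed

end

section \<open>Strong deformation retracts of simplicial sets\<close>

lemma sset_weak_equivalence_deformation_retract:
  assumes M: "simplicial_set M" and N: "simplicial_set N"
    and g: "simplicial_map M N g" and f: "simplicial_map N M f"
    and fg: "\<And>n y. y \<in> cells M n \<Longrightarrow> f n (g n y) = y"
    and H: "simplicial_homotopy N N H"
    and H0: "\<And>n x. x \<in> cells N n \<Longrightarrow> H n x (\<lambda>i\<in>{..n}. 0) = x"
    and H1: "\<And>n x. x \<in> cells N n \<Longrightarrow> H n x (\<lambda>i\<in>{..n}. 1) = g n (f n x)"
    and Hg: "\<And>n y \<xi>. y \<in> cells M n \<Longrightarrow> \<xi> \<in> Delta n 1 \<Longrightarrow> H n (g n y) \<xi> = g n y"
  shows "sset_weak_equivalence M N g"
proof -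
  interpret simplicial_homotopy N N H by (rule H)
  note gr = realization_map_rpt[OF M N g] and fr = realization_map_rpt[OF N M f]
  note gc = simplicial_map_cells[OF g] and fc = simplicial_map_cells[OF f]
  obtain h where h: "continuous_map (prod_topology (top_of_set {0..1}) (realization N)) (realization N) h"
    "\<And>s n x t. s \<in> {0..1} \<Longrightarrow> x \<in> cells N n \<Longrightarrow> t \<in> standard_simplex n \<Longrightarrow>
       h (s, rpt N n x t) = prism_map (s, ((n, x), t))"
    using realization_homotopy by blast
  have "weak_homotopy_equivalence (realization M) (realization N) (realization_map N g)"
  proof (rule strong_deformation_retract_weak_homotopy_equivalence[OF _ _ _ h(1)])
    show "continuous_map (realization M) (realization N) (realization_map N g)"
      by (rule continuous_map_realization_map[OF M N g])
    show "continuous_map (realization N) (realization M) (realization_map M f)"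
      by (rule continuous_map_realization_map[OF N M f])
    show "realization_map M f (realization_map N g z) = z" if "z \<in> topspace (realization M)" for z
      by (rule realizationE[OF M that]) (simp add: gr fr gc fg)
    show "h (0, z) = z" if "z \<in> topspace (realization N)" for z
      by (rule realizationE[OF N that]) (simp add: h(2) prism_map_0 H0)
    show "h (1, z) = realization_map N g (realization_map M f z)" if "z \<in> topspace (realization N)" for z
      by (rule realizationE[OF N that]) (simp add: h(2) prism_map_1 H1[simplified] gr fr fc)
    show "h (s, realization_map N g z) = realization_map N g z"
      if "z \<in> topspace (realization M)" and s: "s \<in> {0..1}" for z s
    proof (rule realizationE[OF M that(1)])
      fix n x t assume x: "x \<in> cells M n" and t: "t \<in> standard_simplex n" and z: "z = rpt M n x t"
      have "prism_map (s, ((n, g n x), t)) = rpt N n (g n x) t"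
      proof (rule prism_map_stationary[OF gc[OF x] t s gc[OF x]])
        fix m \<alpha> \<xi> assume a: "\<alpha> \<in> Delta m n" "\<xi> \<in> Delta m 1"
        show "H m (sop N m n \<alpha> (g n x)) \<xi> = sop N m n \<alpha> (g n x)"
          using simplicial_map_sop[OF g a(1) x] Hg[OF sop_cells[OF M a(1) x] a(2)] by simp
      qed
      then show ?thesis using z gr[OF x t] h(2)[OF s gc[OF x] t] by simp
    qed
  qed
  then show ?thesis using M N g by (simp add: sset_weak_equivalence_def)
qed

lemma cells_sset_of [simp]: "cells (sset_of C s) = C"
  by (simp add: sset_of_def)

lemma sop_sset_of [simp]: "\<alpha> \<in> Delta m n \<Longrightarrow> x \<in> C n \<Longrightarrow> sop (sset_of C s) m n \<alpha> x = s m n \<alpha> x"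
  by (simp add: sset_of_def)

lemma simplicial_set_sset_of:
  assumes "\<And>m n \<alpha> x. \<alpha> \<in> Delta m n \<Longrightarrow> x \<in> C n \<Longrightarrow> s m n \<alpha> x \<in> C m"
    and "\<And>n x. x \<in> C n \<Longrightarrow> s n n (\<lambda>i\<in>{..n}. i) x = x"
    and "\<And>k m n \<alpha> \<beta> x. \<alpha> \<in> Delta k m \<Longrightarrow> \<beta> \<in> Delta m n \<Longrightarrow> x \<in> C n \<Longrightarrow>
      s k n (compose {..k} \<beta> \<alpha>) x = s k m \<alpha> (s m n \<beta> x)"
  shows "simplicial_set (sset_of C s)"
  unfolding simplicial_set_def
proof (intro conjI allI ballI)
  show "sop (sset_of C s) m n \<in> Delta m n \<rightarrow>\<^sub>E cells (sset_of C s) n \<rightarrow>\<^sub>E cells (sset_of C s) m" for m n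
    using assms(1) by (auto simp: sset_of_def)
qed (use assms Delta_id Delta_compose in auto)

lemma simplicial_mapI:
  assumes "\<And>n x. x \<in> cells K n \<Longrightarrow> \<phi> n x \<in> cells L n" and "\<And>n. \<phi> n \<in> extensional (cells K n)"
    and "\<And>m n \<alpha> x. \<alpha> \<in> Delta m n \<Longrightarrow> x \<in> cells K n \<Longrightarrow> \<phi> m (sop K m n \<alpha> x) = sop L m n \<alpha> (\<phi> n x)"
  shows "simplicial_map K L \<phi>"
  using assms by (auto simp: simplicial_map_def PiE_iff)

lemma simplicial_set_copy:
  assumes K: "simplicial_set K" and i: "inj \<iota>"
  shows "simplicial_set (sset_copy \<iota> K)"
  unfolding sset_copy_def
  by (rule simplicial_set_sset_of) (auto simp: i sop_cells[OF K] sop_id[OF K] sop_compose[OF K])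

lemma cells_copy: "cells (sset_copy \<iota> K) n = \<iota> ` cells K n"
  by (simp add: sset_copy_def)

lemma sop_copy:
  "inj \<iota> \<Longrightarrow> \<alpha> \<in> Delta m n \<Longrightarrow> x \<in> cells K n \<Longrightarrow> sop (sset_copy \<iota> K) m n \<alpha> (\<iota> x) = \<iota> (sop K m n \<alpha> x)"
  by (simp add: sset_copy_def)

text \<open>The zigzag lives in the sum type. A single arrow, from the copy of \<open>M\<close> to
  the copy of \<open>N\<close>, suffices and is traversed backwards.\<close>

lemma weakly_homotopy_equivalent_deformation_retract:
  fixes M :: "'b sset" and N :: "'a sset"
  assumes M: "simplicial_set M" and N: "simplicial_set N"
    and g: "simplicial_map M N g" and f: "simplicial_map N M f"
    and fg: "\<And>n y. y \<in> cells M n \<Longrightarrow> f n (g n y) = y"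
    and H: "simplicial_homotopy N N H"
    and H0: "\<And>n x. x \<in> cells N n \<Longrightarrow> H n x (\<lambda>i\<in>{..n}. 0) = x"
    and H1: "\<And>n x. x \<in> cells N n \<Longrightarrow> H n x (\<lambda>i\<in>{..n}. 1) = g n (f n x)"
    and Hg: "\<And>n y \<xi>. y \<in> cells M n \<Longrightarrow> \<xi> \<in> Delta n 1 \<Longrightarrow> H n (g n y) \<xi> = g n y"
  shows "weakly_homotopy_equivalent N M"
proof -
  interpret simplicial_homotopy N N H by (rule H)
  define g' :: "nat \<Rightarrow> 'a + 'b \<Rightarrow> 'a + 'b" where "g' n = (\<lambda>y\<in>Inr ` cells M n. Inl (g n (projr y)))" for n
  define f' :: "nat \<Rightarrow> 'a + 'b \<Rightarrow> 'a + 'b" where "f' n = (\<lambda>y\<in>Inl ` cells N n. Inr (f n (projl y)))" for n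
  define H' :: "nat \<Rightarrow> 'a + 'b \<Rightarrow> (nat \<Rightarrow> nat) \<Rightarrow> 'a + 'b" where "H' n x \<xi> = Inl (H n (projl x) \<xi>)" for n x \<xi>
  note c = simplicial_map_cells[OF g] simplicial_map_cells[OF f] H_cells
    sop_cells[OF M] sop_cells[OF N] cells_copy
  have inl: "inj Inl" and inr: "inj Inr" by simp_all
  have M': "simplicial_set (sset_copy Inr M)" and N': "simplicial_set (sset_copy Inl N)"
    using M N by (simp_all add: simplicial_set_copy)
  have "sset_weak_equivalence (sset_copy Inr M) (sset_copy Inl N) g'"
  proof (rule sset_weak_equivalence_deformation_retract[OF M' N', where f = f' and H = H'])
    show "simplicial_map (sset_copy Inr M) (sset_copy Inl N) g'"
      by (rule simplicial_mapI)
        (auto simp: g'_def c sop_copy[OF inl] sop_copy[OF inr] simplicial_map_sop[OF g])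
    show "simplicial_map (sset_copy Inl N) (sset_copy Inr M) f'"
      by (rule simplicial_mapI)
        (auto simp: f'_def c sop_copy[OF inl] sop_copy[OF inr] simplicial_map_sop[OF f])
    show "simplicial_homotopy (sset_copy Inl N) (sset_copy Inl N) H'"
      by unfold_locales (auto simp: N' H'_def c sop_copy[OF inl] H_sop)
  qed (auto simp: g'_def f'_def H'_def c fg H0 H1[simplified] Hg)
  then have "equivclp (\<lambda>M N. \<exists>\<phi>. sset_weak_equivalence M N \<phi>) (sset_copy Inr M) (sset_copy Inl N)"
    by (intro r_into_equivclp) blast
  then show ?thesis
    unfolding weakly_homotopy_equivalent_def using M N by (blast intro: equivclp_sym)
qed

section \<open>Nerves of reflective subcategories\<close>

definition category :: "('o, 'm) cat \<Rightarrow> bool" where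
  "category C \<longleftrightarrow>
     (\<forall>a\<in>Ob C. Ident C a \<in> Mor C a a) \<and>
     (\<forall>a\<in>Ob C. \<forall>b\<in>Ob C. \<forall>c\<in>Ob C. \<forall>f\<in>Mor C a b. \<forall>g\<in>Mor C b c. Comp C a b c g f \<in> Mor C a c) \<and>
     (\<forall>a\<in>Ob C. \<forall>b\<in>Ob C. \<forall>f\<in>Mor C a b.
        Comp C a b b (Ident C b) f = f \<and> Comp C a a b f (Ident C a) = f) \<and>
     (\<forall>a\<in>Ob C. \<forall>b\<in>Ob C. \<forall>c\<in>Ob C. \<forall>d\<in>Ob C. \<forall>f\<in>Mor C a b. \<forall>g\<in>Mor C b c. \<forall>h\<in>Mor C c d.
        Comp C a c d h (Comp C a b c g f) = Comp C a b d (Comp C b c d h g) f)"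

context
  fixes C :: "('o, 'm) cat"
  assumes C: "category C"
begin

lemma Ident_Mor: "a \<in> Ob C \<Longrightarrow> Ident C a \<in> Mor C a a"
  and Comp_Mor: "a \<in> Ob C \<Longrightarrow> b \<in> Ob C \<Longrightarrow> c \<in> Ob C \<Longrightarrow> f \<in> Mor C a b \<Longrightarrow> g \<in> Mor C b c \<Longrightarrow>
    Comp C a b c g f \<in> Mor C a c"
  and Comp_Ident_left: "a \<in> Ob C \<Longrightarrow> b \<in> Ob C \<Longrightarrow> f \<in> Mor C a b \<Longrightarrow> Comp C a b b (Ident C b) f = f"
  and Comp_Ident_right: "a \<in> Ob C \<Longrightarrow> b \<in> Ob C \<Longrightarrow> f \<in> Mor C a b \<Longrightarrow> Comp C a a b f (Ident C a) = f"
  and Comp_assoc: "a \<in> Ob C \<Longrightarrow> b \<in> Ob C \<Longrightarrow> c \<in> Ob C \<Longrightarrow> d \<in> Ob C \<Longrightarrow>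
    f \<in> Mor C a b \<Longrightarrow> g \<in> Mor C b c \<Longrightarrow> h \<in> Mor C c d \<Longrightarrow>
    Comp C a c d h (Comp C a b c g f) = Comp C a b d (Comp C b c d h g) f"
  using C by (auto simp: category_def)

end

lemma nerve_cells_iff:
  "(x, u) \<in> cells (nerve C) n \<longleftrightarrow>
     x \<in> extensional {..n} \<and> u \<in> extensional {(i, j). i \<le> j \<and> j \<le> n} \<and>
     (\<forall>i\<le>n. x i \<in> Ob C) \<and> (\<forall>i j. i \<le> j \<and> j \<le> n \<longrightarrow> u (i, j) \<in> Mor C (x i) (x j)) \<and>
     (\<forall>i\<le>n. u (i, i) = Ident C (x i)) \<and>
     (\<forall>i j k. i \<le> j \<and> j \<le> k \<and> k \<le> n \<longrightarrow>
        u (i, k) = Comp C (x i) (x j) (x k) (u (j, k)) (u (i, j)))"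
  unfolding nerve_def by (auto simp: PiE_iff)

lemma nerve_cellsD:
  assumes "(x, u) \<in> cells (nerve C) n"
  shows "x \<in> extensional {..n}" "u \<in> extensional {(i, j). i \<le> j \<and> j \<le> n}"
    and "i \<le> n \<Longrightarrow> x i \<in> Ob C" "i \<le> j \<Longrightarrow> j \<le> n \<Longrightarrow> u (i, j) \<in> Mor C (x i) (x j)"
  using assms by (simp_all add: nerve_cells_iff)

lemma nerve_cells_unit: "(x, u) \<in> cells (nerve C) n \<Longrightarrow> i \<le> n \<Longrightarrow> u (i, i) = Ident C (x i)"
  by (simp add: nerve_cells_iff)

lemma nerve_cells_comp:
  "(x, u) \<in> cells (nerve C) n \<Longrightarrow> i \<le> j \<Longrightarrow> j \<le> k \<Longrightarrow> k \<le> n \<Longrightarrow>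
   u (i, k) = Comp C (x i) (x j) (x k) (u (j, k)) (u (i, j))"
  unfolding nerve_cells_iff by blast

lemma nerve_cellsI:
  assumes "\<And>i. i \<le> n \<Longrightarrow> y i \<in> Ob C"
    and "\<And>i j. i \<le> j \<Longrightarrow> j \<le> n \<Longrightarrow> v i j \<in> Mor C (y i) (y j)"
    and "\<And>i. i \<le> n \<Longrightarrow> v i i = Ident C (y i)"
    and comp: "\<And>i j k. i \<le> j \<Longrightarrow> j \<le> k \<Longrightarrow> k \<le> n \<Longrightarrow> v i k = Comp C (y i) (y j) (y k) (v j k) (v i j)"
  shows "(restrict y {..n}, \<lambda>(i, j)\<in>{(i, j). i \<le> j \<and> j \<le> n}. v i j) \<in> cells (nerve C) n"
  unfolding nerve_cells_iff
proof (intro conjI allI impI)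
  fix i j k assume ijk: "i \<le> j \<and> j \<le> k \<and> k \<le> n"
  show "(\<lambda>(i, j)\<in>{(i, j). i \<le> j \<and> j \<le> n}. v i j) (i, k) =
      Comp C (restrict y {..n} i) (restrict y {..n} j) (restrict y {..n} k)
      ((\<lambda>(i, j)\<in>{(i, j). i \<le> j \<and> j \<le> n}. v i j) (j, k))
      ((\<lambda>(i, j)\<in>{(i, j). i \<le> j \<and> j \<le> n}. v i j) (i, j))"
    using comp[of i j k] ijk by auto
qed (use assms(1-3) in auto)

lemma nerve_sop:
  "\<alpha> \<in> Delta m n \<Longrightarrow> (x, u) \<in> cells (nerve C) n \<Longrightarrow>
   sop (nerve C) m n \<alpha> (x, u) = (compose {..m} x \<alpha>, \<lambda>(i, j) \<in> {(i, j). i \<le> j \<and> j \<le> m}. u (\<alpha> i, \<alpha> j))"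
  unfolding nerve_def by simp

lemma simplicial_set_nerve: "simplicial_set (nerve C)"
  unfolding nerve_def
proof (rule simplicial_set_sset_of, goal_cases)
  case (1 m n \<alpha> z)
  then show ?case by (auto simp: PiE_iff compose_def Delta_le Delta_mono)
next
  case (2 n z)
  then show ?case
    by (auto simp: PiE_iff compose_def fun_eq_iff extensional_def restrict_def)
next
  case (3 k m n \<alpha> \<beta> z)
  then show ?case
    by (auto simp: PiE_iff compose_def fun_eq_iff restrict_def Delta_le Delta_mono)
qed

text \<open>An arrow does not determine its endpoints here, so the arrow part of the functor takes
  source and target as arguments.\<close>

definition nerve_map :: "('o \<Rightarrow> 'p) \<Rightarrow> ('o \<Rightarrow> 'o \<Rightarrow> 'm \<Rightarrow> 'k) \<Rightarrow> ('o, 'm) cat \<Rightarrow> nat \<Rightarrow>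
    (nat \<Rightarrow> 'o) \<times> (nat \<times> nat \<Rightarrow> 'm) \<Rightarrow> (nat \<Rightarrow> 'p) \<times> (nat \<times> nat \<Rightarrow> 'k)" where
  "nerve_map Fo Fa C n = (\<lambda>(x, u)\<in>cells (nerve C) n.
     (\<lambda>i\<in>{..n}. Fo (x i), \<lambda>(i, j)\<in>{(i, j). i \<le> j \<and> j \<le> n}. Fa (x i) (x j) (u (i, j))))"

lemma simplicial_map_nerve_map:
  assumes Fo: "\<And>a. a \<in> Ob C \<Longrightarrow> Fo a \<in> Ob D"
    and Fa: "\<And>a b m. a \<in> Ob C \<Longrightarrow> b \<in> Ob C \<Longrightarrow> m \<in> Mor C a b \<Longrightarrow> Fa a b m \<in> Mor D (Fo a) (Fo b)"
    and id: "\<And>a. a \<in> Ob C \<Longrightarrow> Fa a a (Ident C a) = Ident D (Fo a)"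
    and comp: "\<And>a b c m k. a \<in> Ob C \<Longrightarrow> b \<in> Ob C \<Longrightarrow> c \<in> Ob C \<Longrightarrow> m \<in> Mor C a b \<Longrightarrow> k \<in> Mor C b c \<Longrightarrow>
      Fa a c (Comp C a b c k m) = Comp D (Fo a) (Fo b) (Fo c) (Fa b c k) (Fa a b m)"
  shows "simplicial_map (nerve C) (nerve D) (nerve_map Fo Fa C)"
proof -
  have cell: "nerve_map Fo Fa C n (x, u) \<in> cells (nerve D) n" if xu: "(x, u) \<in> cells (nerve C) n" for n x u
  proof -
    note xo = nerve_cellsD(3)[OF xu] and um = nerve_cellsD(4)[OF xu]
    have "(\<lambda>i\<in>{..n}. Fo (x i), \<lambda>(i, j)\<in>{(i, j). i \<le> j \<and> j \<le> n}. Fa (x i) (x j) (u (i, j))) \<in> cells (nerve D) n"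
    proof (rule nerve_cellsI)
      fix i j k assume ijk: "i \<le> j" "j \<le> k" "k \<le> n"
      show "Fa (x i) (x k) (u (i, k)) = Comp D (Fo (x i)) (Fo (x j)) (Fo (x k))
          (Fa (x j) (x k) (u (j, k))) (Fa (x i) (x j) (u (i, j)))"
        unfolding nerve_cells_comp[OF xu ijk] using ijk by (intro comp xo um) auto
    qed (auto simp: nerve_cells_unit[OF xu] intro!: id Fo Fa xo um)
    then show ?thesis using xu by (simp add: nerve_map_def)
  qed
  show ?thesis
  proof (rule simplicial_mapI)
  fix n z assume z: "z \<in> cells (nerve C) n"
  obtain x u where "z = (x, u)" by (cases z)
  with z cell show "nerve_map Fo Fa C n z \<in> cells (nerve D) n" by simp
next
  show "nerve_map Fo Fa C n \<in> extensional (cells (nerve C) n)" for n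
    by (simp add: nerve_map_def)
next
  fix m n \<alpha> z assume a: "\<alpha> \<in> Delta m n" and z: "z \<in> cells (nerve C) n"
  obtain x u where zz: "z = (x, u)" by (cases z)
  have xu: "(x, u) \<in> cells (nerve C) n" using z zz by simp
  have D: "nerve_map Fo Fa C n (x, u) \<in> cells (nerve D) n" by (rule cell[OF xu])
  have "(compose {..m} x \<alpha>, \<lambda>(i, j) \<in> {(i, j). i \<le> j \<and> j \<le> m}. u (\<alpha> i, \<alpha> j)) \<in> cells (nerve C) m"
    using sop_cells[OF simplicial_set_nerve a xu] by (simp add: nerve_sop[OF a xu])
  then show "nerve_map Fo Fa C m (sop (nerve C) m n \<alpha> z) = sop (nerve D) m n \<alpha> (nerve_map Fo Fa C n z)"
    using D a xu unfolding zz nerve_sop[OF a xu] nerve_map_def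
    by (auto simp: nerve_sop compose_def fun_eq_iff Delta_le Delta_mono restrict_def)
  qed
qed

text \<open>\<open>C\<close> is the ambient category and \<open>D\<close> the subcategory embedded
  by \<open>Ro\<close> and \<open>Ra\<close>; \<open>univ\<close> states the reflection as a
  universal arrow out of each object. Injectivity on objects lets a reflector be chosen that fixes
  the subcategory strictly.\<close>

locale reflective_subcategory =
  fixes C :: "('o, 'm) cat" and D :: "('p, 'k) cat"
    and Ro :: "'p \<Rightarrow> 'o" and Ra :: "'p \<Rightarrow> 'p \<Rightarrow> 'k \<Rightarrow> 'm"
  assumes C: "category C" and D: "category D"
    and Ro: "\<And>d. d \<in> Ob D \<Longrightarrow> Ro d \<in> Ob C"
    and Ro_inj: "inj_on Ro (Ob D)"
    and Ra: "\<And>d e m. d \<in> Ob D \<Longrightarrow> e \<in> Ob D \<Longrightarrow> m \<in> Mor D d e \<Longrightarrow> Ra d e m \<in> Mor C (Ro d) (Ro e)"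
    and Ra_id: "\<And>d. d \<in> Ob D \<Longrightarrow> Ra d d (Ident D d) = Ident C (Ro d)"
    and Ra_comp: "\<And>a b c m k. a \<in> Ob D \<Longrightarrow> b \<in> Ob D \<Longrightarrow> c \<in> Ob D \<Longrightarrow> m \<in> Mor D a b \<Longrightarrow> k \<in> Mor D b c \<Longrightarrow>
      Ra a c (Comp D a b c k m) = Comp C (Ro a) (Ro b) (Ro c) (Ra b c k) (Ra a b m)"
    and Ra_full: "\<And>d e f. d \<in> Ob D \<Longrightarrow> e \<in> Ob D \<Longrightarrow> f \<in> Mor C (Ro d) (Ro e) \<Longrightarrow> \<exists>m\<in>Mor D d e. Ra d e m = f"
    and Ra_faithful: "\<And>d e m k. d \<in> Ob D \<Longrightarrow> e \<in> Ob D \<Longrightarrow> m \<in> Mor D d e \<Longrightarrow> k \<in> Mor D d e \<Longrightarrow>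
      Ra d e m = Ra d e k \<Longrightarrow> m = k"
    and univ: "\<And>c. c \<in> Ob C \<Longrightarrow> \<exists>d\<in>Ob D. \<exists>\<eta>\<in>Mor C c (Ro d). \<forall>e\<in>Ob D. \<forall>f\<in>Mor C c (Ro e).
      \<exists>!m. m \<in> Mor D d e \<and> f = Comp C c (Ro d) (Ro e) (Ra d e m) \<eta>"
begin

text \<open>A reflector that is the identity on the subcategory makes the retraction of nerves strong.\<close>

lemma normalized_reflector:
  obtains Lo \<eta> where "\<And>c. c \<in> Ob C \<Longrightarrow> Lo c \<in> Ob D" "\<And>c. c \<in> Ob C \<Longrightarrow> \<eta> c \<in> Mor C c (Ro (Lo c))"
    "\<And>c e f. c \<in> Ob C \<Longrightarrow> e \<in> Ob D \<Longrightarrow> f \<in> Mor C c (Ro e) \<Longrightarrow>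
      \<exists>!m. m \<in> Mor D (Lo c) e \<and> f = Comp C c (Ro (Lo c)) (Ro e) (Ra (Lo c) e m) (\<eta> c)"
    "\<And>d. d \<in> Ob D \<Longrightarrow> Lo (Ro d) = d" "\<And>d. d \<in> Ob D \<Longrightarrow> \<eta> (Ro d) = Ident C (Ro d)"
proof -
  \<comment> \<open>The last clause prescribes the identity reflection on objects of the
    subcategory; by \<open>Ro_inj\<close> it prescribes only one object \<open>d\<close>.\<close>
  define U where "U c p \<longleftrightarrow> (case p of (d, h) \<Rightarrow> d \<in> Ob D \<and> h \<in> Mor C c (Ro d) \<and>
      (\<forall>e\<in>Ob D. \<forall>f\<in>Mor C c (Ro e). \<exists>!m. m \<in> Mor D d e \<and> f = Comp C c (Ro d) (Ro e) (Ra d e m) h) \<and>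
      (\<forall>d'\<in>Ob D. c = Ro d' \<longrightarrow> d = d' \<and> h = Ident C c))" for c p
  have "\<forall>c\<in>Ob C. \<exists>p. U c p"
  proof
    fix c assume c: "c \<in> Ob C"
    show "\<exists>p. U c p"
    proof (cases "c \<in> Ro ` Ob D")
      case True
      then obtain d where d: "d \<in> Ob D" "c = Ro d" by auto
      have "\<exists>!m. m \<in> Mor D d e \<and> f = Comp C c (Ro d) (Ro e) (Ra d e m) (Ident C c)"
        if e: "e \<in> Ob D" and f: "f \<in> Mor C c (Ro e)" for e f
      proof -
        have "Comp C c (Ro d) (Ro e) (Ra d e m) (Ident C c) = Ra d e m" if "m \<in> Mor D d e" for m
          using Comp_Ident_right[OF C Ro[OF d(1)] Ro[OF e] Ra[OF d(1) e that]] d by simp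
        then show ?thesis using Ra_full[OF d(1) e] Ra_faithful[OF d(1) e] f d by metis
      qed
      then have "U c (d, Ident C c)"
        using d Ident_Mor[OF C c] Ro_inj by (auto simp: U_def inj_on_def)
      then show ?thesis ..
    next
      case False
      obtain d h where "d \<in> Ob D" "h \<in> Mor C c (Ro d)" "\<forall>e\<in>Ob D. \<forall>f\<in>Mor C c (Ro e).
          \<exists>!m. m \<in> Mor D d e \<and> f = Comp C c (Ro d) (Ro e) (Ra d e m) h"
        using univ[OF c] by blast
      then have "U c (d, h)" using False by (auto simp: U_def)
      then show ?thesis ..
    qed
  qed
  then obtain P where P: "\<And>c. c \<in> Ob C \<Longrightarrow> U c (P c)" by metis
  show ?thesis
  proof (rule that[of "\<lambda>c. fst (P c)" "\<lambda>c. snd (P c)"])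
    show "fst (P (Ro d)) = d" "snd (P (Ro d)) = Ident C (Ro d)" if "d \<in> Ob D" for d
      using P[OF Ro[OF that]] that unfolding U_def by (auto simp: case_prod_unfold)
  qed (use P in \<open>auto simp: U_def case_prod_unfold\<close>)
qed

theorem nerve_weakly_homotopy_equivalent: "weakly_homotopy_equivalent (nerve C) (nerve D)"
proof -
  obtain Lo \<eta> where Lo: "\<And>c. c \<in> Ob C \<Longrightarrow> Lo c \<in> Ob D" and \<eta>: "\<And>c. c \<in> Ob C \<Longrightarrow> \<eta> c \<in> Mor C c (Ro (Lo c))"
    and un: "\<And>c e f. c \<in> Ob C \<Longrightarrow> e \<in> Ob D \<Longrightarrow> f \<in> Mor C c (Ro e) \<Longrightarrow>
      \<exists>!m. m \<in> Mor D (Lo c) e \<and> f = Comp C c (Ro (Lo c)) (Ro e) (Ra (Lo c) e m) (\<eta> c)"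
    and LR: "\<And>d. d \<in> Ob D \<Longrightarrow> Lo (Ro d) = d" and \<eta>R: "\<And>d. d \<in> Ob D \<Longrightarrow> \<eta> (Ro d) = Ident C (Ro d)"
    by (rule normalized_reflector) (rule that; assumption)
  define T where "T c = Ro (Lo c)" for c
  have T: "T c \<in> Ob C" if "c \<in> Ob C" for c using that by (simp add: T_def Ro Lo)
  have \<eta>T: "\<eta> c \<in> Mor C c (T c)" if "c \<in> Ob C" for c using \<eta>[OF that] by (simp add: T_def)
  \<comment> \<open>The action on arrows is the only one making \<open>\<eta>\<close> natural. Its
    uniqueness, in the form \<open>La_eq\<close>, yields functoriality.\<close>
  define La where "La a b m = (THE k. k \<in> Mor D (Lo a) (Lo b) \<and>
      Comp C a b (T b) (\<eta> b) m = Comp C a (T a) (T b) (Ra (Lo a) (Lo b) k) (\<eta> a))" for a b m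
  have ex: "\<exists>!k. k \<in> Mor D (Lo a) (Lo b) \<and>
      Comp C a b (T b) (\<eta> b) m = Comp C a (T a) (T b) (Ra (Lo a) (Lo b) k) (\<eta> a)"
    if "a \<in> Ob C" "b \<in> Ob C" "m \<in> Mor C a b" for a b m
    using un[OF that(1) Lo[OF that(2)], of "Comp C a b (T b) (\<eta> b) m"] Comp_Mor[OF C that(1,2) T that(3) \<eta>T] that
    by (simp add: T_def)
  have La: "La a b m \<in> Mor D (Lo a) (Lo b)"
    and nat: "Comp C a b (T b) (\<eta> b) m = Comp C a (T a) (T b) (Ra (Lo a) (Lo b) (La a b m)) (\<eta> a)"
    if "a \<in> Ob C" "b \<in> Ob C" "m \<in> Mor C a b" for a b m
    using theI'[OF ex[OF that]] unfolding La_def by auto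
  have La_eq: "La a b m = k" if "a \<in> Ob C" "b \<in> Ob C" "m \<in> Mor C a b" "k \<in> Mor D (Lo a) (Lo b)"
      "Comp C a b (T b) (\<eta> b) m = Comp C a (T a) (T b) (Ra (Lo a) (Lo b) k) (\<eta> a)" for a b m k
    using ex[OF that(1-3)] La[OF that(1-3)] nat[OF that(1-3)] that(4,5) by blast
  have RaT: "Ra (Lo a) (Lo b) k \<in> Mor C (T a) (T b)" if "a \<in> Ob C" "b \<in> Ob C" "k \<in> Mor D (Lo a) (Lo b)" for a b k
    using Ra[OF Lo[OF that(1)] Lo[OF that(2)] that(3)] by (simp add: T_def)
  have La_id: "La a a (Ident C a) = Ident D (Lo a)" if a: "a \<in> Ob C" for a
  proof (rule La_eq[OF a a Ident_Mor[OF C a] Ident_Mor[OF D Lo[OF a]]])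
    show "Comp C a a (T a) (\<eta> a) (Ident C a) = Comp C a (T a) (T a) (Ra (Lo a) (Lo a) (Ident D (Lo a))) (\<eta> a)"
      using Comp_Ident_right[OF C a T[OF a] \<eta>T[OF a]] Comp_Ident_left[OF C a T[OF a] \<eta>T[OF a]] Ra_id[OF Lo[OF a]]
      by (simp add: T_def)
  qed
  have La_comp: "La a c (Comp C a b c k m) = Comp D (Lo a) (Lo b) (Lo c) (La b c k) (La a b m)"
    if o: "a \<in> Ob C" "b \<in> Ob C" "c \<in> Ob C" and m: "m \<in> Mor C a b" and k: "k \<in> Mor C b c" for a b c m k
  proof (rule La_eq[OF o(1,3) Comp_Mor[OF C o m k]])
    note L = La[OF o(1,2) m] La[OF o(2,3) k]
    show "Comp D (Lo a) (Lo b) (Lo c) (La b c k) (La a b m) \<in> Mor D (Lo a) (Lo c)"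
      by (rule Comp_Mor[OF D Lo[OF o(1)] Lo[OF o(2)] Lo[OF o(3)] L])
    have "Comp C a c (T c) (\<eta> c) (Comp C a b c k m) = Comp C a b (T c) (Comp C b c (T c) (\<eta> c) k) m"
      by (rule Comp_assoc[OF C o T[OF o(3)] m k \<eta>T[OF o(3)]])
    also have "Comp C b c (T c) (\<eta> c) k = Comp C b (T b) (T c) (Ra (Lo b) (Lo c) (La b c k)) (\<eta> b)"
      by (rule nat[OF o(2,3) k])
    also have "Comp C a b (T c) \<dots> m = Comp C a (T b) (T c) (Ra (Lo b) (Lo c) (La b c k)) (Comp C a b (T b) (\<eta> b) m)"
      by (rule Comp_assoc[OF C o(1,2) T[OF o(2)] T[OF o(3)] m \<eta>T[OF o(2)] RaT[OF o(2,3) L(2)], symmetric])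
    also have "Comp C a b (T b) (\<eta> b) m = Comp C a (T a) (T b) (Ra (Lo a) (Lo b) (La a b m)) (\<eta> a)"
      by (rule nat[OF o(1,2) m])
    also have "Comp C a (T b) (T c) (Ra (Lo b) (Lo c) (La b c k)) \<dots> =
       Comp C a (T a) (T c) (Comp C (T a) (T b) (T c) (Ra (Lo b) (Lo c) (La b c k)) (Ra (Lo a) (Lo b) (La a b m))) (\<eta> a)"
      by (rule Comp_assoc[OF C o(1) T[OF o(1)] T[OF o(2)] T[OF o(3)] \<eta>T[OF o(1)] RaT[OF o(1,2) L(1)] RaT[OF o(2,3) L(2)]])
    finally show "Comp C a c (T c) (\<eta> c) (Comp C a b c k m) =
        Comp C a (T a) (T c) (Ra (Lo a) (Lo c) (Comp D (Lo a) (Lo b) (Lo c) (La b c k) (La a b m))) (\<eta> a)"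
      using Ra_comp[OF Lo[OF o(1)] Lo[OF o(2)] Lo[OF o(3)] L] by (simp add: T_def)
  qed
  \<comment> \<open>At objects \<open>Ro d\<close> the unit is an identity, so the reflector undoes
    \<open>Ra\<close> on the nose and the map of nerves is retracted strictly.\<close>
  have La_Ra: "La (Ro d) (Ro e) (Ra d e m) = m" if o: "d \<in> Ob D" "e \<in> Ob D" and m: "m \<in> Mor D d e" for d e m
  proof (rule La_eq[OF Ro[OF o(1)] Ro[OF o(2)] Ra[OF o m]])
    show "m \<in> Mor D (Lo (Ro d)) (Lo (Ro e))" using o m LR by simp
    show "Comp C (Ro d) (Ro e) (T (Ro e)) (\<eta> (Ro e)) (Ra d e m) =
      Comp C (Ro d) (T (Ro d)) (T (Ro e)) (Ra (Lo (Ro d)) (Lo (Ro e)) m) (\<eta> (Ro d))"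
      using Comp_Ident_left[OF C Ro[OF o(1)] Ro[OF o(2)] Ra[OF o m]]
        Comp_Ident_right[OF C Ro[OF o(1)] Ro[OF o(2)] Ra[OF o m]] o LR \<eta>R by (simp add: T_def)
  qed
  define Ta where "Ta a b m = Ra (Lo a) (Lo b) (La a b m)" for a b m
  have Ta: "Ta a b m \<in> Mor C (T a) (T b)" if "a \<in> Ob C" "b \<in> Ob C" "m \<in> Mor C a b" for a b m
    using RaT La that by (simp add: Ta_def)
  have Ta_id: "Ta a a (Ident C a) = Ident C (T a)" if "a \<in> Ob C" for a
    using that by (simp add: Ta_def La_id Ra_id Lo T_def)
  have Ta_comp: "Ta a c (Comp C a b c k m) = Comp C (T a) (T b) (T c) (Ta b c k) (Ta a b m)"
    if "a \<in> Ob C" "b \<in> Ob C" "c \<in> Ob C" "m \<in> Mor C a b" "k \<in> Mor C b c" for a b c m k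
    using that Ra_comp[OF Lo Lo Lo La La] by (simp add: Ta_def La_comp T_def)
  have nat': "Comp C a b (T b) (\<eta> b) m = Comp C a (T a) (T b) (Ta a b m) (\<eta> a)"
    if "a \<in> Ob C" "b \<in> Ob C" "m \<in> Mor C a b" for a b m
    using nat[OF that] by (simp add: Ta_def)
  define g where "g = nerve_map Ro Ra D"
  define f where "f = nerve_map Lo La C"
  \<comment> \<open>In a chain, objects with \<open>\<xi> i = 0\<close> are kept and the others are
    replaced by their reflections. As \<open>\<xi>\<close> is monotone, there is one switch, and
    \<open>\<eta>\<close> enters exactly in the arrows that cross it.\<close>
  define H where "H n z \<xi> = (case z of (x, u) \<Rightarrow> (\<lambda>i\<in>{..n}. if \<xi> i = (0::nat) then x i else T (x i),
      \<lambda>(i, j)\<in>{(i, j). i \<le> j \<and> j \<le> n}. if \<xi> j = 0 then u (i, j) else if \<xi> i = 0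
        then Comp C (x i) (x j) (T (x j)) (\<eta> (x j)) (u (i, j)) else Ta (x i) (x j) (u (i, j))))" for n :: nat and z \<xi>
  have g: "simplicial_map (nerve D) (nerve C) g"
    unfolding g_def by (rule simplicial_map_nerve_map[OF Ro Ra Ra_id Ra_comp])
  have f: "simplicial_map (nerve C) (nerve D) f"
    unfolding f_def by (rule simplicial_map_nerve_map[OF Lo La La_id La_comp])
  have Hc: "H n (x, u) \<xi> \<in> cells (nerve C) n" if xu: "(x, u) \<in> cells (nerve C) n" and xi: "\<xi> \<in> Delta n 1" for n x u \<xi>
  proof -
    have xo: "x i \<in> Ob C" if "i \<le> n" for i using xu that by (simp add: nerve_cells_iff)
    have um: "u (i, j) \<in> Mor C (x i) (x j)" if "i \<le> j" "j \<le> n" for i j using xu that by (simp add: nerve_cells_iff)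
    have ui: "u (i, i) = Ident C (x i)" if "i \<le> n" for i using xu that by (simp add: nerve_cells_iff)
    have uc: "u (i, k) = Comp C (x i) (x j) (x k) (u (j, k)) (u (i, j))" if "i \<le> j" "j \<le> k" "k \<le> n" for i j k
      using xu that unfolding nerve_cells_iff by blast
    have mono: "\<xi> i = 0" if "\<xi> j = 0" "i \<le> j" "j \<le> n" for i j using Delta_mono[OF xi that(2,3)] that(1) by simp
    define y where "y i = (if \<xi> i = (0::nat) then x i else T (x i))" for i
    define v where "v i j = (if \<xi> j = 0 then u (i, j) else if \<xi> i = 0
        then Comp C (x i) (x j) (T (x j)) (\<eta> (x j)) (u (i, j)) else Ta (x i) (x j) (u (i, j)))" for i j
    have 1: "y i \<in> Ob C" if "i \<le> n" for i using xo[OF that] T by (simp add: y_def)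
    have 2: "v i j \<in> Mor C (y i) (y j)" if ij: "i \<le> j" "j \<le> n" for i j
    proof -
      have i: "x i \<in> Ob C" and j: "x j \<in> Ob C" using xo ij by auto
      show ?thesis
        unfolding v_def y_def
        using um[OF ij] mono[OF _ ij] Ta[OF i j um[OF ij]] Comp_Mor[OF C i j T[OF j] um[OF ij] \<eta>T[OF j]] by auto
    qed
    have 3: "v i i = Ident C (y i)" if "i \<le> n" for i
      unfolding v_def y_def using ui[OF that] Ta_id[OF xo[OF that]] by simp
    have 4: "v i k = Comp C (y i) (y j) (y k) (v j k) (v i j)" if ijk: "i \<le> j" "j \<le> k" "k \<le> n" for i j k
    proof -
      have o: "x i \<in> Ob C" "x j \<in> Ob C" "x k \<in> Ob C" using xo ijk by auto
      have m: "u (i, j) \<in> Mor C (x i) (x j)" "u (j, k) \<in> Mor C (x j) (x k)" using um ijk by auto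
      have "j \<le> n" using ijk by simp
      consider "\<xi> i = 0" "\<xi> j = 0" "\<xi> k = 0" | "\<xi> i = 0" "\<xi> j = 0" "\<xi> k \<noteq> 0"
        | "\<xi> i = 0" "\<xi> j \<noteq> 0" "\<xi> k \<noteq> 0" | "\<xi> i \<noteq> 0" "\<xi> j \<noteq> 0" "\<xi> k \<noteq> 0"
        using mono[OF _ ijk(2,3)] mono[OF _ ijk(1) \<open>j \<le> n\<close>] by metis
      then show ?thesis
      proof cases
        case 1 then show ?thesis by (simp add: v_def y_def uc[OF ijk])
      next
        case 2
        then show ?thesis
          using Comp_assoc[OF C o T[OF o(3)] m \<eta>T[OF o(3)]] by (simp add: v_def y_def uc[OF ijk])
      next
        \<comment> \<open>The switch lies between \<open>i\<close> and \<open>j\<close>, so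
          \<open>\<eta>\<close> must be moved past \<open>u (j, k)\<close>: the one case that uses
          naturality.\<close>
        case 3
        have "v i k = Comp C (x i) (x j) (T (x k)) (Comp C (x j) (x k) (T (x k)) (\<eta> (x k)) (u (j, k))) (u (i, j))"
          using 3 Comp_assoc[OF C o T[OF o(3)] m \<eta>T[OF o(3)]] by (simp add: v_def uc[OF ijk])
        also have "\<dots> = Comp C (x i) (T (x j)) (T (x k)) (Ta (x j) (x k) (u (j, k)))
            (Comp C (x i) (x j) (T (x j)) (\<eta> (x j)) (u (i, j)))"
          unfolding nat'[OF o(2,3) m(2)]
          by (rule Comp_assoc[OF C o(1,2) T[OF o(2)] T[OF o(3)] m(1) \<eta>T[OF o(2)] Ta[OF o(2,3) m(2)], symmetric])
        finally show ?thesis using 3 by (simp add: v_def y_def)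
      next
        case 4
        then show ?thesis using Ta_comp[OF o m] by (simp add: v_def y_def uc[OF ijk])
      qed
    qed
    have "H n (x, u) \<xi> = (restrict y {..n}, \<lambda>(i, j)\<in>{(i, j). i \<le> j \<and> j \<le> n}. v i j)"
      by (simp add: H_def y_def[abs_def] v_def)
    moreover have "\<dots> \<in> cells (nerve C) n"
      using 1 2 3 4 by (rule nerve_cellsI)
    ultimately show ?thesis by simp
  qed
  show ?thesis
  proof (rule weakly_homotopy_equivalent_deformation_retract[OF simplicial_set_nerve simplicial_set_nerve g f, where H = H])
    have g_eq: "g n (x, u) = (\<lambda>i\<in>{..n}. Ro (x i), \<lambda>(i, j)\<in>{(i, j). i \<le> j \<and> j \<le> n}. Ra (x i) (x j) (u (i, j)))"
      if "(x, u) \<in> cells (nerve D) n" for n x u using that by (simp add: g_def nerve_map_def)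
    have f_eq: "f n (x, u) = (\<lambda>i\<in>{..n}. Lo (x i), \<lambda>(i, j)\<in>{(i, j). i \<le> j \<and> j \<le> n}. La (x i) (x j) (u (i, j)))"
      if "(x, u) \<in> cells (nerve C) n" for n x u using that by (simp add: f_def nerve_map_def)
    show "f n (g n z) = z" if "z \<in> cells (nerve D) n" for n z
    proof -
      obtain x u where z: "z = (x, u)" by (cases z)
      have xu: "(x, u) \<in> cells (nerve D) n" using that z by simp
      have "g n (x, u) \<in> cells (nerve C) n" by (rule simplicial_map_cells[OF g xu])
      then show ?thesis
        unfolding z g_eq[OF xu] using nerve_cellsD[OF xu]
        by (subst f_eq) (auto simp: LR La_Ra fun_eq_iff extensional_def restrict_def)
    qed
    show "simplicial_homotopy (nerve C) (nerve C) H"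
    proof
      show "H n z \<xi> \<in> cells (nerve C) n" if "z \<in> cells (nerve C) n" "\<xi> \<in> Delta n 1" for n z \<xi>
        using Hc that by (cases z) auto
      show "H m (sop (nerve C) m n \<alpha> z) (compose {..m} \<xi> \<alpha>) = sop (nerve C) m n \<alpha> (H n z \<xi>)"
        if a: "\<alpha> \<in> Delta m n" and "z \<in> cells (nerve C) n" and xi: "\<xi> \<in> Delta n 1" for m n \<alpha> z \<xi>
      proof -
        obtain x u where z: "z = (x, u)" by (cases z)
        have xu: "(x, u) \<in> cells (nerve C) n" using that z by simp
        have "sop (nerve C) m n \<alpha> (H n (x, u) \<xi>) = (case H n (x, u) \<xi> of (y, v) \<Rightarrow>
            (compose {..m} y \<alpha>, \<lambda>(i, j)\<in>{(i, j). i \<le> j \<and> j \<le> m}. v (\<alpha> i, \<alpha> j)))"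
          using nerve_sop[OF a, of "fst (H n (x, u) \<xi>)" "snd (H n (x, u) \<xi>)" C] Hc[OF xu xi]
          by (simp add: case_prod_unfold)
        moreover have "compose {..m} (\<lambda>i\<in>{..n}. if \<xi> i = 0 then x i else T (x i)) \<alpha> =
            (\<lambda>i\<in>{..m}. if compose {..m} \<xi> \<alpha> i = 0 then compose {..m} x \<alpha> i else T (compose {..m} x \<alpha> i))"
          using Delta_le[OF a] by (auto simp: compose_def fun_eq_iff)
        ultimately show ?thesis
          unfolding z nerve_sop[OF a xu] using Delta_le[OF a] Delta_mono[OF a]
          by (simp add: H_def) (auto simp: compose_def fun_eq_iff)
      qed
    qed (simp_all add: simplicial_set_nerve)
    show "H n z (\<lambda>i\<in>{..n}. 0) = z" if "z \<in> cells (nerve C) n" for n z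
    proof -
      obtain x u where z: "z = (x, u)" by (cases z)
      then show ?thesis
        using nerve_cellsD(1,2)[of x u C n] that by (auto simp: H_def fun_eq_iff extensional_def restrict_def)
    qed
    show "H n z (\<lambda>i\<in>{..n}. 1) = g n (f n z)" if "z \<in> cells (nerve C) n" for n z
    proof -
      obtain x u where z: "z = (x, u)" by (cases z)
      have xu: "(x, u) \<in> cells (nerve C) n" using that z by simp
      have "f n (x, u) \<in> cells (nerve D) n" by (rule simplicial_map_cells[OF f xu])
      then show ?thesis
        unfolding z f_eq[OF xu]
        by (subst g_eq) (auto simp: H_def T_def Ta_def fun_eq_iff restrict_def)
    qed
    show "H n (g n z) \<xi> = g n z" if "z \<in> cells (nerve D) n" and xi: "\<xi> \<in> Delta n 1" for n z \<xi>
    proof -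
      obtain x u where z: "z = (x, u)" by (cases z)
      have xu: "(x, u) \<in> cells (nerve D) n" using that z by simp
      have xo: "x i \<in> Ob D" if "i \<le> n" for i using xu that by (simp add: nerve_cells_iff)
      have um: "u (i, j) \<in> Mor D (x i) (x j)" if "i \<le> j" "j \<le> n" for i j using xu that by (simp add: nerve_cells_iff)
      have 1: "T (Ro (x i)) = Ro (x i)" if "i \<le> n" for i using LR[OF xo[OF that]] by (simp add: T_def)
      have 2: "Ta (Ro (x i)) (Ro (x j)) (Ra (x i) (x j) (u (i, j))) = Ra (x i) (x j) (u (i, j))"
        if "i \<le> j" "j \<le> n" for i j
        using La_Ra[OF xo xo um, of i j] LR xo that by (simp add: Ta_def)
      have 3: "Comp C (Ro (x i)) (Ro (x j)) (Ro (x j)) (\<eta> (Ro (x j))) (Ra (x i) (x j) (u (i, j)))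
          = Ra (x i) (x j) (u (i, j))" if "i \<le> j" "j \<le> n" for i j
        using Comp_Ident_left[OF C Ro[OF xo] Ro[OF xo] Ra[OF xo xo um], of i j] \<eta>R xo that by simp
      show ?thesis
        unfolding z g_eq[OF xu] using 1 2 3 by (auto simp: H_def fun_eq_iff restrict_def)
    qed
  qed
qed

end

section \<open>Differentiable functions of several variables\<close>

text \<open>Coordinates from \<open>n\<close> on vanish, so a product neighbourhood imposes
  conditions on the first \<open>n\<close> only, and the least of finitely many radii gives a
  cube.\<close>

lemma openin_Euclidean_space_iff:
  "openin (Euclidean_space n) S \<longleftrightarrow> S \<subseteq> topspace (Euclidean_space n) \<and>
     (\<forall>x\<in>S. \<exists>e>0. \<forall>y\<in>topspace (Euclidean_space n). (\<forall>i<n. \<bar>y i - x i\<bar> < e) \<longrightarrow> y \<in> S)"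
  (is "?L \<longleftrightarrow> ?R")
proof
  assume L: ?L
  then obtain T where T: "openin (powertop_real UNIV) T" and S: "S = T \<inter> {x. \<forall>i\<ge>n. x i = 0}"
    unfolding Euclidean_space_def openin_subtopology by blast
  have "\<exists>e>0. \<forall>y\<in>topspace (Euclidean_space n). (\<forall>i<n. \<bar>y i - x i\<bar> < e) \<longrightarrow> y \<in> S" if x: "x \<in> S" for x
  proof -
    obtain U where U: "\<And>i. open (U i)" "x \<in> Pi\<^sub>E UNIV U" "Pi\<^sub>E UNIV U \<subseteq> T"
    proof -
      have "x \<in> T" using x S by simp
      with T[unfolded openin_product_topology_alt]
      have "\<exists>U. finite {i \<in> UNIV. U i \<noteq> topspace euclideanreal} \<and> (\<forall>i\<in>UNIV. openin euclideanreal (U i)) \<and>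
          x \<in> Pi\<^sub>E UNIV U \<and> Pi\<^sub>E UNIV U \<subseteq> T" by (rule bspec)
      then obtain U where U: "finite {i \<in> UNIV. U i \<noteq> topspace euclideanreal} \<and> (\<forall>i\<in>UNIV. openin euclideanreal (U i)) \<and>
          x \<in> Pi\<^sub>E UNIV U \<and> Pi\<^sub>E UNIV U \<subseteq> T" by (rule exE)
      have "open (U i)" for i using U by (simp only: ball_UNIV open_openin)
      then show ?thesis by (rule that[OF _ conjunct1[OF conjunct2[OF conjunct2[OF U]]] conjunct2[OF conjunct2[OF conjunct2[OF U]]]])
    qed
    have "\<exists>e>0. \<forall>s. \<bar>s - x i\<bar> < e \<longrightarrow> s \<in> U i" for i
      using U(1)[of i] U(2) unfolding open_dist dist_real_def by (auto simp: PiE_iff)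
    then obtain d where d: "\<And>i. d i > 0" "\<And>i s. \<bar>s - x i\<bar> < d i \<Longrightarrow> s \<in> U i" by metis
    \<comment> \<open>The extra 1 keeps \<open>Min\<close> meaningful for
      \<open>n = 0\<close>.\<close>
    define e where "e = Min (insert 1 (d ` {..<n}))"
    have e: "e > 0" "\<And>i. i < n \<Longrightarrow> e \<le> d i" using d(1) by (auto simp: e_def)
    have "y \<in> S" if y: "y \<in> topspace (Euclidean_space n)" "\<forall>i<n. \<bar>y i - x i\<bar> < e" for y
    proof -
      have "y i \<in> U i" for i
      proof (cases "i < n")
        case True then show ?thesis using d(2) e(2) y(2) by fastforce
      next
        case False
        then show ?thesis using y(1) x S d(1)[of i] by (intro d(2)) (auto simp: topspace_Euclidean_space)
      qed
      then show ?thesis using U(3) S y(1) by (auto simp: topspace_Euclidean_space)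
    qed
    then show ?thesis using e(1) by blast
  qed
  then show ?R using openin_subset[OF L] by blast
next
  assume R: ?R
  show ?L
  proof (subst openin_subopen, intro ballI)
    fix x assume x: "x \<in> S"
    then obtain e where e: "e > 0" "\<And>y. y \<in> topspace (Euclidean_space n) \<Longrightarrow> (\<forall>i<n. \<bar>y i - x i\<bar> < e) \<Longrightarrow> y \<in> S"
      using R by blast
    let ?U = "\<lambda>i. if i < n then {s. \<bar>s - x i\<bar> < e} else UNIV"
    have "open {s. \<bar>s - x i\<bar> < e}" for i
      using open_ball[of "x i" e] by (simp add: ball_def dist_real_def abs_minus_commute)
    then have "openin (powertop_real UNIV) (Pi\<^sub>E UNIV ?U)"
      by (subst openin_PiE_gen) (auto intro!: finite_subset[of _ "{..<n}"] simp: open_openin[symmetric])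
    then have "openin (Euclidean_space n) (Pi\<^sub>E UNIV ?U \<inter> {x. \<forall>i\<ge>n. x i = 0})"
      unfolding Euclidean_space_def openin_subtopology by blast
    moreover have "x \<in> Pi\<^sub>E UNIV ?U \<inter> {x. \<forall>i\<ge>n. x i = 0}"
      using x R e(1) by (auto simp: topspace_Euclidean_space)
    moreover have "Pi\<^sub>E UNIV ?U \<inter> {x. \<forall>i\<ge>n. x i = 0} \<subseteq> S"
      by (auto simp: PiE_iff topspace_Euclidean_space split: if_splits intro!: e(2))
    ultimately show "\<exists>T. openin (Euclidean_space n) T \<and> x \<in> T \<and> T \<subseteq> S" by blast
  qed
qed

lemma openin_EuclideanD:
  "openin (Euclidean_space n) S \<Longrightarrow> x \<in> S \<Longrightarrow>
   \<exists>e>0. \<forall>y\<in>topspace (Euclidean_space n). (\<forall>i<n. \<bar>y i - x i\<bar> < e) \<longrightarrow> y \<in> S"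
  by (simp add: openin_Euclidean_space_iff)

text \<open>Asking that the whole cube around \<open>x\<close> stay in \<open>S\<close> absorbs the
  subspace topology.\<close>

lemma continuous_Euclidean_iff:
  assumes S: "openin (Euclidean_space n) S"
  shows "continuous_map (subtopology (Euclidean_space n) S) euclideanreal f \<longleftrightarrow>
    (\<forall>x\<in>S. \<forall>\<epsilon>>0. \<exists>\<delta>>0. \<forall>y\<in>topspace (Euclidean_space n).
       (\<forall>i<n. \<bar>y i - x i\<bar> < \<delta>) \<longrightarrow> y \<in> S \<and> \<bar>f y - f x\<bar> < \<epsilon>)" (is "?L \<longleftrightarrow> ?R")
proof
  have top: "topspace (subtopology (Euclidean_space n) S) = S"
    using openin_subset[OF S] by auto
  {
    assume L: ?L
    show ?R
    proof (intro ballI allI impI)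
      fix x and \<epsilon> :: real assume x: "x \<in> S" and "\<epsilon> > 0"
      have "openin (subtopology (Euclidean_space n) S)
          {y \<in> topspace (subtopology (Euclidean_space n) S). f y \<in> ball (f x) \<epsilon>}"
        using L by (rule openin_continuous_map_preimage) simp
      then have "openin (Euclidean_space n) {y \<in> S. f y \<in> ball (f x) \<epsilon>}"
        unfolding top using openin_trans_full[OF _ S] by blast
      from openin_EuclideanD[OF this, of x] x \<open>\<epsilon> > 0\<close>
      show "\<exists>\<delta>>0. \<forall>y\<in>topspace (Euclidean_space n). (\<forall>i<n. \<bar>y i - x i\<bar> < \<delta>) \<longrightarrow> y \<in> S \<and> \<bar>f y - f x\<bar> < \<epsilon>"
        by (simp add: dist_real_def abs_minus_commute)
    qed
  }
  assume R: ?R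
  show ?L
    unfolding continuous_map_def top
  proof (intro conjI allI impI)
    fix U assume U: "openin euclideanreal U"
    have "openin (Euclidean_space n) {x \<in> S. f x \<in> U}"
      unfolding openin_Euclidean_space_iff
    proof (intro conjI ballI)
      show "{x \<in> S. f x \<in> U} \<subseteq> topspace (Euclidean_space n)" using openin_subset[OF S] by blast
      fix x assume x: "x \<in> {x \<in> S. f x \<in> U}"
      then obtain \<epsilon> where "\<epsilon> > 0" and e: "\<And>s. \<bar>s - f x\<bar> < \<epsilon> \<Longrightarrow> s \<in> U"
        using U unfolding open_openin[symmetric] open_dist dist_real_def by blast
      then obtain \<delta> where "\<delta> > 0" "\<forall>y\<in>topspace (Euclidean_space n).
          (\<forall>i<n. \<bar>y i - x i\<bar> < \<delta>) \<longrightarrow> y \<in> S \<and> \<bar>f y - f x\<bar> < \<epsilon>" using R x by blast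
      then show "\<exists>e>0. \<forall>y\<in>topspace (Euclidean_space n). (\<forall>i<n. \<bar>y i - x i\<bar> < e) \<longrightarrow> y \<in> {x \<in> S. f x \<in> U}"
        using e by (intro exI[of _ \<delta>]) auto
    qed
    then show "openin (subtopology (Euclidean_space n) S) {x \<in> S. f x \<in> U}"
      using openin_open_subtopology[OF S] by auto
  qed auto
qed

lemma line_in_open:
  assumes S: "openin (Euclidean_space n) S" and x: "x \<in> S" and i: "i < n"
  shows "\<exists>e>0. \<forall>t. \<bar>t - x i\<bar> < e \<longrightarrow> x(i := t) \<in> S"
proof -
  obtain e where e: "e > 0" "\<And>y. y \<in> topspace (Euclidean_space n) \<Longrightarrow> (\<forall>i<n. \<bar>y i - x i\<bar> < e) \<Longrightarrow> y \<in> S"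
    using openin_EuclideanD[OF S x] by blast
  have "x \<in> topspace (Euclidean_space n)" using openin_subset[OF S] x by blast
  then show ?thesis using e i by (intro exI[of _ e]) (auto simp: topspace_Euclidean_space)
qed

section \<open>Algebra of functions with continuous partial derivatives\<close>

lemma C_diff_continuous: "C_diff k n S f \<Longrightarrow> continuous_map (subtopology (Euclidean_space n) S) euclideanreal f"
  by (cases k) auto

lemma C_diff_SucD:
  assumes "C_diff (Suc k) n S f"
  shows "\<exists>f'. (\<forall>i x. i < n \<longrightarrow> x \<in> S \<longrightarrow> ((\<lambda>t. f (x(i := t))) has_real_derivative f' i x) (at (x i))) \<and>
    (\<forall>i. i < n \<longrightarrow> C_diff k n S (f' i))"
  using assms unfolding C_diff.simps by metis

lemma C_diff_SucI:
  assumes "continuous_map (subtopology (Euclidean_space n) S) euclideanreal f"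
    and "\<And>i x. i < n \<Longrightarrow> x \<in> S \<Longrightarrow> ((\<lambda>t. f (x(i := t))) has_real_derivative f' i x) (at (x i))"
    and "\<And>i. i < n \<Longrightarrow> C_diff k n S (f' i)"
  shows "C_diff (Suc k) n S f"
  unfolding C_diff.simps using assms by blast

lemma C_diff_mono: "C_diff (Suc k) n S f \<Longrightarrow> C_diff k n S f"
proof (induct k arbitrary: f)
  case (Suc k)
  obtain f' where f':
    "\<And>i x. i < n \<Longrightarrow> x \<in> S \<Longrightarrow> ((\<lambda>t. f (x(i := t))) has_real_derivative f' i x) (at (x i))"
    "\<And>i. i < n \<Longrightarrow> C_diff (Suc k) n S (f' i)"
    using C_diff_SucD[OF Suc.prems] by blast
  show ?case
    by (rule C_diff_SucI[OF C_diff_continuous[OF Suc.prems] f'(1) Suc.hyps[OF f'(2)]])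
qed simp

lemma C_diff_subset: "C_diff k n S f \<Longrightarrow> T \<subseteq> S \<Longrightarrow> C_diff k n T f"
proof (induct k arbitrary: f)
  case 0
  then show ?case using continuous_map_from_subtopology_mono by auto
next
  case (Suc k)
  obtain f' where f':
    "\<And>i x. i < n \<Longrightarrow> x \<in> S \<Longrightarrow> ((\<lambda>t. f (x(i := t))) has_real_derivative f' i x) (at (x i))"
    "\<And>i. i < n \<Longrightarrow> C_diff k n S (f' i)"
    using C_diff_SucD[OF Suc.prems(1)] by blast
  show ?case
    by (rule C_diff_SucI[OF continuous_map_from_subtopology_mono[OF C_diff_continuous[OF Suc.prems(1)] Suc.prems(2)]
          f'(1)[OF _ subsetD[OF Suc.prems(2)]] Suc.hyps[OF f'(2) Suc.prems(2)]])
qed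

text \<open>A partial derivative at \<open>x\<close> depends on values along a line near
  \<open>x\<close>; openness of \<open>S\<close> keeps a piece of this line inside \<open>S\<close>,
  where the two functions agree.\<close>

lemma C_diff_cong:
  assumes S: "openin (Euclidean_space n) S" and f: "C_diff k n S f" and eq: "\<And>x. x \<in> S \<Longrightarrow> f x = g x"
  shows "C_diff k n S g"
proof -
  have cont: "continuous_map (subtopology (Euclidean_space n) S) euclideanreal g"
    using C_diff_continuous[OF f] by (rule continuous_map_eq) (use eq in auto)
  show ?thesis
  proof (cases k)
    case (Suc l)
    obtain f' where f':
      "\<And>i x. i < n \<Longrightarrow> x \<in> S \<Longrightarrow> ((\<lambda>t. f (x(i := t))) has_real_derivative f' i x) (at (x i))"
      "\<And>i. i < n \<Longrightarrow> C_diff l n S (f' i)"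
      using C_diff_SucD[OF f[unfolded Suc]] by blast
    have "((\<lambda>t. g (x(i := t))) has_real_derivative f' i x) (at (x i))" if i: "i < n" and x: "x \<in> S" for i x
    proof -
      obtain e where e: "e > 0" "\<And>t. \<bar>t - x i\<bar> < e \<Longrightarrow> x(i := t) \<in> S" using line_in_open[OF S x i] by blast
      show ?thesis
        by (rule has_field_derivative_transform_within_open[OF f'(1)[OF i x] open_ball[of "x i" e]])
          (use e eq in \<open>auto simp: dist_real_def abs_minus_commute\<close>)
    qed
    then show ?thesis unfolding Suc using cont f'(2) by (intro C_diff_SucI)
  qed (use cont in simp)
qed

context
  fixes n :: nat and S :: "point set"
  assumes S: "openin (Euclidean_space n) S"
begin

lemma C_diff_const: "C_diff k n S (\<lambda>x. c)"
proof (induct k arbitrary: c)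
  case (Suc k)
  show ?case by (rule C_diff_SucI[where f' = "\<lambda>i x. 0"]) (use Suc in auto)
qed simp

lemma C_diff_coord: "C_diff k n S (\<lambda>x. x j)"
proof -
  have c: "continuous_map (subtopology (Euclidean_space n) S) euclideanreal (\<lambda>x. x j)"
    unfolding Euclidean_space_def
    by (intro continuous_map_from_subtopology continuous_map_product_projection) simp
  show ?thesis
  proof (cases k)
    case (Suc l)
    show ?thesis
      unfolding Suc
    proof (rule C_diff_SucI[where f' = "\<lambda>i x. if i = j then 1 else 0"])
      show "C_diff l n S (\<lambda>x. if i = j then 1 else 0)" for i by (rule C_diff_const)
    qed (use c in \<open>auto intro!: derivative_eq_intros\<close>)
  qed (use c in simp)
qed

lemma C_diff_add: "C_diff k n S f \<Longrightarrow> C_diff k n S g \<Longrightarrow> C_diff k n S (\<lambda>x. f x + g x)"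
proof (induct k arbitrary: f g)
  case 0
  then show ?case by (auto intro: continuous_map_add)
next
  case (Suc k)
  obtain f' where f':
    "\<And>i x. i < n \<Longrightarrow> x \<in> S \<Longrightarrow> ((\<lambda>t. f (x(i := t))) has_real_derivative f' i x) (at (x i))"
    "\<And>i. i < n \<Longrightarrow> C_diff k n S (f' i)" using C_diff_SucD[OF Suc.prems(1)] by blast
  obtain g' where g':
    "\<And>i x. i < n \<Longrightarrow> x \<in> S \<Longrightarrow> ((\<lambda>t. g (x(i := t))) has_real_derivative g' i x) (at (x i))"
    "\<And>i. i < n \<Longrightarrow> C_diff k n S (g' i)" using C_diff_SucD[OF Suc.prems(2)] by blast
  show ?case
    by (rule C_diff_SucI[OF continuous_map_add[OF C_diff_continuous[OF Suc.prems(1)] C_diff_continuous[OF Suc.prems(2)]]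
          DERIV_add[OF f'(1) g'(1)] Suc.hyps[OF f'(2) g'(2)]])
qed

lemma C_diff_mult: "C_diff k n S f \<Longrightarrow> C_diff k n S g \<Longrightarrow> C_diff k n S (\<lambda>x. f x * g x)"
proof (induct k arbitrary: f g)
  case 0
  then show ?case by (auto intro: continuous_map_real_mult)
next
  case (Suc k)
  obtain f' where f':
    "\<And>i x. i < n \<Longrightarrow> x \<in> S \<Longrightarrow> ((\<lambda>t. f (x(i := t))) has_real_derivative f' i x) (at (x i))"
    "\<And>i. i < n \<Longrightarrow> C_diff k n S (f' i)" using C_diff_SucD[OF Suc.prems(1)] by blast
  obtain g' where g':
    "\<And>i x. i < n \<Longrightarrow> x \<in> S \<Longrightarrow> ((\<lambda>t. g (x(i := t))) has_real_derivative g' i x) (at (x i))"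
    "\<And>i. i < n \<Longrightarrow> C_diff k n S (g' i)" using C_diff_SucD[OF Suc.prems(2)] by blast
  show ?case
  proof (rule C_diff_SucI[where f' = "\<lambda>i x. f' i x * g x + g' i x * f x"])
    show "continuous_map (subtopology (Euclidean_space n) S) euclideanreal (\<lambda>x. f x * g x)"
      using C_diff_continuous[OF Suc.prems(1)] C_diff_continuous[OF Suc.prems(2)]
      by (rule continuous_map_real_mult)
    show "((\<lambda>t. f (x(i := t)) * g (x(i := t))) has_real_derivative f' i x * g x + g' i x * f x) (at (x i))"
      if "i < n" "x \<in> S" for i x
      using DERIV_mult[OF f'(1)[OF that] g'(1)[OF that]] by simp
    show "C_diff k n S (\<lambda>x. f' i x * g x + g' i x * f x)" if "i < n" for i
      by (rule C_diff_add[OF Suc.hyps[OF f'(2)[OF that] C_diff_mono[OF Suc.prems(2)]]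
            Suc.hyps[OF g'(2)[OF that] C_diff_mono[OF Suc.prems(1)]]])
  qed
qed

lemma C_diff_diff: "C_diff k n S f \<Longrightarrow> C_diff k n S g \<Longrightarrow> C_diff k n S (\<lambda>x. f x - g x)"
  using C_diff_add[OF _ C_diff_mult[OF C_diff_const[of k "-1"]]] by simp

lemma C_diff_sum: "(\<And>j. j < (m::nat) \<Longrightarrow> C_diff k n S (f j)) \<Longrightarrow> C_diff k n S (\<lambda>x. \<Sum>j<m. f j x)"
  by (induct m) (auto intro: C_diff_add C_diff_const)

text \<open>Composition with functions of one real variable. A family \<open>F\<close> closed under
  differentiation on \<open>A\<close> carries the induction on the order and avoids formulas for
  higher derivatives.\<close>

lemma C_diff_outer:
  assumes F: "\<And>\<phi>. \<phi> \<in> F \<Longrightarrow> \<exists>\<psi>\<in>F. \<forall>s\<in>A. (\<phi> has_real_derivative \<psi> s) (at s)"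
    and f: "C_diff k n S f" "f ` S \<subseteq> A" and \<phi>: "\<phi> \<in> F"
  shows "C_diff k n S (\<lambda>x. \<phi> (f x))"
  using f(1) \<phi>
proof (induct k arbitrary: \<phi>)
  have cont: "continuous_map (subtopology (Euclidean_space n) S) euclideanreal (\<lambda>x. \<phi> (f x))"
    if "continuous_map (subtopology (Euclidean_space n) S) euclideanreal f" "\<phi> \<in> F" for \<phi>
  proof -
    have "continuous_on A \<phi>"
      using F[OF that(2)] by (meson DERIV_isCont continuous_at_imp_continuous_on)
    moreover have "continuous_map (subtopology (Euclidean_space n) S) (top_of_set A) f"
      using that(1) f(2) by (auto simp: continuous_map_in_subtopology)
    ultimately show ?thesis
      using continuous_map_compose[of _ "top_of_set A" f euclideanreal \<phi>] by (simp add: o_def)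
  qed
  {
    case 0
    then show ?case using cont by simp
  next
    case (Suc k)
    obtain f' where f':
      "\<And>i x. i < n \<Longrightarrow> x \<in> S \<Longrightarrow> ((\<lambda>t. f (x(i := t))) has_real_derivative f' i x) (at (x i))"
      "\<And>i. i < n \<Longrightarrow> C_diff k n S (f' i)" using C_diff_SucD[OF Suc.prems(1)] by blast
    obtain \<psi> where \<psi>: "\<psi> \<in> F" "\<And>s. s \<in> A \<Longrightarrow> (\<phi> has_real_derivative \<psi> s) (at s)"
      using F[OF Suc.prems(2)] by blast
    show ?case
    proof (rule C_diff_SucI[where f' = "\<lambda>i x. \<psi> (f x) * f' i x"])
      show "((\<lambda>t. \<phi> (f (x(i := t)))) has_real_derivative \<psi> (f x) * f' i x) (at (x i))"
        if "i < n" "x \<in> S" for i x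
      proof -
        have "(\<phi> has_real_derivative \<psi> (f x)) (at (f (x(i := x i))))" using \<psi>(2) f(2) that(2) by auto
        from DERIV_chain2[OF this f'(1)[OF that]] show ?thesis .
      qed
      show "C_diff k n S (\<lambda>x. \<psi> (f x) * f' i x)" if "i < n" for i
        by (rule C_diff_mult[OF Suc.hyps[OF C_diff_mono[OF Suc.prems(1)] \<psi>(1)] f'(2)[OF that]])
    qed (rule cont[OF C_diff_continuous[OF Suc.prems(1)] Suc.prems(2)])
  }
qed

lemma C_diff_exp: "C_diff k n S f \<Longrightarrow> C_diff k n S (\<lambda>x. exp (f x))"
  by (rule C_diff_outer[where F = "{exp}" and A = UNIV]) auto

text \<open>Multiples of negative powers form a family closed under differentiation, as
  \<open>C_diff_outer\<close> asks; the logarithm can be adjoined because its derivative belongs to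
  it.\<close>

lemma inverse_power_deriv:
  "(s::real) \<noteq> 0 \<Longrightarrow> ((\<lambda>s. c * inverse s ^ k) has_real_derivative (- c * real k) * inverse s ^ Suc k) (at s)"
  using DERIV_cmult[OF DERIV_chain2[OF DERIV_pow[of k "inverse s"] DERIV_inverse[of s]], of c]
  by (cases k) (auto simp: power2_eq_square algebra_simps)

lemma C_diff_inverse: "C_diff k n S f \<Longrightarrow> (\<And>x. x \<in> S \<Longrightarrow> f x \<noteq> 0) \<Longrightarrow> C_diff k n S (\<lambda>x. inverse (f x))"
  by (rule C_diff_outer[where F = "{\<lambda>s. c * inverse s ^ k | c k. True}" and A = "- {0}"])
    (auto intro!: inverse_power_deriv exI[of _ "1::real"] exI[of _ "1::nat"], use inverse_power_deriv in blast)

lemma C_diff_ln: "C_diff k n S f \<Longrightarrow> (\<And>x. x \<in> S \<Longrightarrow> f x > 0) \<Longrightarrow> C_diff k n S (\<lambda>x. ln (f x))"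
proof (rule C_diff_outer[where \<phi> = ln and f = f and F = "insert ln {\<lambda>s. c * inverse s ^ k | c k. True}" and A = "{0<..}"])
  fix \<phi> assume "\<phi> \<in> insert ln {\<lambda>s::real. c * inverse s ^ k | c k. True}"
  then consider "\<phi> = ln" | c k where "\<phi> = (\<lambda>s. c * inverse s ^ k)" by auto
  then show "\<exists>\<psi>\<in>insert ln {\<lambda>s::real. c * inverse s ^ k | c k. True}. \<forall>s\<in>{0<..}. (\<phi> has_real_derivative \<psi> s) (at s)"
  proof cases
    case 1
    have "(\<lambda>s::real. 1 * inverse s ^ 1) \<in> {\<lambda>s. c * inverse s ^ k | c k. True}" by blast
    moreover have "\<forall>s\<in>{0<..}. (\<phi> has_real_derivative 1 * inverse s ^ 1) (at s)"
      using 1 by (auto intro!: DERIV_ln)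
    ultimately show ?thesis by (metis (no_types, lifting) insertI2)
  next
    case 2
    then show ?thesis
    proof (intro bexI)
      show "\<forall>s\<in>{0<..}. (\<phi> has_real_derivative (- c * real k) * inverse s ^ Suc k) (at s)"
        unfolding 2 by (intro ballI inverse_power_deriv) auto
      show "(\<lambda>s. (- c * real k) * inverse s ^ Suc k) \<in> insert ln {\<lambda>s. c * inverse s ^ k | c k. True}"
        by blast
    qed
  qed
qed auto

end

section \<open>Total differentiability and the chain rule\<close>

text \<open>Continuous partial derivatives give a linear approximation: passing from
  \<open>x\<close> to \<open>y\<close> one coordinate at a time, the mean value inequality bounds
  the error of each move by \<epsilon> times its length.\<close>

lemma partial_derivatives_approx:
  assumes S: "openin (Euclidean_space n) S" and x: "x \<in> S"
    and d: "\<And>i z. i < n \<Longrightarrow> z \<in> S \<Longrightarrow> ((\<lambda>t. f (z(i := t))) has_real_derivative f' i z) (at (z i))"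
    and c: "\<And>i. i < n \<Longrightarrow> continuous_map (subtopology (Euclidean_space n) S) euclideanreal (f' i)"
    and \<epsilon>: "\<epsilon> > 0"
  shows "\<exists>\<delta>>0. \<forall>y\<in>topspace (Euclidean_space n). (\<forall>i<n. \<bar>y i - x i\<bar> < \<delta>) \<longrightarrow>
     \<bar>f y - f x - (\<Sum>i<n. f' i x * (y i - x i))\<bar> \<le> \<epsilon> * (\<Sum>i<n. \<bar>y i - x i\<bar>)"
proof -
  have "\<exists>\<delta>>0. \<forall>y\<in>topspace (Euclidean_space n). (\<forall>i<n. \<bar>y i - x i\<bar> < \<delta>) \<longrightarrow> y \<in> S \<and> \<bar>f' j y - f' j x\<bar> < \<epsilon>"
    if "j < n" for j
    using c[OF that] x \<epsilon> unfolding continuous_Euclidean_iff[OF S] by blast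
  then obtain D where D: "\<And>j. j < n \<Longrightarrow> D j > 0" "\<And>j y. j < n \<Longrightarrow> y \<in> topspace (Euclidean_space n) \<Longrightarrow>
      (\<forall>i<n. \<bar>y i - x i\<bar> < D j) \<Longrightarrow> y \<in> S \<and> \<bar>f' j y - f' j x\<bar> < \<epsilon>" by metis
  define \<delta> where "\<delta> = Min (insert 1 (D ` {..<n}))"
  have \<delta>: "\<delta> > 0" "\<And>j. j < n \<Longrightarrow> \<delta> \<le> D j" using D(1) by (auto simp: \<delta>_def)
  have in_box: "z \<in> S \<and> \<bar>f' j z - f' j x\<bar> < \<epsilon>"
    if "j < n" "z \<in> topspace (Euclidean_space n)" "\<forall>i<n. \<bar>z i - x i\<bar> < \<delta>" for j z
    using D(2)[OF that(1,2)] \<delta>(2)[OF that(1)] that(3) by fastforce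
  have xt: "x \<in> topspace (Euclidean_space n)" using openin_subset[OF S] x by blast
  have "\<bar>f y - f x - (\<Sum>i<n. f' i x * (y i - x i))\<bar> \<le> \<epsilon> * (\<Sum>i<n. \<bar>y i - x i\<bar>)"
    if y: "y \<in> topspace (Euclidean_space n)" "\<forall>i<n. \<bar>y i - x i\<bar> < \<delta>" for y
  proof -
    \<comment> \<open>The intermediate point at which the first \<open>k\<close> coordinates have
      already been changed to those of \<open>y\<close>.\<close>
    define w where "w k = (\<lambda>i. if i < k then y i else x i)" for k
    have "\<bar>f (w k) - f x - (\<Sum>i<k. f' i x * (y i - x i))\<bar> \<le> \<epsilon> * (\<Sum>i<k. \<bar>y i - x i\<bar>)" if "k \<le> n" for k
      using that
    proof (induct k)
      case 0
      then show ?case by (simp add: w_def)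
    next
      case (Suc k)
      then have k: "k < n" by simp
      let ?h = "\<lambda>t. f ((w k)(k := t)) - f' k x * t"
      have seg: "\<bar>t - x k\<bar> < \<delta>" if "t \<in> closed_segment (x k) (y k)" for t
        using y(2) k segment_bound(1)[OF that] by (fastforce simp: abs_minus_commute)
      have zin: "(w k)(k := t) \<in> topspace (Euclidean_space n)" "\<forall>i<n. \<bar>((w k)(k := t)) i - x i\<bar> < \<delta>"
        if "t \<in> closed_segment (x k) (y k)" for t
        using xt y seg[OF that] k \<delta>(1) by (auto simp: w_def topspace_Euclidean_space)
      have "norm (?h (y k) - ?h (x k)) \<le> \<epsilon> * norm (y k - x k)"
      proof (rule field_differentiable_bound[where f' = "\<lambda>t. f' k ((w k)(k := t)) - f' k x"])
        fix t assume t: "t \<in> closed_segment (x k) (y k)"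
        have "(w k)(k := t) \<in> S" using in_box[OF k zin[OF t]] by blast
        from d[OF k this] have "((\<lambda>t. f ((w k)(k := t))) has_real_derivative f' k ((w k)(k := t))) (at t)" by simp
        then have "(?h has_real_derivative f' k ((w k)(k := t)) - f' k x) (at t)"
          by (auto intro!: derivative_eq_intros)
        then show "(?h has_real_derivative f' k ((w k)(k := t)) - f' k x) (at t within closed_segment (x k) (y k))"
          by (rule has_field_derivative_at_within)
        show "norm (f' k ((w k)(k := t)) - f' k x) \<le> \<epsilon>"
          unfolding real_norm_def using in_box[OF k zin[OF t]] by (blast intro: less_imp_le)
      qed auto
      moreover have "(w k)(k := y k) = w (Suc k)" "(w k)(k := x k) = w k" by (auto simp: w_def)
      ultimately have "\<bar>f (w (Suc k)) - f (w k) - f' k x * (y k - x k)\<bar> \<le> \<epsilon> * \<bar>y k - x k\<bar>"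
        by (simp add: algebra_simps)
      then show ?case using Suc by (simp add: algebra_simps)
    qed
    from this[of n] have "\<bar>f (w n) - f x - (\<Sum>i<n. f' i x * (y i - x i))\<bar> \<le> \<epsilon> * (\<Sum>i<n. \<bar>y i - x i\<bar>)" by simp
    moreover have "w n = y" using xt y(1) by (auto simp: w_def topspace_Euclidean_space)
    ultimately show ?thesis by simp
  qed
  then show ?thesis using \<delta>(1) by blast
qed

text \<open>The curve is substituted into the linear approximation. The error, divided by the
  increment of the parameter, is at most \<epsilon> times the sum of the absolute difference
  quotients of the components, and these stay bounded near \<open>t0\<close>.\<close>

lemma derivative_along_curve:
  assumes S: "openin (Euclidean_space n) S" and x: "\<gamma> t0 \<in> S"
    and d: "\<And>i z. i < n \<Longrightarrow> z \<in> S \<Longrightarrow> ((\<lambda>t. f (z(i := t))) has_real_derivative f' i z) (at (z i))"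
    and c: "\<And>i. i < n \<Longrightarrow> continuous_map (subtopology (Euclidean_space n) S) euclideanreal (f' i)"
    and \<gamma>: "\<And>i. i < n \<Longrightarrow> ((\<lambda>t. \<gamma> t i) has_real_derivative \<gamma>' i) (at t0)"
    and top: "\<forall>\<^sub>F t in at t0. \<gamma> t \<in> topspace (Euclidean_space n)"
  shows "((\<lambda>t. f (\<gamma> t)) has_real_derivative (\<Sum>i<n. f' i (\<gamma> t0) * \<gamma>' i)) (at t0)"
proof -
  let ?x = "\<gamma> t0"
  let ?q = "\<lambda>i t. (\<gamma> t i - \<gamma> t0 i) / (t - t0)"
  have q: "(?q i \<longlongrightarrow> \<gamma>' i) (at t0)" if "i < n" for i
    using \<gamma>[OF that] by (simp add: has_field_derivative_iff)
  \<comment> \<open>The difference quotients tend to \<open>\<gamma>'\<close>; the summand 1 makes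
    \<open>M\<close> a strict bound for their absolute sum near \<open>t0\<close>, and also makes it
    positive.\<close>
  define M where "M = (\<Sum>i<n. \<bar>\<gamma>' i\<bar>) + 1"
  have M: "M > 0" unfolding M_def by (smt (verit) sum_nonneg abs_ge_zero)
  have qM: "\<forall>\<^sub>F t in at t0. (\<Sum>i<n. \<bar>?q i t\<bar>) < M"
  proof (rule order_tendstoD(2))
    show "((\<lambda>t. \<Sum>i<n. \<bar>?q i t\<bar>) \<longlongrightarrow> (\<Sum>i<n. \<bar>\<gamma>' i\<bar>)) (at t0)"
      by (intro tendsto_sum tendsto_rabs q) auto
  qed (simp add: M_def)
  let ?r = "\<lambda>t. (f (\<gamma> t) - f ?x) / (t - t0) - (\<Sum>i<n. f' i ?x * ?q i t)"
  have r: "(?r \<longlongrightarrow> 0) (at t0)"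
  proof (rule tendstoI)
    fix e :: real assume "e > 0"
    define \<epsilon> where "\<epsilon> = e / M"
    have "\<epsilon> > 0" using \<open>e > 0\<close> M by (simp add: \<epsilon>_def)
    obtain \<delta> where \<delta>: "\<delta> > 0" "\<And>y. y \<in> topspace (Euclidean_space n) \<Longrightarrow> (\<forall>i<n. \<bar>y i - ?x i\<bar> < \<delta>) \<Longrightarrow>
      \<bar>f y - f ?x - (\<Sum>i<n. f' i ?x * (y i - ?x i))\<bar> \<le> \<epsilon> * (\<Sum>i<n. \<bar>y i - ?x i\<bar>)"
      using partial_derivatives_approx[OF S x d c \<open>\<epsilon> > 0\<close>] by blast
    have "\<forall>\<^sub>F t in at t0. \<bar>\<gamma> t i - ?x i\<bar> < \<delta>" if "i < n" for i
    proof -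
      have "isCont (\<lambda>t. \<gamma> t i) t0" using \<gamma>[OF that] by (rule DERIV_isCont)
      then have "((\<lambda>t. \<gamma> t i) \<longlongrightarrow> ?x i) (at t0)" by (simp add: isCont_def)
      from tendstoD[OF this \<delta>(1)] show ?thesis by (simp add: dist_real_def)
    qed
    then have "\<forall>\<^sub>F t in at t0. \<forall>i\<in>{..<n}. \<bar>\<gamma> t i - ?x i\<bar> < \<delta>"
      by (intro eventually_ball_finite) auto
    moreover have "\<forall>\<^sub>F t in at t0. t \<noteq> t0" by (simp add: eventually_at_filter)
    ultimately show "\<forall>\<^sub>F t in at t0. dist (?r t) 0 < e"
      using qM top
    proof eventually_elim
      case (elim t)
      then have b: "\<bar>f (\<gamma> t) - f ?x - (\<Sum>i<n. f' i ?x * (\<gamma> t i - ?x i))\<bar> \<le> \<epsilon> * (\<Sum>i<n. \<bar>\<gamma> t i - ?x i\<bar>)"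
        by (intro \<delta>(2)) auto
      have "\<bar>?r t\<bar> = \<bar>f (\<gamma> t) - f ?x - (\<Sum>i<n. f' i ?x * (\<gamma> t i - ?x i))\<bar> / \<bar>t - t0\<bar>"
        by (simp add: diff_divide_distrib sum_divide_distrib abs_divide[symmetric] right_diff_distrib)
      also have "\<dots> \<le> \<epsilon> * (\<Sum>i<n. \<bar>\<gamma> t i - ?x i\<bar>) / \<bar>t - t0\<bar>"
        using b by (rule divide_right_mono) simp
      also have "\<dots> = \<epsilon> * (\<Sum>i<n. \<bar>?q i t\<bar>)"
      proof -
        have "(\<Sum>i<n. \<bar>?q i t\<bar>) = (\<Sum>i<n. \<bar>\<gamma> t i - ?x i\<bar>) / \<bar>t - t0\<bar>"
          unfolding sum_divide_distrib abs_divide ..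
        then show ?thesis by simp
      qed
      also have "\<dots> < \<epsilon> * M" using elim \<open>\<epsilon> > 0\<close> by simp
      finally show ?case using M by (simp add: \<epsilon>_def)
    qed
  qed
  have "((\<lambda>t. ?r t + (\<Sum>i<n. f' i ?x * ?q i t)) \<longlongrightarrow> 0 + (\<Sum>i<n. f' i ?x * \<gamma>' i)) (at t0)"
    by (intro tendsto_add r tendsto_sum tendsto_mult tendsto_const q) auto
  then show ?thesis by (simp add: has_field_derivative_iff)
qed

text \<open>Each partial derivative of the composite is a sum of products of \<open>f' j\<close>
  after \<open>g\<close> with partial derivatives of \<open>g\<close>; all factors have one order of
  differentiability less, so induction on the order applies.\<close>

lemma C_diff_compose:
  assumes S: "openin (Euclidean_space n) S" and T: "openin (Euclidean_space m) T"
    and g: "g ` S \<subseteq> T" "\<And>j. j < m \<Longrightarrow> C_diff k n S (\<lambda>x. g x j)"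
    and f: "C_diff k m T f"
  shows "C_diff k n S (\<lambda>x. f (g x))"
  using g(2) f
proof (induct k arbitrary: f)
  have cont: "continuous_map (subtopology (Euclidean_space n) S) euclideanreal (\<lambda>x. f (g x))"
    if c: "continuous_map (subtopology (Euclidean_space m) T) euclideanreal f"
      and gc: "\<And>j. j < m \<Longrightarrow> C_diff k n S (\<lambda>x. g x j)" for f k
  proof -
    have Tt: "T \<subseteq> topspace (Euclidean_space m)" by (rule openin_subset[OF T])
    have "continuous_map (subtopology (Euclidean_space n) S) (Euclidean_space m) g"
      unfolding Euclidean_space_def[of m] continuous_map_in_subtopology continuous_map_componentwise
    proof (intro conjI ballI)
      show "continuous_map (subtopology (Euclidean_space n) S) euclideanreal (\<lambda>x. g x j)" for j
      proof (cases "j < m")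
        case True then show ?thesis using C_diff_continuous[OF gc] by blast
      next
        case False
        have "continuous_map (subtopology (Euclidean_space n) S) euclideanreal (\<lambda>x. 0)" by simp
        then show ?thesis
          by (rule continuous_map_eq) (use False g(1) Tt in \<open>force simp: topspace_Euclidean_space\<close>)
      qed
    qed (use g(1) Tt in \<open>auto simp: topspace_Euclidean_space\<close>)
    then have "continuous_map (subtopology (Euclidean_space n) S) (subtopology (Euclidean_space m) T) g"
      using g(1) by (auto simp: continuous_map_in_subtopology)
    from continuous_map_compose[OF this c] show ?thesis by (simp add: o_def)
  qed
  {
    case 0
    then show ?case using cont[of f 0] by simp
  next
    case (Suc k)
    obtain f' where f':
      "\<And>i x. i < m \<Longrightarrow> x \<in> T \<Longrightarrow> ((\<lambda>t. f (x(i := t))) has_real_derivative f' i x) (at (x i))"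
      "\<And>i. i < m \<Longrightarrow> C_diff k m T (f' i)" using C_diff_SucD[OF Suc.prems(2)] by blast
    have "\<forall>j. j < m \<longrightarrow> (\<exists>g'. (\<forall>i x. i < n \<longrightarrow> x \<in> S \<longrightarrow> ((\<lambda>t. g (x(i := t)) j) has_real_derivative g' i x) (at (x i)))
        \<and> (\<forall>i. i < n \<longrightarrow> C_diff k n S (g' i)))"
      by (intro allI impI C_diff_SucD[OF Suc.prems(1)])
    then obtain g' where g':
      "\<And>j i x. j < m \<Longrightarrow> i < n \<Longrightarrow> x \<in> S \<Longrightarrow> ((\<lambda>t. g (x(i := t)) j) has_real_derivative g' j i x) (at (x i))"
      "\<And>j i. j < m \<Longrightarrow> i < n \<Longrightarrow> C_diff k n S (g' j i)" by metis
    show ?case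
    proof (rule C_diff_SucI[where f' = "\<lambda>i x. \<Sum>j<m. f' j (g x) * g' j i x"])
      show "continuous_map (subtopology (Euclidean_space n) S) euclideanreal (\<lambda>x. f (g x))"
        by (rule cont[OF C_diff_continuous[OF Suc.prems(2)] Suc.prems(1)])
      show "((\<lambda>t. f (g (x(i := t)))) has_real_derivative (\<Sum>j<m. f' j (g x) * g' j i x)) (at (x i))"
        if i: "i < n" and x: "x \<in> S" for i x
      proof -
        obtain e where e: "e > 0" "\<And>t. \<bar>t - x i\<bar> < e \<Longrightarrow> x(i := t) \<in> S" using line_in_open[OF S x i] by blast
        have "\<forall>\<^sub>F t in at (x i). g (x(i := t)) \<in> topspace (Euclidean_space m)"
          unfolding eventually_at using e g(1) openin_subset[OF T]
          by (intro exI[of _ e]) (auto simp: dist_real_def)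
        then have "((\<lambda>t. f (g (x(i := t)))) has_real_derivative
            (\<Sum>j<m. f' j (g (x(i := x i))) * g' j i x)) (at (x i))"
          by (intro derivative_along_curve[OF T _ f'(1) C_diff_continuous[OF f'(2)] g'(1)[OF _ i x]])
            (use g(1) x in auto)
        then show ?thesis by simp
      qed
      show "C_diff k n S (\<lambda>x. \<Sum>j<m. f' j (g x) * g' j i x)" if "i < n" for i
        by (rule C_diff_sum[OF S C_diff_mult[OF S Suc.hyps[OF C_diff_mono[OF Suc.prems(1)] f'(2)] g'(2)[OF _ that]]])
    qed
  }
qed

text \<open>The derivatives of \<open>exp (-1/s)\<close> are of the form \<open>p (1/s) * exp (-1/s)\<close> with a polynomial \<open>p\<close>.\<close>

definition flat :: "real poly \<Rightarrow> real \<Rightarrow> real" where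
  "flat p s = (if s > 0 then poly p (inverse s) * exp (- inverse s) else 0)"

text \<open>The extra power of \<open>y\<close> carries the induction: \<open>pCons\<close>
  multiplies the remaining polynomial by \<open>y\<close>, which is absorbed into
  \<open>k\<close>.\<close>

lemma poly_times_exp_tendsto_0: "((\<lambda>y::real. y ^ k * poly p y * exp (- y)) \<longlongrightarrow> 0) at_top"
proof (induct p arbitrary: k)
  case (pCons a p)
  have "((\<lambda>y. a * (y ^ k / exp y) + y ^ Suc k * poly p y * exp (- y)) \<longlongrightarrow> a * 0 + 0) at_top"
    by (intro tendsto_add tendsto_mult tendsto_const tendsto_power_div_exp_0 pCons(2))
  then show ?case by (simp add: algebra_simps exp_minus divide_inverse)
qed simp

text \<open>With y = 1/s, the derivative of p(y) exp(-y) with respect to s is y^2 (p - p')(y)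
  exp(-y), and \<open>[:0, 0, 1:]\<close> is the polynomial y^2. At 0 the right-hand difference
  quotient is y p(y) exp(-y) with y tending to infinity.\<close>

lemma flat_deriv: "(flat p has_real_derivative flat ([:0, 0, 1:] * (p - pderiv p)) s) (at s)"
proof -
  consider "s > 0" | "s < 0" | "s = 0" by linarith
  then show ?thesis
  proof cases
    case 1
    have "((\<lambda>s. poly p (inverse s) * exp (- inverse s)) has_real_derivative
        flat ([:0, 0, 1:] * (p - pderiv p)) s) (at s)"
      using 1 by (auto intro!: derivative_eq_intros poly_DERIV[THEN DERIV_chain2] simp: flat_def algebra_simps power2_eq_square)
    then show ?thesis
      by (rule has_field_derivative_transform_within_open[of _ _ _ "{0<..}"]) (use 1 in \<open>auto simp: flat_def\<close>)
  next
    case 2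
    have "((\<lambda>s. 0) has_real_derivative flat ([:0, 0, 1:] * (p - pderiv p)) s) (at s)"
      using 2 by (simp add: flat_def)
    then show ?thesis
      by (rule has_field_derivative_transform_within_open[of _ _ _ "{..<0}"]) (use 2 in \<open>auto simp: flat_def\<close>)
  next
    case 3
    have "((\<lambda>h. flat p h / h) \<longlongrightarrow> 0) (at_right 0)"
    proof -
      have "((\<lambda>h. inverse h ^ 1 * poly p (inverse h) * exp (- inverse h)) \<longlongrightarrow> 0) (at_right (0::real))"
        using filterlim_compose[OF poly_times_exp_tendsto_0 filterlim_inverse_at_top_right] .
      then show ?thesis
        by (rule Lim_transform_eventually)
          (auto simp: flat_def divide_inverse eventually_at_right_field intro!: exI[of _ 1])
    qed
    moreover have "((\<lambda>h. flat p h / h) \<longlongrightarrow> 0) (at_left 0)"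
      by (rule Lim_transform_eventually[OF tendsto_const])
        (auto simp: flat_def eventually_at_left_field intro!: exI[of _ "-1"])
    ultimately have "((\<lambda>h. flat p h / h) \<longlongrightarrow> 0) (at 0)" by (simp add: filterlim_at_split)
    then show ?thesis using 3 by (simp add: has_field_derivative_iff flat_def)
  qed
qed

lemma C_diff_flat: "openin (Euclidean_space n) S \<Longrightarrow> C_diff k n S f \<Longrightarrow> C_diff k n S (\<lambda>x. flat p (f x))"
  by (rule C_diff_outer[where F = "range flat" and A = UNIV]) (auto intro: flat_deriv)

text \<open>For \<open>c < d\<close>, a smooth cut-off function: 1 up to \<open>c\<close>, 0 from
  \<open>d\<close> on, and between 0 and 1 throughout.\<close>

definition smooth_step :: "real \<Rightarrow> real \<Rightarrow> real \<Rightarrow> real" where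
  "smooth_step c d s = flat 1 (d - s) * inverse (flat 1 (d - s) + flat 1 (s - c))"

lemma flat_1_nonneg: "flat 1 s \<ge> 0" and flat_1_pos: "s > 0 \<Longrightarrow> flat 1 s > 0"
  and flat_1_zero: "s \<le> 0 \<Longrightarrow> flat 1 s = 0"
  by (auto simp: flat_def)

lemma smooth_step_denom: "c < d \<Longrightarrow> flat 1 (d - s) + flat 1 (s - c) > 0"
  using flat_1_nonneg[of "d - s"] flat_1_nonneg[of "s - c"] flat_1_pos[of "d - s"] flat_1_pos[of "s - c"]
  by (cases "s < d") auto

lemma smooth_step_eq_1: "c < d \<Longrightarrow> s \<le> c \<Longrightarrow> smooth_step c d s = 1"
  using flat_1_pos[of "d - s"] by (simp add: smooth_step_def flat_1_zero)

lemma smooth_step_eq_0: "d \<le> s \<Longrightarrow> smooth_step c d s = 0"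
  by (simp add: smooth_step_def flat_1_zero)

lemma smooth_step_range: "c < d \<Longrightarrow> 0 \<le> smooth_step c d s" "c < d \<Longrightarrow> smooth_step c d s \<le> 1"
  using smooth_step_denom[of c d s] flat_1_nonneg[of "d - s"] flat_1_nonneg[of "s - c"]
  by (auto simp: smooth_step_def divide_inverse[symmetric])

lemma C_diff_smooth_step:
  assumes "openin (Euclidean_space n) S" "C_diff k n S f" "c < d"
  shows "C_diff k n S (\<lambda>x. smooth_step c d (f x))"
  unfolding smooth_step_def
  using smooth_step_denom[OF assms(3)]
  by (intro C_diff_mult C_diff_inverse C_diff_add C_diff_flat C_diff_diff C_diff_const assms(1,2)) (metis less_irrefl)

section \<open>Charts and cartesian spaces\<close>

lemma smooth_on_cong:
  "openin (Euclidean_space n) S \<Longrightarrow> smooth_on n S m f \<Longrightarrow> (\<And>x. x \<in> S \<Longrightarrow> f x = g x) \<Longrightarrow> smooth_on n S m g"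
  unfolding smooth_on_def by (metis (no_types, lifting) C_diff_cong image_cong)

lemma smooth_on_subset: "smooth_on n S m f \<Longrightarrow> T \<subseteq> S \<Longrightarrow> smooth_on n T m f"
  unfolding smooth_on_def by (meson C_diff_subset image_mono order_trans)

lemma smooth_on_id: "openin (Euclidean_space n) S \<Longrightarrow> smooth_on n S n (\<lambda>x. x)"
  unfolding smooth_on_def image_ident by (intro conjI allI impI C_diff_coord openin_subset)

lemma image_Int_Collect: "(\<And>x. x \<in> A \<Longrightarrow> Q (f x) \<longleftrightarrow> x \<in> B) \<Longrightarrow> f ` (A \<inter> B) = {y \<in> f ` A. Q y}"
  by auto

lemma smooth_on_preimage:
  assumes S: "openin (Euclidean_space n) S" and T: "openin (Euclidean_space m) T" and g: "smooth_on n S m g"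
  shows "openin (Euclidean_space n) {x \<in> S. g x \<in> T}"
proof -
  have gS: "g ` S \<subseteq> topspace (Euclidean_space m)" and gc: "\<And>j k. j < m \<Longrightarrow> C_diff k n S (\<lambda>x. g x j)"
    using g by (auto simp: smooth_on_def)
  have "continuous_map (subtopology (Euclidean_space n) S) (Euclidean_space m) g"
    unfolding Euclidean_space_def[of m] continuous_map_in_subtopology continuous_map_componentwise
  proof (intro conjI ballI)
    show "continuous_map (subtopology (Euclidean_space n) S) euclideanreal (\<lambda>x. g x j)" for j
    proof (cases "j < m")
      case True then show ?thesis using C_diff_continuous[OF gc] by blast
    next
      case False
      have "continuous_map (subtopology (Euclidean_space n) S) euclideanreal (\<lambda>x. 0)" by simp
      then show ?thesis
        by (rule continuous_map_eq) (use False gS in \<open>force simp: topspace_Euclidean_space\<close>)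
    qed
  qed (use gS in \<open>auto simp: topspace_Euclidean_space\<close>)
  then have "openin (subtopology (Euclidean_space n) S) {x \<in> topspace (subtopology (Euclidean_space n) S). g x \<in> T}"
    using T by (rule openin_continuous_map_preimage)
  then have "openin (Euclidean_space n) {x \<in> topspace (subtopology (Euclidean_space n) S). g x \<in> T}"
    using openin_trans_full[OF _ S] by blast
  moreover have "{x \<in> topspace (subtopology (Euclidean_space n) S). g x \<in> T} = {x \<in> S. g x \<in> T}"
    using openin_subset[OF S] by auto
  ultimately show ?thesis by simp
qed

lemma smooth_on_compose:
  assumes "openin (Euclidean_space n) S" "openin (Euclidean_space m) T"
    and "smooth_on n S m g" "smooth_on m T l f" "g ` S \<subseteq> T"
  shows "smooth_on n S l (\<lambda>x. f (g x))"
  unfolding smooth_on_def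
proof (intro conjI allI impI)
  show "(\<lambda>x. f (g x)) ` S \<subseteq> topspace (Euclidean_space l)"
    using assms(4,5) by (auto simp: smooth_on_def image_subset_iff)
  show "C_diff k n S (\<lambda>x. f (g x) j)" if "j < l" for j k
    by (rule C_diff_compose[OF assms(1,2,5), of k "\<lambda>y. f y j"])
      (use assms(3,4) that in \<open>auto simp: smooth_on_def\<close>)
qed

lemma is_chartD:
  assumes "is_chart n M c"
  shows "fst c \<subseteq> M" "inj_on (snd c) (fst c)" "openin (Euclidean_space n) (snd c ` fst c)"
  using assms by (auto simp: is_chart_def)

lemma compatibleD:
  assumes "compatible n c d"
  shows "openin (Euclidean_space n) (snd c ` (fst c \<inter> fst d))"
    and "openin (Euclidean_space n) (snd d ` (fst c \<inter> fst d))"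
    and "smooth_on n (snd c ` (fst c \<inter> fst d)) n (transition c d)"
    and "smooth_on n (snd d ` (fst c \<inter> fst d)) n (transition d c)"
  using assms by (auto simp: compatible_def Let_def)

lemma compatibleI:
  assumes "openin (Euclidean_space n) (snd c ` (fst c \<inter> fst d))"
    and "openin (Euclidean_space n) (snd d ` (fst c \<inter> fst d))"
    and "smooth_on n (snd c ` (fst c \<inter> fst d)) n (transition c d)"
    and "smooth_on n (snd d ` (fst c \<inter> fst d)) n (transition d c)"
  shows "compatible n c d"
  using assms by (auto simp: compatible_def Let_def)

lemma compatible_sym: "compatible n c d \<Longrightarrow> compatible n d c"
  by (auto simp: compatible_def Let_def Int_commute)

lemma transition_chart: "inj_on (snd c) (fst c) \<Longrightarrow> x \<in> fst c \<Longrightarrow> transition c d (snd c x) = snd d x"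
  by (simp add: transition_def)

lemma compatible_refl: "is_chart n M c \<Longrightarrow> compatible n c c"
proof -
  assume c: "is_chart n M c"
  note cD = is_chartD[OF c]
  have "smooth_on n (snd c ` fst c) n (transition c c)"
    by (rule smooth_on_cong[OF cD(3) smooth_on_id[OF cD(3)]]) (auto simp: transition_chart cD(2))
  then show ?thesis using cD(3) by (intro compatibleI) auto
qed

text \<open>The transition from \<open>c\<close> to \<open>d\<close> is factored through
  \<open>e\<close>. This is possible on the entire overlap of \<open>c\<close> and \<open>d\<close>
  because the domain of \<open>c\<close> lies in that of \<open>e\<close>; without such an inclusion
  compatibility is not transitive.\<close>

lemma compatible_trans:
  assumes c: "is_chart n M c" and d: "is_chart n M d" and e: "is_chart n M e"
    and sub: "fst c \<subseteq> fst e" and ce: "compatible n c e" and ed: "compatible n e d"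
  shows "compatible n c d"
proof -
  note cD = is_chartD[OF c] and dD = is_chartD[OF d] and eD = is_chartD[OF e]
  note tr = transition_chart[OF cD(2)] transition_chart[OF dD(2)] transition_chart[OF eD(2)]
  have int: "fst c \<inter> fst e = fst c" using sub by blast
  note ceD = compatibleD[OF ce, unfolded int] and edD = compatibleD[OF ed]
  have mem: "snd e x \<in> snd e ` A \<longleftrightarrow> x \<in> A" if "x \<in> fst e" "A \<subseteq> fst e" for x A
    using inj_on_image_mem_iff[OF eD(2) that] .
  show ?thesis
  proof (rule compatibleI)
    have "snd c ` (fst c \<inter> fst d) = {y \<in> snd c ` fst c. transition c e y \<in> snd e ` (fst e \<inter> fst d)}"
    proof (rule image_Int_Collect)
      fix x assume x: "x \<in> fst c"
      then have "x \<in> fst e" using sub by blast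
      then show "transition c e (snd c x) \<in> snd e ` (fst e \<inter> fst d) \<longleftrightarrow> x \<in> fst d"
        unfolding tr(1)[OF x] using mem[of x "fst e \<inter> fst d"] by simp
    qed
    also have "openin (Euclidean_space n) \<dots>" by (rule smooth_on_preimage[OF ceD(1) edD(1) ceD(3)])
    finally show 1: "openin (Euclidean_space n) (snd c ` (fst c \<inter> fst d))" .
    have "fst c \<inter> fst d = (fst e \<inter> fst d) \<inter> fst c" using sub by blast
    also have "snd d ` \<dots> = {y \<in> snd d ` (fst e \<inter> fst d). transition d e y \<in> snd e ` fst c}"
    proof (rule image_Int_Collect)
      fix x assume x: "x \<in> fst e \<inter> fst d"
      then show "transition d e (snd d x) \<in> snd e ` fst c \<longleftrightarrow> x \<in> fst c"
        using tr(2)[of x e] mem[OF _ sub, of x] by simp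
    qed
    also have "openin (Euclidean_space n) \<dots>" by (rule smooth_on_preimage[OF edD(2) ceD(2) edD(4)])
    finally show 2: "openin (Euclidean_space n) (snd d ` (fst c \<inter> fst d))" .
    have "smooth_on n (snd c ` (fst c \<inter> fst d)) n (\<lambda>y. transition e d (transition c e y))"
      by (rule smooth_on_compose[OF 1 edD(1) smooth_on_subset[OF ceD(3)] edD(3)]) (use sub in \<open>auto simp: tr\<close>)
    then show "smooth_on n (snd c ` (fst c \<inter> fst d)) n (transition c d)"
      by (rule smooth_on_cong[OF 1]) (use sub in \<open>auto simp: tr\<close>)
    have "smooth_on n (snd d ` (fst c \<inter> fst d)) n (\<lambda>y. transition e c (transition d e y))"
      by (rule smooth_on_compose[OF 2 ceD(2) smooth_on_subset[OF edD(4)] ceD(4)]) (use sub in \<open>auto simp: tr\<close>)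
    then show "smooth_on n (snd d ` (fst c \<inter> fst d)) n (transition d c)"
      by (rule smooth_on_cong[OF 2]) (use sub in \<open>auto simp: tr\<close>)
  qed
qed

lemma smooth_structureD:
  assumes "smooth_structure M"
  shows "c \<in> atlas M \<Longrightarrow> is_chart (mdim M) (points M) c"
    and "c \<in> atlas M \<Longrightarrow> d \<in> atlas M \<Longrightarrow> compatible (mdim M) c d"
    and "(\<Union>c\<in>atlas M. fst c) = points M"
    and "is_chart (mdim M) (points M) c \<Longrightarrow> (\<And>d. d \<in> atlas M \<Longrightarrow> compatible (mdim M) c d) \<Longrightarrow> c \<in> atlas M"
  using assms unfolding smooth_structure_def by blast+

text \<open>By \<open>charted_Cart\<close> and \<open>Cart_charted\<close>, such a global chart onto
  R^n exists exactly for cartesian spaces, and smoothness can be computed in a single coordinate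
  system.\<close>

definition charted :: "manifold \<Rightarrow> (point \<Rightarrow> point) \<Rightarrow> bool" where
  "charted M \<phi> \<longleftrightarrow> smooth_structure M \<and> (points M, \<phi>) \<in> atlas M \<and>
     \<phi> ` points M = topspace (Euclidean_space (mdim M))"

lemma chartedD:
  assumes "charted M \<phi>"
  shows "smooth_structure M" "(points M, \<phi>) \<in> atlas M" "\<phi> ` points M = topspace (Euclidean_space (mdim M))"
    "inj_on \<phi> (points M)"
proof -
  show s: "smooth_structure M" "(points M, \<phi>) \<in> atlas M" "\<phi> ` points M = topspace (Euclidean_space (mdim M))"
    using assms by (simp_all add: charted_def)
  show "inj_on \<phi> (points M)"
    using is_chartD(2)[OF smooth_structureD(1)[OF s(1,2)]] by simp
qed

lemma charted_transitions:
  assumes \<phi>: "charted M \<phi>" and c: "c \<in> atlas M"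
  shows "openin (Euclidean_space (mdim M)) (\<phi> ` fst c)"
    and "smooth_on (mdim M) (snd c ` fst c) (mdim M) (\<lambda>y. \<phi> (inv_into (fst c) (snd c) y))"
    and "smooth_on (mdim M) (\<phi> ` fst c) (mdim M) (\<lambda>y. snd c (inv_into (points M) \<phi> y))"
    and "fst c \<subseteq> points M" "inj_on (snd c) (fst c)" "openin (Euclidean_space (mdim M)) (snd c ` fst c)"
proof -
  note S = smooth_structureD[OF chartedD(1)[OF \<phi>]]
  note cD = is_chartD[OF S(1)[OF c]]
  show "fst c \<subseteq> points M" "inj_on (snd c) (fst c)" "openin (Euclidean_space (mdim M)) (snd c ` fst c)" by (fact cD)+
  have int: "fst c \<inter> points M = fst c" using cD(1) by blast
  note K = compatibleD[OF S(2)[OF c chartedD(2)[OF \<phi>]], unfolded fst_conv snd_conv int transition_def o_def]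
  show "openin (Euclidean_space (mdim M)) (\<phi> ` fst c)"
    "smooth_on (mdim M) (snd c ` fst c) (mdim M) (\<lambda>y. \<phi> (inv_into (fst c) (snd c) y))"
    "smooth_on (mdim M) (\<phi> ` fst c) (mdim M) (\<lambda>y. snd c (inv_into (points M) \<phi> y))"
    using K by auto
qed

text \<open>An expression in arbitrary charts is the expression in the global charts, preceded and
  followed by transition maps.\<close>

lemma smooth_map_iff:
  assumes \<phi>: "charted M \<phi>" and \<psi>: "charted N \<psi>"
  shows "smooth_map M N f \<longleftrightarrow> f \<in> points M \<rightarrow>\<^sub>E points N \<and>
    smooth_on (mdim M) (topspace (Euclidean_space (mdim M))) (mdim N) (\<lambda>y. \<psi> (f (inv_into (points M) \<phi> y)))"
    (is "?L \<longleftrightarrow> ?R")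
proof
  note P = chartedD[OF \<phi>] and Q = chartedD[OF \<psi>]
  {
    assume L: ?L
    then have f: "f \<in> points M \<rightarrow>\<^sub>E points N" by (simp add: smooth_map_def)
    then have "{x \<in> points M. f x \<in> points N} = points M" by auto
    then show ?R
      using L f P(2,3) Q(2) unfolding smooth_map_def Let_def o_def by fastforce
  }
  assume R: ?R
  then have f: "f \<in> points M \<rightarrow>\<^sub>E points N" by simp
  let ?F = "\<lambda>y. \<psi> (f (inv_into (points M) \<phi> y))"
  have F: "smooth_on (mdim M) (topspace (Euclidean_space (mdim M))) (mdim N) ?F" using R by simp
  show ?L
    unfolding smooth_map_def Let_def
  proof (intro conjI ballI f)
    fix c d assume c: "c \<in> atlas M" and d: "d \<in> atlas N"
    note C = charted_transitions[OF \<phi> c] and D = charted_transitions[OF \<psi> d]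
    let ?W = "{x \<in> fst c. f x \<in> fst d}"
    let ?a = "\<lambda>y. \<phi> (inv_into (fst c) (snd c) y)"
    have aS: "?a ` (snd c ` fst c) \<subseteq> topspace (Euclidean_space (mdim M))"
      by (auto simp: P(3)[symmetric] C(5) intro!: imageI subsetD[OF C(4)])
    have ev: "\<psi> (f (inv_into (points M) \<phi> (\<phi> (inv_into (fst c) (snd c) (snd c x))))) = \<psi> (f x)" if "x \<in> fst c" for x
      using that C(4,5) P(4) by (simp add: subsetD)
    have fc: "f x \<in> points N" if "x \<in> fst c" for x using that C(4) f by auto
    have Fa: "smooth_on (mdim M) (snd c ` fst c) (mdim N) (\<lambda>y. ?F (?a y))"
      by (rule smooth_on_compose[OF C(6) _ C(2) F aS]) simp
    have "?W = fst c \<inter> {x. f x \<in> fst d}" by blast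
    also have "snd c ` \<dots> = {y \<in> snd c ` fst c. ?F (?a y) \<in> \<psi> ` fst d}"
      by (rule image_Int_Collect) (use inj_on_image_mem_iff[OF Q(4) _ D(4)] fc ev in simp)
    finally have W: "snd c ` ?W = {y \<in> snd c ` fst c. ?F (?a y) \<in> \<psi> ` fst d}" .
    show o: "openin (Euclidean_space (mdim M)) (snd c ` ?W)"
      unfolding W by (rule smooth_on_preimage[OF C(6) D(1) Fa])
    have "smooth_on (mdim M) (snd c ` ?W) (mdim N) (\<lambda>y. snd d (inv_into (points N) \<psi> (?F (?a y))))"
      by (rule smooth_on_compose[OF o D(1) smooth_on_subset[OF Fa] D(3)]) (use W in auto)
    then show "smooth_on (mdim M) (snd c ` ?W) (mdim N) (snd d \<circ> f \<circ> inv_into (fst c) (snd c))"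
      by (rule smooth_on_cong[OF o]) (use ev fc C(5) Q(4) in auto)
  qed
qed

lemma mdim_Rn [simp]: "mdim (Rn n) = n" and points_Rn [simp]: "points (Rn n) = topspace (Euclidean_space n)"
  by (simp_all add: Rn_def)

lemma charted_Rn: "charted (Rn n) (\<lambda>x. x)"
proof -
  let ?I = "(topspace (Euclidean_space n), id :: point \<Rightarrow> point)"
  have I: "is_chart n (topspace (Euclidean_space n)) ?I" by (simp add: is_chart_def)
  have at: "c \<in> atlas (Rn n) \<longleftrightarrow> is_chart n (topspace (Euclidean_space n)) c \<and> compatible n c ?I" for c
    by (simp add: Rn_def)
  have I': "?I \<in> atlas (Rn n)" unfolding at using I compatible_refl[OF I] by blast
  have "smooth_structure (Rn n)"
    unfolding smooth_structure_def mdim_Rn points_Rn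
  proof (intro conjI ballI allI impI)
    show "is_chart n (topspace (Euclidean_space n)) c" if "c \<in> atlas (Rn n)" for c using that at by blast
    show "compatible n c d" if "c \<in> atlas (Rn n)" "d \<in> atlas (Rn n)" for c d
    proof -
      have c: "is_chart n (topspace (Euclidean_space n)) c" "compatible n c ?I"
        and d: "is_chart n (topspace (Euclidean_space n)) d" "compatible n d ?I" using that unfolding at by blast+
      show ?thesis
        by (rule compatible_trans[OF c(1) d(1) I _ c(2) compatible_sym[OF d(2)]]) (use is_chartD(1)[OF c(1)] in simp)
    qed
    show "(\<Union>c\<in>atlas (Rn n). fst c) = topspace (Euclidean_space n)"
    proof
      show "(\<Union>c\<in>atlas (Rn n). fst c) \<subseteq> topspace (Euclidean_space n)"
      proof (rule UN_least)
        fix c assume "c \<in> atlas (Rn n)"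
        then show "fst c \<subseteq> topspace (Euclidean_space n)" unfolding at by (blast dest: is_chartD(1))
      qed
      show "topspace (Euclidean_space n) \<subseteq> (\<Union>c\<in>atlas (Rn n). fst c)" using I' by force
    qed
    show "c \<in> atlas (Rn n)"
      if "is_chart n (topspace (Euclidean_space n)) c \<and> (\<forall>d\<in>atlas (Rn n). compatible n c d)" for c
      unfolding at using that I' by blast
  qed
  then show ?thesis using I' by (simp add: charted_def id_def)
qed

lemma charted_Cart:
  assumes \<phi>: "charted M \<phi>" shows "M \<in> Cart"
proof -
  note P = chartedD[OF \<phi>]
  let ?n = "mdim M" and ?f = "restrict \<phi> (points M)"
  let ?E = "topspace (Euclidean_space ?n)"
  have oE: "openin (Euclidean_space ?n) ?E" by simp
  have "smooth_map M (Rn ?n) ?f"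
    unfolding smooth_map_iff[OF \<phi> charted_Rn] mdim_Rn points_Rn
  proof
    show "?f \<in> points M \<rightarrow>\<^sub>E ?E" using P(3) by auto
    show "smooth_on ?n ?E ?n (\<lambda>y. ?f (inv_into (points M) \<phi> y))"
      by (rule smooth_on_cong[OF oE smooth_on_id[OF oE]]) (use P(3) in \<open>auto simp: inv_into_into f_inv_into_f\<close>)
  qed
  moreover have b: "bij_betw ?f (points M) ?E"
    using P(3,4) by (auto simp: bij_betw_def inj_on_def)
  moreover have "smooth_map (Rn ?n) M (restrict (inv_into (points M) ?f) (points (Rn ?n)))"
    unfolding smooth_map_iff[OF charted_Rn \<phi>] mdim_Rn points_Rn
  proof
    show "restrict (inv_into (points M) ?f) ?E \<in> ?E \<rightarrow>\<^sub>E points M"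
      using b by (auto simp: bij_betw_def inv_into_into)
    have "\<phi> (inv_into (points M) ?f y) = y" if "y \<in> ?E" for y
      using b that f_inv_into_f[of y ?f "points M"] inv_into_into[of y ?f "points M"]
      by (auto simp: bij_betw_def)
    moreover have "inv_into ?E (\<lambda>x. x) y = y" if "y \<in> ?E" for y
      using that f_inv_into_f[of y "\<lambda>x. x" ?E] by simp
    ultimately show "smooth_on ?n ?E ?n (\<lambda>y. \<phi> (restrict (inv_into (points M) ?f) ?E (inv_into ?E (\<lambda>x. x) y)))"
      by (intro smooth_on_cong[OF oE smooth_on_id[OF oE]]) auto
  qed
  ultimately show ?thesis
    unfolding Cart_def diffeomorphism_def using P(1) by auto
qed

text \<open>Smoothness of the diffeomorphism and of its inverse says that it is compatible with
  every chart, so it belongs to the maximal atlas itself.\<close>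

lemma Cart_charted:
  assumes M: "M \<in> Cart" obtains \<phi> where "charted M \<phi>"
proof -
  let ?n = "mdim M"
  let ?E = "topspace (Euclidean_space ?n)"
  obtain f where S: "smooth_structure M" and f: "diffeomorphism M (Rn ?n) f"
    using M by (auto simp: Cart_def)
  have b: "bij_betw f (points M) ?E" using f by (simp add: diffeomorphism_def)
  let ?e = "(points M, f)" and ?I = "(?E, \<lambda>x::point. x)"
  have I: "?I \<in> atlas (Rn ?n)" using chartedD(2)[OF charted_Rn, of ?n] by simp
  have e: "is_chart ?n (points M) ?e" using b by (auto simp: is_chart_def bij_betw_def)
  have "compatible ?n ?e c" if c: "c \<in> atlas M" for c
  proof -
    note cD = is_chartD[OF smooth_structureD(1)[OF S c]]
    have int: "points M \<inter> fst c = fst c" using cD(1) by blast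
    have "{x \<in> fst c. f x \<in> ?E} = fst c" using b cD(1) by (auto simp: bij_betw_def)
    then have 1: "smooth_on ?n (snd c ` fst c) ?n (\<lambda>y. f (inv_into (fst c) (snd c) y))"
      using f c I unfolding diffeomorphism_def smooth_map_def Let_def o_def mdim_Rn by fastforce
    let ?g = "restrict (inv_into (points M) f) ?E"
    have g: "smooth_map (Rn ?n) M ?g" using f by (simp add: diffeomorphism_def)
    have W: "{x \<in> ?E. ?g x \<in> fst c} = f ` fst c"
    proof
      show "{x \<in> ?E. ?g x \<in> fst c} \<subseteq> f ` fst c"
        using b f_inv_into_f[of _ f "points M"] by (force simp: bij_betw_def image_iff)
      show "f ` fst c \<subseteq> {x \<in> ?E. ?g x \<in> fst c}"
        using b cD(1) by (auto simp: bij_betw_def subsetD)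
    qed
    have "openin (Euclidean_space ?n) ((\<lambda>x. x) ` {x \<in> ?E. ?g x \<in> fst c}) \<and>
        smooth_on ?n ((\<lambda>x. x) ` {x \<in> ?E. ?g x \<in> fst c}) ?n (snd c \<circ> ?g \<circ> inv_into ?E (\<lambda>x. x))"
      using bspec[OF bspec[OF conjunct2[OF g[unfolded smooth_map_def Let_def mdim_Rn]] I] c]
      by (simp only: fst_conv snd_conv)
    then have 2: "openin (Euclidean_space ?n) (f ` fst c)"
      and 3: "smooth_on ?n (f ` fst c) ?n (snd c \<circ> ?g \<circ> inv_into ?E (\<lambda>x. x))"
      unfolding W by simp_all
    have "inv_into ?E (\<lambda>x. x) y = y" if "y \<in> ?E" for y
      using that f_inv_into_f[of y "\<lambda>x. x" ?E] by simp
    note inv = this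
    have 4: "smooth_on ?n (f ` fst c) ?n (\<lambda>y. snd c (inv_into (points M) f y))"
    proof (intro smooth_on_cong[OF 2 3])
      fix y assume y: "y \<in> f ` fst c"
      have yE: "y \<in> ?E" using y b cD(1) by (auto simp: bij_betw_def)
      then show "(snd c \<circ> ?g \<circ> inv_into ?E (\<lambda>x. x)) y = snd c (inv_into (points M) f y)"
        using inv[OF yE] by simp
    qed
    show ?thesis
      by (rule compatibleI) (use 1 2 4 cD(3) in \<open>simp_all add: int transition_def o_def\<close>)
  qed
  then have "?e \<in> atlas M" by (rule smooth_structureD(4)[OF S e])
  then have "charted M f" using S b by (simp add: charted_def bij_betw_def)
  then show ?thesis by (rule that)
qed

section \<open>Open subsets and good covers\<close>

lemma open_sub_simps [simp]: "points (open_sub M S) = S" "mdim (open_sub M S) = mdim M"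
  "atlas (open_sub M S) = {c \<in> atlas M. fst c \<subseteq> S}"
  by (simp_all add: open_sub_def)

context
  fixes M \<phi> S
  assumes \<phi>: "charted M \<phi>" and S: "S \<subseteq> points M" and oS: "openin (Euclidean_space (mdim M)) (\<phi> ` S)"
begin

lemma restricted_chart:
  assumes c: "c \<in> atlas M" shows "(fst c \<inter> S, snd c) \<in> atlas M"
proof -
  note P = chartedD[OF \<phi>]
  note C = charted_transitions[OF \<phi> c]
  note SS = smooth_structureD[OF P(1)]
  let ?c = "(fst c \<inter> S, snd c)"
  have "snd c ` (fst c \<inter> S) = {y \<in> snd c ` fst c. \<phi> (inv_into (fst c) (snd c) y) \<in> \<phi> ` S}"
    by (rule image_Int_Collect) (use inj_on_image_mem_iff[OF P(4) _ S] C(4,5) in \<open>simp add: subsetD\<close>)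
  then have o: "openin (Euclidean_space (mdim M)) (snd c ` (fst c \<inter> S))"
    using smooth_on_preimage[OF C(6) oS C(2)] by simp
  have ch: "is_chart (mdim M) (points M) ?c"
    using C(4,5) o by (auto simp: is_chart_def intro: inj_on_subset)
  have inv: "inv_into (fst c \<inter> S) (snd c) (snd c x) = x" if "x \<in> fst c \<inter> S" for x
    using that inv_into_f_f[OF inj_on_subset[OF C(5)], of "fst c \<inter> S" x] by blast
  have "compatible (mdim M) ?c c"
  proof (rule compatibleI)
    have int: "fst ?c \<inter> fst c = fst c \<inter> S" by auto
    show "openin (Euclidean_space (mdim M)) (snd ?c ` (fst ?c \<inter> fst c))"
      "openin (Euclidean_space (mdim M)) (snd c ` (fst ?c \<inter> fst c))" unfolding int using o by simp_all
    show "smooth_on (mdim M) (snd ?c ` (fst ?c \<inter> fst c)) (mdim M) (transition ?c c)"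
      "smooth_on (mdim M) (snd c ` (fst ?c \<inter> fst c)) (mdim M) (transition c ?c)"
      unfolding int using o inv C(5)
      by (auto intro!: smooth_on_cong[OF _ smooth_on_id] simp: transition_def)
  qed
  then have "compatible (mdim M) ?c d" if "d \<in> atlas M" for d
    by (rule compatible_trans[OF ch SS(1)[OF that] SS(1)[OF c] _ _ SS(2)[OF c that], rotated]) auto
  then show ?thesis by (rule SS(4)[OF ch])
qed

lemma open_subsetI: "open_subset M S"
  unfolding open_subset_def
proof (intro conjI ballI S)
  fix c assume "c \<in> atlas M"
  then show "openin (Euclidean_space (mdim M)) (snd c ` (fst c \<inter> S))"
    using is_chartD(3)[OF smooth_structureD(1)[OF chartedD(1)[OF \<phi>] restricted_chart]] by simp
qed

lemma chart_on_open_subset: "(S, \<phi>) \<in> atlas M"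
  using restricted_chart[OF chartedD(2)[OF \<phi>]] S by (simp add: Int_absorb1)

lemma smooth_structure_open_sub: "smooth_structure (open_sub M S)"
proof -
  note SS = smooth_structureD[OF chartedD(1)[OF \<phi>]]
  have ch: "is_chart (mdim M) (points M) c \<longleftrightarrow> is_chart (mdim M) S c" if "fst c \<subseteq> S" for c
    using that S by (auto simp: is_chart_def)
  show ?thesis
    unfolding smooth_structure_def open_sub_simps
  proof (intro conjI ballI allI impI)
    show "is_chart (mdim M) S c" if "c \<in> {c \<in> atlas M. fst c \<subseteq> S}" for c
      using that SS(1) ch by blast
    show "compatible (mdim M) c d" if "c \<in> {c \<in> atlas M. fst c \<subseteq> S}" "d \<in> {c \<in> atlas M. fst c \<subseteq> S}" for c d
      using that SS(2) by blast
    show "(\<Union>c\<in>{c \<in> atlas M. fst c \<subseteq> S}. fst c) = S" using chart_on_open_subset by force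
    fix c assume c: "is_chart (mdim M) S c \<and> (\<forall>d\<in>{c \<in> atlas M. fst c \<subseteq> S}. compatible (mdim M) c d)"
    have cS: "fst c \<subseteq> S" using c is_chartD(1) by blast
    have c': "is_chart (mdim M) (points M) c" using c ch[OF cS] by blast
    have "compatible (mdim M) c d" if d: "d \<in> atlas M" for d
      by (rule compatible_trans[OF c' SS(1)[OF d] SS(1)[OF chart_on_open_subset] _ _ SS(2)[OF chart_on_open_subset d]])
        (use c cS chart_on_open_subset in auto)
    then show "c \<in> {c \<in> atlas M. fst c \<subseteq> S}" using SS(4)[OF c'] cS by blast
  qed
qed

text \<open>The way to show that an open subset is cartesian: smooth mutually inverse
  \<open>\<beta>\<close> and \<open>\<gamma>\<close> identify its image in R^n with all of R^n.
  Compatibility of the new chart is checked against \<open>(S, \<phi>)\<close> and passes from there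
  to the atlas.\<close>

lemma charted_open_sub:
  assumes \<beta>: "smooth_on (mdim M) (\<phi> ` S) (mdim M) \<beta>"
    and \<gamma>: "smooth_on (mdim M) (topspace (Euclidean_space (mdim M))) (mdim M) \<gamma>"
    and \<gamma>S: "\<gamma> ` topspace (Euclidean_space (mdim M)) \<subseteq> \<phi> ` S"
    and \<beta>\<gamma>: "\<And>y. y \<in> topspace (Euclidean_space (mdim M)) \<Longrightarrow> \<beta> (\<gamma> y) = y"
    and \<gamma>\<beta>: "\<And>y. y \<in> \<phi> ` S \<Longrightarrow> \<gamma> (\<beta> y) = y"
  shows "charted (open_sub M S) (\<beta> \<circ> \<phi>)"
proof -
  note P = chartedD[OF \<phi>]
  note SS = smooth_structureD[OF P(1)]
  let ?E = "topspace (Euclidean_space (mdim M))"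
  have \<beta>S: "\<beta> ` \<phi> ` S \<subseteq> ?E" using \<beta> by (simp add: smooth_on_def)
  have im: "(\<beta> \<circ> \<phi>) ` S = ?E"
    unfolding image_comp[symmetric] using \<beta>S \<gamma>S \<beta>\<gamma> by (metis image_subset_iff subsetI subset_antisym imageI)
  have inj\<phi>: "inj_on \<phi> S" using P(4) S inj_on_subset by blast
  have inj: "inj_on (\<beta> \<circ> \<phi>) S"
    by (rule comp_inj_on[OF inj\<phi>]) (metis \<gamma>\<beta> inj_on_inverseI)
  let ?c = "(S, \<beta> \<circ> \<phi>)" and ?e = "(S, \<phi>)"
  have c: "is_chart (mdim M) (points M) ?c"
    using S inj im by (simp add: is_chart_def)
  have "compatible (mdim M) ?c ?e"
  proof (rule compatibleI; simp only: fst_conv snd_conv Int_absorb im oS openin_topspace)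
    have "\<phi> (inv_into S (\<beta> \<circ> \<phi>) y) = \<gamma> y" if y: "y \<in> ?E" for y
    proof -
      obtain x where "x \<in> S" "y = \<beta> (\<phi> x)" using y im by auto
      then show ?thesis using inv_into_f_f[OF inj, of x] \<gamma>\<beta> by simp
    qed
    then show "smooth_on (mdim M) ?E (mdim M) (transition ?c ?e)"
      by (intro smooth_on_cong[OF _ \<gamma>]) (auto simp: transition_def)
    show "smooth_on (mdim M) (\<phi> ` S) (mdim M) (transition ?e ?c)"
      by (rule smooth_on_cong[OF oS \<beta>]) (use inj\<phi> in \<open>auto simp: transition_def\<close>)
  qed
  then have "compatible (mdim M) ?c d" if "d \<in> atlas M" for d
    by (rule compatible_trans[OF c SS(1)[OF that] SS(1)[OF chart_on_open_subset] _ _ SS(2)[OF chart_on_open_subset that], rotated])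
      simp
  then have "?c \<in> atlas M" by (rule SS(4)[OF c])
  then show ?thesis
    using smooth_structure_open_sub im by (simp add: charted_def)
qed

end

section \<open>Cartesian open subsets and boxes\<close>

definition opens :: "manifold \<Rightarrow> point set set" where
  "opens U = {S. open_subset U S \<and> open_sub U S \<in> Cart}"

lemma opens_subset: "S \<in> opens U \<Longrightarrow> S \<subseteq> points U"
  by (simp add: opens_def open_subset_def)

lemma opens_Cart: "S \<in> opens U \<Longrightarrow> open_sub U S \<in> Cart"
  by (simp add: opens_def)

lemma open_subset_charted:
  "charted U \<phi> \<Longrightarrow> open_subset U S \<Longrightarrow> openin (Euclidean_space (mdim U)) (\<phi> ` S)"
  unfolding open_subset_def using chartedD(2)[of U \<phi>] by (metis fst_conv snd_conv inf.absorb2)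

definition open_box :: "nat \<Rightarrow> (nat \<Rightarrow> real) \<Rightarrow> (nat \<Rightarrow> real) \<Rightarrow> point set" where
  "open_box n l u = {y \<in> topspace (Euclidean_space n). \<forall>i<n. l i < y i \<and> y i < u i}"

lemma openin_box: "openin (Euclidean_space n) (open_box n l u)"
  unfolding openin_Euclidean_space_iff
proof (intro conjI ballI)
  fix x assume x: "x \<in> open_box n l u"
  define e where "e = Min (insert 1 ((\<lambda>i. min (x i - l i) (u i - x i)) ` {..<n}))"
  have "e > 0" using x by (auto simp: e_def open_box_def)
  moreover have "e \<le> min (x i - l i) (u i - x i)" if "i < n" for i
    unfolding e_def using that by (intro Min_le) auto
  ultimately show "\<exists>e>0. \<forall>y\<in>topspace (Euclidean_space n). (\<forall>i<n. \<bar>y i - x i\<bar> < e) \<longrightarrow> y \<in> open_box n l u"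
    by (intro exI[of _ e]) (fastforce simp: open_box_def)
qed (auto simp: open_box_def)

text \<open>Coordinatewise, an open interval is identified with the real line by the logarithm of (y
  - l)/(u - y), whose inverse is the rescaled logistic function.\<close>

lemma charted_box:
  assumes \<phi>: "charted U \<phi>" and S: "S \<subseteq> points U" "\<phi> ` S = open_box (mdim U) l u" and lu: "\<And>i. i < mdim U \<Longrightarrow> l i < u i"
  shows "S \<in> opens U"
proof -
  let ?n = "mdim U"
  let ?E = "topspace (Euclidean_space ?n)"
  define \<beta> where "\<beta> y = (\<lambda>i. if i < ?n then ln (y i - l i) - ln (u i - y i) else 0)" for y :: point
  define \<gamma> where "\<gamma> z = (\<lambda>i. if i < ?n then l i + (u i - l i) * inverse (1 + exp (0 - z i)) else 0)" for z :: point
  have o: "openin (Euclidean_space ?n) (\<phi> ` S)" unfolding S(2) by (rule openin_box)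
  have pos: "1 + exp (0 - s) > 0" for s :: real by (simp add: add_pos_pos)
  have "charted (open_sub U S) (\<beta> \<circ> \<phi>)"
  proof (rule charted_open_sub[OF \<phi> S(1) o, unfolded S(2)])
    show "smooth_on ?n (open_box ?n l u) ?n \<beta>"
      unfolding smooth_on_def
    proof (intro conjI allI impI)
      fix j k assume "j < ?n"
      then have "C_diff k ?n (open_box ?n l u) (\<lambda>y. ln (y j - l j) - ln (u j - y j))"
        by (intro C_diff_diff C_diff_ln openin_box C_diff_coord C_diff_const) (auto simp: open_box_def)
      then show "C_diff k ?n (open_box ?n l u) (\<lambda>y. \<beta> y j)" using \<open>j < ?n\<close> by (simp add: \<beta>_def)
    qed (auto simp: \<beta>_def topspace_Euclidean_space)
    show "smooth_on ?n ?E ?n \<gamma>"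
      unfolding smooth_on_def
    proof (intro conjI allI impI)
      fix j k assume "j < ?n"
      have "C_diff k ?n ?E (\<lambda>y. l j + (u j - l j) * inverse (1 + exp (0 - y j)))"
        by (intro C_diff_add C_diff_mult C_diff_inverse C_diff_exp C_diff_diff C_diff_coord C_diff_const openin_topspace)
          (use pos in \<open>metis less_irrefl\<close>)
      then show "C_diff k ?n ?E (\<lambda>y. \<gamma> y j)" using \<open>j < ?n\<close> by (simp add: \<gamma>_def)
    qed (auto simp: \<gamma>_def topspace_Euclidean_space)
    have \<gamma>_gap: "\<gamma> y i - l i = (u i - l i) * inverse (1 + exp (0 - y i))"
      "u i - \<gamma> y i = (u i - l i) * inverse (1 + exp (0 - y i)) * exp (0 - y i)" if "i < ?n" for y i
      using that pos[of "y i"] by (auto simp: \<gamma>_def field_simps)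
    have gap_pos: "\<gamma> y i - l i > 0" "u i - \<gamma> y i > 0" if "i < ?n" for y i
      unfolding \<gamma>_gap[OF that] using lu[OF that] pos[of "y i"] by simp_all
    show "\<gamma> ` ?E \<subseteq> open_box ?n l u"
      using gap_pos by (force simp: open_box_def topspace_Euclidean_space \<gamma>_def)
    show "\<beta> (\<gamma> y) = y" if "y \<in> ?E" for y
    proof
      fix i
      show "\<beta> (\<gamma> y) i = y i"
      proof (cases "i < ?n")
        case True
        define A where "A = (u i - l i) * inverse (1 + exp (0 - y i))"
        have "A > 0" using gap_pos(1)[OF True, of y] \<gamma>_gap(1)[OF True, of y] by (simp add: A_def)
        then have "ln A - ln (A * exp (0 - y i)) = y i" by (simp add: ln_mult)
        then show ?thesis using \<gamma>_gap[OF True, of y] True by (simp add: \<beta>_def A_def)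
      qed (use that in \<open>simp add: \<beta>_def topspace_Euclidean_space\<close>)
    qed
    show "\<gamma> (\<beta> y) = y" if y: "y \<in> open_box ?n l u" for y
    proof
      fix i
      show "\<gamma> (\<beta> y) i = y i"
      proof (cases "i < ?n")
        case True
        define a b where "a = y i - l i" and "b = u i - y i"
        have ab: "a > 0" "b > 0" using y True by (auto simp: a_def b_def open_box_def)
        have "0 - \<beta> y i = ln (b / a)" using True ab by (simp add: \<beta>_def a_def b_def ln_div)
        then have e: "exp (0 - \<beta> y i) = b / a" using ab by (simp del: ln_divide_pos)
        have "\<gamma> (\<beta> y) i = l i + (a + b) * inverse (1 + b / a)"
          using True e by (simp add: \<gamma>_def a_def b_def)
        also have "(a + b) * inverse (1 + b / a) = a" using ab by (simp add: field_simps)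
        finally show ?thesis by (simp add: a_def)
      qed (use y in \<open>simp add: \<gamma>_def open_box_def topspace_Euclidean_space\<close>)
    qed
  qed
  then show ?thesis
    using open_subsetI[OF \<phi> S(1) o] charted_Cart by (simp add: opens_def)
qed

text \<open>Boxes are convenient because a non-empty finite intersection of boxes is again a box and
  hence cartesian, as a good cover demands.\<close>

definition chart_boxes :: "manifold \<Rightarrow> (point \<Rightarrow> point) \<Rightarrow> point set set" where
  "chart_boxes U \<phi> = {S. S \<noteq> {} \<and> (\<exists>l u. S = {x \<in> points U. \<phi> x \<in> open_box (mdim U) l u})}"

lemma chart_boxes_opens:
  assumes \<phi>: "charted U \<phi>" and S: "S \<in> chart_boxes U \<phi>" shows "S \<in> opens U"
proof -
  obtain l u where lu: "S = {x \<in> points U. \<phi> x \<in> open_box (mdim U) l u}" and "S \<noteq> {}"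
    using S by (auto simp: chart_boxes_def)
  then obtain x where "\<phi> x \<in> open_box (mdim U) l u" by blast
  then have "l i < u i" if "i < mdim U" for i using that by (force simp: open_box_def)
  moreover have "\<phi> ` S = open_box (mdim U) l u"
  proof -
    have "\<phi> ` S = \<phi> ` points U \<inter> open_box (mdim U) l u" unfolding lu by auto
    then show ?thesis unfolding chartedD(3)[OF \<phi>] by (auto simp: open_box_def)
  qed
  ultimately show ?thesis by (intro charted_box[OF \<phi>, of S l u]) (use lu in blast)+
qed

lemma chart_boxes_Int:
  assumes "S \<in> chart_boxes U \<phi>" "T \<in> chart_boxes U \<phi>" "S \<inter> T \<noteq> {}"
  shows "S \<inter> T \<in> chart_boxes U \<phi>"
proof -
  obtain l u l' u' where "S = {x \<in> points U. \<phi> x \<in> open_box (mdim U) l u}" "T = {x \<in> points U. \<phi> x \<in> open_box (mdim U) l' u'}"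
    using assms by (auto simp: chart_boxes_def)
  then have "S \<inter> T = {x \<in> points U. \<phi> x \<in> open_box (mdim U) (\<lambda>i. max (l i) (l' i)) (\<lambda>i. min (u i) (u' i))}"
    by (auto simp: open_box_def)
  then show ?thesis using assms(3) by (auto simp: chart_boxes_def)
qed

lemma chart_boxes_Inter:
  assumes "finite F" "F \<noteq> {}" "F \<subseteq> chart_boxes U \<phi>" "\<Inter>F \<noteq> {}"
  shows "\<Inter>F \<in> chart_boxes U \<phi>"
  using assms
proof (induct rule: finite_ne_induct)
  case (insert S F)
  then have "S \<inter> \<Inter>F \<noteq> {}" by simp
  moreover from this have "\<Inter>F \<noteq> {}" by blast
  ultimately show ?case using insert chart_boxes_Int[of S U \<phi> "\<Inter>F"] by auto
qed simp

lemma chart_boxes_basis: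
  assumes \<phi>: "charted U \<phi>" and S: "openin (Euclidean_space (mdim U)) (\<phi> ` S)" "S \<subseteq> points U" and x: "x \<in> S"
  shows "\<exists>B\<in>chart_boxes U \<phi>. x \<in> B \<and> B \<subseteq> S"
proof -
  obtain e where e: "e > 0" "\<And>y. y \<in> topspace (Euclidean_space (mdim U)) \<Longrightarrow>
      (\<forall>i<mdim U. \<bar>y i - \<phi> x i\<bar> < e) \<Longrightarrow> y \<in> \<phi> ` S"
    using openin_EuclideanD[OF S(1) imageI[OF x]] by blast
  let ?B = "{z \<in> points U. \<phi> z \<in> open_box (mdim U) (\<lambda>i. \<phi> x i - e) (\<lambda>i. \<phi> x i + e)}"
  have xU: "x \<in> points U" "\<phi> x \<in> topspace (Euclidean_space (mdim U))"
    using x S(2) chartedD(3)[OF \<phi>] by auto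
  have "x \<in> ?B" using xU e(1) by (auto simp: open_box_def)
  moreover have "?B \<subseteq> S"
  proof
    fix z assume z: "z \<in> ?B"
    then have "\<bar>\<phi> z i - \<phi> x i\<bar> < e" if "i < mdim U" for i using that by (auto simp: open_box_def abs_less_iff)
    then have "\<phi> z \<in> \<phi> ` S" using z e(2) by (auto simp: open_box_def)
    then show "z \<in> S" using inj_on_image_mem_iff[OF chartedD(4)[OF \<phi>] _ S(2)] z by blast
  qed
  ultimately show ?thesis by (intro bexI[of _ ?B]) (auto simp: chart_boxes_def)
qed

text \<open>Boxes in a global chart form good covers refining any given open cover.\<close>

lemma good_open_cover_exists:
  assumes U: "U \<in> Cart" and ex: "\<And>x. x \<in> points U \<Longrightarrow> \<exists>S\<in>opens U. x \<in> S \<and> P S"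
    and mono: "\<And>S T. P S \<Longrightarrow> S \<in> opens U \<Longrightarrow> T \<in> opens U \<Longrightarrow> T \<subseteq> S \<Longrightarrow> P T"
  shows "\<exists>\<U>. good_open_cover U \<U> \<and> (\<forall>S\<in>\<U>. P S)"
proof -
  obtain \<phi> where \<phi>: "charted U \<phi>" using Cart_charted[OF U] .
  define \<U> where "\<U> = {B \<in> chart_boxes U \<phi>. P B}"
  have "\<Union>\<U> = points U"
  proof
    show "\<Union>\<U> \<subseteq> points U" by (auto simp: \<U>_def chart_boxes_def)
    show "points U \<subseteq> \<Union>\<U>"
    proof
      fix x assume "x \<in> points U"
      then obtain S where S: "S \<in> opens U" "x \<in> S" "P S" using ex by blast
      obtain B where "B \<in> chart_boxes U \<phi>" "x \<in> B" "B \<subseteq> S"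
        using chart_boxes_basis[OF \<phi> open_subset_charted[OF \<phi>] opens_subset[OF S(1)] S(2)] S(1)
        by (auto simp: opens_def)
      then show "x \<in> \<Union>\<U>" using mono[OF S(3,1) chart_boxes_opens[OF \<phi>]] by (auto simp: \<U>_def)
    qed
  qed
  moreover have "open_sub U (\<Inter>F) \<in> Cart" if "F \<subseteq> \<U>" "finite F" "F \<noteq> {}" "\<Inter>F \<noteq> {}" for F
  proof -
    have "F \<subseteq> chart_boxes U \<phi>" using that(1) by (auto simp: \<U>_def)
    then show ?thesis by (rule opens_Cart[OF chart_boxes_opens[OF \<phi> chart_boxes_Inter[OF that(2,3) _ that(4)]]])
  qed
  ultimately have "good_open_cover U \<U>"
    unfolding good_open_cover_def using chart_boxes_opens[OF \<phi>] by (auto simp: \<U>_def opens_def)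
  then show ?thesis by (auto simp: \<U>_def)
qed

lemma good_open_cover_opens: "good_open_cover U \<U> \<Longrightarrow> S \<in> \<U> \<Longrightarrow> S \<in> opens U"
  unfolding good_open_cover_def opens_def by blast

lemma good_open_cover_covers: "good_open_cover U \<U> \<Longrightarrow> x \<in> points U \<Longrightarrow> \<exists>S\<in>\<U>. x \<in> S"
  unfolding good_open_cover_def by blast

section \<open>Smooth maps between cartesian spaces\<close>

lemma cart_hom_iff: "f \<in> cart_hom V U \<longleftrightarrow> V \<in> Cart \<and> U \<in> Cart \<and> smooth_map V U f"
  by (simp add: cart_hom_def)

lemma cart_hom_PiE: "f \<in> cart_hom V U \<Longrightarrow> f \<in> points V \<rightarrow>\<^sub>E points U"
  by (simp add: cart_hom_iff smooth_map_def)

lemma cart_hom_compose: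
  assumes g: "g \<in> cart_hom W V" and f: "f \<in> cart_hom V U"
  shows "compose (points W) f g \<in> cart_hom W U"
proof -
  have C: "W \<in> Cart" "V \<in> Cart" "U \<in> Cart" using f g by (auto simp: cart_hom_iff)
  obtain \<phi> where \<phi>: "charted W \<phi>" using Cart_charted[OF C(1)] .
  obtain \<psi> where \<psi>: "charted V \<psi>" using Cart_charted[OF C(2)] .
  obtain \<tau> where \<tau>: "charted U \<tau>" using Cart_charted[OF C(3)] .
  note gP = cart_hom_PiE[OF g] and fP = cart_hom_PiE[OF f]
  let ?E = "topspace (Euclidean_space (mdim W))" and ?E' = "topspace (Euclidean_space (mdim V))"
  have G: "smooth_on (mdim W) ?E (mdim V) (\<lambda>y. \<psi> (g (inv_into (points W) \<phi> y)))"
    using g smooth_map_iff[OF \<phi> \<psi>] by (simp add: cart_hom_iff)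
  have F: "smooth_on (mdim V) ?E' (mdim U) (\<lambda>y. \<tau> (f (inv_into (points V) \<psi> y)))"
    using f smooth_map_iff[OF \<psi> \<tau>] by (simp add: cart_hom_iff)
  have "smooth_on (mdim W) ?E (mdim U) (\<lambda>y. \<tau> (f (inv_into (points V) \<psi> (\<psi> (g (inv_into (points W) \<phi> y))))))"
    by (rule smooth_on_compose[OF _ _ G F]) (use G in \<open>auto simp: smooth_on_def\<close>)
  then have "smooth_on (mdim W) ?E (mdim U) (\<lambda>y. \<tau> (compose (points W) f g (inv_into (points W) \<phi> y)))"
  proof (rule smooth_on_cong[rotated])
    fix y assume "y \<in> ?E"
    then have "inv_into (points W) \<phi> y \<in> points W" using chartedD(3)[OF \<phi>] by (simp add: inv_into_into)
    then show "\<tau> (f (inv_into (points V) \<psi> (\<psi> (g (inv_into (points W) \<phi> y))))) =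
        \<tau> (compose (points W) f g (inv_into (points W) \<phi> y))"
      by (simp add: compose_def PiE_mem[OF gP] chartedD(4)[OF \<psi>])
  qed simp
  then show ?thesis
    unfolding cart_hom_iff smooth_map_iff[OF \<phi> \<tau>] using C gP fP by (auto simp: compose_def)
qed

lemma cart_hom_id: "U \<in> Cart \<Longrightarrow> (\<lambda>x\<in>points U. x) \<in> cart_hom U U"
proof -
  assume U: "U \<in> Cart"
  obtain \<phi> where \<phi>: "charted U \<phi>" using Cart_charted[OF U] .
  note P = chartedD[OF \<phi>]
  let ?E = "topspace (Euclidean_space (mdim U))"
  have "smooth_on (mdim U) ?E (mdim U) (\<lambda>y. \<phi> ((\<lambda>x\<in>points U. x) (inv_into (points U) \<phi> y)))"
    by (rule smooth_on_cong[OF _ smooth_on_id])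
      (use P(3) in \<open>auto simp: inv_into_into f_inv_into_f\<close>)
  then show ?thesis unfolding cart_hom_iff smooth_map_iff[OF \<phi> \<phi>] using U by auto
qed

lemma smooth_map_restrict:
  assumes f: "smooth_map V U f" and V: "smooth_structure V"
    and T: "T \<subseteq> points V" and S: "S \<subseteq> points U" and fTS: "f ` T \<subseteq> S"
  shows "smooth_map (open_sub V T) (open_sub U S) (restrict f T)"
  unfolding smooth_map_def open_sub_simps Let_def
proof (intro conjI ballI)
  show "restrict f T \<in> T \<rightarrow>\<^sub>E S" using fTS by auto
  fix c d assume c: "c \<in> {c \<in> atlas V. fst c \<subseteq> T}" and d: "d \<in> {c \<in> atlas U. fst c \<subseteq> S}"
  have W: "{x \<in> fst c. restrict f T x \<in> fst d} = {x \<in> fst c. f x \<in> fst d}" using c by auto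
  have o: "openin (Euclidean_space (mdim V)) (snd c ` {x \<in> fst c. f x \<in> fst d})"
    and s: "smooth_on (mdim V) (snd c ` {x \<in> fst c. f x \<in> fst d}) (mdim U) (snd d \<circ> f \<circ> inv_into (fst c) (snd c))"
    using f c d unfolding smooth_map_def Let_def by blast+
  show "openin (Euclidean_space (mdim V)) (snd c ` {x \<in> fst c. restrict f T x \<in> fst d})" unfolding W by (rule o)
  have "inj_on (snd c) (fst c)" using is_chartD(2)[OF smooth_structureD(1)[OF V]] c by blast
  then show "smooth_on (mdim V) (snd c ` {x \<in> fst c. restrict f T x \<in> fst d}) (mdim U)
      (snd d \<circ> restrict f T \<circ> inv_into (fst c) (snd c))"
    unfolding W by (intro smooth_on_cong[OF o s]) (use c in auto)
qed

lemma Cart_smooth_structure: "U \<in> Cart \<Longrightarrow> smooth_structure U"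
  by (simp add: Cart_def)

lemma open_sub_points:
  assumes U: "U \<in> Cart" shows "open_sub U (points U) = U"
proof -
  have "{c \<in> atlas U. fst c \<subseteq> points U} = atlas U"
    using is_chartD(1)[OF smooth_structureD(1)[OF Cart_smooth_structure[OF U]]] by blast
  then show ?thesis by (simp add: open_sub_def)
qed

lemma points_opens: "U \<in> Cart \<Longrightarrow> points U \<in> opens U"
  using is_chartD[OF smooth_structureD(1)[OF Cart_smooth_structure]]
  by (auto simp: opens_def open_sub_points open_subset_def Int_absorb2)

lemma cart_hom_restrict:
  assumes f: "f \<in> cart_hom V U" and T: "T \<in> opens V" and S: "S \<in> opens U" and fTS: "f ` T \<subseteq> S"
  shows "restrict f T \<in> cart_hom (open_sub V T) (open_sub U S)"
  using smooth_map_restrict[OF _ Cart_smooth_structure opens_subset[OF T] opens_subset[OF S] fTS] f T S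
  by (auto simp: cart_hom_iff opens_Cart)

lemma incl_cart_hom:
  assumes U: "U \<in> Cart" and S: "S \<in> opens U"
  shows "incl S \<in> cart_hom (open_sub U S) U"
proof -
  have "restrict (\<lambda>x\<in>points U. x) S \<in> cart_hom (open_sub U S) (open_sub U (points U))"
    by (rule cart_hom_restrict[OF cart_hom_id[OF U] S points_opens[OF U]]) (use opens_subset[OF S] in auto)
  moreover have "restrict (\<lambda>x\<in>points U. x) S = incl S" using opens_subset[OF S] by (auto simp: incl_def restrict_def fun_eq_iff)
  ultimately show ?thesis using open_sub_points[OF U] by simp
qed

lemma open_sub_open_sub: "T \<subseteq> S \<Longrightarrow> open_sub (open_sub U S) T = open_sub U T"
  by (auto simp: open_sub_def)

lemma opens_trans:
  assumes U: "U \<in> Cart" and S: "S \<in> opens U" and T: "T \<in> opens (open_sub U S)"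
  shows "T \<in> opens U"
proof -
  obtain \<phi> where \<phi>: "charted U \<phi>" using Cart_charted[OF U] .
  have TS: "T \<subseteq> S" using opens_subset[OF T] by simp
  have SU: "S \<subseteq> points U" by (rule opens_subset[OF S])
  have oS: "openin (Euclidean_space (mdim U)) (\<phi> ` S)"
    using open_subset_charted[OF \<phi>] S by (simp add: opens_def)
  have "(S, \<phi>) \<in> atlas (open_sub U S)" using chart_on_open_subset[OF \<phi> SU oS] by simp
  then have "openin (Euclidean_space (mdim U)) (\<phi> ` T)"
    using T TS unfolding opens_def open_subset_def by (force simp: Int_absorb1)
  then have "open_subset U T" using open_subsetI[OF \<phi>] TS SU by blast
  then show ?thesis using T open_sub_open_sub[OF TS] by (simp add: opens_def)
qed

lemma opens_of_subset:
  assumes U: "U \<in> Cart" and S: "S \<in> opens U" and T: "T \<in> opens U" "T \<subseteq> S"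
  shows "T \<in> opens (open_sub U S)"
proof -
  have "openin (Euclidean_space (mdim U)) (snd c ` (fst c \<inter> T))" if "c \<in> atlas U" for c
    using T(1) that unfolding opens_def open_subset_def by blast
  then have "open_subset (open_sub U S) T"
    unfolding open_subset_def open_sub_simps using T(2) by blast
  then show ?thesis using T by (simp add: opens_def open_sub_open_sub)
qed

text \<open>The full preimage of \<open>S\<close> is open but need not be cartesian, so a chart box
  around \<open>x\<close> inside it is taken.\<close>

lemma opens_preimage:
  assumes f: "f \<in> cart_hom V U" and S: "S \<in> opens U" and x: "x \<in> points V" "f x \<in> S"
  shows "\<exists>T\<in>opens V. x \<in> T \<and> f ` T \<subseteq> S"
proof -
  have C: "V \<in> Cart" "U \<in> Cart" using f by (auto simp: cart_hom_iff)
  obtain \<phi> where \<phi>: "charted V \<phi>" using Cart_charted[OF C(1)] .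
  obtain \<psi> where \<psi>: "charted U \<psi>" using Cart_charted[OF C(2)] .
  note P = chartedD[OF \<phi>] and fP = cart_hom_PiE[OF f]
  have oS: "openin (Euclidean_space (mdim U)) (\<psi> ` S)"
    using open_subset_charted[OF \<psi>] S by (simp add: opens_def)
  let ?F = "\<lambda>y. \<psi> (f (inv_into (points V) \<phi> y))"
  have F: "smooth_on (mdim V) (topspace (Euclidean_space (mdim V))) (mdim U) ?F"
    using f smooth_map_iff[OF \<phi> \<psi>] by (simp add: cart_hom_iff)
  let ?T = "{z \<in> points V. f z \<in> S}"
  have "?T = points V \<inter> {z. f z \<in> S}" by blast
  also have "\<phi> ` \<dots> = {y \<in> \<phi> ` points V. ?F y \<in> \<psi> ` S}"
    by (rule image_Int_Collect)
      (use inj_on_image_mem_iff[OF chartedD(4)[OF \<psi>] _ opens_subset[OF S]] PiE_mem[OF fP] P(4) in simp)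
  finally have "\<phi> ` ?T = {y \<in> topspace (Euclidean_space (mdim V)). ?F y \<in> \<psi> ` S}" unfolding P(3) .
  then have "openin (Euclidean_space (mdim V)) (\<phi> ` ?T)"
    using smooth_on_preimage[OF openin_topspace oS F] by simp
  then obtain B where "B \<in> chart_boxes V \<phi>" "x \<in> B" "B \<subseteq> ?T"
    using chart_boxes_basis[OF \<phi>, of ?T x] x by blast
  then show ?thesis using chart_boxes_opens[OF \<phi>] by blast
qed

text \<open>The intersection of two cartesian open subsets need not be cartesian. It is the preimage
  of \<open>T\<close> under the inclusion of \<open>S\<close>, so \<open>opens_preimage\<close>
  provides a neighbourhood.\<close>

lemma opens_Int_basis:
  assumes U: "U \<in> Cart" and S: "S \<in> opens U" and T: "T \<in> opens U" and x: "x \<in> S" "x \<in> T"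
  shows "\<exists>B\<in>opens U. x \<in> B \<and> B \<subseteq> S \<and> B \<subseteq> T"
proof -
  have "\<exists>B\<in>opens (open_sub U S). x \<in> B \<and> incl S ` B \<subseteq> T"
    by (rule opens_preimage[OF incl_cart_hom[OF U S] T]) (use x in \<open>simp_all add: incl_def\<close>)
  then obtain B where B: "B \<in> opens (open_sub U S)" "x \<in> B" "incl S ` B \<subseteq> T" by blast
  have BS: "B \<subseteq> S" using opens_subset[OF B(1)] by simp
  have "B \<subseteq> T"
  proof
    fix z assume z: "z \<in> B"
    then have "incl S z = z" using BS by (auto simp: incl_def)
    then show "z \<in> T" using B(3) z by (metis imageI subsetD)
  qed
  then show ?thesis using opens_trans[OF U S B(1)] B(2) BS by blast
qed

lemma Rn_Cart: "Rn n \<in> Cart"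
  by (rule charted_Cart[OF charted_Rn])

definition pt :: point where "pt = (\<lambda>_. 0)"

lemma points_R0: "points (Rn 0) = {pt}"
  by (auto simp: topspace_Euclidean_space pt_def)

lemma const_cart_hom:
  assumes U: "U \<in> Cart" and u: "u \<in> points U"
  shows "(\<lambda>_\<in>points (Rn 0). u) \<in> cart_hom (Rn 0) U"
proof -
  obtain \<phi> where \<phi>: "charted U \<phi>" using Cart_charted[OF U] .
  have "smooth_on 0 (topspace (Euclidean_space 0)) (mdim U) (\<lambda>y. \<phi> u)"
    unfolding smooth_on_def using u chartedD(3)[OF \<phi>] by (auto intro!: C_diff_const)
  then have "smooth_on 0 (topspace (Euclidean_space 0)) (mdim U)
      (\<lambda>y. \<phi> ((\<lambda>_\<in>points (Rn 0). u) (inv_into (points (Rn 0)) (\<lambda>x. x) y)))"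
    by (rule smooth_on_cong[rotated]) (auto intro: inv_into_into)
  then show ?thesis
    unfolding cart_hom_iff smooth_map_iff[OF charted_Rn \<phi>] using U u Rn_Cart by auto
qed

text \<open>The only non-empty subset of a point is the point itself, so over R^0 a local statement
  holds globally.\<close>

lemma good_open_cover_R0: "good_open_cover (Rn 0) \<U> \<Longrightarrow> points (Rn 0) \<in> \<U>"
proof -
  assume U: "good_open_cover (Rn 0) \<U>"
  then obtain S where S: "S \<in> \<U>" "pt \<in> S" using good_open_cover_covers[OF U] unfolding points_R0 by blast
  then have "S = points (Rn 0)" using opens_subset[OF good_open_cover_opens[OF U S(1)]] unfolding points_R0 by blast
  then show ?thesis using S(1) by simp
qed

lemma good_open_cover_trivial:
  assumes U: "U \<in> Cart" shows "good_open_cover U {points U}"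
proof -
  have "open_sub U (\<Inter>F) \<in> Cart" if "F \<subseteq> {points U}" "F \<noteq> {}" for F
  proof -
    have "F = {points U}" using that by blast
    then show ?thesis using opens_Cart[OF points_opens[OF U]] by simp
  qed
  then show ?thesis
    using points_opens[OF U] unfolding good_open_cover_def opens_def by auto
qed

section \<open>Plots are local\<close>

context
  fixes X :: "'a diffspace"
  assumes X: "diffeological_space X"
begin

lemmas diffeological_spaceD = X[unfolded diffeological_space_def]

lemma plots_Cart: "p \<in> plots X U \<Longrightarrow> U \<in> Cart"
  and plots_PiE: "p \<in> plots X U \<Longrightarrow> p \<in> points U \<rightarrow>\<^sub>E carrier X"
  using conjunct1[OF diffeological_spaceD] by simp_all

lemma plots_point: "p \<in> points (Rn 0) \<rightarrow>\<^sub>E carrier X \<Longrightarrow> p \<in> plots X (Rn 0)"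
  using conjunct1[OF conjunct2[OF diffeological_spaceD]] by (rule subsetD)

lemma plots_compose: "p \<in> plots X U \<Longrightarrow> f \<in> cart_hom V U \<Longrightarrow> compose (points V) p f \<in> plots X V"
  using conjunct1[OF conjunct2[OF conjunct2[OF diffeological_spaceD]]] by simp

lemma plots_good_cover:
  "U \<in> Cart \<Longrightarrow> p \<in> points U \<rightarrow>\<^sub>E carrier X \<Longrightarrow> good_open_cover U \<U> \<Longrightarrow>
   (\<And>S. S \<in> \<U> \<Longrightarrow> restrict p S \<in> plots X (open_sub U S)) \<Longrightarrow> p \<in> plots X U"
  by (rule mp[OF bspec[OF spec[OF bspec[OF conjunct2[OF conjunct2[OF conjunct2[OF diffeological_spaceD]]]]]]])
    (assumption | intro conjI ballI)+

lemma plots_restrict: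
  assumes p: "p \<in> plots X U" and S: "S \<in> opens U"
  shows "restrict p S \<in> plots X (open_sub U S)"
proof -
  have "compose (points (open_sub U S)) p (incl S) \<in> plots X (open_sub U S)"
    by (rule plots_compose[OF p incl_cart_hom[OF plots_Cart[OF p] S]])
  moreover have "compose (points (open_sub U S)) p (incl S) = restrict p S"
    by (auto simp: compose_def incl_def restrict_def)
  ultimately show ?thesis by simp
qed

text \<open>The sheaf axiom speaks of good covers only; neighbourhoods on which the restriction is a
  plot are refined to a good cover.\<close>

lemma plots_local:
  assumes U: "U \<in> Cart" and p: "p \<in> points U \<rightarrow>\<^sub>E carrier X"
    and ex: "\<And>x. x \<in> points U \<Longrightarrow> \<exists>S\<in>opens U. x \<in> S \<and> restrict p S \<in> plots X (open_sub U S)"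
  shows "p \<in> plots X U"
proof -
  have "restrict p T \<in> plots X (open_sub U T)"
    if "restrict p S \<in> plots X (open_sub U S)" "S \<in> opens U" "T \<in> opens U" "T \<subseteq> S" for S T
    using plots_restrict[OF that(1) opens_of_subset[OF U that(2-4)]] that(4)
    by (simp add: open_sub_open_sub Int_absorb1)
  then have "\<exists>\<U>. good_open_cover U \<U> \<and> (\<forall>S\<in>\<U>. restrict p S \<in> plots X (open_sub U S))"
    by (intro good_open_cover_exists[OF U ex]) blast+
  then show ?thesis using plots_good_cover[OF U p] by blast
qed

end

lemma dsmoothD:
  assumes "dsmooth X Y f"
  shows "f \<in> carrier X \<rightarrow>\<^sub>E carrier Y" "p \<in> plots X U \<Longrightarrow> compose (points U) f p \<in> plots Y U"
  using assms by (auto simp: dsmooth_def)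

lemma dspace_simps [simp]: "carrier (dspace G) = carrier G" "plots (dspace G) = gplots G"
  by (simp_all add: dspace_def)

lemma dprod_carrier [simp]: "carrier (dprod X Y) = carrier X \<times> carrier Y"
  by (simp add: dprod_def)

lemma dprod_plotI:
  assumes X: "diffeological_space X" and Y: "diffeological_space Y" and p: "p \<in> plots X U" and q: "q \<in> plots Y U"
  shows "(\<lambda>u\<in>points U. (p u, q u)) \<in> plots (dprod X Y) U"
proof -
  note pP = plots_PiE[OF X p] and qP = plots_PiE[OF Y q]
  have "compose (points U) fst (\<lambda>u\<in>points U. (p u, q u)) = p" "compose (points U) snd (\<lambda>u\<in>points U. (p u, q u)) = q"
    by (simp_all add: compose_def fun_eq_iff PiE_arb[OF pP] PiE_arb[OF qP])
  moreover have "(\<lambda>u\<in>points U. (p u, q u)) \<in> points U \<rightarrow>\<^sub>E carrier X \<times> carrier Y"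
    by (rule PiE_I) (simp_all add: PiE_mem[OF pP] PiE_mem[OF qP])
  ultimately show ?thesis by (simp add: dprod_def p q)
qed

section \<open>Diffeological principal bundles\<close>

locale diff_bundle =
  fixes X :: "'x diffspace" and G :: "'g dgroup" and E :: "('p, 'g, 'x) dbundle"
  assumes X: "diffeological_space X" and G: "diffeological_group G" and E: "diff_principal_bundle X G E"
begin

abbreviation "P \<equiv> dtotal E"
abbreviation "\<pi> \<equiv> dproj E"
abbreviation "\<rho> \<equiv> dact E"

lemma Gd: "diffeological_space (dspace G)" and Gg: "group G"
  using G by (simp_all add: diffeological_group_def)

lemma principal_bundle:
  shows P: "diffeological_space P" and sub: "subduction P X \<pi>"
    and act_smooth: "dsmooth (dprod P (dspace G)) P \<rho>"
    and act_one: "p \<in> carrier P \<Longrightarrow> \<rho> (p, \<one>\<^bsub>G\<^esub>) = p"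
    and act_mult: "p \<in> carrier P \<Longrightarrow> g \<in> carrier G \<Longrightarrow> h \<in> carrier G \<Longrightarrow> \<rho> (\<rho> (p, g), h) = \<rho> (p, g \<otimes>\<^bsub>G\<^esub> h)"
    and shear: "diffeo (dprod P (dspace G)) (dfibre_prod P \<pi>) (\<lambda>(p, g) \<in> carrier P \<times> carrier G. (p, \<rho> (p, g)))"
  using E unfolding diff_principal_bundle_def Let_def by blast+

lemma proj_smooth: "dsmooth P X \<pi>"
  using sub by (simp add: subduction_def)

lemma act_carrier: "p \<in> carrier P \<Longrightarrow> g \<in> carrier G \<Longrightarrow> \<rho> (p, g) \<in> carrier P"
  using dsmoothD(1)[OF act_smooth] by (auto simp: PiE_iff)

abbreviation "shear_map \<equiv> (\<lambda>(p, g) \<in> carrier P \<times> carrier G. (p, \<rho> (p, g)))"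

lemma fibre_carrier: "carrier (dfibre_prod P \<pi>) = {(p, q). p \<in> carrier P \<and> q \<in> carrier P \<and> \<pi> p = \<pi> q}"
  by (simp add: dfibre_prod_def)

lemma shear_bij: "bij_betw shear_map (carrier P \<times> carrier G) {(p, q). p \<in> carrier P \<and> q \<in> carrier P \<and> \<pi> p = \<pi> q}"
  using shear unfolding diffeo_def fibre_carrier by simp

lemma proj_act: "p \<in> carrier P \<Longrightarrow> g \<in> carrier G \<Longrightarrow> \<pi> (\<rho> (p, g)) = \<pi> p"
  using bij_betwE[OF shear_bij] by fastforce

lemma act_free:
  assumes "p \<in> carrier P" "g \<in> carrier G" "h \<in> carrier G" "\<rho> (p, g) = \<rho> (p, h)"
  shows "g = h"
  using inj_onD[OF bij_betw_imp_inj_on[OF shear_bij], of "(p, g)" "(p, h)"] assms by simp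

lemma act_plot:
  assumes p: "p \<in> plots P U" and g: "g \<in> gplots G U"
  shows "(\<lambda>u\<in>points U. \<rho> (p u, g u)) \<in> plots P U"
proof -
  have "(\<lambda>u\<in>points U. (p u, g u)) \<in> plots (dprod P (dspace G)) U"
    by (rule dprod_plotI[OF P Gd p]) (use g in simp)
  from dsmoothD(2)[OF act_smooth this]
  have "compose (points U) \<rho> (\<lambda>u\<in>points U. (p u, g u)) \<in> plots P U" .
  moreover have "compose (points U) \<rho> (\<lambda>u\<in>points U. (p u, g u)) = (\<lambda>u\<in>points U. \<rho> (p u, g u))"
    by (auto simp: compose_def)
  ultimately show ?thesis by simp
qed

text \<open>The pair of \<open>p\<close> and \<open>q\<close> is a plot of the fibre product; the
  second component of its image under the smooth inverse of the shear map is the required plot of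
  the group.\<close>

lemma difference_plot:
  assumes p: "p \<in> plots P U" and q: "q \<in> plots P U" and eq: "\<And>u. u \<in> points U \<Longrightarrow> \<pi> (p u) = \<pi> (q u)"
  shows "\<exists>g\<in>gplots G U. \<forall>u\<in>points U. q u = \<rho> (p u, g u)"
proof -
  note pP = plots_PiE[OF P p] and qP = plots_PiE[OF P q]
  let ?r = "\<lambda>u\<in>points U. (p u, q u)"
  let ?D = "{(p, q). p \<in> carrier P \<and> q \<in> carrier P \<and> \<pi> p = \<pi> q}"
  let ?F = "restrict (inv_into (carrier P \<times> carrier G) shear_map) ?D"
  have "compose (points U) fst ?r = p" "compose (points U) snd ?r = q"
    by (simp_all add: compose_def fun_eq_iff PiE_arb[OF pP] PiE_arb[OF qP])
  moreover have rD: "?r \<in> points U \<rightarrow>\<^sub>E ?D"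
    by (rule PiE_I) (simp_all add: PiE_mem[OF pP] PiE_mem[OF qP] eq)
  ultimately have "?r \<in> plots (dfibre_prod P \<pi>) U" using p q by (simp add: dfibre_prod_def)
  moreover have "dsmooth (dfibre_prod P \<pi>) (dprod P (dspace G)) ?F"
    using shear unfolding diffeo_def fibre_carrier dprod_carrier dspace_simps by blast
  ultimately have "compose (points U) ?F ?r \<in> plots (dprod P (dspace G)) U" by (rule dsmoothD(2)[rotated])
  then have "compose (points U) snd (compose (points U) ?F ?r) \<in> gplots G U"
    by (simp add: dprod_def)
  moreover have "q u = \<rho> (p u, compose (points U) snd (compose (points U) ?F ?r) u)" if u: "u \<in> points U" for u
  proof -
    have D: "(p u, q u) \<in> ?D" using rD u by (auto simp: PiE_iff)
    obtain p' g where pg: "?F (p u, q u) = (p', g)" by fastforce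
    have "(p u, q u) \<in> shear_map ` (carrier P \<times> carrier G)" using D shear_bij by (simp add: bij_betw_def)
    then have "shear_map (?F (p u, q u)) = (p u, q u)" "?F (p u, q u) \<in> carrier P \<times> carrier G"
      using D by (auto simp only: restrict_apply' f_inv_into_f intro: inv_into_into)
    then have "p' = p u" "\<rho> (p', g) = q u" unfolding pg by auto
    then show ?thesis unfolding compose_eq[OF u] restrict_apply'[OF u] pg snd_conv by simp
  qed
  ultimately show ?thesis by blast
qed

end

section \<open>Global lifts\<close>

lemma open_box_opens: "(\<And>i. i < n \<Longrightarrow> l i < u i) \<Longrightarrow> open_box n l u \<in> opens (Rn n)"
  by (rule charted_box[OF charted_Rn]) (auto simp: open_box_def)

lemma Rn_cart_hom:
  assumes "\<And>x. x \<in> topspace (Euclidean_space n) \<Longrightarrow> r x \<in> topspace (Euclidean_space n)"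
    and "\<And>j k. j < n \<Longrightarrow> C_diff k n (topspace (Euclidean_space n)) (\<lambda>x. r x j)"
  shows "restrict r (topspace (Euclidean_space n)) \<in> cart_hom (Rn n) (Rn n)"
proof -
  let ?E = "topspace (Euclidean_space n)"
  have "smooth_on n ?E n r" using assms by (auto simp: smooth_on_def)
  moreover have "inv_into ?E (\<lambda>x. x) y = y" if "y \<in> ?E" for y
    using that f_inv_into_f[of y "\<lambda>x. x" ?E] by simp
  ultimately have "smooth_on n ?E n (\<lambda>y. restrict r ?E (inv_into ?E (\<lambda>x. x) y))"
    using smooth_on_cong[OF openin_topspace, of n n r "\<lambda>y. restrict r ?E (inv_into ?E (\<lambda>x. x) y)"] by simp
  then show ?thesis
    unfolding cart_hom_iff smooth_map_iff[OF charted_Rn charted_Rn] using Rn_Cart assms(1) by auto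
qed

locale diff_bundle_plot = diff_bundle X G E
  for X :: "'x diffspace" and G :: "'g dgroup" and E :: "('p, 'g, 'x) dbundle" +
  fixes n :: nat and x :: "point \<Rightarrow> 'x"
  assumes x: "x \<in> plots X (Rn n)"
begin

abbreviation "R \<equiv> Rn n"

text \<open>A section over \<open>S\<close> of the pullback of the bundle along
  \<open>x\<close>.\<close>

definition lift :: "point set \<Rightarrow> (point \<Rightarrow> 'p) \<Rightarrow> bool" where
  "lift S q \<longleftrightarrow> q \<in> plots P (open_sub R S) \<and> (\<forall>u\<in>S. \<pi> (q u) = x u)"

lemma lift_restrict: "lift S q \<Longrightarrow> S \<in> opens R \<Longrightarrow> T \<in> opens R \<Longrightarrow> T \<subseteq> S \<Longrightarrow> lift T (restrict q T)"
  unfolding lift_def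
  using plots_restrict[OF P _ opens_of_subset[OF Rn_Cart], of q n S T] by (auto simp: open_sub_open_sub)

lemma lift_exists_locally: "y \<in> points R \<Longrightarrow> \<exists>S\<in>opens R. y \<in> S \<and> (\<exists>q. lift S q)"
proof -
  assume y: "y \<in> points R"
  obtain \<U> where U: "good_open_cover R \<U>" "\<forall>S\<in>\<U>. \<exists>q\<in>plots P (open_sub R S). compose S \<pi> q = restrict x S"
    using sub x unfolding subduction_def by blast
  obtain S where S: "S \<in> \<U>" "y \<in> S" using good_open_cover_covers[OF U(1) y] by blast
  obtain q where q: "q \<in> plots P (open_sub R S)" "compose S \<pi> q = restrict x S" using U(2) S(1) by blast
  have "\<pi> (q u) = x u" if "u \<in> S" for u using fun_cong[OF q(2), of u] that by (simp add: compose_def)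
  then show ?thesis using S q(1) good_open_cover_opens[OF U(1)] by (auto simp: lift_def)
qed

lemma lift_glue:
  assumes T: "T \<in> opens R" and q: "q \<in> extensional T"
    and loc: "\<And>y. y \<in> T \<Longrightarrow> \<exists>S\<in>opens R. y \<in> S \<and> S \<subseteq> T \<and> lift S (restrict q S)"
  shows "lift T q"
proof -
  have qP: "q u \<in> carrier P \<and> \<pi> (q u) = x u" if u: "u \<in> T" for u
  proof -
    obtain S where S: "u \<in> S" "lift S (restrict q S)" using loc[OF u] by blast
    then show ?thesis using plots_PiE[OF P, of "restrict q S" "open_sub R S"] by (auto simp: lift_def PiE_iff)
  qed
  have "q \<in> plots P (open_sub R T)"
  proof (rule plots_local[OF P opens_Cart[OF T]])
    show "q \<in> points (open_sub R T) \<rightarrow>\<^sub>E carrier P" using qP q by (auto simp: PiE_iff)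
    fix y assume "y \<in> points (open_sub R T)"
    then obtain S where S: "S \<in> opens R" "y \<in> S" "S \<subseteq> T" "lift S (restrict q S)" using loc by auto
    then show "\<exists>S\<in>opens (open_sub R T). y \<in> S \<and> restrict q S \<in> plots P (open_sub (open_sub R T) S)"
      using opens_of_subset[OF Rn_Cart T S(1,3)] by (auto simp: lift_def open_sub_open_sub)
  qed
  then show ?thesis using qP by (simp add: lift_def)
qed

text \<open>Two lifts differ by a plot \<open>g\<close> of the group on the overlap.  Precomposing \<open>g\<close> with a smooth map
  into the overlap that is the identity on \<open>A\<close> extends its restriction to \<open>A\<close>.\<close>

lemma lift_modify:
  assumes O1: "O1 \<in> opens R" and O2: "O2 \<in> opens R" and O: "O1 \<inter> O2 \<in> opens R"
    and q1: "lift O1 q1" and q2: "lift O2 q2"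
    and r: "r \<in> cart_hom (open_sub R O2) (open_sub R (O1 \<inter> O2))"
    and A: "A \<subseteq> O1 \<inter> O2" "\<And>y. y \<in> A \<Longrightarrow> r y = y"
  shows "\<exists>q. lift O2 q \<and> (\<forall>y\<in>A. q y = q1 y)"
proof -
  have "\<exists>g\<in>gplots G (open_sub R (O1 \<inter> O2)). \<forall>u\<in>points (open_sub R (O1 \<inter> O2)).
      restrict q1 (O1 \<inter> O2) u = \<rho> (restrict q2 (O1 \<inter> O2) u, g u)"
  proof (rule difference_plot)
    show "restrict q2 (O1 \<inter> O2) \<in> plots P (open_sub R (O1 \<inter> O2))"
      "restrict q1 (O1 \<inter> O2) \<in> plots P (open_sub R (O1 \<inter> O2))"
      using lift_restrict[OF q1 O1 O] lift_restrict[OF q2 O2 O] unfolding lift_def by blast+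
    show "\<pi> (restrict q2 (O1 \<inter> O2) u) = \<pi> (restrict q1 (O1 \<inter> O2) u)"
      if "u \<in> points (open_sub R (O1 \<inter> O2))" for u
      using that q1 q2 by (simp add: lift_def)
  qed
  then obtain g where g: "g \<in> gplots G (open_sub R (O1 \<inter> O2))"
    "\<And>u. u \<in> O1 \<inter> O2 \<Longrightarrow> q1 u = \<rho> (q2 u, g u)" by auto
  have gr: "compose O2 g r \<in> gplots G (open_sub R O2)"
    using plots_compose[OF Gd, of g "open_sub R (O1 \<inter> O2)" r "open_sub R O2"] g(1) r by simp
  define q where "q = (\<lambda>u\<in>O2. \<rho> (q2 u, compose O2 g r u))"
  have "q \<in> plots P (open_sub R O2)"
    using act_plot[OF _ gr, of q2] q2 by (simp add: lift_def q_def)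
  moreover have "\<pi> (q u) = x u" if u: "u \<in> O2" for u
  proof -
    have "q2 u \<in> carrier P" using q2 plots_PiE[OF P, of q2 "open_sub R O2"] u by (auto simp: lift_def PiE_iff)
    moreover have "compose O2 g r u \<in> carrier G" using plots_PiE[OF Gd, of "compose O2 g r" "open_sub R O2"] gr u by (auto simp: PiE_iff)
    ultimately show ?thesis using q2 u by (simp add: q_def proj_act lift_def)
  qed
  moreover have "q y = q1 y" if y: "y \<in> A" for y
    using y A(1) A(2)[OF y] g(2)[of y] by (auto simp: q_def compose_def)
  ultimately show ?thesis by (auto simp: lift_def)
qed

text \<open>The two boxes overlap in the slab between \<open>a\<close> and \<open>b\<close> in
  direction \<open>j\<close>. A smooth map pushing the second box into the slab and fixing the part
  below \<open>c\<close> lets \<open>lift_modify\<close> replace \<open>q2\<close> by a lift equal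
  to \<open>q1\<close> on that part.\<close>

lemma lift_boxes_glue:
  assumes lu: "\<And>i. i < n \<Longrightarrow> l i < u i" and j: "j < n" and ab: "l j \<le> a" "a < b" "b \<le> u j"
    and q1: "lift (open_box n l (u(j := b))) q1" and q2: "lift (open_box n (l(j := a)) u) q2"
  shows "\<exists>q. lift (open_box n l u) q"
proof -
  let ?O1 = "open_box n l (u(j := b))" and ?O2 = "open_box n (l(j := a)) u"
  \<comment> \<open>The points dividing the overlap into thirds: old values are kept below
    \<open>c\<close>, and the deformation takes place between \<open>c\<close> and
    \<open>d\<close>.\<close>
  define c d where "c = (2 * a + b) / 3" and "d = (a + 2 * b) / 3"
  have cd: "a < c" "c < d" "d < b" using ab by (auto simp: c_def d_def)
  have O1: "?O1 \<in> opens R" and O2: "?O2 \<in> opens R" using lu ab by (auto intro!: open_box_opens)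
  have Oeq: "?O1 \<inter> ?O2 = open_box n (l(j := a)) (u(j := b))"
    using ab by (fastforce simp: open_box_def split: if_splits)
  have O: "?O1 \<inter> ?O2 \<in> opens R" unfolding Oeq using lu ab by (auto intro!: open_box_opens)
  \<comment> \<open>The identity up to \<open>c\<close> and the constant \<open>c\<close> from
    \<open>d\<close> on, with values strictly between \<open>a\<close> and \<open>b\<close> for
    every argument above \<open>a\<close>.\<close>
  define \<sigma> where "\<sigma> t = smooth_step c d t * (t - c) + c" for t
  have \<sigma>: "a < \<sigma> t \<and> \<sigma> t < b" if "a < t" for t
  proof -
    consider "t \<le> c" | "c < t" "t < d" | "d \<le> t" by linarith
    then show ?thesis
    proof cases
      case 1 then show ?thesis using that cd by (simp add: \<sigma>_def smooth_step_eq_1)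
    next
      case 2
      define S where "S = smooth_step c d t * (t - c)"
      have "0 \<le> S" "S \<le> 1 * (t - c)"
        unfolding S_def using 2 smooth_step_range[OF cd(2), of t] by (auto intro: mult_right_mono)
      then have "0 \<le> S" "S \<le> t - c" by simp_all
      then show ?thesis unfolding \<sigma>_def S_def[symmetric] using 2 cd by simp
    next
      case 3 then show ?thesis using cd by (simp add: \<sigma>_def smooth_step_eq_0)
    qed
  qed
  define r where "r y = y(j := \<sigma> (y j))" for y :: point
  let ?E = "topspace (Euclidean_space n)"
  have "restrict r ?E \<in> cart_hom R R"
  proof (rule Rn_cart_hom)
    show "r y \<in> ?E" if "y \<in> ?E" for y using that j by (auto simp: r_def topspace_Euclidean_space)
    have "C_diff k n ?E (\<lambda>y. \<sigma> (y j))" for k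
      unfolding \<sigma>_def
      by (intro C_diff_add C_diff_mult C_diff_diff C_diff_smooth_step C_diff_coord C_diff_const openin_topspace cd)
    then show "C_diff k n ?E (\<lambda>y. r y i)" for i k
      by (cases "i = j") (simp_all add: r_def C_diff_coord)
  qed
  moreover have rO: "r y \<in> ?O1 \<inter> ?O2" if y: "y \<in> ?O2" for y
    unfolding Oeq using y \<sigma>[of "y j"] j by (auto simp: r_def open_box_def topspace_Euclidean_space)
  ultimately have r: "restrict (restrict r ?E) ?O2 \<in> cart_hom (open_sub R ?O2) (open_sub R (?O1 \<inter> ?O2))"
  proof (intro cart_hom_restrict O2 O image_subsetI)
    fix y assume y: "y \<in> ?O2"
    then have "y \<in> ?E" by (simp add: open_box_def)
    then show "restrict r ?E y \<in> ?O1 \<inter> ?O2" using rO[OF y] by (simp only: restrict_apply if_True)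
  qed
  define A where "A = {y \<in> ?O1 \<inter> ?O2. y j < c}"
  have "\<exists>q. lift ?O2 q \<and> (\<forall>y\<in>A. q y = q1 y)"
  proof (rule lift_modify[OF O1 O2 O q1 q2 r])
    show "A \<subseteq> ?O1 \<inter> ?O2" by (auto simp: A_def)
    show "restrict (restrict r ?E) ?O2 y = y" if "y \<in> A" for y
      using that cd by (auto simp: A_def r_def \<sigma>_def smooth_step_eq_1 open_box_def)
  qed
  then obtain q2' where q2': "lift ?O2 q2'" "\<And>y. y \<in> A \<Longrightarrow> q2' y = q1 y" by blast
  \<comment> \<open>Since \<open>q2'\<close> equals \<open>q1\<close> on the part of the overlap
    below \<open>c\<close>, the function \<open>q\<close> is \<open>q1\<close> on the box cut off at
    \<open>c\<close> and \<open>q2'\<close> on the whole second box; these two boxes cover.\<close>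
  define q where "q = (\<lambda>y\<in>open_box n l u. if y j < c then q1 y else q2' y)"
  have "lift (open_box n l u) q"
  proof (rule lift_glue[OF open_box_opens[OF lu]])
    fix y assume y: "y \<in> open_box n l u"
    show "\<exists>S\<in>opens R. y \<in> S \<and> S \<subseteq> open_box n l u \<and> lift S (restrict q S)"
    proof (cases "y j < c")
      case True
      let ?S = "open_box n l (u(j := c))"
      have S: "?S \<in> opens R" using lu ab cd by (auto intro!: open_box_opens)
      have sub: "?S \<subseteq> ?O1" "?S \<subseteq> open_box n l u" using ab cd by (fastforce simp: open_box_def split: if_splits)+
      have "restrict q ?S = restrict q1 ?S" using sub j by (auto simp: q_def restrict_def fun_eq_iff open_box_def)
      then have "lift ?S (restrict q ?S)" using lift_restrict[OF q1 O1 S sub(1)] by simp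
      then show ?thesis using S sub y True by (intro bexI[of _ ?S]) (auto simp: open_box_def)
    next
      case False
      have sub: "?O2 \<subseteq> open_box n l u" using ab by (fastforce simp: open_box_def split: if_splits)
      have "q z = q2' z" if z: "z \<in> ?O2" for z
      proof (cases "z j < c")
        case True
        then have "z \<in> A" using z sub cd by (fastforce simp: A_def open_box_def split: if_splits)
        then show ?thesis using q2'(2) z sub True by (auto simp: q_def)
      qed (use z sub in \<open>auto simp: q_def\<close>)
      moreover have ext: "q2' \<in> extensional ?O2"
        using plots_PiE[OF P, of q2' "open_sub R ?O2"] q2'(1) by (simp add: lift_def PiE_iff)
      ultimately have "restrict q ?O2 = q2'"
        by (intro extensionalityI[OF restrict_extensional ext]) (simp only: restrict_apply if_True)
      then show ?thesis
        using q2'(1) sub O2 y False cd by (intro bexI[of _ ?O2]) (auto simp: open_box_def)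
    qed
  next
    show "q \<in> extensional (open_box n l u)" unfolding q_def by (rule restrict_extensional)
  qed
  then show ?thesis by blast
qed

text \<open>Lifts over a closed box are taken on an open neighbourhood of it; the margin
  \<open>e\<close> supplies the overlap needed for gluing.\<close>

definition liftable :: "(nat \<Rightarrow> real) \<Rightarrow> (nat \<Rightarrow> real) \<Rightarrow> bool" where
  "liftable a b \<longleftrightarrow> (\<exists>e>0. \<exists>q. lift (open_box n (\<lambda>i. a i - e) (\<lambda>i. b i + e)) q)"

text \<open>Induction on the number of directions in which the box may have positive length. A
  single point lifts because the projection is a subduction, and each further direction is added by
  bisection.\<close>

lemma liftable_closed_box:
  assumes "k \<le> n" "\<And>i. i < k \<Longrightarrow> a i \<le> b i" "\<And>i. k \<le> i \<Longrightarrow> i < n \<Longrightarrow> a i = b i"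
  shows "liftable a b"
  using assms
proof (induct k arbitrary: a b)
  case 0
  let ?y = "\<lambda>i. if i < n then a i else 0"
  have "?y \<in> points R" by (simp add: topspace_Euclidean_space)
  then obtain S q where S: "S \<in> opens R" "?y \<in> S" "lift S q" using lift_exists_locally by blast
  have "openin (Euclidean_space n) ((\<lambda>x. x) ` S)"
    using open_subset_charted[OF charted_Rn, of n S] S(1) by (simp add: opens_def)
  then obtain e where e: "e > 0" "\<And>z. z \<in> topspace (Euclidean_space n) \<Longrightarrow> (\<forall>i<n. \<bar>z i - ?y i\<bar> < e) \<Longrightarrow> z \<in> S"
    using openin_EuclideanD[of n S ?y] S(2) by auto
  let ?B = "open_box n (\<lambda>i. a i - e) (\<lambda>i. b i + e)"
  have "?B \<subseteq> S"
  proof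
    fix z assume z: "z \<in> ?B"
    show "z \<in> S"
    proof (rule e(2))
      show "\<forall>i<n. \<bar>z i - ?y i\<bar> < e" using z 0(3) by (auto simp: open_box_def abs_less_iff)
    qed (use z in \<open>simp add: open_box_def\<close>)
  qed
  moreover have "?B \<in> opens R" using e(1) 0(3) by (intro open_box_opens) auto
  ultimately have "lift ?B (restrict q ?B)" using lift_restrict[OF S(3,1)] by blast
  then show ?case using e(1) by (auto simp: liftable_def)
next
  case (Suc k)
  have k: "k < n" using Suc.prems(1) by simp
  have ab: "a i \<le> b i" if "i < n" for i using Suc.prems(2,3)[of i] that by (cases "i < Suc k") auto
  have "liftable (a(k := a k)) (b(k := b k))"
  \<comment> \<open>Compactness of the interval in direction \<open>k\<close>: liftability passes to
    the union of adjacent intervals by gluing along the margins around \<open>m\<close>, and holds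
    for all short intervals around \<open>y\<close> because the slice at \<open>y\<close> is
    liftable with a margin.\<close>
  proof (rule Bolzano[where P = "\<lambda>s t. liftable (a(k := s)) (b(k := t))"])
    show "a k \<le> b k" using Suc.prems(2) by simp
    show "liftable (a(k := s)) (b(k := t))"
      if st: "liftable (a(k := s)) (b(k := m))" "liftable (a(k := m)) (b(k := t))" "s \<le> m" "m \<le> t" for s m t
    proof -
      obtain e1 q1 where e1: "e1 > 0" "lift (open_box n (\<lambda>i. (a(k := s)) i - e1) (\<lambda>i. (b(k := m)) i + e1)) q1"
        using st(1) by (auto simp: liftable_def)
      obtain e2 q2 where e2: "e2 > 0" "lift (open_box n (\<lambda>i. (a(k := m)) i - e2) (\<lambda>i. (b(k := t)) i + e2)) q2"
        using st(2) by (auto simp: liftable_def)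
      define e where "e = min e1 e2"
      have e: "e > 0" "e \<le> e1" "e \<le> e2" using e1 e2 by (auto simp: e_def)
      let ?l = "\<lambda>i. (a(k := s)) i - e" and ?u = "\<lambda>i. (b(k := t)) i + e"
      have b1: "open_box n ?l (?u(k := m + e)) \<subseteq> open_box n (\<lambda>i. (a(k := s)) i - e1) (\<lambda>i. (b(k := m)) i + e1)"
        and b2: "open_box n (?l(k := m - e)) ?u \<subseteq> open_box n (\<lambda>i. (a(k := m)) i - e2) (\<lambda>i. (b(k := t)) i + e2)"
        using e by (fastforce simp: open_box_def split: if_splits)+
      show ?thesis
        unfolding liftable_def
      proof (intro exI[of _ e] conjI e(1) lift_boxes_glue[where a = "m - e" and b = "m + e"])
        show "lift (open_box n ?l (?u(k := m + e)))
            (restrict q1 (open_box n ?l (?u(k := m + e))))"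
        proof (rule lift_restrict[OF e1(2) _ _ b1]; rule open_box_opens)
          show "(a(k := s)) i - e1 < (b(k := m)) i + e1" if "i < n" for i using ab[OF that] e1(1) st(3) by auto
          show "?l i < (?u(k := m + e)) i" if "i < n" for i using ab[OF that] e(1) st(3) by auto
        qed
        show "lift (open_box n (?l(k := m - e)) ?u)
            (restrict q2 (open_box n (?l(k := m - e)) ?u))"
        proof (rule lift_restrict[OF e2(2) _ _ b2]; rule open_box_opens)
          show "(a(k := m)) i - e2 < (b(k := t)) i + e2" if "i < n" for i using ab[OF that] e2(1) st(4) by auto
          show "(?l(k := m - e)) i < ?u i" if "i < n" for i using ab[OF that] e(1) st(4) by auto
        qed
        show "?l i < ?u i" if "i < n" for i using ab[OF that] e(1) st(3,4) by auto
      qed (use k e st in auto)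
    qed
    show "\<exists>d>0. \<forall>s t. s \<le> y \<and> y \<le> t \<and> t - s < d \<longrightarrow> liftable (a(k := s)) (b(k := t))" for y
    proof -
      have "liftable (a(k := y)) (b(k := y))"
        by (rule Suc.hyps) (use Suc.prems in auto)
      then obtain e q where e: "e > 0" "lift (open_box n (\<lambda>i. (a(k := y)) i - e) (\<lambda>i. (b(k := y)) i + e)) q"
        by (auto simp: liftable_def)
      have "liftable (a(k := s)) (b(k := t))" if st: "s \<le> y" "y \<le> t" "t - s < e / 2" for s t
      proof -
        let ?B = "open_box n (\<lambda>i. (a(k := s)) i - e / 2) (\<lambda>i. (b(k := t)) i + e / 2)"
        have sub: "?B \<subseteq> open_box n (\<lambda>i. (a(k := y)) i - e) (\<lambda>i. (b(k := y)) i + e)"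
          using e(1) st by (fastforce simp: open_box_def split: if_splits)
        have "lift ?B (restrict q ?B)"
        proof (rule lift_restrict[OF e(2) _ _ sub]; rule open_box_opens)
          show "(a(k := y)) i - e < (b(k := y)) i + e" if "i < n" for i using ab[OF that] e(1) by auto
          show "(a(k := s)) i - e / 2 < (b(k := t)) i + e / 2" if "i < n" for i using ab[OF that] e(1) st by auto
        qed
        then show ?thesis unfolding liftable_def using e(1) by (intro exI[of _ "e / 2"]) auto
      qed
      then show ?thesis using e(1) by (intro exI[of _ "e / 2"]) auto
    qed
  qed
  then show ?case by simp
qed

definition cube_nbhd :: "nat \<Rightarrow> point set" where
  "cube_nbhd k = open_box n (\<lambda>i. - real (Suc k)) (\<lambda>i. real (Suc k))"

lemma cube_nbhd_opens: "cube_nbhd k \<in> opens R"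
  unfolding cube_nbhd_def by (rule open_box_opens) simp

lemma cube_nbhd_iff: "y \<in> cube_nbhd k \<longleftrightarrow> y \<in> topspace (Euclidean_space n) \<and> (\<forall>i<n. \<bar>y i\<bar> < real (Suc k))"
  by (auto simp: cube_nbhd_def open_box_def abs_less_iff)

lemma cube_nbhd_mono: "k \<le> l \<Longrightarrow> cube_nbhd k \<subseteq> cube_nbhd l"
  by (force simp: cube_nbhd_iff)

lemma lift_cube_nbhd: "\<exists>q. lift (cube_nbhd k) q"
proof -
  obtain e q where e: "e > 0" "lift (open_box n (\<lambda>i. - real (Suc k) - e) (\<lambda>i. real (Suc k) + e)) q"
    using liftable_closed_box[of n "\<lambda>i. - real (Suc k)" "\<lambda>i. real (Suc k)"] by (auto simp: liftable_def)
  have "lift (cube_nbhd k) (restrict q (cube_nbhd k))"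
  proof (rule lift_restrict[OF e(2) _ cube_nbhd_opens])
    show "open_box n (\<lambda>i. - real (Suc k) - e) (\<lambda>i. real (Suc k) + e) \<in> opens R" using e(1) by (intro open_box_opens) auto
    show "cube_nbhd k \<subseteq> open_box n (\<lambda>i. - real (Suc k) - e) (\<lambda>i. real (Suc k) + e)"
      using e(1) by (fastforce simp: cube_nbhd_def open_box_def)
  qed
  then show ?thesis by blast
qed

text \<open>The extension keeps \<open>q1\<close> only on the smaller cube
  \<open>cube_nbhd k\<close>; the collar between it and \<open>cube_nbhd (Suc k)\<close> is room for
  the map that pushes the largest cube into the middle one and fixes the smallest.\<close>

lemma lift_extend:
  assumes q1: "lift (cube_nbhd (Suc k)) q1"
  shows "\<exists>q. lift (cube_nbhd (Suc (Suc k))) q \<and> (\<forall>y\<in>cube_nbhd k. q y = q1 y)"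
proof -
  let ?O1 = "cube_nbhd (Suc k)" and ?O2 = "cube_nbhd (Suc (Suc k))"
  let ?E = "topspace (Euclidean_space n)"
  obtain q2 where q2: "lift ?O2 q2" using lift_cube_nbhd by blast
  have int: "?O1 \<inter> ?O2 = ?O1" using cube_nbhd_mono[of "Suc k" "Suc (Suc k)"] by auto
  define c d where "c = real (Suc k)" and "d = real (Suc (Suc k))"
  have cd: "c < d" "0 < d" by (auto simp: c_def d_def)
  \<comment> \<open>Here \<open>c\<close> and \<open>d\<close> are the half-sides of the smallest
    and of the middle cube. The two cut-offs make \<open>\<tau>\<close> the identity on arguments of
    absolute value below \<open>c\<close> and zero beyond \<open>d\<close>, and it never reaches
    \<open>d\<close> in absolute value.\<close>
  define \<tau> where "\<tau> t = smooth_step c d t * smooth_step c d (0 - t) * t" for t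
  have \<tau>: "\<bar>\<tau> t\<bar> < d" for t
  proof (cases "\<bar>t\<bar> < d")
    case True
    have "\<bar>smooth_step c d t * smooth_step c d (0 - t)\<bar> \<le> 1"
      using smooth_step_range[OF cd(1), of t] smooth_step_range[OF cd(1), of "0 - t"]
      by (simp add: abs_mult mult_le_one)
    then have "\<bar>\<tau> t\<bar> \<le> 1 * \<bar>t\<bar>" unfolding \<tau>_def abs_mult[of _ t] by (rule mult_right_mono) simp
    then show ?thesis using True by simp
  next
    case False
    then have "d \<le> t \<or> d \<le> 0 - t" by linarith
    then have "smooth_step c d t = 0 \<or> smooth_step c d (0 - t) = 0" using smooth_step_eq_0 by blast
    then show ?thesis using cd by (auto simp: \<tau>_def)
  qed
  define r where "r y = (\<lambda>i. if i < n then \<tau> (y i) else 0)" for y :: point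
  have "restrict r ?E \<in> cart_hom R R"
  proof (rule Rn_cart_hom)
    show "r y \<in> ?E" for y by (simp add: r_def topspace_Euclidean_space)
    have "C_diff k n ?E (\<lambda>y. \<tau> (y j))" for j k
      unfolding \<tau>_def
      by (intro C_diff_mult C_diff_diff C_diff_smooth_step C_diff_coord C_diff_const openin_topspace cd)
    then show "C_diff k n ?E (\<lambda>y. r y j)" if "j < n" for j k using that by (simp add: r_def)
  qed
  moreover have "r y \<in> ?O1" for y
    using \<tau> by (auto simp: cube_nbhd_iff r_def topspace_Euclidean_space d_def)
  ultimately have r: "restrict (restrict r ?E) ?O2 \<in> cart_hom (open_sub R ?O2) (open_sub R (?O1 \<inter> ?O2))"
    unfolding int by (intro cart_hom_restrict cube_nbhd_opens) (auto simp: cube_nbhd_iff)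
  show ?thesis
  proof (rule lift_modify[OF cube_nbhd_opens cube_nbhd_opens _ q1 q2 r])
    show "?O1 \<inter> ?O2 \<in> opens R" unfolding int by (rule cube_nbhd_opens)
    show "cube_nbhd k \<subseteq> ?O1 \<inter> ?O2" unfolding int by (rule cube_nbhd_mono) simp
    show "restrict (restrict r ?E) ?O2 y = y" if y: "y \<in> cube_nbhd k" for y
    proof -
      have "y \<in> ?O2" using y cube_nbhd_mono[of k "Suc (Suc k)"] by auto
      moreover have "\<tau> (y i) = y i" if "i < n" for i
      proof -
        have "\<bar>y i\<bar> < c" using y that by (auto simp: cube_nbhd_iff c_def)
        then show ?thesis using cd by (simp add: \<tau>_def smooth_step_eq_1)
      qed
      ultimately show ?thesis using y by (auto simp: r_def cube_nbhd_iff topspace_Euclidean_space fun_eq_iff)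
    qed
  qed
qed

text \<open>The lift over the k-th cube is never changed again from stage \<open>k\<close> on, so
  the lifts over an exhausting sequence of cubes have a limit that is locally one of them.\<close>

lemma global_lift: "\<exists>q\<in>plots P R. \<forall>u\<in>points R. \<pi> (q u) = x u"
proof -
  have "\<exists>f. \<forall>k. lift (cube_nbhd (Suc k)) (f k) \<and> (\<forall>y\<in>cube_nbhd k. f (Suc k) y = f k y)"
    using lift_cube_nbhd[of "Suc 0"] lift_extend
    by (intro dependent_nat_choice[where P = "\<lambda>k q. lift (cube_nbhd (Suc k)) q"]) auto
  then obtain f where f: "\<And>k. lift (cube_nbhd (Suc k)) (f k)" "\<And>k y. y \<in> cube_nbhd k \<Longrightarrow> f (Suc k) y = f k y"
    by blast
  have stable: "f l y = f k y" if "k \<le> l" "y \<in> cube_nbhd k" for k l y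
    using that
  proof (induct l rule: dec_induct)
    case (step l)
    then show ?case using f(2)[of y l] cube_nbhd_mono[of k l] by auto
  qed simp
  have ex: "\<exists>k. y \<in> cube_nbhd k" if y: "y \<in> points R" for y
  proof -
    define m where "m = Max (insert 0 ((\<lambda>i. \<bar>y i\<bar>) ` {..<n}))"
    obtain k where "m < real k" using reals_Archimedean2 by blast
    moreover have "\<bar>y i\<bar> \<le> m" if "i < n" for i unfolding m_def using that by (intro Max_ge) auto
    ultimately have "y \<in> cube_nbhd k" using y by (force simp: cube_nbhd_iff)
    then show ?thesis ..
  qed
  define q where "q = (\<lambda>y\<in>points R. f (LEAST k. y \<in> cube_nbhd k) y)"
  have sub: "cube_nbhd k \<subseteq> points R" for k by (auto simp: cube_nbhd_iff)
  have q: "q y = f k y" if y: "y \<in> cube_nbhd k" for k y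
  proof -
    have "y \<in> cube_nbhd (LEAST k. y \<in> cube_nbhd k)" by (rule LeastI[of "\<lambda>k. y \<in> cube_nbhd k", OF y])
    moreover have "(LEAST k. y \<in> cube_nbhd k) \<le> k" by (rule Least_le[of "\<lambda>k. y \<in> cube_nbhd k", OF y])
    ultimately show ?thesis using stable[of _ k y] sub y by (auto simp: q_def)
  qed
  have "lift (points R) q"
  proof (rule lift_glue[OF points_opens[OF Rn_Cart]])
    fix y assume "y \<in> points R"
    then obtain k where k: "y \<in> cube_nbhd k" using ex by blast
    have "restrict q (cube_nbhd k) = restrict (f k) (cube_nbhd k)" using q by (auto simp: restrict_def)
    moreover have "lift (cube_nbhd k) (restrict (f k) (cube_nbhd k))"
      by (rule lift_restrict[OF f(1) cube_nbhd_opens cube_nbhd_opens cube_nbhd_mono]) simp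
    ultimately show "\<exists>S\<in>opens R. y \<in> S \<and> S \<subseteq> points R \<and> lift S (restrict q S)"
      using k sub cube_nbhd_opens by metis
  next
    show "q \<in> extensional (points R)" unfolding q_def by (rule restrict_extensional)
  qed
  then show ?thesis unfolding lift_def open_sub_points[OF Rn_Cart] by blast
qed

end

context diff_bundle
begin

lemma plot_lift:
  assumes x: "x \<in> plots X U" shows "\<exists>q\<in>plots P U. \<forall>u\<in>points U. \<pi> (q u) = x u"
proof -
  let ?n = "mdim U"
  have U: "U \<in> Cart" by (rule plots_Cart[OF X x])
  then obtain f where f: "diffeomorphism U (Rn ?n) f" by (auto simp: Cart_def)
  let ?g = "restrict (inv_into (points U) f) (points (Rn ?n))"
  have fc: "f \<in> cart_hom U (Rn ?n)" and gc: "?g \<in> cart_hom (Rn ?n) U"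
    using f U Rn_Cart by (auto simp: diffeomorphism_def cart_hom_iff)
  have b: "bij_betw f (points U) (points (Rn ?n))" using f by (simp add: diffeomorphism_def)
  interpret diff_bundle_plot X G E ?n "compose (points (Rn ?n)) x ?g"
    by unfold_locales (rule plots_compose[OF X x gc])
  obtain q where q: "q \<in> plots P (Rn ?n)" "\<And>v. v \<in> points (Rn ?n) \<Longrightarrow> \<pi> (q v) = compose (points (Rn ?n)) x ?g v"
    using global_lift by blast
  have "\<pi> (compose (points U) q f u) = x u" if u: "u \<in> points U" for u
  proof -
    have "f u \<in> points (Rn ?n)" using b u by (auto simp: bij_betw_def)
    moreover have "inv_into (points U) f (f u) = u" using b u by (auto simp: bij_betw_def)
    ultimately show ?thesis using q(2)[of "f u"] u by (simp add: compose_def del: points_Rn)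
  qed
  then show ?thesis using plots_compose[OF P q(1) fc] by blast
qed

end

section \<open>Path components of simplicial sets\<close>

text \<open>The target \<open>[n]\<close> is left implicit, so one term is the vertex
  \<open>i\<close> of every simplex that has one.\<close>

definition vtx :: "nat \<Rightarrow> nat \<Rightarrow> nat" where "vtx i = (\<lambda>_\<in>{..0}. i)"

lemma vtx_Delta: "i \<le> n \<Longrightarrow> vtx i \<in> Delta 0 n"
  unfolding vtx_def by (rule DeltaI) auto

lemma vtx_0 [simp]: "vtx i 0 = i"
  by (simp add: vtx_def)

lemma compose_vtx [simp]: "compose {..0} \<beta> (vtx i) = vtx (\<beta> i)" "compose {0} \<beta> (vtx i) = vtx (\<beta> i)"
  by (auto simp: vtx_def compose_def fun_eq_iff)

definition vert :: "'a sset \<Rightarrow> nat \<Rightarrow> 'a \<Rightarrow> 'a" where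
  "vert K n x = sop K 0 n (vtx 0) x"

definition edge :: "'a sset \<Rightarrow> 'a \<Rightarrow> 'a \<Rightarrow> bool" where
  "edge K a b \<longleftrightarrow> (\<exists>e\<in>cells K 1. a = sop K 0 1 (vtx 0) e \<and> b = sop K 0 1 (vtx 1) e)"

definition conn :: "'a sset \<Rightarrow> 'a \<Rightarrow> 'a \<Rightarrow> bool" where
  "conn K = equivclp (edge K)"

lemma conn_refl [simp]: "conn K a a"
  by (simp add: conn_def)

lemma conn_sym: "conn K a b \<Longrightarrow> conn K b a"
  unfolding conn_def by (rule equivclp_sym)

lemma conn_trans: "conn K a b \<Longrightarrow> conn K b c \<Longrightarrow> conn K a c"
  unfolding conn_def by (rule equivclp_trans)

lemma edge_conn: "edge K a b \<Longrightarrow> conn K a b"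
  unfolding conn_def by (rule r_into_equivclp)

lemma edge_conn_either: "edge K a b \<or> edge K b a \<Longrightarrow> conn K a b"
  using edge_conn[of K a b] conn_sym[OF edge_conn[of K b a]] by blast

lemma conn_induct [consumes 1, case_names base step]:
  assumes "conn K a b" "P a" "\<And>y z. conn K a y \<Longrightarrow> edge K y z \<or> edge K z y \<Longrightarrow> P y \<Longrightarrow> P z"
  shows "P b"
  using assms(1) unfolding conn_def
  by (rule equivclp_induct) (use assms(2,3) in \<open>auto simp: conn_def\<close>)

lemma conn_map:
  assumes \<phi>: "simplicial_map K L \<phi>" and c: "conn K a b"
  shows "conn L (\<phi> 0 a) (\<phi> 0 b)"
  using c
proof (induct rule: conn_induct)
  case (step y z)
  have "edge L (\<phi> 0 a) (\<phi> 0 b)" if ab: "edge K a b" for a b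
  proof -
    obtain e where e: "e \<in> cells K 1" "a = sop K 0 1 (vtx 0) e" "b = sop K 0 1 (vtx 1) e"
      using ab unfolding edge_def by blast
    show ?thesis
      unfolding edge_def e(2,3) simplicial_map_sop[OF \<phi> vtx_Delta[OF le0] e(1)]
        simplicial_map_sop[OF \<phi> vtx_Delta[OF order_refl] e(1)]
      using simplicial_map_cells[OF \<phi> e(1)] by blast
  qed
  then have "conn L (\<phi> 0 y) (\<phi> 0 z)" using step(2) by (intro edge_conn_either) blast
  then show ?case by (rule conn_trans[OF step(3)])
qed simp

lemma conn_discrete:
  assumes "conn (sdiscrete A) a b" shows "a = b"
  using assms
proof (induct rule: conn_induct)
  case (step y z)
  have "a = b" if ab: "edge (sdiscrete A) a b" for a b
  proof -
    obtain e where e: "e \<in> A" "a = sop (sdiscrete A) 0 1 (vtx 0) e" "b = sop (sdiscrete A) 0 1 (vtx 1) e"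
      using ab by (auto simp: edge_def sdiscrete_def)
    then show ?thesis
      unfolding sdiscrete_def by (simp only: sop_sset_of[OF vtx_Delta[OF le0]] sop_sset_of[OF vtx_Delta[OF order_refl]])
  qed
  then show ?case using step by metis
qed simp

context
  fixes K :: "'a sset"
  assumes K: "simplicial_set K"
begin

lemma edge_cells: "edge K a b \<Longrightarrow> a \<in> cells K 0 \<and> b \<in> cells K 0"
  unfolding edge_def using sop_cells[OF K vtx_Delta] by auto

lemma conn_cells: "conn K a b \<Longrightarrow> a \<in> cells K 0 \<Longrightarrow> b \<in> cells K 0"
  by (induct rule: conn_induct) (use edge_cells in blast)+

lemma vert_cells: "x \<in> cells K n \<Longrightarrow> vert K n x \<in> cells K 0"
  unfolding vert_def by (rule sop_cells[OF K vtx_Delta]) simp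

lemma vert_0: "x \<in> cells K 0 \<Longrightarrow> vert K 0 x = x"
proof -
  assume x: "x \<in> cells K 0"
  have "vtx 0 = (\<lambda>i\<in>{..0}. i)" by (auto simp: vtx_def)
  then show ?thesis unfolding vert_def using sop_id[OF K x] by simp
qed

lemma conn_vertices:
  assumes x: "x \<in> cells K n" and i: "i \<le> n"
  shows "conn K (vert K n x) (sop K 0 n (vtx i) x)"
proof -
  let ?\<epsilon> = "\<lambda>k\<in>{..1}. if k = 0 then 0 else i"
  have e: "?\<epsilon> \<in> Delta 1 n" by (rule DeltaI) (use i in auto)
  have "sop K 0 1 (vtx 0) (sop K 1 n ?\<epsilon> x) = vert K n x"
    "sop K 0 1 (vtx 1) (sop K 1 n ?\<epsilon> x) = sop K 0 n (vtx i) x"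
    unfolding vert_def sop_compose[OF K vtx_Delta[OF le0] e x] sop_compose[OF K vtx_Delta[OF order_refl] e x]
    by simp_all
  then have "edge K (vert K n x) (sop K 0 n (vtx i) x)"
    unfolding edge_def using sop_cells[OF K e x] by metis
  then show ?thesis by (rule edge_conn)
qed

text \<open>The initial vertex of the new simplex is the vertex \<open>\<alpha> 0\<close> of
  \<open>x\<close>, which an edge of \<open>x\<close> joins to the initial vertex of
  \<open>x\<close>.\<close>

lemma conn_vert_sop:
  assumes x: "x \<in> cells K n" and a: "\<alpha> \<in> Delta m n"
  shows "conn K (vert K n x) (vert K m (sop K m n \<alpha> x))"
proof -
  have "vert K m (sop K m n \<alpha> x) = sop K 0 n (vtx (\<alpha> 0)) x"
    unfolding vert_def sop_compose[OF K vtx_Delta[OF le0] a x]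
    by simp
  then show ?thesis using conn_vertices[OF x Delta_le[OF a le0]] by simp
qed

text \<open>Sending a point to the component of the initial vertex of its simplex respects the
  gluing and is constant on simplices. It is therefore a continuous function from the realization to
  a discrete space, hence constant along paths.\<close>

lemma path_component_conn:
  assumes x: "x \<in> cells K n" "t \<in> standard_simplex n" and y: "y \<in> cells K m" "u \<in> standard_simplex m"
    and p: "path_component_of (realization K) (rpt K n x t) (rpt K m y u)"
  shows "conn K (vert K n x) (vert K m y)"
proof -
  define \<Phi> where "\<Phi> = (\<lambda>((n, x), t :: nat \<Rightarrow> real). Collect (conn K (vert K n x)))"
  have eq: "Collect (conn K a) = Collect (conn K b)" if "conn K a b" for a b
    using conn_trans[OF that] conn_trans[OF conn_sym[OF that]] by blast
  have c: "continuous_map (simplex_sum K) (discrete_topology UNIV) \<Phi>"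
    by (rule continuous_map_simplex_sum[OF K]) (simp add: \<Phi>_def)
  obtain g where g: "continuous_map (realization K) (discrete_topology UNIV) g"
    "\<And>z. z \<in> topspace (simplex_sum K) \<Longrightarrow> g (glue_equiv K `` {z}) = \<Phi> z"
  proof (rule quotient_map_lift_exists[OF quotient_map_realization[OF K] c])
    fix z z' assume "glue_equiv K `` {z} = glue_equiv K `` {z'}"
    then have "(z, z') \<in> glue_equiv K" by (rule eq_equiv_class[OF _ equiv_glue_equiv]) simp
    then show "\<Phi> z = \<Phi> z'"
    proof (rule glue_equiv_invariant[OF K, rotated])
      fix m n \<alpha> x and t :: "nat \<Rightarrow> real" assume "\<alpha> \<in> Delta m n" "x \<in> cells K n"
      then show "\<Phi> ((m, sop K m n \<alpha> x), t) = \<Phi> ((n, x), affine_map m \<alpha> t)"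
        unfolding \<Phi>_def prod.case by (intro eq conn_sym[OF conn_vert_sop])
    qed
  qed blast
  have gr: "g (rpt K n x t) = Collect (conn K (vert K n x))" if "x \<in> cells K n" "t \<in> standard_simplex n" for n x t
    using g(2)[of "((n, x), t)"] that by (simp add: rpt_def \<Phi>_def topspace_simplex_sum[OF K])
  obtain T where T: "path_connectedin (realization K) T" "rpt K n x t \<in> T" "rpt K m y u \<in> T"
    using p unfolding path_component_of by blast
  have "connectedin (discrete_topology UNIV) (g ` T)"
    by (rule path_connectedin_imp_connectedin[OF path_connectedin_continuous_map_image[OF g(1) T(1)]])
  then obtain a where "g ` T \<subseteq> {a}" unfolding connectedin_discrete_topology by blast
  then have "g (rpt K n x t) = g (rpt K m y u)" using T(2,3) by blast
  then have "Collect (conn K (vert K n x)) = Collect (conn K (vert K m y))" using gr x y by simp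
  then show ?thesis using conn_refl[of K "vert K m y"] by blast
qed

end

section \<open>Paths in the realization and singular 1-simplices\<close>

definition e0 :: "nat \<Rightarrow> real" where "e0 = (\<lambda>j. if j = 0 then 1 else 0)"

definition corner :: "nat \<Rightarrow> nat \<Rightarrow> real" where "corner i = (\<lambda>j. if j = i then 1 else 0)"

lemma e0_simplex: "e0 \<in> standard_simplex 0"
  by (simp add: e0_def standard_simplex_0)

lemma corner_simplex: "i \<le> n \<Longrightarrow> corner i \<in> standard_simplex n"
  unfolding corner_def by (rule basis_in_standard_simplex[THEN iffD2])

lemma affine_const:
  assumes t: "t \<in> standard_simplex m" and c: "\<And>l. l \<le> m \<Longrightarrow> \<beta> l = i"
  shows "affine_map m \<beta> t = corner i"
proof
  fix j
  show "affine_map m \<beta> t j = corner i j"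
  proof (cases "j = i")
    case True
    then have "{l. l \<le> m \<and> \<beta> l = j} = {..m}" using c by auto
    then show ?thesis using t True by (simp add: affine_map_def corner_def standard_simplex_def)
  next
    case False
    then have "{l. l \<le> m \<and> \<beta> l = j} = {}" using c by auto
    then show ?thesis using False by (simp only: affine_map_def corner_def sum.empty if_False)
  qed
qed

lemma singular_path:
  assumes "singular_simplex 1 Z \<sigma>"
  shows "path_component_of Z (\<sigma> (corner 0)) (\<sigma> (corner 1))"
proof -
  have "path_connectedin Z (\<sigma> ` standard_simplex 1)"
  proof -
    have "path_connectedin (top_simplex 1) (standard_simplex 1)"
      using path_connectedin_standard_simplex path_connectedin_subtopology by blast
    then show ?thesis
      using assms path_connectedin_continuous_map_image unfolding singular_simplex_def by blast
  qed
  then show ?thesis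
    unfolding path_component_of using corner_simplex[of 0 1] corner_simplex[of 1 1] by blast
qed

lemma path_singular:
  assumes "path_component_of Z p q"
  shows "\<exists>\<sigma>. singular_simplex 1 Z \<sigma> \<and> \<sigma> (corner 0) = p \<and> \<sigma> (corner 1) = q"
proof -
  obtain \<gamma> where \<gamma>: "pathin Z \<gamma>" "\<gamma> 0 = p" "\<gamma> 1 = q" using assms by (auto simp: path_component_of_def)
  let ?\<sigma> = "\<lambda>t\<in>standard_simplex 1. \<gamma> (t 1)"
  have "continuous_map (top_simplex 1) (top_of_set {0..1}) (\<lambda>t. t 1)"
    unfolding continuous_map_in_subtopology
  proof
    show "continuous_map (top_simplex 1) euclidean (\<lambda>t. t 1)"
      by (intro continuous_map_from_subtopology continuous_map_product_projection) simp
  qed (auto simp: standard_simplex_def)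
  then have "continuous_map (top_simplex 1) Z (\<lambda>t. \<gamma> (t 1))"
    using continuous_map_compose[OF _ \<gamma>(1)[unfolded pathin_def]] by (fastforce simp: o_def)
  then have "continuous_map (top_simplex 1) Z ?\<sigma>"
    by (rule continuous_map_eq) simp
  then have "singular_simplex 1 Z ?\<sigma>" by (simp add: singular_simplex_def)
  moreover have "?\<sigma> (corner 0) = p" "?\<sigma> (corner 1) = q"
    using \<gamma> corner_simplex[of 0 1] corner_simplex[of 1 1] by (simp_all add: corner_def)
  ultimately show ?thesis by blast
qed

lemma conn_path_component:
  assumes K: "simplicial_set K" and a: "a \<in> cells K 0" and c: "conn K a b"
  shows "path_component_of (realization K) (rpt K 0 a e0) (rpt K 0 b e0)"
  using c
proof (induct rule: conn_induct)
  case base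
  show ?case using rpt_in_topspace[OF K a e0_simplex] by (simp add: path_component_of_refl)
next
  case (step y z)
  have "path_component_of (realization K) (rpt K 0 a e0) (rpt K 0 b e0)" if ab: "edge K a b" for a b
  proof -
    obtain e where e: "e \<in> cells K 1" "a = sop K 0 1 (vtx 0) e" "b = sop K 0 1 (vtx 1) e"
      using ab by (auto simp: edge_def)
    let ?\<sigma> = "restrict (rpt K 1 e) (standard_simplex 1)"
    have "continuous_map (top_simplex 1) (realization K) ?\<sigma>"
      by (rule continuous_map_eq[OF continuous_map_rpt[OF K e(1)]]) simp
    then have "singular_simplex 1 (realization K) ?\<sigma>" by (simp add: singular_simplex_def)
    from singular_path[OF this] have "path_component_of (realization K) (rpt K 1 e (corner 0)) (rpt K 1 e (corner 1))"
      using corner_simplex[of 0 1] corner_simplex[of 1 1] by simp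
    moreover have "rpt K 0 (sop K 0 1 (vtx i) e) e0 = rpt K 1 e (corner i)" if "i \<le> 1" for i
      using rpt_glue[OF K vtx_Delta[OF that] e(1) e0_simplex] affine_const[OF e0_simplex, of "vtx i" i] by simp
    ultimately show ?thesis using e(2,3) by simp
  qed
  note edge_path = this
  have "path_component_of (realization K) (rpt K 0 y e0) (rpt K 0 z e0)"
    using step(2) by (elim disjE) (rule edge_path, assumption, rule path_component_of_sym, rule edge_path, assumption)
  then show ?case by (rule path_component_of_trans[OF step(3)])
qed

section \<open>Local weak equivalences on path components\<close>

lemma cells_sing [simp]: "cells (sing Z) n = singular_simplex_set n Z"
  by (simp add: sing_def)

lemma sop_sing:
  "\<alpha> \<in> Delta m n \<Longrightarrow> singular_simplex n Z f \<Longrightarrow> sop (sing Z) m n \<alpha> f = (\<lambda>t\<in>standard_simplex m. f (affine_map m \<alpha> t))"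
  by (simp add: sing_def)

lemma singular_affine:
  assumes a: "\<alpha> \<in> Delta m n" and f: "singular_simplex n Z f"
  shows "singular_simplex m Z (\<lambda>t\<in>standard_simplex m. f (affine_map m \<alpha> t))"
proof -
  have "continuous_map (top_simplex m) Z (f \<circ> affine_map m \<alpha>)"
    by (rule continuous_map_compose[OF continuous_map_affine[OF a]]) (use f in \<open>simp add: singular_simplex_def\<close>)
  then have "continuous_map (top_simplex m) Z (\<lambda>t\<in>standard_simplex m. f (affine_map m \<alpha> t))"
    by (rule continuous_map_eq) simp
  then show ?thesis by (simp add: singular_simplex_def)
qed

lemma cells_std_simplex [simp]: "cells (std_simplex n) m = Delta m n"
  by (simp add: std_simplex_def)

lemma sop_std_simplex:
  "\<alpha> \<in> Delta k m \<Longrightarrow> \<beta> \<in> Delta m n \<Longrightarrow> sop (std_simplex n) k m \<alpha> \<beta> = compose {..k} \<beta> \<alpha>"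
  by (simp add: std_simplex_def)

lemma cells_boundary: "cells (boundary n) m = {\<beta> \<in> Delta m n. \<exists>i\<le>n. i \<notin> \<beta> ` {..m}}"
  by (simp add: boundary_def)

lemma sop_boundary:
  "\<alpha> \<in> Delta k m \<Longrightarrow> \<beta> \<in> cells (boundary n) m \<Longrightarrow> sop (boundary n) k m \<alpha> \<beta> = compose {..k} \<beta> \<alpha>"
  by (simp add: boundary_def)

text \<open>The simplicial map from the standard simplex to the singular complex that classifies the
  singular simplex \<open>\<sigma>\<close>.\<close>

definition yoneda :: "nat \<Rightarrow> ((nat \<Rightarrow> real) \<Rightarrow> 'a) \<Rightarrow> nat \<Rightarrow> (nat \<Rightarrow> nat) \<Rightarrow> (nat \<Rightarrow> real) \<Rightarrow> 'a" where
  "yoneda n \<sigma> m = (\<lambda>\<beta>\<in>Delta m n. \<lambda>t\<in>standard_simplex m. \<sigma> (affine_map m \<beta> t))"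

lemma simplicial_map_yoneda:
  assumes \<sigma>: "singular_simplex n Z \<sigma>"
  shows "simplicial_map (std_simplex n) (sing Z) (yoneda n \<sigma>)"
proof (rule simplicial_mapI)
  show "yoneda n \<sigma> m \<beta> \<in> cells (sing Z) m" if "\<beta> \<in> cells (std_simplex n) m" for m \<beta>
    using that singular_affine[OF _ \<sigma>] by (simp add: yoneda_def)
  show "yoneda n \<sigma> m \<in> extensional (cells (std_simplex n) m)" for m by (simp add: yoneda_def)
  fix k m \<alpha> \<beta> assume a: "\<alpha> \<in> Delta k m" and "\<beta> \<in> cells (std_simplex n) m"
  then have b: "\<beta> \<in> Delta m n" by simp
  show "yoneda n \<sigma> k (sop (std_simplex n) k m \<alpha> \<beta>) = sop (sing Z) k m \<alpha> (yoneda n \<sigma> m \<beta>)"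
  proof -
    have "yoneda n \<sigma> m \<beta> = (\<lambda>t\<in>standard_simplex m. \<sigma> (affine_map m \<beta> t))" using b by (simp add: yoneda_def)
    then have "sop (sing Z) k m \<alpha> (yoneda n \<sigma> m \<beta>) =
        (\<lambda>t\<in>standard_simplex k. (\<lambda>t\<in>standard_simplex m. \<sigma> (affine_map m \<beta> t)) (affine_map k \<alpha> t))"
      using sop_sing[OF a singular_affine[OF b \<sigma>]] by simp
    also have "\<dots> = (\<lambda>t\<in>standard_simplex k. \<sigma> (affine_map k (compose {..k} \<beta> \<alpha>) t))"
      by (rule restrict_ext) (simp add: affine_map_compose[OF a b] affine_map_in_simplex[OF a])
    finally show ?thesis using Delta_compose[OF a b] by (simp add: yoneda_def sop_std_simplex[OF a b])
  qed
qed

lemma fib_map_eq: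
  assumes "singular_simplex n (realization K) f"
  shows "fib_map K L \<phi> n f = (\<lambda>t\<in>standard_simplex n. realization_map L \<phi> (f t))"
  using assms by (simp add: fib_map_def srestrict_def fib_def simplex_map_def o_def)

text \<open>\<open>A\<close> and \<open>Y\<close> are the values over a cartesian space,
  \<open>A'\<close> and \<open>Y'\<close> those over one member of a cover, \<open>r\<close> and
  \<open>s\<close> the restrictions. The assumption \<open>lift\<close> is the condition of a local
  weak equivalence for this member.\<close>

locale sset_square =
  fixes A :: "'a sset" and Y :: "'b sset" and A' :: "'a sset" and Y' :: "'b sset" and f f' r s
  assumes A: "simplicial_set A" and Y: "simplicial_set Y" and A': "simplicial_set A'" and Y': "simplicial_set Y'"
    and f: "simplicial_map A Y f" and f': "simplicial_map A' Y' f'"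
    and r: "simplicial_map A A' r" and s: "simplicial_map Y Y' s"
    and lift: "\<And>n a y. simplicial_map (boundary n) (fib A) a \<Longrightarrow> simplicial_map (std_simplex n) (fib Y) y \<Longrightarrow>
      scomp (boundary n) (fib_map A Y f) a = srestrict (boundary n) y \<Longrightarrow>
      \<exists>l. simplicial_map (std_simplex n) (fib A') l \<and>
        srestrict (boundary n) l = scomp (boundary n) (fib_map A A' r) a \<and>
        homotopic_rel_boundary n (fib Y') (scomp (std_simplex n) (fib_map A' Y' f') l)
          (scomp (std_simplex n) (fib_map Y Y' s) y)"
begin

text \<open>The lifting problem for n = 0. The lift is a point of the realization of
  \<open>A'\<close>; the initial vertex of a simplex containing it serves as \<open>a\<close>, and
  the homotopy is a path between the two images in the realization of \<open>Y'\<close>.\<close>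

lemma components_surj:
  assumes y: "y \<in> cells Y 0"
  shows "\<exists>a\<in>cells A' 0. conn Y' (f' 0 a) (s 0 y)"
proof -
  let ?p = "rpt Y 0 y e0"
  let ?\<sigma> = "\<lambda>t\<in>standard_simplex 0. ?p"
  have pt: "?p \<in> topspace (realization Y)" by (rule rpt_in_topspace[OF Y y e0_simplex])
  have "continuous_map (top_simplex 0) (realization Y) (\<lambda>_. ?p)" using pt by simp
  then have "continuous_map (top_simplex 0) (realization Y) ?\<sigma>"
    by (rule continuous_map_eq) simp
  then have \<sigma>: "singular_simplex 0 (realization Y) ?\<sigma>" by (simp add: singular_simplex_def)
  have empty: "cells (boundary 0) m = {}" for m
    by (auto simp: cells_boundary Delta_def PiE_iff)
  \<comment> \<open>The boundary of the 0-simplex is empty, and \<open>undefined\<close> is the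
    value that extensionality then prescribes.\<close>
  define a where "a = (\<lambda>(m::nat) (\<beta>::nat \<Rightarrow> nat). undefined :: (nat \<Rightarrow> real) \<Rightarrow> 'a rpoint set)"
  have "simplicial_map (boundary 0) (fib A) a"
    by (rule simplicial_mapI) (auto simp: empty a_def)
  moreover have "scomp (boundary 0) (fib_map A Y f) a = srestrict (boundary 0) (yoneda 0 ?\<sigma>)"
    by (auto simp: scomp_def srestrict_def empty compose_def fun_eq_iff)
  ultimately obtain l where l: "simplicial_map (std_simplex 0) (fib A') l"
    and hom: "homotopic_rel_boundary 0 (fib Y') (scomp (std_simplex 0) (fib_map A' Y' f') l)
          (scomp (std_simplex 0) (fib_map Y Y' s) (yoneda 0 ?\<sigma>))"
    using lift[OF _ simplicial_map_yoneda[OF \<sigma>, folded fib_def]] by blast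
  obtain H where H: "simplicial_map (sprod (std_simplex 0) (std_simplex 1)) (fib Y') H"
    and H01: "\<And>m x. x \<in> Delta m 0 \<Longrightarrow> H m (x, \<lambda>i\<in>{..m}. 0) = scomp (std_simplex 0) (fib_map A' Y' f') l m x"
      "\<And>m x. x \<in> Delta m 0 \<Longrightarrow> H m (x, \<lambda>i\<in>{..m}. 1) = scomp (std_simplex 0) (fib_map Y Y' s) (yoneda 0 ?\<sigma>) m x"
    using hom unfolding homotopic_rel_boundary_def cells_std_simplex by blast
  have v: "vtx 0 \<in> Delta 0 0" by (rule vtx_Delta) simp
  define w where "w = l 0 (vtx 0) e0"
  have ls: "singular_simplex 0 (realization A') (l 0 (vtx 0))"
    using simplicial_map_cells[OF l, of "vtx 0" 0] v by (simp add: fib_def)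
  then have "w \<in> topspace (realization A')"
    unfolding w_def singular_simplex_def continuous_map_def using e0_simplex by auto
  then obtain n x t where x: "x \<in> cells A' n" "t \<in> standard_simplex n" "w = rpt A' n x t"
    by (rule realizationE[OF A'])
  \<comment> \<open>The pair \<open>(?b, ?i)\<close> is the fundamental edge of the product of the
    0-simplex with the interval, and \<open>H\<close> sends it to the path in question.\<close>
  let ?b = "\<lambda>i\<in>{..1}. 0 :: nat" and ?i = "\<lambda>i\<in>{..1}. i :: nat"
  have bi: "?b \<in> Delta 1 0" "?i \<in> Delta 1 1" by (rule DeltaI; simp)+
  have \<tau>c: "H 1 (?b, ?i) \<in> cells (fib Y') 1"
    by (rule simplicial_map_cells[OF H]) (use bi in \<open>simp add: sprod_def\<close>)
  then have \<tau>: "singular_simplex 1 (realization Y') (H 1 (?b, ?i))" by (simp add: fib_def)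
  have ends: "H 0 (vtx 0, vtx i) = (\<lambda>t\<in>standard_simplex 0. H 1 (?b, ?i) (corner i))" if i: "i \<le> 1" for i
  proof -
    have "compose {..0} ?b (vtx i) = vtx 0" "compose {..0} ?i (vtx i) = vtx i"
      using i by simp_all
    then have "sop (sprod (std_simplex 0) (std_simplex 1)) 0 1 (vtx i) (?b, ?i) = (vtx 0, vtx i)"
      using bi vtx_Delta[OF i] by (simp add: sprod_def sop_std_simplex)
    then have "H 0 (vtx 0, vtx i) = sop (fib Y') 0 1 (vtx i) (H 1 (?b, ?i))"
      using simplicial_map_sop[OF H vtx_Delta[OF i], of "(?b, ?i)"] bi by (simp add: sprod_def)
    also have "\<dots> = (\<lambda>t\<in>standard_simplex 0. H 1 (?b, ?i) (affine_map 0 (vtx i) t))"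
      unfolding fib_def by (rule sop_sing[OF vtx_Delta[OF i] \<tau>])
    also have "\<dots> = (\<lambda>t\<in>standard_simplex 0. H 1 (?b, ?i) (corner i))"
    proof (rule restrict_ext)
      fix t assume "t \<in> standard_simplex 0"
      then show "H 1 (?b, ?i) (affine_map 0 (vtx i) t) = H 1 (?b, ?i) (corner i)"
        using affine_const[of t 0 "vtx i" i] by simp
    qed
    finally show ?thesis .
  qed
  have "H 1 (?b, ?i) (corner 0) = H 0 (vtx 0, vtx 0) e0" using ends[of 0] e0_simplex by simp
  also have "\<dots> = scomp (std_simplex 0) (fib_map A' Y' f') l 0 (vtx 0) e0"
    using H01(1)[OF v] by (simp add: vtx_def)
  also have "\<dots> = realization_map Y' f' w"
    using v by (simp add: scomp_def compose_def fib_map_eq[OF ls] e0_simplex w_def)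
  also have "\<dots> = rpt Y' n (f' n x) t" unfolding x(3) by (rule realization_map_rpt[OF A' Y' f' x(1,2)])
  finally have 0: "H 1 (?b, ?i) (corner 0) = rpt Y' n (f' n x) t" .
  have ys: "singular_simplex 0 (realization Y) (yoneda 0 ?\<sigma> 0 (vtx 0))"
    using simplicial_map_cells[OF simplicial_map_yoneda[OF \<sigma>], of "vtx 0" 0] v by simp
  have "H 1 (?b, ?i) (corner 1) = H 0 (vtx 0, vtx 1) e0" using ends[of 1] e0_simplex by simp
  also have "\<dots> = scomp (std_simplex 0) (fib_map Y Y' s) (yoneda 0 ?\<sigma>) 0 (vtx 0) e0"
    using H01(2)[OF v] by (simp add: vtx_def)
  also have "\<dots> = realization_map Y' s (yoneda 0 ?\<sigma> 0 (vtx 0) e0)"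
    using v by (simp add: scomp_def compose_def fib_map_eq[OF ys] e0_simplex)
  also have "yoneda 0 ?\<sigma> 0 (vtx 0) e0 = ?p"
    using v e0_simplex affine_map_in_simplex[OF v e0_simplex] by (simp add: yoneda_def)
  also have "realization_map Y' s ?p = rpt Y' 0 (s 0 y) e0" by (rule realization_map_rpt[OF Y Y' s y e0_simplex])
  finally have 1: "H 1 (?b, ?i) (corner 1) = rpt Y' 0 (s 0 y) e0" .
  have "conn Y' (vert Y' n (f' n x)) (vert Y' 0 (s 0 y))"
    by (rule path_component_conn[OF Y' simplicial_map_cells[OF f' x(1)] x(2) simplicial_map_cells[OF s y] e0_simplex])
      (use singular_path[OF \<tau>] in \<open>simp only: 0 1\<close>)
  moreover have "vert Y' n (f' n x) = f' 0 (vert A' n x)"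
    unfolding vert_def by (rule simplicial_map_sop[OF f' vtx_Delta[OF le0] x(1), symmetric])
  moreover have "vert Y' 0 (s 0 y) = s 0 y" by (rule vert_0[OF Y' simplicial_map_cells[OF s y]])
  ultimately show ?thesis using vert_cells[OF A' x(1)] by metis
qed

text \<open>The lifting problem for n = 1. A path joins the images of \<open>a0\<close> and
  \<open>a1\<close> in the realization of \<open>Y\<close>, its ends are lifted to these vertices,
  and the lift of the whole path joins their restrictions.\<close>

lemma components_inj:
  assumes a: "a0 \<in> cells A 0" "a1 \<in> cells A 0" and c: "conn Y (f 0 a0) (f 0 a1)"
  shows "conn A' (r 0 a0) (r 0 a1)"
proof -
  define v where "v i = (if i = 0 then a0 else a1)" for i :: nat
  have v: "v i \<in> cells A 0" for i using a by (simp add: v_def)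
  note fv = simplicial_map_cells[OF f v] and rv = simplicial_map_cells[OF r v]
  obtain \<sigma> where \<sigma>: "singular_simplex 1 (realization Y) \<sigma>"
    "\<sigma> (corner 0) = rpt Y 0 (f 0 a0) e0" "\<sigma> (corner 1) = rpt Y 0 (f 0 a1) e0"
    using path_singular[OF conn_path_component[OF Y simplicial_map_cells[OF f a(1)] c]] by blast
  have \<sigma>v: "\<sigma> (corner i) = rpt Y 0 (f 0 (v i)) e0" if "i \<le> 1" for i
    using \<sigma> that by (cases i) (auto simp: v_def)
  \<comment> \<open>A simplex of the boundary of the 1-simplex misses 0 or 1, so it is
    constant.\<close>
  have const: "\<beta> l = \<beta> 0 \<and> \<beta> 0 \<le> 1" if "\<beta> \<in> cells (boundary 1) m" "l \<le> m" for \<beta> m l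
  proof -
    have b: "\<beta> \<in> Delta m 1" and "\<exists>i\<le>1. i \<notin> \<beta> ` {..m}" using that(1) by (auto simp: cells_boundary)
    then obtain i where "i \<le> 1" "\<And>l. l \<le> m \<Longrightarrow> \<beta> l \<noteq> i" by auto
    moreover have "\<beta> l \<le> 1" "\<beta> 0 \<le> 1" using Delta_le[OF b] that(2) by auto
    ultimately show ?thesis using that(2) by (metis One_nat_def le0 le_Suc_eq le_zero_eq)
  qed
  \<comment> \<open>Constant singular simplices at the two vertices, as every boundary simplex is
    degenerate on one of the two ends.\<close>
  define pa where "pa m i = (\<lambda>t\<in>standard_simplex m. rpt A 0 (v i) e0)" for m i
  have pa: "singular_simplex m (realization A) (pa m i)" for m i
  proof -
    have "continuous_map (top_simplex m) (realization A) (\<lambda>_. rpt A 0 (v i) e0)"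
      using rpt_in_topspace[OF A v e0_simplex] by simp
    then have "continuous_map (top_simplex m) (realization A) (pa m i)"
      by (rule continuous_map_eq) (simp add: pa_def)
    then show ?thesis by (simp add: singular_simplex_def pa_def)
  qed
  define \<alpha> where "\<alpha> m = (\<lambda>\<beta>\<in>cells (boundary 1) m. pa m (\<beta> 0))" for m
  have \<alpha>: "simplicial_map (boundary 1) (fib A) \<alpha>"
  proof (rule simplicial_mapI)
    show "\<alpha> m \<beta> \<in> cells (fib A) m" if "\<beta> \<in> cells (boundary 1) m" for m \<beta>
      using that pa by (simp add: \<alpha>_def fib_def)
    show "\<alpha> m \<in> extensional (cells (boundary 1) m)" for m by (simp add: \<alpha>_def)
    fix k m \<gamma> \<beta> assume g: "\<gamma> \<in> Delta k m" and b: "\<beta> \<in> cells (boundary 1) m"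
    have "compose {..k} \<beta> \<gamma> \<in> cells (boundary 1) k"
      using b g Delta_compose[OF g, of \<beta> 1] Delta_le[OF g] by (force simp: cells_boundary compose_def)
    moreover have "compose {..k} \<beta> \<gamma> 0 = \<beta> 0" using const[OF b Delta_le[OF g le0]] by (simp add: compose_def)
    ultimately show "\<alpha> k (sop (boundary 1) k m \<gamma> \<beta>) = sop (fib A) k m \<gamma> (\<alpha> m \<beta>)"
      unfolding sop_boundary[OF g b] using b
      by (simp add: \<alpha>_def fib_def sop_sing[OF g pa]) (auto simp: pa_def affine_map_in_simplex[OF g] restrict_def fun_eq_iff)
  qed
  have "scomp (boundary 1) (fib_map A Y f) \<alpha> = srestrict (boundary 1) (yoneda 1 \<sigma>)"
  proof (rule ext, rule ext)
    fix m \<beta>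
    show "scomp (boundary 1) (fib_map A Y f) \<alpha> m \<beta> = srestrict (boundary 1) (yoneda 1 \<sigma>) m \<beta>"
    proof (cases "\<beta> \<in> cells (boundary 1) m")
      case True
      then have b: "\<beta> \<in> Delta m 1" by (simp add: cells_boundary)
      have "fib_map A Y f m (pa m (\<beta> 0)) = (\<lambda>t\<in>standard_simplex m. \<sigma> (affine_map m \<beta> t))"
        unfolding fib_map_eq[OF pa]
      proof (rule restrict_ext)
        fix t assume t: "t \<in> standard_simplex m"
        have "affine_map m \<beta> t = corner (\<beta> 0)" by (rule affine_const[OF t]) (use const[OF True] in blast)
        then show "realization_map Y f (pa m (\<beta> 0) t) = \<sigma> (affine_map m \<beta> t)"
          using \<sigma>v const[OF True le0] t by (simp add: pa_def realization_map_rpt[OF A Y f v e0_simplex])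
      qed
      then show ?thesis using True b by (simp add: scomp_def srestrict_def compose_def \<alpha>_def yoneda_def)
    qed (simp add: scomp_def srestrict_def compose_def)
  qed
  then obtain l where l: "simplicial_map (std_simplex 1) (fib A') l"
    "srestrict (boundary 1) l = scomp (boundary 1) (fib_map A A' r) \<alpha>"
    using lift[OF \<alpha> simplicial_map_yoneda[OF \<sigma>(1), folded fib_def]] by blast
  let ?i = "\<lambda>i\<in>{..1}. i :: nat"
  have i1: "?i \<in> Delta 1 1" by (rule DeltaI) auto
  have \<tau>: "singular_simplex 1 (realization A') (l 1 ?i)"
    using simplicial_map_cells[OF l(1), of ?i 1] i1 by (simp add: fib_def)
  have "l 1 ?i (corner i) = rpt A' 0 (r 0 (v i)) e0" if i: "i \<le> 1" for i
  proof -
    have vb: "vtx i \<in> cells (boundary 1) 0"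
      using i vtx_Delta[OF i] by (auto simp: cells_boundary intro: exI[of _ "1 - i"])
    have comp: "compose {..0} ?i (vtx i) = vtx i" using i by simp
    have "l 0 (sop (std_simplex 1) 0 1 (vtx i) ?i) = sop (fib A') 0 1 (vtx i) (l 1 ?i)"
      by (rule simplicial_map_sop[OF l(1) vtx_Delta[OF i]]) (simp only: cells_std_simplex i1)
    then have "l 0 (vtx i) = sop (fib A') 0 1 (vtx i) (l 1 ?i)"
      unfolding sop_std_simplex[OF vtx_Delta[OF i] i1] comp .
    then have "l 0 (vtx i) e0 = l 1 ?i (affine_map 0 (vtx i) e0)"
      unfolding fib_def sop_sing[OF vtx_Delta[OF i] \<tau>] by (simp only: restrict_apply'[OF e0_simplex])
    then have "l 1 ?i (corner i) = l 0 (vtx i) e0" using affine_const[OF e0_simplex, of "vtx i" i] by simp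
    also have "l 0 (vtx i) = srestrict (boundary 1) l 0 (vtx i)" using vb by (simp add: srestrict_def)
    also have "\<dots> = fib_map A A' r 0 (pa 0 i)" unfolding l(2) using vb by (simp add: scomp_def compose_def \<alpha>_def)
    also have "\<dots> e0 = realization_map A' r (rpt A 0 (v i) e0)"
      unfolding fib_map_eq[OF pa] using e0_simplex by (simp add: pa_def)
    also have "\<dots> = rpt A' 0 (r 0 (v i)) e0" by (rule realization_map_rpt[OF A A' r v e0_simplex])
    finally show ?thesis .
  qed
  from this[of 0] this[of 1] have "path_component_of (realization A') (rpt A' 0 (r 0 a0) e0) (rpt A' 0 (r 0 a1) e0)"
    using singular_path[OF \<tau>] by (simp add: v_def)
  then have "conn A' (vert A' 0 (r 0 a0)) (vert A' 0 (r 0 a1))"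
    using path_component_conn[OF A' _ e0_simplex _ e0_simplex] simplicial_map_cells[OF r a(1)] simplicial_map_cells[OF r a(2)]
    by blast
  then show ?thesis using vert_0[OF A'] simplicial_map_cells[OF r] a by simp
qed

end

section \<open>Presheaves\<close>

lemma val_spsh_of [simp]: "U \<in> Cart \<Longrightarrow> val (spsh_of K r) U = K U"
  by (simp add: spsh_of_def)

lemma res_spsh_of [simp]: "f \<in> cart_hom V U \<Longrightarrow> x \<in> cells (K U) n \<Longrightarrow> res (spsh_of K r) V U f n x = r V U f n x"
  by (simp add: spsh_of_def srestrict_def)

lemma cart_hom_Cart: "f \<in> cart_hom V U \<Longrightarrow> V \<in> Cart" "f \<in> cart_hom V U \<Longrightarrow> U \<in> Cart"
  by (simp_all add: cart_hom_iff)

text \<open>\<open>spsh_of\<close> makes all data extensional, so the axioms reduce to equations on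
  cells and smooth maps.\<close>

lemma simplicial_presheaf_spsh_of:
  assumes K: "\<And>U. U \<in> Cart \<Longrightarrow> simplicial_set (K U)"
    and r: "\<And>V U f n x. f \<in> cart_hom V U \<Longrightarrow> x \<in> cells (K U) n \<Longrightarrow> r V U f n x \<in> cells (K V) n"
    and rs: "\<And>V U f m n \<alpha> x. f \<in> cart_hom V U \<Longrightarrow> \<alpha> \<in> Delta m n \<Longrightarrow> x \<in> cells (K U) n \<Longrightarrow>
      r V U f m (sop (K U) m n \<alpha> x) = sop (K V) m n \<alpha> (r V U f n x)"
    and rid: "\<And>U n x. U \<in> Cart \<Longrightarrow> x \<in> cells (K U) n \<Longrightarrow> r U U (\<lambda>x\<in>points U. x) n x = x"
    and rc: "\<And>W V U g f n x. g \<in> cart_hom W V \<Longrightarrow> f \<in> cart_hom V U \<Longrightarrow> x \<in> cells (K U) n \<Longrightarrow>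
      r W U (compose (points W) f g) n x = r W V g n (r V U f n x)"
  shows "simplicial_presheaf (spsh_of K r)"
  unfolding simplicial_presheaf_def
proof (intro conjI allI ballI)
  show "val (spsh_of K r) \<in> extensional Cart" by (simp add: spsh_of_def)
  show "simplicial_set (val (spsh_of K r) U)" if "U \<in> Cart" for U using K that by simp
  show "res (spsh_of K r) V U \<in> extensional (cart_hom V U)" for V U by (simp add: spsh_of_def)
  show "simplicial_map (val (spsh_of K r) U) (val (spsh_of K r) V) (res (spsh_of K r) V U f)"
    if f: "f \<in> cart_hom V U" for V U f
    unfolding val_spsh_of[OF cart_hom_Cart(1)[OF f]] val_spsh_of[OF cart_hom_Cart(2)[OF f]]
  proof (rule simplicial_mapI)
    show "res (spsh_of K r) V U f n x \<in> cells (K V) n" if "x \<in> cells (K U) n" for n x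
      using r f that by simp
    show "res (spsh_of K r) V U f n \<in> extensional (cells (K U) n)" for n
      using f by (simp add: spsh_of_def srestrict_def)
    show "res (spsh_of K r) V U f m (sop (K U) m n \<alpha> x) = sop (K V) m n \<alpha> (res (spsh_of K r) V U f n x)"
      if "\<alpha> \<in> Delta m n" "x \<in> cells (K U) n" for m n \<alpha> x
      using rs[OF f that] f that sop_cells[OF K[OF cart_hom_Cart(2)[OF f]] that] by simp
  qed
  show "res (spsh_of K r) U U (\<lambda>x\<in>points U. x) = sid (val (spsh_of K r) U)" if U: "U \<in> Cart" for U
    unfolding val_spsh_of[OF U] sid_def
    using cart_hom_id[OF U] rid[OF U] by (simp add: spsh_of_def srestrict_def) (intro ext restrict_ext, simp)
  show "res (spsh_of K r) W U (compose (points W) f g) =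
      scomp (val (spsh_of K r) U) (res (spsh_of K r) W V g) (res (spsh_of K r) V U f)"
    if g: "g \<in> cart_hom W V" and f: "f \<in> cart_hom V U" for W V U g f
  proof (rule ext)
    fix n
    show "res (spsh_of K r) W U (compose (points W) f g) n =
      scomp (val (spsh_of K r) U) (res (spsh_of K r) W V g) (res (spsh_of K r) V U f) n"
    proof (rule extensionalityI[of _ "cells (K U) n"])
      show "res (spsh_of K r) W U (compose (points W) f g) n \<in> extensional (cells (K U) n)"
        using cart_hom_compose[OF g f] by (simp add: spsh_of_def srestrict_def)
      show "scomp (val (spsh_of K r) U) (res (spsh_of K r) W V g) (res (spsh_of K r) V U f) n \<in> extensional (cells (K U) n)"
        using cart_hom_Cart(2)[OF f] by (simp add: scomp_def)
      fix x assume x: "x \<in> cells (K U) n"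
      show "res (spsh_of K r) W U (compose (points W) f g) n x =
        scomp (val (spsh_of K r) U) (res (spsh_of K r) W V g) (res (spsh_of K r) V U f) n x"
        using cart_hom_compose[OF g f] x f g r[OF f x] cart_hom_Cart(2)[OF f] rc[OF g f x]
        by (simp add: scomp_def compose_eq)
    qed
  qed
qed

context
  fixes A :: "'a spsh"
  assumes A: "simplicial_presheaf A"
begin

lemma presheaf_sset: "U \<in> Cart \<Longrightarrow> simplicial_set (val A U)"
  and presheaf_res: "f \<in> cart_hom V U \<Longrightarrow> simplicial_map (val A U) (val A V) (res A V U f)"
  and presheaf_id: "U \<in> Cart \<Longrightarrow> res A U U (\<lambda>x\<in>points U. x) = sid (val A U)"
  using A by (simp_all add: simplicial_presheaf_def)

lemma presheaf_cells: "f \<in> cart_hom V U \<Longrightarrow> x \<in> cells (val A U) n \<Longrightarrow> res A V U f n x \<in> cells (val A V) n"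
  by (rule simplicial_map_cells[OF presheaf_res])

lemma presheaf_compose: "g \<in> cart_hom W V \<Longrightarrow> f \<in> cart_hom V U \<Longrightarrow> x \<in> cells (val A U) n \<Longrightarrow>
    res A W V g n (res A V U f n x) = res A W U (compose (points W) f g) n x"
  using A by (simp add: simplicial_presheaf_def scomp_def compose_eq)

end

lemma psh_mapI:
  assumes "\<phi> \<in> extensional Cart" "\<And>U. U \<in> Cart \<Longrightarrow> simplicial_map (val A U) (val B U) (\<phi> U)"
    and nat: "\<And>V U f n x. f \<in> cart_hom V U \<Longrightarrow> x \<in> cells (val A U) n \<Longrightarrow>
      \<phi> V n (res A V U f n x) = res B V U f n (\<phi> U n x)"
  shows "psh_map A B \<phi>"
  unfolding psh_map_def
proof (intro conjI ballI allI)
  show "scomp (val A U) (\<phi> V) (res A V U f) = scomp (val A U) (res B V U f) (\<phi> U)" if "f \<in> cart_hom V U" for V U f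
    using nat[OF that] by (auto simp: scomp_def compose_def restrict_def fun_eq_iff)
qed (use assms in auto)

lemma psh_mapD:
  assumes "psh_map A B \<phi>"
  shows "\<phi> \<in> extensional Cart" "U \<in> Cart \<Longrightarrow> simplicial_map (val A U) (val B U) (\<phi> U)"
    and "f \<in> cart_hom V U \<Longrightarrow> x \<in> cells (val A U) n \<Longrightarrow> \<phi> V n (res A V U f n x) = res B V U f n (\<phi> U n x)"
proof -
  show "\<phi> \<in> extensional Cart" "U \<in> Cart \<Longrightarrow> simplicial_map (val A U) (val B U) (\<phi> U)"
    using assms by (simp_all add: psh_map_def)
  assume f: "f \<in> cart_hom V U" and x: "x \<in> cells (val A U) n"
  have "scomp (val A U) (\<phi> V) (res A V U f) = scomp (val A U) (res B V U f) (\<phi> U)"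
    using assms f by (simp add: psh_map_def)
  from fun_cong[OF fun_cong[OF this, of n], of x]
  show "\<phi> V n (res A V U f n x) = res B V U f n (\<phi> U n x)" using x by (simp add: scomp_def compose_eq)
qed

lemma psh_map_cells: "psh_map A B \<phi> \<Longrightarrow> U \<in> Cart \<Longrightarrow> x \<in> cells (val A U) n \<Longrightarrow> \<phi> U n x \<in> cells (val B U) n"
  by (rule simplicial_map_cells[OF psh_mapD(2)])

lemma cells_sdiscrete [simp]: "cells (sdiscrete A) n = A"
  by (simp add: sdiscrete_def)

lemma sop_sdiscrete [simp]: "\<alpha> \<in> Delta m n \<Longrightarrow> x \<in> A \<Longrightarrow> sop (sdiscrete A) m n \<alpha> x = x"
  by (simp add: sdiscrete_def)

lemma simplicial_set_sdiscrete: "simplicial_set (sdiscrete A)"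
  unfolding sdiscrete_def by (rule simplicial_set_sset_of) auto

lemma cells_sprod [simp]: "cells (sprod K L) n = cells K n \<times> cells L n"
  by (simp add: sprod_def)

lemma sop_sprod [simp]: "\<alpha> \<in> Delta m n \<Longrightarrow> x \<in> cells K n \<Longrightarrow> y \<in> cells L n \<Longrightarrow>
    sop (sprod K L) m n \<alpha> (x, y) = (sop K m n \<alpha> x, sop L m n \<alpha> y)"
  by (simp add: sprod_def)

lemma simplicial_set_sprod: "simplicial_set K \<Longrightarrow> simplicial_set L \<Longrightarrow> simplicial_set (sprod K L)"
  unfolding sprod_def
  by (rule simplicial_set_sset_of) (auto simp: sop_cells sop_id sop_compose)

lemma cells_sfibre_prod [simp]:
  "(x, y) \<in> cells (sfibre_prod K \<phi>) n \<longleftrightarrow> x \<in> cells K n \<and> y \<in> cells K n \<and> \<phi> n x = \<phi> n y"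
  by (simp add: sfibre_prod_def)

lemma sop_sfibre_prod [simp]: "\<alpha> \<in> Delta m n \<Longrightarrow> (x, y) \<in> cells (sfibre_prod K \<phi>) n \<Longrightarrow>
    sop (sfibre_prod K \<phi>) m n \<alpha> (x, y) = (sop K m n \<alpha> x, sop K m n \<alpha> y)"
  by (simp add: sfibre_prod_def)

lemma simplicial_set_sfibre_prod:
  assumes K: "simplicial_set K" and \<phi>: "simplicial_map K L \<phi>"
  shows "simplicial_set (sfibre_prod K \<phi>)"
  unfolding sfibre_prod_def
  by (rule simplicial_set_sset_of)
    (auto simp: sop_cells[OF K] sop_id[OF K] sop_compose[OF K] simplicial_map_sop[OF \<phi>])

lemma val_psh_prod [simp]: "U \<in> Cart \<Longrightarrow> val (psh_prod A B) U = sprod (val A U) (val B U)"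
  by (simp add: psh_prod_def)

lemma res_psh_prod [simp]: "f \<in> cart_hom V U \<Longrightarrow> x \<in> cells (val A U) n \<Longrightarrow> y \<in> cells (val B U) n \<Longrightarrow>
    res (psh_prod A B) V U f n (x, y) = (res A V U f n x, res B V U f n y)"
  by (simp add: psh_prod_def)

lemma val_psh_fibre_prod [simp]: "U \<in> Cart \<Longrightarrow> val (psh_fibre_prod A \<phi>) U = sfibre_prod (val A U) (\<phi> U)"
  by (simp add: psh_fibre_prod_def)

lemma res_psh_fibre_prod [simp]: "f \<in> cart_hom V U \<Longrightarrow> (x, y) \<in> cells (sfibre_prod (val A U) (\<phi> U)) n \<Longrightarrow>
    res (psh_fibre_prod A \<phi>) V U f n (x, y) = (res A V U f n x, res A V U f n y)"
  unfolding psh_fibre_prod_def by (subst res_spsh_of) auto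

lemma simplicial_presheaf_prod:
  assumes A: "simplicial_presheaf A" and B: "simplicial_presheaf B"
  shows "simplicial_presheaf (psh_prod A B)"
  unfolding psh_prod_def
proof (rule simplicial_presheaf_spsh_of)
  show "simplicial_set (sprod (val A U) (val B U))" if "U \<in> Cart" for U
    by (rule simplicial_set_sprod[OF presheaf_sset[OF A that] presheaf_sset[OF B that]])
  fix V U f n and z assume f: "f \<in> cart_hom V U" and z: "z \<in> cells (sprod (val A U) (val B U)) n"
  then show "(\<lambda>(x, y). (res A V U f n x, res B V U f n y)) z \<in> cells (sprod (val A V) (val B V)) n"
    using presheaf_cells[OF A f] presheaf_cells[OF B f] by auto
  fix m \<alpha> assume a: "\<alpha> \<in> Delta m n"
  show "(\<lambda>(x, y). (res A V U f m x, res B V U f m y)) (sop (sprod (val A U) (val B U)) m n \<alpha> z) =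
      sop (sprod (val A V) (val B V)) m n \<alpha> ((\<lambda>(x, y). (res A V U f n x, res B V U f n y)) z)"
    using z a presheaf_cells[OF A f] presheaf_cells[OF B f]
      simplicial_map_sop[OF presheaf_res[OF A f]] simplicial_map_sop[OF presheaf_res[OF B f]] by auto
next
  fix U n z assume "U \<in> Cart" "z \<in> cells (sprod (val A U) (val B U)) n"
  then show "(\<lambda>(x, y). (res A U U (\<lambda>x\<in>points U. x) n x, res B U U (\<lambda>x\<in>points U. x) n y)) z = z"
    by (auto simp: presheaf_id[OF A] presheaf_id[OF B] sid_def)
next
  fix W V U g f n z assume "g \<in> cart_hom W V" "f \<in> cart_hom V U" "z \<in> cells (sprod (val A U) (val B U)) n"
  then show "(\<lambda>(x, y). (res A W U (compose (points W) f g) n x, res B W U (compose (points W) f g) n y)) z =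
      (\<lambda>(x, y). (res A W V g n x, res B W V g n y)) ((\<lambda>(x, y). (res A V U f n x, res B V U f n y)) z)"
    by (auto simp: presheaf_compose[OF A] presheaf_compose[OF B])
qed

lemma simplicial_presheaf_fibre_prod:
  assumes A: "simplicial_presheaf A" and \<phi>: "psh_map A B \<phi>"
  shows "simplicial_presheaf (psh_fibre_prod A \<phi>)"
  unfolding psh_fibre_prod_def
proof (rule simplicial_presheaf_spsh_of)
  show "simplicial_set (sfibre_prod (val A U) (\<phi> U))" if "U \<in> Cart" for U
    by (rule simplicial_set_sfibre_prod[OF presheaf_sset[OF A that] psh_mapD(2)[OF \<phi> that]])
  fix V U f n and z assume f: "f \<in> cart_hom V U" and z: "z \<in> cells (sfibre_prod (val A U) (\<phi> U)) n"
  obtain x y where xy: "z = (x, y)" "x \<in> cells (val A U) n" "y \<in> cells (val A U) n" "\<phi> U n x = \<phi> U n y"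
    using z by (cases z) auto
  have fz: "(res A V U f n x, res A V U f n y) \<in> cells (sfibre_prod (val A V) (\<phi> V)) n"
    using presheaf_cells[OF A f] psh_mapD(3)[OF \<phi> f] xy by simp
  then show "(\<lambda>(x, y). (res A V U f n x, res A V U f n y)) z \<in> cells (sfibre_prod (val A V) (\<phi> V)) n"
    using xy by simp
  fix m \<alpha> assume a: "\<alpha> \<in> Delta m n"
  show "(\<lambda>(x, y). (res A V U f m x, res A V U f m y)) (sop (sfibre_prod (val A U) (\<phi> U)) m n \<alpha> z) =
      sop (sfibre_prod (val A V) (\<phi> V)) m n \<alpha> ((\<lambda>(x, y). (res A V U f n x, res A V U f n y)) z)"
    using z a fz simplicial_map_sop[OF presheaf_res[OF A f] a] unfolding xy(1)
    by (simp add: xy(2,3))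
next
  fix U n z assume "U \<in> Cart" "z \<in> cells (sfibre_prod (val A U) (\<phi> U)) n"
  then show "(\<lambda>(x, y). (res A U U (\<lambda>x\<in>points U. x) n x, res A U U (\<lambda>x\<in>points U. x) n y)) z = z"
    by (cases z) (simp add: presheaf_id[OF A] sid_def)
next
  fix W V U g f n z assume "g \<in> cart_hom W V" "f \<in> cart_hom V U" "z \<in> cells (sfibre_prod (val A U) (\<phi> U)) n"
  then show "(\<lambda>(x, y). (res A W U (compose (points W) f g) n x, res A W U (compose (points W) f g) n y)) z =
      (\<lambda>(x, y). (res A W V g n x, res A W V g n y)) ((\<lambda>(x, y). (res A V U f n x, res A V U f n y)) z)"
    by (cases z) (simp add: presheaf_compose[OF A])
qed

lemma val_psh_discrete [simp]: "U \<in> Cart \<Longrightarrow> val (psh_discrete X) U = sdiscrete (plots X U)"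
  by (simp add: psh_discrete_def)

lemma res_psh_discrete [simp]: "f \<in> cart_hom V U \<Longrightarrow> p \<in> plots X U \<Longrightarrow> res (psh_discrete X) V U f n p = compose (points V) p f"
  by (simp add: psh_discrete_def)

lemma compose_id_plot: "p \<in> points U \<rightarrow>\<^sub>E A \<Longrightarrow> compose (points U) p (\<lambda>x\<in>points U. x) = p"
  by (rule extensionalityI[of _ "points U"]) (simp_all add: compose_def PiE_iff)

lemma compose_compose_hom:
  "g \<in> cart_hom W V \<Longrightarrow> compose (points W) p (compose (points W) f g) = compose (points W) (compose (points V) p f) g"
  using cart_hom_PiE[of g W V] by (auto simp: compose_def fun_eq_iff)

lemma simplicial_presheaf_discrete:
  assumes X: "diffeological_space X" shows "simplicial_presheaf (psh_discrete X)"
  unfolding psh_discrete_def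
  by (rule simplicial_presheaf_spsh_of)
    (auto simp: simplicial_set_sdiscrete plots_compose[OF X] compose_compose_hom intro: compose_id_plot[OF plots_PiE[OF X]])

section \<open>Objectwise isomorphisms are local weak equivalences\<close>

lemma simplicial_map_inv:
  assumes f: "simplicial_map K L \<phi>" and K: "simplicial_set K"
    and bij: "\<And>n. bij_betw (\<phi> n) (cells K n) (cells L n)"
  shows "simplicial_map L K (\<lambda>n. restrict (inv_into (cells K n) (\<phi> n)) (cells L n))"
proof (rule simplicial_mapI)
  show "restrict (inv_into (cells K n) (\<phi> n)) (cells L n) y \<in> cells K n" if "y \<in> cells L n" for n y
    using that bij[of n] by (simp add: bij_betw_def inv_into_into)
  fix m n \<alpha> y assume a: "\<alpha> \<in> Delta m n" and y: "y \<in> cells L n"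
  obtain x where x: "x \<in> cells K n" "y = \<phi> n x" using y bij[of n] by (auto simp: bij_betw_def)
  have "sop L m n \<alpha> y = \<phi> m (sop K m n \<alpha> x)" unfolding x(2) by (rule simplicial_map_sop[OF f a x(1), symmetric])
  moreover have "sop K m n \<alpha> x \<in> cells K m" by (rule sop_cells[OF K a x(1)])
  ultimately show "restrict (inv_into (cells K m) (\<phi> m)) (cells L m) (sop L m n \<alpha> y) =
      sop K m n \<alpha> (restrict (inv_into (cells K n) (\<phi> n)) (cells L n) y)"
    using x y simplicial_map_cells[OF f] bij by (simp add: bij_betw_def)
qed simp

lemma simplicial_map_fib_map:
  assumes K: "simplicial_set K" and L: "simplicial_set L" and f: "simplicial_map K L \<phi>"
  shows "simplicial_map (fib K) (fib L) (fib_map K L \<phi>)"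
proof -
  have s: "singular_simplex n (realization L) (\<lambda>t\<in>standard_simplex n. realization_map L \<phi> (s t))"
    if "singular_simplex n (realization K) s" for n s
    using singular_simplex_simplex_map[OF that continuous_map_realization_map[OF K L f]]
    by (simp add: simplex_map_def o_def)
  show ?thesis
    unfolding fib_def
  proof (rule simplicial_mapI)
    show "fib_map K L \<phi> n x \<in> cells (sing (realization L)) n" if "x \<in> cells (sing (realization K)) n" for n x
      using that s by (simp add: fib_map_eq)
    show "fib_map K L \<phi> n \<in> extensional (cells (sing (realization K)) n)" for n
      by (simp add: fib_map_def srestrict_def fib_def)
    fix m n \<alpha> x assume a: "\<alpha> \<in> Delta m n" and "x \<in> cells (sing (realization K)) n"
    then have x: "singular_simplex n (realization K) x" by simp
    show "fib_map K L \<phi> m (sop (sing (realization K)) m n \<alpha> x) = sop (sing (realization L)) m n \<alpha> (fib_map K L \<phi> n x)"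
      unfolding sop_sing[OF a x] fib_map_eq[OF x] fib_map_eq[OF singular_affine[OF a x]] sop_sing[OF a s[OF x]]
      by (rule restrict_ext) (simp add: affine_map_in_simplex[OF a])
  qed
qed

lemma fib_map_sid:
  assumes K: "simplicial_set K" and x: "x \<in> cells (fib K) n"
  shows "fib_map K K (sid K) n x = x"
proof -
  have x': "singular_simplex n (realization K) x" using x by (simp add: fib_def)
  have id: "simplicial_map K K (sid K)"
    by (rule simplicial_mapI) (auto simp: sid_def sop_cells[OF K])
  have "realization_map K (sid K) z = z" if "z \<in> topspace (realization K)" for z
    by (rule realizationE[OF K that]) (simp add: realization_map_rpt[OF K K id], simp add: sid_def)
  moreover have "x t \<in> topspace (realization K)" if "t \<in> standard_simplex n" for t
    using x' that by (auto simp: singular_simplex_def continuous_map_def)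
  ultimately show ?thesis
    unfolding fib_map_eq[OF x'] using x'
    by (intro extensionalityI[of _ "standard_simplex n"]) (auto simp: singular_simplex_def)
qed

lemma fib_map_inverse:
  assumes K: "simplicial_set K" and L: "simplicial_set L" and f: "simplicial_map K L \<phi>" and g: "simplicial_map L K \<psi>"
    and gf: "\<And>n x. x \<in> cells K n \<Longrightarrow> \<psi> n (\<phi> n x) = x" and x: "x \<in> cells (fib K) n"
  shows "fib_map L K \<psi> n (fib_map K L \<phi> n x) = x"
proof -
  have x': "singular_simplex n (realization K) x" using x by (simp add: fib_def)
  have fx: "singular_simplex n (realization L) (fib_map K L \<phi> n x)"
    using simplicial_map_cells[OF simplicial_map_fib_map[OF K L f] x] by (simp add: fib_def)
  have "realization_map K \<psi> (realization_map L \<phi> z) = z" if "z \<in> topspace (realization K)" for z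
    by (rule realizationE[OF K that])
      (simp add: realization_map_rpt[OF K L f] realization_map_rpt[OF L K g] simplicial_map_cells[OF f] gf)
  moreover have "x t \<in> topspace (realization K)" if "t \<in> standard_simplex n" for t
    using x' that by (auto simp: singular_simplex_def continuous_map_def)
  ultimately show ?thesis
    unfolding fib_map_eq[OF fx] unfolding fib_map_eq[OF x'] using x'
    by (intro extensionalityI[of _ "standard_simplex n"]) (auto simp: singular_simplex_def)
qed

lemma homotopic_rel_boundary_refl:
  assumes y: "simplicial_map (std_simplex n) L y"
  shows "homotopic_rel_boundary n L y y"
  unfolding homotopic_rel_boundary_def
proof (intro exI conjI allI ballI)
  let ?H = "\<lambda>m. \<lambda>(x, s)\<in>cells (sprod (std_simplex n) (std_simplex 1)) m. y m x"
  show "simplicial_map (sprod (std_simplex n) (std_simplex 1)) L ?H"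
  proof (rule simplicial_mapI)
    show "?H m z \<in> cells L m" if "z \<in> cells (sprod (std_simplex n) (std_simplex 1)) m" for m z
      using that simplicial_map_cells[OF y] by auto
    show "?H k (sop (sprod (std_simplex n) (std_simplex 1)) k m \<alpha> z) = sop L k m \<alpha> (?H m z)"
      if a: "\<alpha> \<in> Delta k m" and z: "z \<in> cells (sprod (std_simplex n) (std_simplex 1)) m" for k m \<alpha> z
    proof -
      obtain x s where xs: "z = (x, s)" "x \<in> Delta m n" "s \<in> Delta m 1" using z by auto
      have "?H k (sop (sprod (std_simplex n) (std_simplex 1)) k m \<alpha> z) = y k (compose {..k} x \<alpha>)"
        using a xs Delta_compose[OF a] by (simp add: sop_std_simplex)
      also have "\<dots> = sop L k m \<alpha> (y m x)"
        using simplicial_map_sop[OF y a, of x] xs by (simp add: sop_std_simplex[OF a])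
      finally show ?thesis using xs by simp
    qed
  qed simp
  fix m x assume x: "x \<in> cells (std_simplex n) m"
  have "(\<lambda>i\<in>{..m}. 0) \<in> Delta m 1" "(\<lambda>i\<in>{..m}. 1) \<in> Delta m 1" by (rule DeltaI; simp)+
  then show "?H m (x, \<lambda>i\<in>{..m}. 0) = y m x" "?H m (x, \<lambda>i\<in>{..m}. 1) = y m x" using x by simp_all
next
  fix m x s assume "x \<in> cells (boundary n) m" "s \<in> cells (std_simplex 1) m"
  then show "(\<lambda>(x, s)\<in>cells (sprod (std_simplex n) (std_simplex 1)) m. y m x) (x, s) = y m x"
    by (simp add: cells_boundary)
qed

lemma simplicial_map_scomp:
  assumes f: "simplicial_map K L \<phi>" and g: "simplicial_map L M \<psi>" and K: "simplicial_set K"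
  shows "simplicial_map K M (scomp K \<psi> \<phi>)"
  by (rule simplicial_mapI)
    (auto simp: scomp_def compose_eq sop_cells[OF K] simplicial_map_cells[OF f] simplicial_map_cells[OF g]
      simplicial_map_sop[OF f] simplicial_map_sop[OF g])

lemma simplicial_set_std_simplex: "simplicial_set (std_simplex n)"
  unfolding std_simplex_def
proof (rule simplicial_set_sset_of, goal_cases)
  case (1 m k \<alpha> \<beta>)
  then show ?case by (rule Delta_compose)
next
  case (2 m \<beta>)
  then show ?case by (intro Delta_ext[OF Delta_compose[OF Delta_id]]) (auto simp: compose_def)
next
  case (3 j k m \<alpha> \<beta> \<gamma>)
  then show ?case by (auto simp: compose_def fun_eq_iff Delta_le)
qed

lemma incl_points: "incl (points U) = (\<lambda>x\<in>points U. x)"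
  by (simp add: incl_def)

text \<open>The cover by the space itself suffices. Applying the fibrant replacement of the inverse
  to \<open>y\<close> gives a lift for which both triangles commute strictly, so the homotopy is
  constant.\<close>

lemma local_weak_equivalence_iso:
  assumes A: "simplicial_presheaf A" and Y: "simplicial_presheaf Y" and f: "psh_map A Y f"
    and bij: "\<And>U n. U \<in> Cart \<Longrightarrow> bij_betw (f U n) (cells (val A U) n) (cells (val Y U) n)"
  shows "local_weak_equivalence A Y f"
  unfolding local_weak_equivalence_def
proof (intro conjI ballI f)
  fix U assume U: "U \<in> Cart"
  let ?A = "val A U" and ?Y = "val Y U" and ?f = "f U"
  note KA = presheaf_sset[OF A U] and KY = presheaf_sset[OF Y U] and fU = psh_mapD(2)[OF f U]
  define h where "h n = restrict (inv_into (cells ?A n) (?f n)) (cells ?Y n)" for n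
  have h: "simplicial_map ?Y ?A h"
    using simplicial_map_inv[OF fU KA bij[OF U]] by (simp add: h_def[abs_def])
  have hf: "h n (?f n x) = x" if "x \<in> cells ?A n" for n x
    using that bij[OF U, of n] by (auto simp: bij_betw_def h_def)
  have fh: "?f n (h n y) = y" if "y \<in> cells ?Y n" for n y
    using that bij[OF U, of n] by (auto simp: bij_betw_def f_inv_into_f h_def)
  have "\<exists>l. simplicial_map (std_simplex n) (fib ?A) l \<and>
      srestrict (boundary n) l = scomp (boundary n) (fib_map ?A ?A (sid ?A)) a \<and>
      homotopic_rel_boundary n (fib ?Y) (scomp (std_simplex n) (fib_map ?A ?Y ?f) l)
        (scomp (std_simplex n) (fib_map ?Y ?Y (sid ?Y)) y)"
    if a: "simplicial_map (boundary n) (fib ?A) a" and y: "simplicial_map (std_simplex n) (fib ?Y) y"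
      and ay: "scomp (boundary n) (fib_map ?A ?Y ?f) a = srestrict (boundary n) y" for n a y
  proof (intro exI conjI)
    let ?l = "scomp (std_simplex n) (fib_map ?Y ?A h) y"
    note fibh = simplicial_map_fib_map[OF KY KA h]
    show l: "simplicial_map (std_simplex n) (fib ?A) ?l"
      by (rule simplicial_map_scomp[OF y fibh simplicial_set_std_simplex])
    show "srestrict (boundary n) ?l = scomp (boundary n) (fib_map ?A ?A (sid ?A)) a"
    proof (rule ext, rule ext)
      fix m \<beta>
      show "srestrict (boundary n) ?l m \<beta> = scomp (boundary n) (fib_map ?A ?A (sid ?A)) a m \<beta>"
      proof (cases "\<beta> \<in> cells (boundary n) m")
        case True
        then have b: "\<beta> \<in> Delta m n" by (simp add: cells_boundary)
        have "fib_map ?A ?Y ?f m (a m \<beta>) = y m \<beta>"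
          using fun_cong[OF fun_cong[OF ay, of m], of \<beta>] True by (simp add: scomp_def srestrict_def compose_eq)
        then have "fib_map ?Y ?A h m (y m \<beta>) = a m \<beta>"
          using fib_map_inverse[OF KA KY fU h hf simplicial_map_cells[OF a True]] by simp
        then show ?thesis
          using True b fib_map_sid[OF KA simplicial_map_cells[OF a True]] by (simp add: scomp_def srestrict_def compose_eq)
      qed (simp add: scomp_def srestrict_def compose_def)
    qed
    have "scomp (std_simplex n) (fib_map ?A ?Y ?f) ?l = y \<and> scomp (std_simplex n) (fib_map ?Y ?Y (sid ?Y)) y = y"
    proof (intro conjI; rule ext; rule extensionalityI[of _ "Delta _ n"])
      fix m \<beta> assume b: "\<beta> \<in> Delta m n"
      then have yb: "y m \<beta> \<in> cells (fib ?Y) m" using simplicial_map_cells[OF y, of \<beta> m] by simp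
      show "scomp (std_simplex n) (fib_map ?A ?Y ?f) ?l m \<beta> = y m \<beta>"
        using fib_map_inverse[OF KY KA h fU fh yb] b by (simp add: scomp_def compose_eq)
      show "scomp (std_simplex n) (fib_map ?Y ?Y (sid ?Y)) y m \<beta> = y m \<beta>"
        using fib_map_sid[OF KY yb] b by (simp add: scomp_def compose_eq)
    qed (use y in \<open>auto simp: scomp_def simplicial_map_def PiE_iff\<close>)
    then show "homotopic_rel_boundary n (fib ?Y) (scomp (std_simplex n) (fib_map ?A ?Y ?f) ?l)
        (scomp (std_simplex n) (fib_map ?Y ?Y (sid ?Y)) y)"
      using homotopic_rel_boundary_refl[OF y] by simp
  qed
  then show "\<exists>\<U>. good_open_cover U \<U> \<and>
       (\<forall>S\<in>\<U>.
         let V = open_sub U S;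
             fU = fib_map (val A U) (val Y U) (f U);
             fV = fib_map (val A V) (val Y V) (f V);
             rA = fib_map (val A U) (val A V) (res A V U (incl S));
             rY = fib_map (val Y U) (val Y V) (res Y V U (incl S))
         in
         \<forall>n a y.
           simplicial_map (boundary n) (fib (val A U)) a \<and>
           simplicial_map (std_simplex n) (fib (val Y U)) y \<and>
           scomp (boundary n) fU a = srestrict (boundary n) y \<longrightarrow>
           (\<exists>l. simplicial_map (std_simplex n) (fib (val A V)) l \<and>
              srestrict (boundary n) l = scomp (boundary n) rA a \<and>
              homotopic_rel_boundary n (fib (val Y V))
                (scomp (std_simplex n) fV l) (scomp (std_simplex n) rY y)))"
    by (intro exI[of _ "{points U}"] conjI good_open_cover_trivial[OF U])
      (simp add: Let_def open_sub_points[OF U] incl_points presheaf_id[OF A U] presheaf_id[OF Y U])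
qed

section \<open>The presheaf of plots\<close>

lemma const_R0_cart_hom: "U \<in> Cart \<Longrightarrow> (\<lambda>_\<in>points U. pt) \<in> cart_hom U (Rn 0)"
proof -
  assume U: "U \<in> Cart"
  obtain \<phi> where \<phi>: "charted U \<phi>" using Cart_charted[OF U] .
  have "inv_into (points U) \<phi> y \<in> points U" if "y \<in> topspace (Euclidean_space (mdim U))" for y
    using that chartedD(3)[OF \<phi>] by (metis inv_into_into)
  then have "smooth_on (mdim U) (topspace (Euclidean_space (mdim U))) (mdim (Rn 0))
      (\<lambda>y. (\<lambda>_\<in>points U. pt) (inv_into (points U) \<phi> y))"
    using points_R0 by (auto simp: smooth_on_def)
  then show ?thesis
    unfolding cart_hom_iff smooth_map_iff[OF \<phi> charted_Rn] points_R0 by (simp add: U Rn_Cart)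
qed

lemma const_plot:
  assumes X: "diffeological_space X" and U: "U \<in> Cart" and a: "a \<in> carrier X"
  shows "(\<lambda>_\<in>points U. a) \<in> plots X U"
proof -
  have "(\<lambda>_\<in>points (Rn 0). a) \<in> plots X (Rn 0)" by (rule plots_point[OF X]) (simp add: a)
  from plots_compose[OF X this const_R0_cart_hom[OF U]]
  have "compose (points U) (\<lambda>_\<in>points (Rn 0). a) (\<lambda>_\<in>points U. pt) \<in> plots X U" .
  moreover have "compose (points U) (\<lambda>_\<in>points (Rn 0). a) (\<lambda>_\<in>points U. pt) = (\<lambda>_\<in>points U. a)"
    unfolding points_R0 by (auto simp: compose_def)
  ultimately show ?thesis by simp
qed

lemma gplots_mult:
  assumes G: "diffeological_group G" and g: "g \<in> gplots G U" and h: "h \<in> gplots G U"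
  shows "(\<lambda>u\<in>points U. g u \<otimes>\<^bsub>G\<^esub> h u) \<in> gplots G U"
proof -
  have Gd: "diffeological_space (dspace G)" using G by (simp add: diffeological_group_def)
  note gP = plots_PiE[OF Gd, unfolded dspace_simps]
  have "(\<lambda>u\<in>points U. (g u, h u)) \<in> plots (dprod (dspace G) (dspace G)) U"
    by (rule dprod_plotI[OF Gd Gd]) (simp_all add: g h)
  moreover have "dsmooth (dprod (dspace G) (dspace G)) (dspace G) (\<lambda>(g, h) \<in> carrier G \<times> carrier G. g \<otimes>\<^bsub>G\<^esub> h)"
    using G by (simp add: diffeological_group_def)
  ultimately have "compose (points U) (\<lambda>(g, h) \<in> carrier G \<times> carrier G. g \<otimes>\<^bsub>G\<^esub> h) (\<lambda>u\<in>points U. (g u, h u)) \<in> gplots G U"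
    using dsmoothD(2) by fastforce
  moreover have "compose (points U) (\<lambda>(g, h) \<in> carrier G \<times> carrier G. g \<otimes>\<^bsub>G\<^esub> h) (\<lambda>u\<in>points U. (g u, h u)) =
      (\<lambda>u\<in>points U. g u \<otimes>\<^bsub>G\<^esub> h u)"
    using PiE_mem[OF gP[OF g]] PiE_mem[OF gP[OF h]] by (simp add: compose_def cong: restrict_cong)
  ultimately show ?thesis by simp
qed

lemma group_discrete_simps [simp]:
  "underlying (group_discrete G) = psh_discrete (dspace G)" "carrier (grp (group_discrete G) U n) = gplots G U"
  "\<one>\<^bsub>grp (group_discrete G) U n\<^esub> = (\<lambda>u\<in>points U. \<one>\<^bsub>G\<^esub>)"
  "g \<otimes>\<^bsub>grp (group_discrete G) U n\<^esub> h = (\<lambda>u\<in>points U. g u \<otimes>\<^bsub>G\<^esub> h u)"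
  by (simp_all add: group_discrete_def)

lemma cells_horn: "cells (horn n k) m = {\<beta> \<in> Delta m n. \<exists>i\<le>n. i \<noteq> k \<and> i \<notin> \<beta> ` {..m}}"
  by (simp add: horn_def)

lemma sop_horn: "\<alpha> \<in> Delta j m \<Longrightarrow> \<beta> \<in> cells (horn n k) m \<Longrightarrow> sop (horn n k) j m \<alpha> \<beta> = compose {..j} \<beta> \<alpha>"
  by (simp add: horn_def)

lemma std_simplex_map_discrete:
  assumes y: "simplicial_map (std_simplex n) (sdiscrete A) y" and b: "\<beta> \<in> Delta m n"
  shows "y m \<beta> = y n (\<lambda>i\<in>{..n}. i)"
proof -
  have "compose {..m} (\<lambda>i\<in>{..n}. i) \<beta> = \<beta>"
    by (rule Delta_ext[OF Delta_compose[OF b Delta_id] b]) (simp add: compose_def Delta_le[OF b])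
  then show ?thesis
    using simplicial_map_sop[OF y b, of "\<lambda>i\<in>{..n}. i"] simplicial_map_cells[OF y, of "\<lambda>i\<in>{..n}. i" n] b
    by (simp add: Delta_id sop_std_simplex)
qed

text \<open>A map to a discrete simplicial set takes one value on connected pieces, and the horn is
  connected: every vertex of \<open>\<beta>\<close> is joined to \<open>k\<close> by an edge that
  still misses the vertex missed by \<open>\<beta>\<close>.\<close>

lemma horn_map_discrete:
  assumes a: "simplicial_map (horn n k) (sdiscrete A) a" and k: "k \<le> n" and b: "\<beta> \<in> cells (horn n k) m"
  shows "a m \<beta> = a 0 (vtx k)"
proof -
  have move: "a m \<beta> = a 0 (vtx (\<beta> i))" if "\<beta> \<in> cells (horn n k) m" "i \<le> m" for m \<beta> i
    using simplicial_map_sop[OF a vtx_Delta[OF that(2)] that(1)] simplicial_map_cells[OF a that(1)]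
      sop_horn[OF vtx_Delta[OF that(2)] that(1)] vtx_Delta[OF that(2)] by simp
  obtain j where j: "j \<le> n" "j \<noteq> k" "j \<notin> \<beta> ` {..m}" and bD: "\<beta> \<in> Delta m n" using b by (auto simp: cells_horn)
  let ?i = "\<beta> 0"
  \<comment> \<open>The edge between the first vertex of \<open>\<beta>\<close> and
    \<open>k\<close>, oriented by \<open>min\<close> and \<open>max\<close> to be monotone.\<close>
  let ?\<xi> = "\<lambda>l\<in>{..1}. if l = 0 then min ?i k else max ?i k"
  have i: "?i \<le> n" by (rule Delta_le[OF bD]) simp
  have "?\<xi> \<in> Delta 1 n" by (rule DeltaI) (use i k in auto)
  moreover have "?i \<noteq> j" using j(3) by auto
  ultimately have e: "?\<xi> \<in> cells (horn n k) 1" unfolding cells_horn using j by (auto simp: min_def max_def)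
  have "a 0 (vtx (min ?i k)) = a 0 (vtx (max ?i k))" using move[OF e, of 0] move[OF e, of 1] by simp
  then have "a 0 (vtx ?i) = a 0 (vtx k)" by (cases "?i \<le> k") (simp_all add: min_def max_def)
  then show ?thesis using move[OF b, of 0] by simp
qed

text \<open>Plots have type \<open>point \<Rightarrow> 'u\<close>, while total spaces must have
  their simplices in \<open>'u\<close>; the injection \<open>e\<close> brings them back.\<close>

locale plot_embedding =
  fixes X :: "'x diffspace" and G :: "'g dgroup" and e :: "(point \<Rightarrow> 'u) \<Rightarrow> 'u"
  assumes X: "diffeological_space X" and G: "diffeological_group G" and e: "inj e"
begin

abbreviation "dec \<equiv> inv_into UNIV e"

lemma dec_e [simp]: "dec (e p) = p"
  by (rule inv_f_f[OF e])

lemma e_eq [simp]: "e p = e q \<longleftrightarrow> p = q"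
  using e by (simp add: inj_eq)

lemma Gd: "diffeological_space (dspace G)" and Gg: "group G"
  using G by (simp_all add: diffeological_group_def)

definition emb :: "'u diffspace \<Rightarrow> 'u spsh" where
  "emb P = spsh_of (\<lambda>U. sdiscrete (e ` plots P U)) (\<lambda>V U f n x. e (compose (points V) (dec x) f))"

lemma val_emb [simp]: "U \<in> Cart \<Longrightarrow> val (emb P) U = sdiscrete (e ` plots P U)"
  by (simp add: emb_def)

lemma res_emb [simp]: "f \<in> cart_hom V U \<Longrightarrow> p \<in> plots P U \<Longrightarrow> res (emb P) V U f n (e p) = e (compose (points V) p f)"
  by (simp add: emb_def)

lemma simplicial_presheaf_emb:
  assumes P: "diffeological_space P" shows "simplicial_presheaf (emb P)"
  unfolding emb_def
  by (rule simplicial_presheaf_spsh_of)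
    (auto simp: simplicial_set_sdiscrete plots_compose[OF P] compose_compose_hom compose_id_plot[OF plots_PiE[OF P]])

text \<open>Only the simplices of the total space are encoded; those of the base and of the group
  are plots as they stand. Hence the projection decodes its argument, and the action decodes the
  point and encodes the result.\<close>

definition Ro :: "('u, 'g, 'x) dbundle \<Rightarrow> ('u, point \<Rightarrow> 'g, point \<Rightarrow> 'x) ibundle" where
  "Ro E = \<lparr>itotal = emb (dtotal E),
     iproj = (\<lambda>U\<in>Cart. srestrict (sdiscrete (e ` plots (dtotal E) U)) (\<lambda>n x. compose (points U) (dproj E) (dec x))),
     iact = (\<lambda>U\<in>Cart. srestrict (sprod (sdiscrete (e ` plots (dtotal E) U)) (sdiscrete (gplots G U)))
       (\<lambda>n (x, g). e (\<lambda>u\<in>points U. dact E (dec x u, g u))))\<rparr>"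

lemma itotal_Ro [simp]: "itotal (Ro E) = emb (dtotal E)"
  by (simp add: Ro_def)

lemma iproj_Ro [simp]: "U \<in> Cart \<Longrightarrow> p \<in> plots (dtotal E) U \<Longrightarrow> iproj (Ro E) U n (e p) = compose (points U) (dproj E) p"
  by (simp add: Ro_def srestrict_def)

lemma iact_Ro [simp]: "U \<in> Cart \<Longrightarrow> p \<in> plots (dtotal E) U \<Longrightarrow> g \<in> gplots G U \<Longrightarrow>
    iact (Ro E) U n (e p, g) = e (\<lambda>u\<in>points U. dact E (p u, g u))"
  by (simp add: Ro_def srestrict_def)

end

locale embedded_bundle = plot_embedding X G e + diff_bundle X G E
  for X :: "'x diffspace" and G :: "'g dgroup" and e :: "(point \<Rightarrow> 'u) \<Rightarrow> 'u" and E :: "('u, 'g, 'x) dbundle"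
begin

lemma psh_map_proj: "psh_map (emb P) (psh_discrete X) (iproj (Ro E))"
proof (rule psh_mapI)
  show "iproj (Ro E) \<in> extensional Cart" by (simp add: Ro_def)
  show "simplicial_map (val (emb P) U) (val (psh_discrete X) U) (iproj (Ro E) U)" if U: "U \<in> Cart" for U
  proof (rule simplicial_mapI)
    show "iproj (Ro E) U n \<in> extensional (cells (val (emb P) U) n)" for n
      using U by (simp add: Ro_def srestrict_def)
  qed (use U dsmoothD(2)[OF proj_smooth] in auto)
  fix V U f n x assume f: "f \<in> cart_hom V U" and x: "x \<in> cells (val (emb P) U) n"
  note VU = cart_hom_Cart[OF f]
  obtain p where p: "x = e p" "p \<in> plots P U" using x VU by auto
  show "iproj (Ro E) V n (res (emb P) V U f n x) = res (psh_discrete X) V U f n (iproj (Ro E) U n x)"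
    using p VU f plots_compose[OF P p(2) f] dsmoothD(2)[OF proj_smooth p(2)] cart_hom_PiE[OF f]
    by (auto simp: compose_def fun_eq_iff PiE_iff)
qed

lemma psh_action_R: "psh_action (group_discrete G) (emb P) (iact (Ro E))"
  unfolding psh_action_def
proof (intro conjI ballI allI)
  show "psh_map (psh_prod (emb P) (underlying (group_discrete G))) (emb P) (iact (Ro E))"
    unfolding group_discrete_simps
  proof (rule psh_mapI)
    show "iact (Ro E) \<in> extensional Cart" by (simp add: Ro_def)
    show "simplicial_map (val (psh_prod (emb P) (psh_discrete (dspace G))) U) (val (emb P) U) (iact (Ro E) U)"
      if U: "U \<in> Cart" for U
    proof (rule simplicial_mapI)
      show "iact (Ro E) U n \<in> extensional (cells (val (psh_prod (emb P) (psh_discrete (dspace G))) U) n)" for n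
        using U by (simp add: Ro_def srestrict_def)
    qed (use U act_plot in auto)
    fix V U f n z assume f: "f \<in> cart_hom V U" and z: "z \<in> cells (val (psh_prod (emb P) (psh_discrete (dspace G))) U) n"
    note VU = cart_hom_Cart[OF f]
    obtain p g where p: "z = (e p, g)" "p \<in> plots P U" "g \<in> gplots G U" using z VU by auto
    have pg: "compose (points V) p f \<in> plots P V" "compose (points V) g f \<in> gplots G V"
      using plots_compose[OF P p(2) f] plots_compose[OF Gd _ f] p(3) by simp_all
    have "(\<lambda>u\<in>points V. \<rho> (compose (points V) p f u, compose (points V) g f u)) =
        compose (points V) (\<lambda>u\<in>points U. \<rho> (p u, g u)) f"
      using cart_hom_PiE[OF f] by (auto simp: compose_def fun_eq_iff PiE_iff)
    then show "iact (Ro E) V n (res (psh_prod (emb P) (psh_discrete (dspace G))) V U f n z) =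
        res (emb P) V U f n (iact (Ro E) U n z)"
      using p VU f pg act_plot[OF p(2,3)] by simp
  qed
  fix U n x assume U: "U \<in> Cart" and x: "x \<in> cells (val (emb P) U) n"
  then obtain p where p: "x = e p" "p \<in> plots P U" by auto
  note pP = plots_PiE[OF P p(2)]
  have "(\<lambda>_\<in>points U. \<one>\<^bsub>G\<^esub>) \<in> gplots G U"
    using const_plot[OF Gd U, of "\<one>\<^bsub>G\<^esub>"] group.is_monoid[OF Gg] by (simp add: monoid.one_closed)
  moreover have "(\<lambda>u\<in>points U. \<rho> (p u, (\<lambda>u\<in>points U. \<one>\<^bsub>G\<^esub>) u)) = p"
    using pP by (intro extensionalityI[of _ "points U"]) (auto simp: act_one PiE_iff)
  ultimately show "iact (Ro E) U n (x, \<one>\<^bsub>grp (group_discrete G) U n\<^esub>) = x"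
    using p U by simp
  fix g h assume "g \<in> carrier (grp (group_discrete G) U n)" "h \<in> carrier (grp (group_discrete G) U n)"
  then have gh: "g \<in> gplots G U" "h \<in> gplots G U" by simp_all
  have gc: "g u \<in> carrier G" "h u \<in> carrier G" "p u \<in> carrier P" if "u \<in> points U" for u
    using that plots_PiE[OF Gd, of g U] plots_PiE[OF Gd, of h U] gh pP by (auto simp: PiE_iff)
  show "iact (Ro E) U n (iact (Ro E) U n (x, g), h) =
      iact (Ro E) U n (x, g \<otimes>\<^bsub>grp (group_discrete G) U n\<^esub> h)"
    using p U gh act_plot[OF p(2) gh(1)] gplots_mult[OF G gh] by (auto simp: act_mult gc fun_eq_iff)
qed

text \<open>The one-element cover works. For n = 0 the horn is empty and a global lift of the plot
  is the filler; for n > 0 the horn is constant, and so is its filler.\<close>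

lemma local_fibration_R: "local_fibration (emb P) (psh_discrete X) (iproj (Ro E))"
  unfolding local_fibration_def
proof (intro conjI ballI psh_map_proj)
  fix U assume U: "U \<in> Cart"
  let ?A = "sdiscrete (e ` plots P U)" and ?Y = "sdiscrete (plots X U)" and ?f = "iproj (Ro E) U"
  have "\<exists>l. simplicial_map (std_simplex n) ?A l \<and>
      srestrict (horn n k) l = scomp (horn n k) (sid ?A) a \<and>
      scomp (std_simplex n) ?f l = scomp (std_simplex n) (sid ?Y) y"
    if k: "k \<le> n" and a: "simplicial_map (horn n k) ?A a" and y: "simplicial_map (std_simplex n) ?Y y"
      and ay: "scomp (horn n k) ?f a = srestrict (horn n k) y" for n k a y
  proof -
    let ?v = "y n (\<lambda>i\<in>{..n}. i)"
    have v: "?v \<in> plots X U" using simplicial_map_cells[OF y, of "\<lambda>i\<in>{..n}. i" n] Delta_id by simp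
    note yv = std_simplex_map_discrete[OF y]
    have fa: "?f m (a m \<beta>) = y m \<beta>" if "\<beta> \<in> cells (horn n k) m" for m \<beta>
      using fun_cong[OF fun_cong[OF ay, of m], of \<beta>] that by (simp add: scomp_def srestrict_def compose_eq)
    have "\<exists>q\<in>plots P U. compose (points U) \<pi> q = ?v \<and> (\<forall>m. \<forall>\<beta>\<in>cells (horn n k) m. a m \<beta> = e q)"
    proof (cases "n = 0")
      case True
      obtain q where q: "q \<in> plots P U" "\<And>u. u \<in> points U \<Longrightarrow> \<pi> (q u) = ?v u" using plot_lift[OF v] by blast
      have "compose (points U) \<pi> q = ?v"
        by (rule extensionalityI[of _ "points U"]) (use q plots_PiE[OF X v] in \<open>auto simp: compose_eq PiE_iff\<close>)
      moreover have "cells (horn n k) m = {}" for m using k True by (simp add: cells_horn)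
      ultimately show ?thesis using q(1) by auto
    next
      case False
      obtain j where "j \<le> n" "j \<noteq> k" using False by (metis le0 order_refl)
      then have kh: "vtx k \<in> cells (horn n k) 0" using vtx_Delta[OF k] by (auto simp: cells_horn)
      obtain q where q: "a 0 (vtx k) = e q" "q \<in> plots P U" using simplicial_map_cells[OF a kh] by auto
      have "compose (points U) \<pi> q = ?v"
        using fa[OF kh] yv[OF vtx_Delta[OF k]] q U by simp
      then show ?thesis using horn_map_discrete[OF a k] q by auto
    qed
    then obtain q where q: "q \<in> plots P U" "compose (points U) \<pi> q = ?v"
      "\<And>m \<beta>. \<beta> \<in> cells (horn n k) m \<Longrightarrow> a m \<beta> = e q" by blast
    let ?l = "\<lambda>m. \<lambda>\<beta>\<in>Delta m n. e q"
    have hD: "\<beta> \<in> Delta m n" if "\<beta> \<in> cells (horn n k) m" for m \<beta> using that by (simp add: cells_horn)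
    show ?thesis
    proof (intro exI conjI)
      show "simplicial_map (std_simplex n) ?A ?l"
        by (rule simplicial_mapI) (auto simp: q(1) sop_std_simplex Delta_compose)
      show "srestrict (horn n k) ?l = scomp (horn n k) (sid ?A) a"
        using hD q(1,3) by (auto simp: srestrict_def scomp_def sid_def compose_def fun_eq_iff)
      show "scomp (std_simplex n) ?f ?l = scomp (std_simplex n) (sid ?Y) y"
      proof (rule ext)
        show "scomp (std_simplex n) ?f ?l m = scomp (std_simplex n) (sid ?Y) y m" for m
          by (rule extensionalityI[of _ "Delta m n"]) (use q(1,2) U v yv in \<open>simp_all add: scomp_def sid_def compose_eq\<close>)
      qed
    qed
  qed
  then show "\<exists>\<U>. good_open_cover U \<U> \<and>
       (\<forall>S\<in>\<U>. let V = open_sub U S in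
         \<forall>n k a y. k \<le> n \<and>
           simplicial_map (horn n k) (val (emb P) U) a \<and> simplicial_map (std_simplex n) (val (psh_discrete X) U) y \<and>
           scomp (horn n k) (iproj (Ro E) U) a = srestrict (horn n k) y \<longrightarrow>
           (\<exists>l. simplicial_map (std_simplex n) (val (emb P) V) l \<and>
              srestrict (horn n k) l = scomp (horn n k) (res (emb P) V U (incl S)) a \<and>
              scomp (std_simplex n) (iproj (Ro E) V) l = scomp (std_simplex n) (res (psh_discrete X) V U (incl S)) y))"
    by (intro exI[of _ "{points U}"] conjI good_open_cover_trivial[OF U])
      (simp add: Let_def open_sub_points[OF U] incl_points presheaf_id[OF simplicial_presheaf_emb[OF P] U]
        presheaf_id[OF simplicial_presheaf_discrete[OF X] U] U)
qed

lemma proj_iact: "U \<in> Cart \<Longrightarrow> p \<in> plots P U \<Longrightarrow> g \<in> gplots G U \<Longrightarrow>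
    compose (points U) \<pi> (\<lambda>u\<in>points U. \<rho> (p u, g u)) = compose (points U) \<pi> p"
  using plots_PiE[OF P, of p U] plots_PiE[OF Gd, of g U] by (auto simp: compose_def fun_eq_iff proj_act PiE_iff)

abbreviation "Rprod \<equiv> psh_prod (emb P) (psh_discrete (dspace G))"
abbreviation "Rfib \<equiv> psh_fibre_prod (emb P) (iproj (Ro E))"
abbreviation "Rshear \<equiv> \<lambda>U\<in>Cart. srestrict (val Rprod U) (\<lambda>n (p, g). (p, iact (Ro E) U n (p, g)))"

lemma Rshear_apply [simp]: "U \<in> Cart \<Longrightarrow> p \<in> plots P U \<Longrightarrow> g \<in> gplots G U \<Longrightarrow>
    Rshear U n (e p, g) = (e p, e (\<lambda>u\<in>points U. \<rho> (p u, g u)))"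
  by (simp add: srestrict_def)

text \<open>The shear map is bijective on each value of the presheaves: injective because the action
  is free on fibres, surjective because two plots over the same plot of the base differ by a plot of
  the group.\<close>

lemma local_weak_equivalence_R: "local_weak_equivalence Rprod Rfib Rshear"
proof (rule local_weak_equivalence_iso)
  note presheaves = simplicial_presheaf_emb[OF P] simplicial_presheaf_discrete[OF Gd]
  show A: "simplicial_presheaf Rprod" by (rule simplicial_presheaf_prod[OF presheaves])
  show Y: "simplicial_presheaf Rfib" by (rule simplicial_presheaf_fibre_prod[OF presheaves(1) psh_map_proj])
  have in_fib: "(e p, e (\<lambda>u\<in>points U. \<rho> (p u, g u))) \<in> cells (val Rfib U) n"
    if "U \<in> Cart" "p \<in> plots P U" "g \<in> gplots G U" for U n p g
    using that act_plot[OF that(2,3)] proj_iact by simp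
  show "psh_map Rprod Rfib Rshear"
  proof (rule psh_mapI)
    show "Rshear \<in> extensional Cart" by simp
    show "simplicial_map (val Rprod U) (val Rfib U) (Rshear U)" if U: "U \<in> Cart" for U
    proof (rule simplicial_mapI)
      show "Rshear U n z \<in> cells (val Rfib U) n" if "z \<in> cells (val Rprod U) n" for n z
        using that U in_fib by (auto simp del: restrict_apply val_psh_fibre_prod)
      show "Rshear U n \<in> extensional (cells (val Rprod U) n)" for n
        using U by (simp add: srestrict_def)
      fix m n \<alpha> z assume a: "\<alpha> \<in> Delta m n" and "z \<in> cells (val Rprod U) n"
      then obtain p g where z: "z = (e p, g)" "p \<in> plots P U" "g \<in> gplots G U" using U by auto
      note f = in_fib[OF U z(2,3), of n]
      show "Rshear U m (sop (val Rprod U) m n \<alpha> z) = sop (val Rfib U) m n \<alpha> (Rshear U n z)"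
        unfolding z(1) Rshear_apply[OF U z(2,3)]
        using sop_sfibre_prod[OF a f[unfolded val_psh_fibre_prod[OF U]]] a z U act_plot[OF z(2,3)] Rshear_apply[OF U z(2,3), of m]
        by (simp del: restrict_apply sop_sfibre_prod)
    qed
    fix V U f n z assume f: "f \<in> cart_hom V U" and zz: "z \<in> cells (val Rprod U) n"
    note VU = cart_hom_Cart[OF f]
    obtain p g where z: "z = (e p, g)" "p \<in> plots P U" "g \<in> gplots G U" using zz VU by auto
    have pg: "compose (points V) p f \<in> plots P V" "compose (points V) g f \<in> gplots G V"
      using plots_compose[OF P z(2) f] plots_compose[OF Gd _ f] z(3) by simp_all
    have "(\<lambda>u\<in>points V. \<rho> (compose (points V) p f u, compose (points V) g f u)) =
        compose (points V) (\<lambda>u\<in>points U. \<rho> (p u, g u)) f"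
      using cart_hom_PiE[OF f] by (auto simp: compose_def fun_eq_iff PiE_iff)
    then show "Rshear V n (res Rprod V U f n z) = res Rfib V U f n (Rshear U n z)"
      unfolding z(1) Rshear_apply[OF VU(2) z(2,3)]
      using res_psh_fibre_prod[where A = "emb P" and \<phi> = "iproj (Ro E)" and x = "e p" and y = "e (\<lambda>u\<in>points U. \<rho> (p u, g u))",
          OF f in_fib[OF VU(2) z(2,3), of n, unfolded val_psh_fibre_prod[OF VU(2)]]]
        Rshear_apply[OF VU(1) pg, of n] act_plot[OF z(2,3)] f z VU
      by (simp del: restrict_apply res_psh_fibre_prod)
  qed
  show "bij_betw (Rshear U n) (cells (val Rprod U) n) (cells (val Rfib U) n)" if U: "U \<in> Cart" for U n
    unfolding bij_betw_def
  proof
    show "inj_on (Rshear U n) (cells (val Rprod U) n)"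
    proof (rule inj_onI)
      fix z z' assume zz: "z \<in> cells (val Rprod U) n" "z' \<in> cells (val Rprod U) n" and eq: "Rshear U n z = Rshear U n z'"
      obtain p g where z: "z = (e p, g)" "p \<in> plots P U" "g \<in> gplots G U" using zz U by auto
      obtain p' g' where z': "z' = (e p', g')" "p' \<in> plots P U" "g' \<in> gplots G U" using zz U by auto
      note gP = plots_PiE[OF Gd, unfolded dspace_simps, OF z(3)] plots_PiE[OF Gd, unfolded dspace_simps, OF z'(3)]
      have "p = p' \<and> (\<lambda>u\<in>points U. \<rho> (p u, g u)) = (\<lambda>u\<in>points U. \<rho> (p' u, g' u))"
        using eq unfolding z(1) z'(1) Rshear_apply[OF U z(2,3)] Rshear_apply[OF U z'(2,3)] prod.inject e_eq .
      then have pp: "p = p'" and r: "(\<lambda>u\<in>points U. \<rho> (p u, g u)) = (\<lambda>u\<in>points U. \<rho> (p' u, g' u))"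
        by blast+
      have "\<rho> (p u, g u) = \<rho> (p u, g' u)" if "u \<in> points U" for u
        using that fun_cong[OF r, of u] pp by simp
      then have "g = g'"
        using gP plots_PiE[OF P z(2)]
        by (intro extensionalityI[of _ "points U"] act_free) (auto simp: PiE_iff)
      then show "z = z'" using pp z z' by simp
    qed
    show "Rshear U n ` cells (val Rprod U) n = cells (val Rfib U) n"
    proof
      show "Rshear U n ` cells (val Rprod U) n \<subseteq> cells (val Rfib U) n"
        using U in_fib by (auto simp del: restrict_apply val_psh_fibre_prod)
      show "cells (val Rfib U) n \<subseteq> Rshear U n ` cells (val Rprod U) n"
      proof
        fix z assume z: "z \<in> cells (val Rfib U) n"
        obtain p q where pq: "z = (e p, e q)" "p \<in> plots P U" "q \<in> plots P U" and
          eq: "compose (points U) \<pi> p = compose (points U) \<pi> q"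
          using z U by (cases z) auto
        have "\<pi> (p u) = \<pi> (q u)" if "u \<in> points U" for u using fun_cong[OF eq, of u] that by (simp add: compose_eq)
        then obtain g where g: "g \<in> gplots G U" "\<And>u. u \<in> points U \<Longrightarrow> q u = \<rho> (p u, g u)"
          using difference_plot[OF pq(2,3)] by blast
        have "(\<lambda>u\<in>points U. \<rho> (p u, g u)) = q"
          using plots_PiE[OF P pq(3)] g(2) by (intro extensionalityI[of _ "points U"]) (auto simp: PiE_iff)
        then have "z = Rshear U n (e p, g)" unfolding Rshear_apply[OF U pq(2) g(1)] pq(1) by simp
        then show "z \<in> Rshear U n ` cells (val Rprod U) n" using U pq(2) g(1) by auto
      qed
    qed
  qed
qed

lemma principal_R: "principal_inf_bundle (psh_discrete X) (group_discrete G) (Ro E)"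
  unfolding principal_inf_bundle_def Let_def itotal_Ro
proof (intro conjI ballI allI)
  show "local_weak_equivalence (psh_prod (emb P) (underlying (group_discrete G))) Rfib
     (\<lambda>U\<in>Cart. srestrict (val (psh_prod (emb P) (underlying (group_discrete G))) U) (\<lambda>n (p, g). (p, iact (Ro E) U n (p, g))))"
    using local_weak_equivalence_R by simp
  fix U n x g assume "U \<in> Cart" "x \<in> cells (val (emb P) U) n" "g \<in> carrier (grp (group_discrete G) U n)"
  then show "iproj (Ro E) U n (iact (Ro E) U n (x, g)) = iproj (Ro E) U n x"
    using act_plot proj_iact by auto
qed (rule simplicial_presheaf_emb[OF P] psh_map_proj psh_action_R local_fibration_R)+

end

section \<open>The categories of bundles\<close>

lemma psh_map_eqI:
  assumes "psh_map A B \<phi>" "psh_map A B \<psi>"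
    and "\<And>U n x. U \<in> Cart \<Longrightarrow> x \<in> cells (val A U) n \<Longrightarrow> \<phi> U n x = \<psi> U n x"
  shows "\<phi> = \<psi>"
proof (rule extensionalityI[of _ Cart])
  show "\<phi> \<in> extensional Cart" "\<psi> \<in> extensional Cart" using assms psh_mapD(1) by blast+
  fix U assume U: "U \<in> Cart"
  have x: "\<xi> U n \<in> extensional (cells (val A U) n)" if "psh_map A B \<xi>" for \<xi> n
    using psh_mapD(2)[OF that U] by (auto simp: simplicial_map_def PiE_iff)
  show "\<phi> U = \<psi> U"
    by (rule ext, rule extensionalityI[OF x[OF assms(1)] x[OF assms(2)]]) (rule assms(3)[OF U])
qed

lemma psh_map_sid: "simplicial_presheaf A \<Longrightarrow> psh_map A A (\<lambda>U\<in>Cart. sid (val A U))"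
proof (rule psh_mapI)
  assume A: "simplicial_presheaf A"
  show "simplicial_map (val A U) (val A U) ((\<lambda>U\<in>Cart. sid (val A U)) U)" if U: "U \<in> Cart" for U
    using sop_cells[OF presheaf_sset[OF A U]] U by (auto intro!: simplicial_mapI simp: sid_def)
  show "(\<lambda>U\<in>Cart. sid (val A U)) V n (res A V U f n x) = res A V U f n ((\<lambda>U\<in>Cart. sid (val A U)) U n x)"
    if "f \<in> cart_hom V U" "x \<in> cells (val A U) n" for V U f n x
    using that cart_hom_Cart[OF that(1)] presheaf_cells[OF A that] by (simp add: sid_def)
qed simp

lemma psh_map_scomp:
  assumes A: "simplicial_presheaf A" and f: "psh_map A B \<phi>" and g: "psh_map B C \<psi>"
  shows "psh_map A C (\<lambda>U\<in>Cart. scomp (val A U) (\<psi> U) (\<phi> U))"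
proof (rule psh_mapI)
  show "simplicial_map (val A U) (val C U) ((\<lambda>U\<in>Cart. scomp (val A U) (\<psi> U) (\<phi> U)) U)" if U: "U \<in> Cart" for U
    using simplicial_map_scomp[OF psh_mapD(2)[OF f U] psh_mapD(2)[OF g U] presheaf_sset[OF A U]] U by simp
  fix V U h n x assume h: "h \<in> cart_hom V U" and x: "x \<in> cells (val A U) n"
  note VU = cart_hom_Cart[OF h]
  show "(\<lambda>U\<in>Cart. scomp (val A U) (\<psi> U) (\<phi> U)) V n (res A V U h n x) =
      res C V U h n ((\<lambda>U\<in>Cart. scomp (val A U) (\<psi> U) (\<phi> U)) U n x)"
    using VU x presheaf_cells[OF A h x] psh_mapD(3)[OF f h x] psh_mapD(3)[OF g h psh_map_cells[OF f VU(2) x]]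
    by (simp add: scomp_def compose_eq)
qed simp

lemma Mor_PrinInf_iff: "\<phi> \<in> Mor (PrinInf X G) E E' \<longleftrightarrow> psh_map (itotal E) (itotal E') \<phi> \<and>
    (\<forall>U\<in>Cart. \<forall>n. \<forall>p\<in>cells (val (itotal E) U) n.
       iproj E' U n (\<phi> U n p) = iproj E U n p \<and>
       (\<forall>g\<in>carrier (grp G U n). \<phi> U n (iact E U n (p, g)) = iact E' U n (\<phi> U n p, g)))"
  by (simp add: PrinInf_def)

lemma PrinInf_simps [simp]:
  "E \<in> Ob (PrinInf X G) \<longleftrightarrow> principal_inf_bundle X G E"
  "Comp (PrinInf X G) E E' E'' \<psi> \<phi> = (\<lambda>U\<in>Cart. scomp (val (itotal E) U) (\<psi> U) (\<phi> U))"
  "Ident (PrinInf X G) E = (\<lambda>U\<in>Cart. sid (val (itotal E) U))"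
  by (simp_all add: PrinInf_def)

lemma DiffPrin_simps [simp]:
  "E \<in> Ob (DiffPrin X G) \<longleftrightarrow> diff_principal_bundle X G E"
  "Comp (DiffPrin X G) E E' E'' g f = compose (carrier (dtotal E)) g f"
  "Ident (DiffPrin X G) E = (\<lambda>p\<in>carrier (dtotal E). p)"
  by (simp_all add: DiffPrin_def)

lemma Mor_DiffPrin_iff: "f \<in> Mor (DiffPrin X G) E E' \<longleftrightarrow> dsmooth (dtotal E) (dtotal E') f \<and>
    (\<forall>p\<in>carrier (dtotal E). dproj E' (f p) = dproj E p) \<and>
    (\<forall>p\<in>carrier (dtotal E). \<forall>g\<in>carrier G. f (dact E (p, g)) = dact E' (f p, g))"
  by (simp add: DiffPrin_def)

locale inf_bundle =
  fixes X :: "'x spsh" and G :: "'g sgpsh" and E :: "('p, 'g, 'x) ibundle"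
  assumes E: "principal_inf_bundle X G E"
    and grp_cells: "\<And>U n. U \<in> Cart \<Longrightarrow> carrier (grp G U n) = cells (val (underlying G) U) n"
begin

abbreviation "P \<equiv> itotal E"
abbreviation "\<pi> \<equiv> iproj E"
abbreviation "\<rho> \<equiv> iact E"

lemma inf_bundleD:
  shows P: "simplicial_presheaf P" and proj: "psh_map P X \<pi>" and action: "psh_action G P \<rho>"
    and fibration: "local_fibration P X \<pi>"
    and proj_act: "U \<in> Cart \<Longrightarrow> p \<in> cells (val P U) n \<Longrightarrow> g \<in> carrier (grp G U n) \<Longrightarrow> \<pi> U n (\<rho> U n (p, g)) = \<pi> U n p"
    and shear: "local_weak_equivalence (psh_prod P (underlying G)) (psh_fibre_prod P \<pi>)
          (\<lambda>U\<in>Cart. srestrict (val (psh_prod P (underlying G)) U) (\<lambda>n (p, g). (p, \<rho> U n (p, g))))"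
  using E unfolding principal_inf_bundle_def Let_def by blast+

lemma act: "psh_map (psh_prod P (underlying G)) P \<rho>"
  and act_one: "U \<in> Cart \<Longrightarrow> p \<in> cells (val P U) n \<Longrightarrow> \<rho> U n (p, \<one>\<^bsub>grp G U n\<^esub>) = p"
  and act_mult: "U \<in> Cart \<Longrightarrow> p \<in> cells (val P U) n \<Longrightarrow> g \<in> carrier (grp G U n) \<Longrightarrow> h \<in> carrier (grp G U n) \<Longrightarrow>
    \<rho> U n (\<rho> U n (p, g), h) = \<rho> U n (p, g \<otimes>\<^bsub>grp G U n\<^esub> h)"
  using action unfolding psh_action_def by blast+

lemma act_cells: "U \<in> Cart \<Longrightarrow> p \<in> cells (val P U) n \<Longrightarrow> g \<in> carrier (grp G U n) \<Longrightarrow> \<rho> U n (p, g) \<in> cells (val P U) n"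
  using psh_map_cells[OF act, of U "(p, g)" n] by (simp add: grp_cells)

lemma mor_map: "\<phi> \<in> Mor (PrinInf X G) E E' \<Longrightarrow> psh_map P (itotal E') \<phi>"
  by (simp add: Mor_PrinInf_iff)

lemma mor_cells: "\<phi> \<in> Mor (PrinInf X G) E E' \<Longrightarrow> U \<in> Cart \<Longrightarrow> p \<in> cells (val P U) n \<Longrightarrow> \<phi> U n p \<in> cells (val (itotal E') U) n"
  by (rule psh_map_cells[OF mor_map])

lemma mor_comp: assumes f: "\<phi> \<in> Mor (PrinInf X G) E E'" and g: "\<psi> \<in> Mor (PrinInf X G) E' E''"
  shows "Comp (PrinInf X G) E E' E'' \<psi> \<phi> \<in> Mor (PrinInf X G) E E''"
  unfolding Mor_PrinInf_iff PrinInf_simps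
proof (intro conjI ballI allI)
  show "psh_map P (itotal E'') (\<lambda>U\<in>Cart. scomp (val P U) (\<psi> U) (\<phi> U))"
    using f g by (intro psh_map_scomp[OF P, of "itotal E'"]) (simp_all add: Mor_PrinInf_iff)
  fix U n p assume U: "U \<in> Cart" and p: "p \<in> cells (val P U) n"
  note fp = mor_cells[OF f U p]
  show "iproj E'' U n ((\<lambda>U\<in>Cart. scomp (val P U) (\<psi> U) (\<phi> U)) U n p) = \<pi> U n p"
    using f g U p fp by (simp add: Mor_PrinInf_iff scomp_def compose_eq)
  fix h assume h: "h \<in> carrier (grp G U n)"
  show "(\<lambda>U\<in>Cart. scomp (val P U) (\<psi> U) (\<phi> U)) U n (\<rho> U n (p, h)) =
      iact E'' U n ((\<lambda>U\<in>Cart. scomp (val P U) (\<psi> U) (\<phi> U)) U n p, h)"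
    using f g U p fp h act_cells[OF U p h] by (simp add: Mor_PrinInf_iff scomp_def compose_eq)
qed

lemma mor_ident: "Ident (PrinInf X G) E \<in> Mor (PrinInf X G) E E"
  unfolding Mor_PrinInf_iff PrinInf_simps using psh_map_sid[OF P] act_cells by (simp add: sid_def)

end

lemma category_PrinInf:
  assumes G: "\<And>U n. U \<in> Cart \<Longrightarrow> carrier (grp G U n) = cells (val (underlying G) U) n"
  shows "category (PrinInf X G)"
proof -
  have b: "inf_bundle X G E" if "E \<in> Ob (PrinInf X G)" for E
    using that G by (simp add: inf_bundle_def)
  note mm = inf_bundle.mor_map[OF b] and mc = inf_bundle.mor_comp[OF b] and mi = inf_bundle.mor_ident[OF b]
    and cl = inf_bundle.mor_cells[OF b]
  show ?thesis
    unfolding category_def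
  proof (intro conjI ballI)
    fix a b \<phi> assume a: "a \<in> Ob (PrinInf X G)" and b: "b \<in> Ob (PrinInf X G)" and f: "\<phi> \<in> Mor (PrinInf X G) a b"
    note c = cl[OF a f]
    show "Comp (PrinInf X G) a b b (Ident (PrinInf X G) b) \<phi> = \<phi>"
      by (rule psh_map_eqI[OF mm[OF a mc[OF a f mi[OF b]]] mm[OF a f]]) (simp add: scomp_def sid_def compose_eq c)
    show "Comp (PrinInf X G) a a b \<phi> (Ident (PrinInf X G) a) = \<phi>"
      by (rule psh_map_eqI[OF mm[OF a mc[OF a mi[OF a] f]] mm[OF a f]]) (simp add: scomp_def sid_def compose_eq)
  next
    fix a b c d \<phi> \<psi> \<theta> assume a: "a \<in> Ob (PrinInf X G)" and b: "b \<in> Ob (PrinInf X G)" and c: "c \<in> Ob (PrinInf X G)"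
      and d: "d \<in> Ob (PrinInf X G)"
      and f: "\<phi> \<in> Mor (PrinInf X G) a b" and g: "\<psi> \<in> Mor (PrinInf X G) b c" and h: "\<theta> \<in> Mor (PrinInf X G) c d"
    show "Comp (PrinInf X G) a c d \<theta> (Comp (PrinInf X G) a b c \<psi> \<phi>) =
        Comp (PrinInf X G) a b d (Comp (PrinInf X G) b c d \<theta> \<psi>) \<phi>"
      by (rule psh_map_eqI[OF mm[OF a mc[OF a mc[OF a f g] h]] mm[OF a mc[OF a f mc[OF b g h]]]])
        (simp add: scomp_def compose_eq cl[OF a f])
  qed (rule mi mc; assumption)+
qed

lemma dsmooth_compose:
  assumes f: "dsmooth X Y f" and g: "dsmooth Y Z g" and X: "diffeological_space X"
  shows "dsmooth X Z (compose (carrier X) g f)"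
  unfolding dsmooth_def
proof (intro conjI allI ballI)
  show "compose (carrier X) g f \<in> carrier X \<rightarrow>\<^sub>E carrier Z"
    using dsmoothD(1)[OF f] dsmoothD(1)[OF g] by (auto simp: compose_def PiE_iff)
  fix U p assume p: "p \<in> plots X U"
  have "compose (points U) (compose (carrier X) g f) p = compose (points U) g (compose (points U) f p)"
    using plots_PiE[OF X p] by (auto simp: compose_def fun_eq_iff PiE_iff)
  then show "compose (points U) (compose (carrier X) g f) p \<in> plots Z U"
    using dsmoothD(2)[OF g dsmoothD(2)[OF f p]] by simp
qed

lemma dsmooth_id: "diffeological_space X \<Longrightarrow> dsmooth X X (\<lambda>x\<in>carrier X. x)"
proof -
  assume X: "diffeological_space X"
  have "compose (points U) (\<lambda>x\<in>carrier X. x) p = p" if "p \<in> plots X U" for p U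
    by (rule extensionalityI[of _ "points U"]) (use plots_PiE[OF X that] in \<open>auto simp: compose_def PiE_iff\<close>)
  then show ?thesis by (simp add: dsmooth_def)
qed

lemma category_DiffPrin:
  assumes X: "diffeological_space X" and G: "diffeological_group G"
  shows "category (DiffPrin X G)"
proof -
  have b: "diff_bundle X G E" if "E \<in> Ob (DiffPrin X G)" for E
    using that X G by (simp add: diff_bundle_def)
  have F: "f \<in> carrier (dtotal E) \<rightarrow>\<^sub>E carrier (dtotal E')" if "f \<in> Mor (DiffPrin X G) E E'" for f E E'
    using that dsmoothD(1) by (auto simp: Mor_DiffPrin_iff)
  show ?thesis
    unfolding category_def
  proof (intro conjI ballI)
    fix a assume a: "a \<in> Ob (DiffPrin X G)"
    interpret a: diff_bundle X G a by (rule b[OF a])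
    show "Ident (DiffPrin X G) a \<in> Mor (DiffPrin X G) a a"
      using dsmooth_id[OF a.P] a.act_carrier by (simp add: Mor_DiffPrin_iff)
    fix b f assume f: "f \<in> Mor (DiffPrin X G) a b"
    show "Comp (DiffPrin X G) a b b (Ident (DiffPrin X G) b) f = f"
      by (rule extensionalityI[of _ "carrier a.P"]) (use F[OF f] in \<open>auto simp: compose_def PiE_iff\<close>)
    show "Comp (DiffPrin X G) a a b f (Ident (DiffPrin X G) a) = f"
      by (rule extensionalityI[of _ "carrier a.P"]) (use F[OF f] in \<open>auto simp: compose_def PiE_iff\<close>)
    fix c g assume g: "g \<in> Mor (DiffPrin X G) b c"
    show "Comp (DiffPrin X G) a b c g f \<in> Mor (DiffPrin X G) a c"
      using f g dsmooth_compose[of a.P "dtotal b" f "dtotal c" g] a.P F[OF f] a.act_carrier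
      by (auto simp: Mor_DiffPrin_iff compose_def PiE_iff)
    fix d h assume "h \<in> Mor (DiffPrin X G) c d"
    show "Comp (DiffPrin X G) a c d h (Comp (DiffPrin X G) a b c g f) =
        Comp (DiffPrin X G) a b d (Comp (DiffPrin X G) b c d h g) f"
      using F[OF f] by (auto simp: compose_def PiE_iff fun_eq_iff)
  qed
qed

section \<open>Bundles form a full subcategory of principal \<open>\<infinity>\<close>-bundles\<close>

context plot_embedding
begin

abbreviation "InfB \<equiv> PrinInf (psh_discrete X) (group_discrete G)"
abbreviation "DiffB \<equiv> DiffPrin X G"
abbreviation single :: "'u \<Rightarrow> point \<Rightarrow> 'u" where "single a \<equiv> \<lambda>_\<in>points (Rn 0). a"

lemma embedded: "d \<in> Ob DiffB \<Longrightarrow> embedded_bundle X G e d"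
  using X G e by (simp add: embedded_bundle_def plot_embedding_def diff_bundle_def)

text \<open>One-point plots recover the carrier; through them maps of presheaves are read as maps of
  points.\<close>

lemma single_plot: "diffeological_space P \<Longrightarrow> single a \<in> plots P (Rn 0) \<longleftrightarrow> a \<in> carrier P"
proof
  assume P: "diffeological_space P"
  show "a \<in> carrier P" if "single a \<in> plots P (Rn 0)"
    using plots_PiE[OF P that] points_R0 by (auto simp: PiE_iff)
  show "single a \<in> plots P (Rn 0)" if "a \<in> carrier P"
    by (rule plots_point[OF P]) (use that in auto)
qed

lemma single_inj: "single a = single b \<longleftrightarrow> a = b"
  using points_R0 by (auto simp: fun_eq_iff)

lemma compose_single: "compose (points (Rn 0)) f (single a) = (\<lambda>_\<in>points (Rn 0). f a)"
  by (auto simp: compose_def)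

definition Ra :: "('u, 'g, 'x) dbundle \<Rightarrow> ('u, 'g, 'x) dbundle \<Rightarrow> ('u \<Rightarrow> 'u) \<Rightarrow> manifold \<Rightarrow> nat \<Rightarrow> 'u \<Rightarrow> 'u" where
  "Ra d d' f = (\<lambda>U\<in>Cart. srestrict (sdiscrete (e ` plots (dtotal d) U)) (\<lambda>n x. e (compose (points U) f (dec x))))"

lemma Ra_apply [simp]: "U \<in> Cart \<Longrightarrow> p \<in> plots (dtotal d) U \<Longrightarrow> Ra d d' f U n (e p) = e (compose (points U) f p)"
  by (simp add: Ra_def srestrict_def)

lemma Ra_mor:
  assumes d: "d \<in> Ob DiffB" and d': "d' \<in> Ob DiffB" and f: "f \<in> Mor DiffB d d'"
  shows "Ra d d' f \<in> Mor InfB (Ro d) (Ro d')"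
  unfolding Mor_PrinInf_iff itotal_Ro
proof (intro conjI ballI allI)
  interpret d: embedded_bundle X G e d by (rule embedded[OF d])
  interpret d': embedded_bundle X G e d' by (rule embedded[OF d'])
  have sm: "dsmooth d.P d'.P f" and fp: "\<And>p. p \<in> carrier d.P \<Longrightarrow> d'.\<pi> (f p) = d.\<pi> p"
    and fa: "\<And>p g. p \<in> carrier d.P \<Longrightarrow> g \<in> carrier G \<Longrightarrow> f (d.\<rho> (p, g)) = d'.\<rho> (f p, g)"
    using f by (auto simp: Mor_DiffPrin_iff)
  show "psh_map (emb d.P) (emb d'.P) (Ra d d' f)"
  proof (rule psh_mapI)
    show "Ra d d' f \<in> extensional Cart" by (simp add: Ra_def)
    show "simplicial_map (val (emb d.P) U) (val (emb d'.P) U) (Ra d d' f U)" if U: "U \<in> Cart" for U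
    proof (rule simplicial_mapI)
      show "Ra d d' f U n \<in> extensional (cells (val (emb d.P) U) n)" for n
        using U by (simp add: Ra_def srestrict_def)
    qed (use U dsmoothD(2)[OF sm] in auto)
    fix V U h n x assume h: "h \<in> cart_hom V U" and x: "x \<in> cells (val (emb d.P) U) n"
    note VU = cart_hom_Cart[OF h]
    obtain p where p: "x = e p" "p \<in> plots d.P U" using x VU by auto
    have "compose (points V) f (compose (points V) p h) = compose (points V) (compose (points U) f p) h"
      using cart_hom_PiE[OF h] by (auto simp: compose_def fun_eq_iff PiE_iff)
    then show "Ra d d' f V n (res (emb d.P) V U h n x) = res (emb d'.P) V U h n (Ra d d' f U n x)"
      using p VU h plots_compose[OF d.P p(2) h] dsmoothD(2)[OF sm p(2)] by simp
  qed
  fix U n x assume U: "U \<in> Cart" and x: "x \<in> cells (val (emb d.P) U) n"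
  obtain p where p: "x = e p" "p \<in> plots d.P U" using x U by auto
  note fpl = dsmoothD(2)[OF sm p(2)] and pP = plots_PiE[OF d.P p(2)]
  show "iproj (Ro d') U n (Ra d d' f U n x) = iproj (Ro d) U n x"
    using p U fpl pP fp by (auto simp: compose_def fun_eq_iff PiE_iff)
  fix g assume "g \<in> carrier (grp (group_discrete G) U n)"
  then have g: "g \<in> gplots G U" by simp
  have gc: "g u \<in> carrier G" if "u \<in> points U" for u using that plots_PiE[OF Gd, of g U] g by (auto simp: PiE_iff)
  have "compose (points U) f (\<lambda>u\<in>points U. d.\<rho> (p u, g u)) = (\<lambda>u\<in>points U. d'.\<rho> (compose (points U) f p u, g u))"
    using fa gc pP by (auto simp: compose_def fun_eq_iff PiE_iff)
  then show "Ra d d' f U n (iact (Ro d) U n (x, g)) = iact (Ro d') U n (Ra d d' f U n x, g)"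
    using p U fpl g d.act_plot[OF p(2) g] by simp
qed

lemma inf_bundle_discrete: "c \<in> Ob InfB \<Longrightarrow> inf_bundle (psh_discrete X) (group_discrete G) c"
  by (simp add: inf_bundle_def)

lemma Ro_Ob: "d \<in> Ob DiffB \<Longrightarrow> Ro d \<in> Ob InfB"
  using embedded_bundle.principal_R[OF embedded] by simp

lemmas inf_Ro = inf_bundle_discrete[OF Ro_Ob]

lemma Ra_id: assumes d: "d \<in> Ob DiffB" shows "Ra d d (Ident DiffB d) = Ident InfB (Ro d)"
proof -
  interpret d: embedded_bundle X G e d by (rule embedded[OF d])
  interpret r: inf_bundle "psh_discrete X" "group_discrete G" "Ro d" by (rule inf_Ro[OF d])
  note id = category_DiffPrin[OF X G, unfolded category_def, THEN conjunct1, rule_format, OF d]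
  show ?thesis
  proof (rule psh_map_eqI[OF r.mor_map[OF Ra_mor[OF d d id]] r.mor_map[OF r.mor_ident]])
    fix U n x assume U: "U \<in> Cart" and x: "x \<in> cells (val r.P U) n"
    then obtain p where p: "x = e p" "p \<in> plots d.P U" by auto
    have "compose (points U) (\<lambda>x\<in>carrier d.P. x) p = p"
      by (rule extensionalityI[of _ "points U"]) (use plots_PiE[OF d.P p(2)] in \<open>auto simp: compose_def PiE_iff\<close>)
    then show "Ra d d (Ident DiffB d) U n x = Ident InfB (Ro d) U n x" using p U by (simp add: sid_def)
  qed
qed

lemma Ra_comp:
  assumes a: "a \<in> Ob DiffB" and b: "b \<in> Ob DiffB" and c: "c \<in> Ob DiffB"
    and m: "m \<in> Mor DiffB a b" and k: "k \<in> Mor DiffB b c"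
  shows "Ra a c (Comp DiffB a b c k m) = Comp InfB (Ro a) (Ro b) (Ro c) (Ra b c k) (Ra a b m)"
proof -
  interpret a: embedded_bundle X G e a by (rule embedded[OF a])
  interpret r: inf_bundle "psh_discrete X" "group_discrete G" "Ro a" by (rule inf_Ro[OF a])
  have km: "Comp DiffB a b c k m \<in> Mor DiffB a c"
    using category_DiffPrin[OF X G] a b c m k unfolding category_def by blast
  show ?thesis
  proof (rule psh_map_eqI[OF r.mor_map[OF Ra_mor[OF a c km]] r.mor_map[OF r.mor_comp[OF Ra_mor[OF a b m] Ra_mor[OF b c k]]]])
    fix U n x assume U: "U \<in> Cart" and x: "x \<in> cells (val r.P U) n"
    then obtain p where p: "x = e p" "p \<in> plots a.P U" by auto
    have "compose (points U) m p \<in> plots (dtotal b) U"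
      using m p(2) dsmoothD(2) by (auto simp: Mor_DiffPrin_iff)
    moreover have "compose (points U) (compose (carrier a.P) k m) p = compose (points U) k (compose (points U) m p)"
      using plots_PiE[OF a.P p(2)] by (auto simp: compose_def PiE_iff fun_eq_iff)
    ultimately show "Ra a c (Comp DiffB a b c k m) U n x = Comp InfB (Ro a) (Ro b) (Ro c) (Ra b c k) (Ra a b m) U n x"
      using p U by (simp add: scomp_def compose_eq)
  qed
qed

lemma Ra_faithful:
  assumes d: "d \<in> Ob DiffB" and d': "d' \<in> Ob DiffB" and m: "m \<in> Mor DiffB d d'" and k: "k \<in> Mor DiffB d d'"
    and eq: "Ra d d' m = Ra d d' k"
  shows "m = k"
proof (rule extensionalityI[of _ "carrier (dtotal d)"])
  interpret d: embedded_bundle X G e d by (rule embedded[OF d])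
  show "m \<in> extensional (carrier d.P)" "k \<in> extensional (carrier d.P)"
    using m k by (auto simp: Mor_DiffPrin_iff dsmooth_def PiE_iff)
  fix a assume a: "a \<in> carrier d.P"
  have "Ra d d' m (Rn 0) 0 (e (single a)) = Ra d d' k (Rn 0) 0 (e (single a))" using eq by simp
  then show "m a = k a"
    using a by (simp add: Rn_Cart single_plot[OF d.P] compose_single single_inj del: points_Rn)
qed

text \<open>Naturality along the inclusion of each point \<open>u\<close> shows that a presheaf map
  between presheaves of plots acts pointwise, by its values on one-point plots. Passing to an
  initial vertex reduces \<open>n\<close> to 0, since the simplicial sets are discrete.\<close>

lemma psh_map_emb_pointwise:
  assumes P: "diffeological_space P" and P': "diffeological_space P'" and \<phi>: "psh_map (emb P) (emb P') \<phi>"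
    and U: "U \<in> Cart" and p: "p \<in> plots P U"
  shows "\<exists>q\<in>plots P' U. \<phi> U n (e p) = e q \<and> (\<forall>u\<in>points U. \<phi> (Rn 0) 0 (e (single (p u))) = e (single (q u)))"
proof -
  have ep: "e p \<in> cells (val (emb P) U) n" for n using U p by simp
  obtain q where q: "\<phi> U n (e p) = e q" "q \<in> plots P' U" using psh_map_cells[OF \<phi> U ep[of n]] U by auto
  have 0: "\<phi> U 0 (e p) = e q"
    using simplicial_map_sop[OF psh_mapD(2)[OF \<phi> U] vtx_Delta[OF le0] ep[of n]] U p q by (simp add: vtx_Delta)
  have "\<phi> (Rn 0) 0 (e (single (p u))) = e (single (q u))" if u: "u \<in> points U" for u
  proof -
    note h = const_cart_hom[OF U u]
    have "compose (points (Rn 0)) r (\<lambda>_\<in>points (Rn 0). u) = single (r u)" for r :: "point \<Rightarrow> 'u"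
      by (auto simp: compose_def)
    then show ?thesis using psh_mapD(3)[OF \<phi> h ep[of 0]] h p q 0 by simp
  qed
  then show ?thesis using q by blast
qed

text \<open>The values on one-point plots define \<open>m\<close>. It is smooth because
  \<open>\<phi>\<close> sends plots to plots and acts on them by composition with
  \<open>m\<close>.\<close>

lemma Ra_full:
  assumes d: "d \<in> Ob DiffB" and d': "d' \<in> Ob DiffB" and f: "\<phi> \<in> Mor InfB (Ro d) (Ro d')"
  shows "\<exists>m\<in>Mor DiffB d d'. Ra d d' m = \<phi>"
proof -
  interpret d: embedded_bundle X G e d by (rule embedded[OF d])
  interpret d': embedded_bundle X G e d' by (rule embedded[OF d'])
  interpret r: inf_bundle "psh_discrete X" "group_discrete G" "Ro d" by (rule inf_Ro[OF d])
  have \<phi>: "psh_map (emb d.P) (emb d'.P) \<phi>" using r.mor_map[OF f] by simp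
  note aux = psh_map_emb_pointwise[OF d.P d'.P \<phi>]
  define m where "m = (\<lambda>a\<in>carrier d.P. dec (\<phi> (Rn 0) 0 (e (single a))) pt)"
  have R0: "pt \<in> points (Rn 0)" unfolding points_R0 by simp
  then have single_pt: "single a pt = a" for a by (simp del: points_Rn)
  have \<phi>p: "\<phi> U n (e p) = e (compose (points U) m p) \<and> compose (points U) m p \<in> plots d'.P U"
    if U: "U \<in> Cart" and p: "p \<in> plots d.P U" for U n p
  proof -
    obtain q where q: "q \<in> plots d'.P U" "\<phi> U n (e p) = e q"
      "\<And>u. u \<in> points U \<Longrightarrow> \<phi> (Rn 0) 0 (e (single (p u))) = e (single (q u))"
      using aux[OF U p, of n] by blast
    have "compose (points U) m p = q"
      by (rule extensionalityI[of _ "points U"])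
        (use plots_PiE[OF d.P p] plots_PiE[OF d'.P q(1)] q(3) in \<open>simp_all add: compose_eq m_def PiE_iff R0 del: points_Rn\<close>)
    then show ?thesis using q by simp
  qed
  have \<phi>a: "\<phi> (Rn 0) 0 (e (single a)) = e (single (m a))" "m a \<in> carrier d'.P" if a: "a \<in> carrier d.P" for a
    using \<phi>p[OF Rn_Cart single_plot[OF d.P, THEN iffD2, OF a], of 0] single_plot[OF d'.P] by (simp_all add: compose_single del: points_Rn)
  have m: "m \<in> Mor DiffB d d'"
    unfolding Mor_DiffPrin_iff
  proof (intro conjI ballI)
    show "dsmooth d.P d'.P m" unfolding dsmooth_def
      using \<phi>p plots_Cart[OF d.P] \<phi>a(2) by (auto simp: m_def)
    fix a assume a: "a \<in> carrier d.P"
    note sa = single_plot[OF d.P, THEN iffD2, OF a] and sm = single_plot[OF d'.P, THEN iffD2, OF \<phi>a(2)[OF a]]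
    have c: "e (single a) \<in> cells (val r.P (Rn 0)) 0" using sa Rn_Cart by (simp del: points_Rn)
    have "iproj (Ro d') (Rn 0) 0 (\<phi> (Rn 0) 0 (e (single a))) = iproj (Ro d) (Rn 0) 0 (e (single a))"
      using f Rn_Cart c unfolding Mor_PrinInf_iff by blast
    then have "compose (points (Rn 0)) d'.\<pi> (single (m a)) pt = compose (points (Rn 0)) d.\<pi> (single a) pt"
      using sa sm by (simp add: \<phi>a[OF a] Rn_Cart del: points_Rn)
    then show "d'.\<pi> (m a) = d.\<pi> a" using R0 by (simp add: compose_eq single_pt del: points_Rn)
    fix g assume g: "g \<in> carrier G"
    have gp: "(\<lambda>_\<in>points (Rn 0). g) \<in> gplots G (Rn 0)" using const_plot[OF Gd Rn_Cart] g by simp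
    have "\<phi> (Rn 0) 0 (iact (Ro d) (Rn 0) 0 (e (single a), \<lambda>_\<in>points (Rn 0). g)) =
        iact (Ro d') (Rn 0) 0 (\<phi> (Rn 0) 0 (e (single a)), \<lambda>_\<in>points (Rn 0). g)"
      using f Rn_Cart c gp unfolding Mor_PrinInf_iff group_discrete_simps by blast
    moreover have "(\<lambda>u\<in>points (Rn 0). r (single b u, (\<lambda>_\<in>points (Rn 0). g) u)) = single (r (b, g))" for r :: "'u \<times> 'g \<Rightarrow> 'u" and b
      by (rule restrict_ext) simp
    ultimately show "m (d.\<rho> (a, g)) = d'.\<rho> (m a, g)"
      using sa sm gp Rn_Cart \<phi>a[OF a] \<phi>a[OF d.act_carrier[OF a g]] by (simp add: single_inj del: points_Rn)
  qed
  moreover have "Ra d d' m = \<phi>"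
    by (rule psh_map_eqI[OF r.mor_map[OF Ra_mor[OF d d' m]] r.mor_map[OF f]]) (use \<phi>p in auto)
  ultimately show ?thesis by blast
qed

text \<open>The plots are read off the presheaf, the carrier from the one-point plots, and
  projection and action from their values on these. Extensionality turns this into equality of
  bundles, as the normalization of the reflector requires.\<close>

lemma Ro_inj: "inj_on Ro (Ob DiffB)"
proof (rule inj_onI)
  fix d d' assume d: "d \<in> Ob DiffB" and d': "d' \<in> Ob DiffB" and eq: "Ro d = Ro d'"
  interpret d: embedded_bundle X G e d by (rule embedded[OF d])
  interpret d': embedded_bundle X G e d' by (rule embedded[OF d'])
  have t: "emb d.P = emb d'.P" using itotal_Ro[of d] itotal_Ro[of d'] eq by simp
  have "plots d.P U = plots d'.P U" for U
  proof (cases "U \<in> Cart")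
    case True
    have "e ` plots d.P U = e ` plots d'.P U"
      using val_emb[OF True, of d.P] val_emb[OF True, of d'.P] t cells_sdiscrete by metis
    then show ?thesis using inj_image_eq_iff[OF e] by blast
  next
    case False
    then show ?thesis using plots_Cart[OF d.P] plots_Cart[OF d'.P] by blast
  qed
  then have pl: "plots d.P = plots d'.P" by (rule ext)
  then have c: "carrier d.P = carrier d'.P" using single_plot[OF d.P] single_plot[OF d'.P] by auto
  have P: "d.P = d'.P" using pl c by (simp add: diffspace.equality)
  have R0: "pt \<in> points (Rn 0)" unfolding points_R0 by auto
  have p: "d.\<pi> = d'.\<pi>"
  proof (rule extensionalityI[of _ "carrier d.P"])
    show "d.\<pi> \<in> extensional (carrier d.P)" "d'.\<pi> \<in> extensional (carrier d.P)"
      unfolding atomize_conj using dsmoothD(1)[OF d.proj_smooth] dsmoothD(1)[OF d'.proj_smooth] P by (simp add: PiE_iff)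
    fix a assume a: "a \<in> carrier d.P"
    then have s: "single a \<in> plots d.P (Rn 0)" "single a \<in> plots d'.P (Rn 0)"
      using single_plot[OF d.P] P by simp_all
    from iproj_Ro[OF Rn_Cart s(1), of 0] iproj_Ro[OF Rn_Cart s(2), of 0]
    have "compose (points (Rn 0)) d.\<pi> (single a) pt = compose (points (Rn 0)) d'.\<pi> (single a) pt"
      unfolding eq by simp
    then show "d.\<pi> a = d'.\<pi> a" using R0 by (simp add: compose_eq del: points_Rn)
  qed
  have r: "d.\<rho> = d'.\<rho>"
  proof (rule extensionalityI[of _ "carrier d.P \<times> carrier G"])
    show "d.\<rho> \<in> extensional (carrier d.P \<times> carrier G)" "d'.\<rho> \<in> extensional (carrier d.P \<times> carrier G)"
      unfolding atomize_conj using dsmoothD(1)[OF d.act_smooth] dsmoothD(1)[OF d'.act_smooth] P by (simp add: PiE_iff)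
    fix z assume "z \<in> carrier d.P \<times> carrier G"
    then obtain a g where z: "z = (a, g)" "a \<in> carrier d.P" "g \<in> carrier G" by auto
    have s: "single a \<in> plots d.P (Rn 0)" "single a \<in> plots d'.P (Rn 0)"
      using single_plot[OF d.P] P z by simp_all
    have gp: "(\<lambda>_\<in>points (Rn 0). g) \<in> gplots G (Rn 0)" using const_plot[OF Gd Rn_Cart] z by simp
    from iact_Ro[OF Rn_Cart s(1) gp, of 0] iact_Ro[OF Rn_Cart s(2) gp, of 0]
    have "e (\<lambda>u\<in>points (Rn 0). d.\<rho> (single a u, (\<lambda>_\<in>points (Rn 0). g) u)) =
        e (\<lambda>u\<in>points (Rn 0). d'.\<rho> (single a u, (\<lambda>_\<in>points (Rn 0). g) u))"
      unfolding eq by simp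
    then have "(\<lambda>u\<in>points (Rn 0). d.\<rho> (single a u, (\<lambda>_\<in>points (Rn 0). g) u)) pt =
        (\<lambda>u\<in>points (Rn 0). d'.\<rho> (single a u, (\<lambda>_\<in>points (Rn 0). g) u)) pt"
      unfolding e_eq by (rule arg_cong)
    then show "d.\<rho> z = d'.\<rho> z" using R0 z by (simp del: points_Rn)
  qed
  show "d = d'" using P p r by (simp add: dbundle.equality)
qed

end

section \<open>The bundle of path components\<close>

declare points_Rn [simp del]

text \<open>One notation for a point of a manifold, seen as a smooth map from R^0, and for one-point
  plots.\<close>

definition at0 :: "'a \<Rightarrow> point \<Rightarrow> 'a" where
  "at0 u = (\<lambda>_\<in>points (Rn 0). u)"

lemma at0_pt [simp]: "at0 u pt = u"
  by (simp add: at0_def points_R0)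

lemma at0_eq [simp]: "at0 u = at0 v \<longleftrightarrow> u = v"
  by (metis at0_pt)

lemma compose_at0 [simp]: "compose (points (Rn 0)) f (at0 u) = at0 (f u)"
  by (auto simp: at0_def compose_def)

lemma at0_cart_hom: "V \<in> Cart \<Longrightarrow> u \<in> points V \<Longrightarrow> at0 u \<in> cart_hom (Rn 0) V"
  unfolding at0_def by (rule const_cart_hom)

lemma at0_expand: "p \<in> points (Rn 0) \<rightarrow>\<^sub>E A \<Longrightarrow> p = at0 (p pt)"
  unfolding at0_def points_R0 by (rule extensionalityI[of _ "{pt}"]) (auto simp: PiE_iff)

lemma pt_R0 [simp]: "pt \<in> points (Rn 0)"
  by (simp add: points_R0)

lemma at0_pt_id: "(\<lambda>x\<in>points (Rn 0). x) = at0 pt"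
  by (auto simp: at0_def points_R0)

lemma restrict_points_R0: "(\<lambda>u\<in>points (Rn 0). f u) = at0 (f pt)"
  by (auto simp: at0_def points_R0)

locale component_bundle = plot_embedding X G e + inf_bundle "psh_discrete X" "group_discrete G" E
  for X :: "'x diffspace" and G :: "'g dgroup" and e :: "(point \<Rightarrow> 'u) \<Rightarrow> 'u"
    and E :: "('u, point \<Rightarrow> 'g, point \<Rightarrow> 'x) ibundle"
begin

abbreviation "K \<equiv> val P (Rn 0)"

lemma K: "simplicial_set K"
  by (rule presheaf_sset[OF P Rn_Cart])

text \<open>Path components are represented by chosen vertices, which are elements of \<^typ>\<open>'u\<close> again.\<close>

definition rep :: "'u \<Rightarrow> 'u" where
  "rep a = (SOME b. conn K a b)"

lemma conn_rep: "conn K a (rep a)"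
  unfolding rep_def by (rule someI) (rule conn_refl)

lemma rep_eq: "rep a = rep b \<longleftrightarrow> conn K a b"
proof
  show "conn K a b" if "rep a = rep b"
    by (rule conn_trans[OF conn_rep]) (unfold that, rule conn_sym[OF conn_rep])
  assume c: "conn K a b"
  have "conn K a z \<longleftrightarrow> conn K b z" for z
    using conn_trans[OF c, of z] conn_trans[OF conn_sym[OF c], of z] by (rule iffI[rotated])
  then show "rep a = rep b" by (simp add: rep_def)
qed

lemma rep_rep [simp]: "rep (rep a) = rep a"
  unfolding rep_eq by (rule conn_sym[OF conn_rep])

lemma rep_cells: "a \<in> cells K 0 \<Longrightarrow> rep a \<in> cells K 0"
  by (rule conn_cells[OF K conn_rep])

definition C :: "'u set" where "C = rep ` cells K 0"

lemma rep_C: "a \<in> cells K 0 \<Longrightarrow> rep a \<in> C"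
  by (simp add: C_def)

lemma C_cells: "a \<in> C \<Longrightarrow> a \<in> cells K 0" and C_rep: "a \<in> C \<Longrightarrow> rep a = a"
  by (auto simp: C_def rep_cells)

text \<open>Restricting a section to the point \<open>u\<close> and taking the component turns a
  section over \<open>V\<close> into a function on its points.\<close>

definition ev :: "manifold \<Rightarrow> 'u \<Rightarrow> point \<Rightarrow> 'u" where
  "ev V s u = rep (res P (Rn 0) V (at0 u) 0 s)"

lemma ev_C: "V \<in> Cart \<Longrightarrow> u \<in> points V \<Longrightarrow> s \<in> cells (val P V) 0 \<Longrightarrow> ev V s u \<in> C"
  unfolding ev_def by (intro rep_C presheaf_cells[OF P] at0_cart_hom)

lemma ev_res:
  assumes f: "f \<in> cart_hom W V" and s: "s \<in> cells (val P V) 0" and w: "w \<in> points W"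
  shows "ev W (res P W V f 0 s) w = ev V s (f w)"
  unfolding ev_def presheaf_compose[OF P at0_cart_hom[OF cart_hom_Cart(1)[OF f] w] f s] by simp

lemma ev_conn:
  assumes V: "V \<in> Cart" and u: "u \<in> points V" and c: "conn (val P V) s s'"
  shows "ev V s u = ev V s' u"
  unfolding ev_def rep_eq by (rule conn_map[OF presheaf_res[OF P at0_cart_hom[OF V u]] c])

lemma ev_R0: "s \<in> cells K 0 \<Longrightarrow> ev (Rn 0) s pt = rep s"
  using presheaf_id[OF P Rn_Cart[of 0], unfolded at0_pt_id] by (simp add: ev_def sid_def)

definition local_section :: "(point \<Rightarrow> 'u) \<Rightarrow> manifold \<Rightarrow> point \<Rightarrow> bool" where
  "local_section p U x \<longleftrightarrow> (\<exists>S\<in>opens U. x \<in> S \<and> (\<exists>s\<in>cells (val P (open_sub U S)) 0. \<forall>u\<in>S. p u = ev (open_sub U S) s u))"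

definition L :: "'u diffspace" where
  "L = \<lparr>carrier = C, plots = (\<lambda>U. {p \<in> points U \<rightarrow>\<^sub>E C. U \<in> Cart \<and> (\<forall>x\<in>points U. local_section p U x)})\<rparr>"

lemma carrier_L [simp]: "carrier L = C"
  by (simp add: L_def)

lemma plots_L_iff: "p \<in> plots L U \<longleftrightarrow> p \<in> points U \<rightarrow>\<^sub>E C \<and> U \<in> Cart \<and> (\<forall>x\<in>points U. local_section p U x)"
  by (simp add: L_def)

lemma local_section_smaller:
  assumes U: "U \<in> Cart" and S: "S \<in> opens U" and T: "T \<in> opens U" "T \<subseteq> S"
    and s: "s \<in> cells (val P (open_sub U S)) 0" "\<And>u. u \<in> S \<Longrightarrow> p u = ev (open_sub U S) s u"
  shows "\<exists>t\<in>cells (val P (open_sub U T)) 0. \<forall>u\<in>T. p u = ev (open_sub U T) t u"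
proof -
  have "incl T \<in> cart_hom (open_sub (open_sub U S) T) (open_sub U S)"
    by (rule incl_cart_hom[OF opens_Cart[OF S] opens_of_subset[OF U S T]])
  then have i: "incl T \<in> cart_hom (open_sub U T) (open_sub U S)" by (simp add: open_sub_open_sub[OF T(2)])
  have "p u = ev (open_sub U T) (res P (open_sub U T) (open_sub U S) (incl T) 0 s) u" if "u \<in> T" for u
    using ev_res[OF i s(1), of u] that s(2) T(2) by (auto simp: incl_def)
  then show ?thesis using presheaf_cells[OF P i s(1)] by blast
qed

lemma ev_plot:
  assumes U: "U \<in> Cart" and s: "s \<in> cells (val P U) 0"
  shows "(\<lambda>u\<in>points U. ev U s u) \<in> plots L U"
  unfolding plots_L_iff local_section_def
  using s ev_C[OF U _ s] U points_opens[OF U] by (auto simp: open_sub_points[OF U] intro!: bexI[of _ "points U"] bexI[of _ s])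

lemma diffeological_space_L: "diffeological_space L"
  unfolding diffeological_space_def
proof (intro conjI allI ballI subsetI impI)
  fix U p assume "p \<in> plots L U"
  then show "U \<in> Cart" "p \<in> points U \<rightarrow>\<^sub>E carrier L" by (simp_all add: plots_L_iff)
next
  fix p assume "p \<in> points (Rn 0) \<rightarrow>\<^sub>E carrier L"
  then have p: "p \<in> points (Rn 0) \<rightarrow>\<^sub>E C" by simp
  then have "p pt \<in> C" by (rule PiE_mem) simp
  \<comment> \<open>The chosen representative \<open>p pt\<close> is a vertex over R^0, so it is
    itself a section whose evaluation is \<open>p\<close>.\<close>
  then have "(\<lambda>u\<in>points (Rn 0). ev (Rn 0) (p pt) u) = p"
    unfolding restrict_points_R0 using ev_R0[OF C_cells] C_rep at0_expand[OF p] by simp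
  then show "p \<in> plots L (Rn 0)" using ev_plot[OF Rn_Cart C_cells[OF \<open>p pt \<in> C\<close>]] by simp
next
  fix V U p f assume "p \<in> plots L U" and f: "f \<in> cart_hom V U"
  then have p: "p \<in> points U \<rightarrow>\<^sub>E C" "\<And>x. x \<in> points U \<Longrightarrow> local_section p U x" by (simp_all add: plots_L_iff)
  note VU = cart_hom_Cart[OF f] and fP = cart_hom_PiE[OF f]
  show "compose (points V) p f \<in> plots L V"
    unfolding plots_L_iff
  proof (intro conjI ballI)
    show "compose (points V) p f \<in> points V \<rightarrow>\<^sub>E C" using p(1) fP by (auto simp: compose_def PiE_iff)
    fix x assume x: "x \<in> points V"
    obtain S s where S: "S \<in> opens U" "f x \<in> S" and s: "s \<in> cells (val P (open_sub U S)) 0" "\<forall>u\<in>S. p u = ev (open_sub U S) s u"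
      using p(2)[OF PiE_mem[OF fP x]] unfolding local_section_def by blast
    obtain T where T: "T \<in> opens V" "x \<in> T" "f ` T \<subseteq> S" using opens_preimage[OF f S(1) x S(2)] by blast
    have g: "restrict f T \<in> cart_hom (open_sub V T) (open_sub U S)" by (rule cart_hom_restrict[OF f T(1) S(1) T(3)])
    have "compose (points V) p f u = ev (open_sub V T) (res P (open_sub V T) (open_sub U S) (restrict f T) 0 s) u"
      if u: "u \<in> T" for u
      using ev_res[OF g s(1), of u] u s(2) T(3) compose_eq[OF subsetD[OF opens_subset[OF T(1)] u], of p f] by auto
    then show "local_section (compose (points V) p f) V x"
      unfolding local_section_def using T presheaf_cells[OF P g s(1)] by blast
  qed (rule VU)
next
  fix U \<U> p assume U: "U \<in> Cart" and p: "p \<in> points U \<rightarrow>\<^sub>E carrier L"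
    and c: "good_open_cover U \<U> \<and> (\<forall>S\<in>\<U>. restrict p S \<in> plots L (open_sub U S))"
  show "p \<in> plots L U"
    unfolding plots_L_iff
  proof (intro conjI ballI)
    fix x assume "x \<in> points U"
    then obtain S where S: "S \<in> \<U>" "x \<in> S" using good_open_cover_covers c by blast
    have So: "S \<in> opens U" using good_open_cover_opens c S(1) by blast
    have "local_section (restrict p S) (open_sub U S) x" using c S by (auto simp: plots_L_iff)
    then obtain T s where T: "T \<in> opens (open_sub U S)" "x \<in> T"
      and s: "s \<in> cells (val P (open_sub (open_sub U S) T)) 0" "\<forall>u\<in>T. restrict p S u = ev (open_sub (open_sub U S) T) s u"
      unfolding local_section_def by blast
    have TS: "T \<subseteq> S" using opens_subset[OF T(1)] by simp
    have "\<forall>u\<in>T. p u = ev (open_sub U T) s u"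
      using s(2) subsetD[OF TS] by (simp add: open_sub_open_sub[OF TS])
    then show "local_section p U x"
      unfolding local_section_def using opens_trans[OF U So T(1)] T(2) s(1) by (auto simp: open_sub_open_sub[OF TS])
  qed (use U p in simp_all)
qed

definition proj_L :: "'u \<Rightarrow> 'x" where
  "proj_L = (\<lambda>a\<in>C. \<pi> (Rn 0) 0 a pt)"

text \<open>The base is simplicially discrete, so a component of the total space lies in a single
  fibre.\<close>

lemma proj_conn: "conn K a b \<Longrightarrow> \<pi> (Rn 0) 0 a = \<pi> (Rn 0) 0 b"
  by (rule conn_discrete, rule conn_map, rule psh_mapD(2)[OF proj Rn_Cart[of 0], unfolded val_psh_discrete[OF Rn_Cart]])

lemma proj_rep: "a \<in> cells K 0 \<Longrightarrow> proj_L (rep a) = \<pi> (Rn 0) 0 a pt"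
  using proj_conn[OF conn_rep[of a]] by (simp add: proj_L_def rep_C)

lemma proj_plot: "U \<in> Cart \<Longrightarrow> x \<in> cells (val P U) n \<Longrightarrow> \<pi> U n x \<in> plots X U"
  using psh_map_cells[OF proj] by simp

lemma proj_ev:
  assumes V: "V \<in> Cart" and u: "u \<in> points V" and s: "s \<in> cells (val P V) 0"
  shows "proj_L (ev V s u) = \<pi> V 0 s u"
proof -
  note h = at0_cart_hom[OF V u]
  show ?thesis
    unfolding ev_def proj_rep[OF presheaf_cells[OF P h s]] psh_mapD(3)[OF proj h s]
    using h proj_plot[OF V s] by simp
qed

lemma dsmooth_proj_L: "dsmooth L X proj_L"
  unfolding dsmooth_def
proof (intro conjI allI ballI)
  have pc: "proj_L a \<in> carrier X" if "a \<in> C" for a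
    using PiE_mem[OF plots_PiE[OF X proj_plot[OF Rn_Cart C_cells[OF that]]] pt_R0] that by (simp add: proj_L_def)
  then show "proj_L \<in> carrier L \<rightarrow>\<^sub>E carrier X" by (auto simp: proj_L_def)
  fix U p assume "p \<in> plots L U"
  then have p: "p \<in> points U \<rightarrow>\<^sub>E C" "U \<in> Cart" "\<And>x. x \<in> points U \<Longrightarrow> local_section p U x" by (simp_all add: plots_L_iff)
  show "compose (points U) proj_L p \<in> plots X U"
  proof (rule plots_local[OF X p(2)])
    show "compose (points U) proj_L p \<in> points U \<rightarrow>\<^sub>E carrier X" using p(1) pc by (auto simp: compose_def PiE_iff)
    fix x assume "x \<in> points U"
    from p(3)[OF this] obtain S s where S: "S \<in> opens U" "x \<in> S"
      and s: "s \<in> cells (val P (open_sub U S)) 0" "\<forall>u\<in>S. p u = ev (open_sub U S) s u"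
      unfolding local_section_def by blast
    note V = opens_Cart[OF S(1)]
    have "restrict (compose (points U) proj_L p) S = \<pi> (open_sub U S) 0 s"
      by (rule extensionalityI[of _ S])
        (use plots_PiE[OF X proj_plot[OF V s(1)]] opens_subset[OF S(1)] s(2) proj_ev[OF V _ s(1)] in \<open>auto simp: compose_eq PiE_iff\<close>)
    then show "\<exists>S\<in>opens U. x \<in> S \<and> restrict (compose (points U) proj_L p) S \<in> plots X (open_sub U S)"
      using S proj_plot[OF V s(1)] by metis
  qed
qed

text \<open>The lifting condition of the local fibration for the empty horn with n = 0, applied to
  the 0-simplex given by the plot.\<close>

lemma vertex_lift:
  assumes x: "x \<in> plots X U"
  shows "\<exists>\<U>. good_open_cover U \<U> \<and> (\<forall>S\<in>\<U>. \<exists>s\<in>cells (val P (open_sub U S)) 0. \<pi> (open_sub U S) 0 s = restrict x S)"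
proof -
  have U: "U \<in> Cart" by (rule plots_Cart[OF X x])
  let ?Y = "val (psh_discrete X)"
  obtain \<U> where c: "good_open_cover U \<U>" and l: "\<And>S n k a y. S \<in> \<U> \<Longrightarrow> k \<le> n \<Longrightarrow>
      simplicial_map (horn n k) (val P U) a \<Longrightarrow> simplicial_map (std_simplex n) (?Y U) y \<Longrightarrow>
      scomp (horn n k) (\<pi> U) a = srestrict (horn n k) y \<Longrightarrow>
      \<exists>l. simplicial_map (std_simplex n) (val P (open_sub U S)) l \<and>
        srestrict (horn n k) l = scomp (horn n k) (res P (open_sub U S) U (incl S)) a \<and>
        scomp (std_simplex n) (\<pi> (open_sub U S)) l = scomp (std_simplex n) (res (psh_discrete X) (open_sub U S) U (incl S)) y"
    using fibration U unfolding local_fibration_def Let_def by metis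
  have "\<exists>s\<in>cells (val P (open_sub U S)) 0. \<pi> (open_sub U S) 0 s = restrict x S" if S: "S \<in> \<U>" for S
  proof -
    have empty: "cells (horn 0 0) m = {}" for m by (simp add: cells_horn)
    let ?a = "\<lambda>(m::nat) (\<beta>::nat \<Rightarrow> nat). undefined :: 'u" and ?y = "\<lambda>m. \<lambda>\<beta>\<in>Delta m 0. x"
    have "simplicial_map (horn 0 0) (val P U) ?a" by (rule simplicial_mapI) (auto simp: empty)
    moreover have "simplicial_map (std_simplex 0) (?Y U) ?y"
      by (rule simplicial_mapI) (auto simp: x U sop_std_simplex Delta_compose)
    moreover have "scomp (horn 0 0) (\<pi> U) ?a = srestrict (horn 0 0) ?y"
      by (auto simp: scomp_def srestrict_def empty compose_def fun_eq_iff)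
    ultimately obtain l where lm: "simplicial_map (std_simplex 0) (val P (open_sub U S)) l"
      and le: "scomp (std_simplex 0) (\<pi> (open_sub U S)) l = scomp (std_simplex 0) (res (psh_discrete X) (open_sub U S) U (incl S)) ?y"
      using l[OF S le0] by blast
    have v: "vtx 0 \<in> cells (std_simplex 0) 0" by (simp add: vtx_Delta)
    have So: "S \<in> opens U" by (rule good_open_cover_opens[OF c S])
    have "\<pi> (open_sub U S) 0 (l 0 (vtx 0)) = res (psh_discrete X) (open_sub U S) U (incl S) 0 x"
      using fun_cong[OF fun_cong[OF le, of 0], of "vtx 0"] v by (simp add: scomp_def compose_eq)
    also have "\<dots> = restrict x S"
      using incl_cart_hom[OF U So] x by (auto simp: compose_def incl_def restrict_def)
    finally show ?thesis using simplicial_map_cells[OF lm v] by blast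
  qed
  then show ?thesis using c by blast
qed

text \<open>Lifts of plots are evaluations of the sections found in \<open>vertex_lift\<close>.
  Surjectivity is the case of a plot on R^0, where every good cover contains R^0.\<close>

lemma subduction_L: "subduction L X proj_L"
  unfolding subduction_def
proof (intro conjI allI ballI dsmooth_proj_L)
  have pE: "proj_L \<in> C \<rightarrow>\<^sub>E carrier X" using dsmoothD(1)[OF dsmooth_proj_L] by simp
  have "x \<in> proj_L ` C" if x: "x \<in> carrier X" for x
  proof -
    have "at0 x \<in> plots X (Rn 0)" unfolding at0_def by (rule const_plot[OF X Rn_Cart x])
    from vertex_lift[OF this] obtain s where s: "s \<in> cells (val P (open_sub (Rn 0) (points (Rn 0)))) 0"
      "\<pi> (open_sub (Rn 0) (points (Rn 0))) 0 s = restrict (at0 x) (points (Rn 0))"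
      using good_open_cover_R0 by blast
    then have "proj_L (rep s) = x" using proj_rep[of s] by (simp add: open_sub_points[OF Rn_Cart] restrict_points_R0)
    then show ?thesis using rep_C[of s] s(1) by (auto simp: open_sub_points[OF Rn_Cart])
  qed
  then show "proj_L ` carrier L = carrier X" using pE by (auto simp: PiE_iff)
  fix U x assume x: "x \<in> plots X U"
  have U: "U \<in> Cart" by (rule plots_Cart[OF X x])
  obtain \<U> where c: "good_open_cover U \<U>"
    and s: "\<And>S. S \<in> \<U> \<Longrightarrow> \<exists>s\<in>cells (val P (open_sub U S)) 0. \<pi> (open_sub U S) 0 s = restrict x S"
    using vertex_lift[OF x] by blast
  have "\<exists>q\<in>plots L (open_sub U S). compose S proj_L q = restrict x S" if S: "S \<in> \<U>" for S
  proof -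
    obtain t where t: "t \<in> cells (val P (open_sub U S)) 0" "\<pi> (open_sub U S) 0 t = restrict x S" using s[OF S] by blast
    note V = opens_Cart[OF good_open_cover_opens[OF c S]]
    have "compose S proj_L (\<lambda>u\<in>points (open_sub U S). ev (open_sub U S) t u) = restrict x S"
      by (rule extensionalityI[of _ S]) (use proj_ev[OF V _ t(1)] t(2) in \<open>auto simp: compose_eq\<close>)
    then show ?thesis using ev_plot[OF V t(1)] by blast
  qed
  then show "\<exists>\<U>. good_open_cover U \<U> \<and> (\<forall>S\<in>\<U>. \<exists>q\<in>plots L (open_sub U S). compose S proj_L q = restrict x S)"
    using c by blast
qed

definition act_L :: "'u \<times> 'g \<Rightarrow> 'u" where
  "act_L = (\<lambda>(a, g)\<in>C \<times> carrier G. rep (\<rho> (Rn 0) 0 (a, at0 g)))"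

lemma at0_gplot: "g \<in> carrier G \<Longrightarrow> at0 g \<in> gplots G (Rn 0)"
  using const_plot[OF Gd Rn_Cart] by (simp add: at0_def)

text \<open>A group element over R^0 is fixed by all structure maps, because the group is
  simplicially discrete; acting by it is therefore a simplicial map and preserves
  components.\<close>

lemma act_conn:
  assumes g: "g \<in> carrier G" and c: "conn K a b" and a: "a \<in> cells K 0"
  shows "conn K (\<rho> (Rn 0) 0 (a, at0 g)) (\<rho> (Rn 0) 0 (b, at0 g))"
proof -
  note gp = at0_gplot[OF g]
  have b: "b \<in> cells K 0" by (rule conn_cells[OF K c a])
  let ?\<phi> = "\<lambda>n. \<lambda>x\<in>cells K n. \<rho> (Rn 0) n (x, at0 g)"
  have "simplicial_map K K ?\<phi>"
  proof (rule simplicial_mapI)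
    show "?\<phi> n x \<in> cells K n" if "x \<in> cells K n" for n x
      using act_cells[OF Rn_Cart that] gp that by simp
    fix m n \<alpha> x assume al: "\<alpha> \<in> Delta m n" and x: "x \<in> cells K n"
    have "(x, at0 g) \<in> cells (val (psh_prod P (underlying (group_discrete G))) (Rn 0)) n" using x gp Rn_Cart by simp
    from simplicial_map_sop[OF psh_mapD(2)[OF act Rn_Cart] al this]
    show "?\<phi> m (sop K m n \<alpha> x) = sop K m n \<alpha> (?\<phi> n x)"
      using al x gp sop_cells[OF K al x] Rn_Cart by simp
  qed simp
  from conn_map[OF this c] show ?thesis using a b by simp
qed

lemma act_rep: "a \<in> cells K 0 \<Longrightarrow> g \<in> carrier G \<Longrightarrow> act_L (rep a, g) = rep (\<rho> (Rn 0) 0 (a, at0 g))"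
  using act_conn[OF _ conn_sym[OF conn_rep] rep_cells] by (simp add: act_L_def rep_C rep_eq)

lemma act_L_C: "a \<in> C \<Longrightarrow> g \<in> carrier G \<Longrightarrow> act_L (a, g) \<in> C"
  using act_cells[OF Rn_Cart C_cells, of a "at0 g"] at0_gplot by (simp add: act_L_def rep_C)

lemma act_ev:
  assumes V: "V \<in> Cart" and u: "u \<in> points V" and s: "s \<in> cells (val P V) 0" and g: "g \<in> gplots G V"
  shows "act_L (ev V s u, g u) = ev V (\<rho> V 0 (s, g)) u"
proof -
  note h = at0_cart_hom[OF V u]
  have "(s, g) \<in> cells (val (psh_prod P (underlying (group_discrete G))) V) 0" using V s g by simp
  from psh_mapD(3)[OF act h this]
  have "\<rho> (Rn 0) 0 (res P (Rn 0) V (at0 u) 0 s, at0 (g u)) = res P (Rn 0) V (at0 u) 0 (\<rho> V 0 (s, g))"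
    using h s g V by simp
  moreover have "g u \<in> carrier G" using plots_PiE[OF Gd, of g V] g u by (auto simp: PiE_iff)
  ultimately show ?thesis
    unfolding ev_def using act_rep[OF presheaf_cells[OF P h s]] by simp
qed

lemma gplot_carrier: "g \<in> gplots G V \<Longrightarrow> u \<in> points V \<Longrightarrow> g u \<in> carrier G"
  using plots_PiE[OF Gd, of g V] by (auto simp: PiE_iff)

lemma dsmooth_act_L: "dsmooth (dprod L (dspace G)) L act_L"
  unfolding dsmooth_def
proof (intro conjI allI ballI)
  show "act_L \<in> carrier (dprod L (dspace G)) \<rightarrow>\<^sub>E carrier L"
    using act_L_C by (auto simp: act_L_def)
  fix U r assume r: "r \<in> plots (dprod L (dspace G)) U"
  define p g where "p = compose (points U) fst r" and "g = compose (points U) snd r"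
  have pL: "p \<in> plots L U" and g: "g \<in> gplots G U" using r by (auto simp: dprod_def p_def g_def)
  have p: "p \<in> points U \<rightarrow>\<^sub>E C" "U \<in> Cart" "\<And>x. x \<in> points U \<Longrightarrow> local_section p U x" using pL by (simp_all add: plots_L_iff)
  have rpg: "r u = (p u, g u)" if "u \<in> points U" for u using that by (simp add: p_def g_def compose_eq)
  show "compose (points U) act_L r \<in> plots L U"
    unfolding plots_L_iff
  proof (intro conjI ballI p(2))
    show "compose (points U) act_L r \<in> points U \<rightarrow>\<^sub>E C"
      using p(1) gplot_carrier[OF g] act_L_C rpg by (auto simp: compose_def PiE_iff)
    fix x assume "x \<in> points U"
    from p(3)[OF this] obtain S s where S: "S \<in> opens U" "x \<in> S"
      and s: "s \<in> cells (val P (open_sub U S)) 0" "\<forall>u\<in>S. p u = ev (open_sub U S) s u"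
      unfolding local_section_def by blast
    note V = opens_Cart[OF S(1)]
    have gS: "restrict g S \<in> gplots G (open_sub U S)" using plots_restrict[OF Gd _ S(1)] g by simp
    have "compose (points U) act_L r u = ev (open_sub U S) (\<rho> (open_sub U S) 0 (s, restrict g S)) u" if u: "u \<in> S" for u
      using act_ev[OF V _ s(1) gS, of u] u s(2) rpg opens_subset[OF S(1)] by (auto simp: compose_eq)
    then show "local_section (compose (points U) act_L r) U x"
      unfolding local_section_def using S act_cells[OF V s(1)] gS by auto
  qed
qed

lemma act_L_one: "a \<in> C \<Longrightarrow> act_L (a, \<one>\<^bsub>G\<^esub>) = a"
  using act_one[OF Rn_Cart C_cells] group.is_monoid[OF Gg]
  by (simp add: act_L_def monoid.one_closed restrict_points_R0 C_rep)

lemma act_L_mult: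
  assumes a: "a \<in> C" and g: "g \<in> carrier G" and h: "h \<in> carrier G"
  shows "act_L (act_L (a, g), h) = act_L (a, g \<otimes>\<^bsub>G\<^esub> h)"
proof -
  have "act_L (act_L (a, g), h) = rep (\<rho> (Rn 0) 0 (\<rho> (Rn 0) 0 (a, at0 g), at0 h))"
    using act_rep[OF act_cells[OF Rn_Cart C_cells[OF a], of "at0 g"] h] a g at0_gplot by (simp add: act_L_def)
  also have "\<dots> = act_L (a, g \<otimes>\<^bsub>G\<^esub> h)"
    using act_mult[OF Rn_Cart C_cells[OF a], of "at0 g" "at0 h"] at0_gplot g h a group.is_monoid[OF Gg]
    by (simp add: act_L_def monoid.m_closed restrict_points_R0)
  finally show ?thesis .
qed

lemma proj_act_L: "a \<in> C \<Longrightarrow> g \<in> carrier G \<Longrightarrow> proj_L (act_L (a, g)) = proj_L a"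
  using proj_rep[OF act_cells[OF Rn_Cart C_cells, of a "at0 g"]] proj_act[OF Rn_Cart C_cells, of a "at0 g"] at0_gplot
  by (simp add: act_L_def) (simp add: proj_L_def)

abbreviation "prodP \<equiv> psh_prod P (psh_discrete (dspace G))"
abbreviation "fibP \<equiv> psh_fibre_prod P \<pi>"
definition "shearP = (\<lambda>U\<in>Cart. srestrict (val prodP U) (\<lambda>n (p, g). (p, \<rho> U n (p, g))))"

lemma shearP_apply: "U \<in> Cart \<Longrightarrow> p \<in> cells (val P U) n \<Longrightarrow> g \<in> gplots G U \<Longrightarrow> shearP U n (p, g) = (p, \<rho> U n (p, g))"
  by (simp add: shearP_def srestrict_def)

text \<open>The form in which the local weak equivalence of the shear map is used: each member of
  the cover gives a square to which the results on components apply.\<close>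

lemma shear_squares:
  assumes U: "U \<in> Cart"
  shows "\<exists>\<U>. good_open_cover U \<U> \<and> (\<forall>S\<in>\<U>. sset_square (val prodP U) (val fibP U) (val prodP (open_sub U S)) (val fibP (open_sub U S))
    (shearP U) (shearP (open_sub U S)) (res prodP (open_sub U S) U (incl S)) (res fibP (open_sub U S) U (incl S)))"
proof -
  have w: "local_weak_equivalence prodP fibP shearP" using shear by (simp add: shearP_def)
  then have f: "psh_map prodP fibP shearP" by (simp add: local_weak_equivalence_def)
  note prodP = simplicial_presheaf_prod[OF P simplicial_presheaf_discrete[OF Gd]]
    and fibP = simplicial_presheaf_fibre_prod[OF P proj]
  obtain \<U> where c: "good_open_cover U \<U>" and l: "\<And>S n a y. S \<in> \<U> \<Longrightarrow>
      simplicial_map (boundary n) (fib (val prodP U)) a \<Longrightarrow> simplicial_map (std_simplex n) (fib (val fibP U)) y \<Longrightarrow>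
      scomp (boundary n) (fib_map (val prodP U) (val fibP U) (shearP U)) a = srestrict (boundary n) y \<Longrightarrow>
      \<exists>l. simplicial_map (std_simplex n) (fib (val prodP (open_sub U S))) l \<and>
        srestrict (boundary n) l = scomp (boundary n)
          (fib_map (val prodP U) (val prodP (open_sub U S)) (res prodP (open_sub U S) U (incl S))) a \<and>
        homotopic_rel_boundary n (fib (val fibP (open_sub U S)))
          (scomp (std_simplex n) (fib_map (val prodP (open_sub U S)) (val fibP (open_sub U S)) (shearP (open_sub U S))) l)
          (scomp (std_simplex n) (fib_map (val fibP U) (val fibP (open_sub U S)) (res fibP (open_sub U S) U (incl S))) y)"
    using w U unfolding local_weak_equivalence_def Let_def by metis
  have "sset_square (val prodP U) (val fibP U) (val prodP (open_sub U S)) (val fibP (open_sub U S))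
    (shearP U) (shearP (open_sub U S)) (res prodP (open_sub U S) U (incl S)) (res fibP (open_sub U S) U (incl S))" if S: "S \<in> \<U>" for S
  proof -
    have So: "S \<in> opens U" by (rule good_open_cover_opens[OF c S])
    note V = opens_Cart[OF So] and i = incl_cart_hom[OF U So]
    show ?thesis
      by (intro sset_square.intro presheaf_sset[OF prodP U] presheaf_sset[OF fibP U] presheaf_sset[OF prodP V]
          presheaf_sset[OF fibP V] psh_mapD(2)[OF f U] psh_mapD(2)[OF f V] presheaf_res[OF prodP i] presheaf_res[OF fibP i])
        (rule l[OF S])
  qed
  then show ?thesis using c by blast
qed

text \<open>A zigzag from \<open>b\<close> to \<open>c\<close> stays in the fibre of
  \<open>a\<close> because the base is discrete, so each of its edges can be paired with the
  degenerate edge at \<open>a\<close>.\<close>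

lemma conn_fibre:
  assumes a: "a \<in> cells K 0" and b: "b \<in> cells K 0" and ab: "\<pi> (Rn 0) 0 a = \<pi> (Rn 0) 0 b" and c: "conn K b c"
  shows "conn (val fibP (Rn 0)) (a, b) (a, c)"
  using c
proof (induct rule: conn_induct)
  case (step y z)
  have e: "edge (val fibP (Rn 0)) (a, y) (a, z)" if yz: "edge K y z" and y: "\<pi> (Rn 0) 0 a = \<pi> (Rn 0) 0 y" for y z
  proof -
    obtain x where x: "x \<in> cells K 1" "y = sop K 0 1 (vtx 0) x" "z = sop K 0 1 (vtx 1) x" using yz unfolding edge_def by blast
    have v: "vtx 0 \<in> Delta 0 1" by (rule vtx_Delta) simp
    \<comment> \<open>The degeneracy that makes the constant edge at \<open>a\<close>.\<close>
    let ?\<sigma> = "\<lambda>i\<in>{..1}. 0"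
    have \<sigma>: "?\<sigma> \<in> Delta 1 0" by (rule DeltaI) auto
    have sv: "compose {..0} ?\<sigma> (vtx i) = (\<lambda>i\<in>{..0}. i)" if "i \<le> 1" for i
      using that by (auto simp: vtx_def compose_def fun_eq_iff)
    have pm: "simplicial_map K (sdiscrete (plots X (Rn 0))) (\<pi> (Rn 0))" using psh_mapD(2)[OF proj Rn_Cart] Rn_Cart by simp
    let ?a = "sop K 1 0 ?\<sigma> a"
    have as: "?a \<in> cells K 1" by (rule sop_cells[OF K \<sigma> a])
    have "\<pi> (Rn 0) 1 ?a = \<pi> (Rn 0) 0 a"
      using simplicial_map_sop[OF pm \<sigma> a] simplicial_map_cells[OF pm a] \<sigma> by simp
    moreover have "\<pi> (Rn 0) 1 x = \<pi> (Rn 0) 0 y"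
      using simplicial_map_sop[OF pm v(1) x(1)] simplicial_map_cells[OF pm x(1)] v x(2) by simp
    ultimately have f: "(?a, x) \<in> cells (sfibre_prod K (\<pi> (Rn 0))) 1" using as x(1) y by simp
    have "sop (sfibre_prod K (\<pi> (Rn 0))) 0 1 (vtx i) (?a, x) = (a, sop K 0 1 (vtx i) x)" if i: "i \<le> 1" for i
      using sop_sfibre_prod[OF vtx_Delta[OF i] f] sop_compose[OF K vtx_Delta[OF i] \<sigma> a] sv[OF i] sop_id[OF K a] by simp
    from this[of 0] this[of 1] show ?thesis
      unfolding edge_def val_psh_fibre_prod[OF Rn_Cart] x(2,3) using f by (intro bexI[of _ "(?a, x)"]) simp_all
  qed
  have y: "\<pi> (Rn 0) 0 a = \<pi> (Rn 0) 0 y" unfolding ab by (rule proj_conn[OF step(1)])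
  have z: "\<pi> (Rn 0) 0 a = \<pi> (Rn 0) 0 z"
    unfolding y by (rule proj_conn[OF edge_conn_either[OF step(2)]])
  have "edge (val fibP (Rn 0)) (a, y) (a, z) \<or> edge (val fibP (Rn 0)) (a, z) (a, y)"
    using step(2) e[OF _ y, of z] e[OF _ z, of y] by (elim disjE) simp_all
  then show ?case by (rule conn_trans[OF step(3) edge_conn_either])
qed simp

text \<open>If both translates of \<open>a\<close> are connected, so are their pairs with
  \<open>a\<close> in the fibre product. Injectivity of the shear map on components over R^0
  connects \<open>(a, at0 g)\<close> to \<open>(a, at0 h)\<close>, and a component of the product
  has a single group coordinate.\<close>

lemma act_L_free:
  assumes a: "a \<in> C" and g: "g \<in> carrier G" and h: "h \<in> carrier G" and eq: "act_L (a, g) = act_L (a, h)"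
  shows "g = h"
proof -
  note R = Rn_Cart[of 0] and ac = C_cells[OF a] and gp = at0_gplot[OF g] and hp = at0_gplot[OF h]
  have gc: "at0 g \<in> carrier (grp (group_discrete G) (Rn 0) 0)" and hc: "at0 h \<in> carrier (grp (group_discrete G) (Rn 0) 0)"
    using gp hp by simp_all
  obtain \<U> where c: "good_open_cover (Rn 0) \<U>" and sq: "\<And>S. S \<in> \<U> \<Longrightarrow>
    sset_square (val prodP (Rn 0)) (val fibP (Rn 0)) (val prodP (open_sub (Rn 0) S)) (val fibP (open_sub (Rn 0) S))
    (shearP (Rn 0)) (shearP (open_sub (Rn 0) S)) (res prodP (open_sub (Rn 0) S) (Rn 0) (incl S)) (res fibP (open_sub (Rn 0) S) (Rn 0) (incl S))"
    using shear_squares[OF R] by blast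
  note sq0 = sq[OF good_open_cover_R0[OF c], unfolded open_sub_points[OF R] incl_points]
  have "conn K (\<rho> (Rn 0) 0 (a, at0 g)) (\<rho> (Rn 0) 0 (a, at0 h))"
    using eq a g h by (simp add: act_L_def rep_eq)
  from conn_fibre[OF ac act_cells[OF R ac gc] proj_act[OF R ac gc, symmetric] this]
 have "conn (val prodP (Rn 0)) (res prodP (Rn 0) (Rn 0) (\<lambda>x\<in>points (Rn 0). x) 0 (a, at0 g))
      (res prodP (Rn 0) (Rn 0) (\<lambda>x\<in>points (Rn 0). x) 0 (a, at0 h))"
    by (intro sset_square.components_inj[OF sq0]) (simp_all add: shearP_apply[OF R ac] ac gp hp R)
  then have c: "conn (sprod K (sdiscrete (gplots G (Rn 0)))) (a, at0 g) (a, at0 h)"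
    using presheaf_id[OF simplicial_presheaf_prod[OF P simplicial_presheaf_discrete[OF Gd]] R] ac gp hp R by (simp add: sid_def)
  let ?\<phi> = "\<lambda>n. restrict snd (cells (sprod K (sdiscrete (gplots G (Rn 0)))) n)"
  have "simplicial_map (sprod K (sdiscrete (gplots G (Rn 0)))) (sdiscrete (gplots G (Rn 0))) ?\<phi>"
    by (rule simplicial_mapI) (auto simp: sop_cells[OF K])
  from conn_discrete[OF conn_map[OF this c]] show ?thesis using ac gp hp by simp
qed

text \<open>Near \<open>x\<close> both plots come from sections with the same projection, that is,
  from a vertex of the fibre product. Surjectivity of the shear map on components gives, on a
  smaller neighbourhood, a section \<open>r\<close> and a plot \<open>g\<close> whose shear is
  connected to this vertex; evaluation sees only components.\<close>

lemma difference_local: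
  assumes p: "p \<in> plots L U" and q: "q \<in> plots L U" and eq: "\<And>u. u \<in> points U \<Longrightarrow> proj_L (p u) = proj_L (q u)"
    and x: "x \<in> points U"
  shows "\<exists>S\<in>opens U. x \<in> S \<and> (\<exists>g\<in>gplots G (open_sub U S). \<forall>u\<in>S. q u = act_L (p u, g u))"
proof -
  have U: "U \<in> Cart" using p by (simp add: plots_L_iff)
  obtain S s where S: "S \<in> opens U" "x \<in> S" and s: "s \<in> cells (val P (open_sub U S)) 0" "\<And>u. u \<in> S \<Longrightarrow> p u = ev (open_sub U S) s u"
    using p x unfolding plots_L_iff local_section_def by blast
  obtain T t where T: "T \<in> opens U" "x \<in> T" and t: "t \<in> cells (val P (open_sub U T)) 0" "\<And>u. u \<in> T \<Longrightarrow> q u = ev (open_sub U T) t u"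
    using q x unfolding plots_L_iff local_section_def by blast
  obtain B where B: "B \<in> opens U" "x \<in> B" "B \<subseteq> S" "B \<subseteq> T" using opens_Int_basis[OF U S(1) T(1) S(2) T(2)] by blast
  let ?V = "open_sub U B"
  note V = opens_Cart[OF B(1)]
  obtain s' where s': "s' \<in> cells (val P ?V) 0" "\<And>u. u \<in> B \<Longrightarrow> p u = ev ?V s' u"
    using local_section_smaller[OF U S(1) B(1,3) s] by blast
  obtain t' where t': "t' \<in> cells (val P ?V) 0" "\<And>u. u \<in> B \<Longrightarrow> q u = ev ?V t' u"
    using local_section_smaller[OF U T(1) B(1,4) t] by blast
  have "\<pi> ?V 0 s' = \<pi> ?V 0 t'"
  proof (rule extensionalityI[of _ B])
    show "\<pi> ?V 0 s' \<in> extensional B" "\<pi> ?V 0 t' \<in> extensional B"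
      using plots_PiE[OF X proj_plot[OF V s'(1)]] plots_PiE[OF X proj_plot[OF V t'(1)]] by (auto simp: PiE_iff)
    show "\<pi> ?V 0 s' u = \<pi> ?V 0 t' u" if u: "u \<in> B" for u
      using eq[of u] proj_ev[OF V _ s'(1), of u] proj_ev[OF V _ t'(1), of u] s'(2) t'(2) opens_subset[OF B(1)] u by auto
  qed
  then have st: "(s', t') \<in> cells (val fibP ?V) 0" using s' t' V by simp
  obtain \<V> where c: "good_open_cover ?V \<V>" and sq: "\<And>S. S \<in> \<V> \<Longrightarrow>
    sset_square (val prodP ?V) (val fibP ?V) (val prodP (open_sub ?V S)) (val fibP (open_sub ?V S))
    (shearP ?V) (shearP (open_sub ?V S)) (res prodP (open_sub ?V S) ?V (incl S)) (res fibP (open_sub ?V S) ?V (incl S))"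
    using shear_squares[OF V] by blast
  obtain Z where Z: "Z \<in> \<V>" "x \<in> Z" using good_open_cover_covers[OF c, of x] B(2) by auto
  have Zo: "Z \<in> opens ?V" by (rule good_open_cover_opens[OF c Z(1)])
  have ZB: "Z \<subseteq> B" using opens_subset[OF Zo] by simp
  have W': "open_sub ?V Z = open_sub U Z" by (rule open_sub_open_sub[OF ZB])
  let ?W = "open_sub U Z"
  have W: "?W \<in> Cart" using opens_Cart[OF Zo] W' by simp
  have i: "incl Z \<in> cart_hom ?W ?V" using incl_cart_hom[OF V Zo] W' by simp
  obtain z where z: "z \<in> cells (val prodP ?W) 0" "conn (val fibP ?W) (shearP ?W 0 z) (res fibP ?W ?V (incl Z) 0 (s', t'))"
    using sset_square.components_surj[OF sq[OF Z(1)] st] unfolding W' by blast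
  obtain r g where rg: "z = (r, g)" "r \<in> cells (val P ?W) 0" "g \<in> gplots G ?W" using z(1) W by auto
  have rfib: "res fibP ?W ?V (incl Z) 0 (s', t') = (res P ?W ?V (incl Z) 0 s', res P ?W ?V (incl Z) 0 t')"
    by (rule res_psh_fibre_prod[OF i]) (use st V in simp)
  have c': "conn (sfibre_prod (val P ?W) (\<pi> ?W)) (r, \<rho> ?W 0 (r, g)) (res P ?W ?V (incl Z) 0 s', res P ?W ?V (incl Z) 0 t')"
    using z(2) shearP_apply[OF W rg(2,3)] rfib rg(1) W by simp
  let ?F = "sfibre_prod (val P ?W) (\<pi> ?W)"
  \<comment> \<open>The two projections of the fibre product split the connection of pairs into
    connections of \<open>r\<close> with the first section and of the translate of \<open>r\<close>
    with the second.\<close>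
  have m: "simplicial_map ?F (val P ?W) (\<lambda>n. restrict fst (cells ?F n))" "simplicial_map ?F (val P ?W) (\<lambda>n. restrict snd (cells ?F n))"
    using sop_cells[OF simplicial_set_sfibre_prod[OF presheaf_sset[OF P W] psh_mapD(2)[OF proj W]]]
    by (auto intro!: simplicial_mapI)
  have st': "(res P ?W ?V (incl Z) 0 s', res P ?W ?V (incl Z) 0 t') \<in> cells ?F 0"
    using presheaf_cells[OF simplicial_presheaf_fibre_prod[OF P proj] i st]
      rfib W by simp
  have rg': "(r, \<rho> ?W 0 (r, g)) \<in> cells ?F 0"
    using act_cells[OF W rg(2), of g] proj_act[OF W rg(2), of g] rg by simp
  have c1: "conn (val P ?W) r (res P ?W ?V (incl Z) 0 s')" and c2: "conn (val P ?W) (\<rho> ?W 0 (r, g)) (res P ?W ?V (incl Z) 0 t')"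
    using conn_map[OF m(1) c'] conn_map[OF m(2) c'] st' rg' by simp_all
  have "q u = act_L (p u, g u)" if u: "u \<in> Z" for u
  proof -
    have uW: "u \<in> points ?W" using u by simp
    have "p u = ev ?W r u" "q u = ev ?W (\<rho> ?W 0 (r, g)) u"
      using ev_conn[OF W uW c1] ev_conn[OF W uW c2] ev_res[OF i s'(1) uW] ev_res[OF i t'(1) uW] s'(2)[of u] t'(2)[of u] u ZB
      by (auto simp: incl_def)
    then show ?thesis using act_ev[OF W uW rg(2,3)] by simp
  qed
  then show ?thesis using opens_trans[OF U B(1) Zo] Z(2) rg(3) by blast
qed

abbreviation "shear_L \<equiv> (\<lambda>(a, g)\<in>C \<times> carrier G. (a, act_L (a, g)))"
abbreviation "fibre_L \<equiv> {(a, b). a \<in> C \<and> b \<in> C \<and> proj_L a = proj_L b}"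

text \<open>Injectivity is freeness. For transitivity on fibres, \<open>difference_local\<close> is
  applied to the one-point plots at \<open>a\<close> and \<open>b\<close>.\<close>

lemma shear_L_bij: "bij_betw shear_L (C \<times> carrier G) fibre_L"
  unfolding bij_betw_def
proof
  show "inj_on shear_L (C \<times> carrier G)" using act_L_free by (auto simp: inj_on_def)
  have "\<exists>g\<in>carrier G. b = act_L (a, g)" if ab: "a \<in> C" "b \<in> C" "proj_L a = proj_L b" for a b
  proof -
    have "at0 a \<in> plots L (Rn 0)" "at0 b \<in> plots L (Rn 0)"
      using const_plot[OF diffeological_space_L Rn_Cart] ab by (simp_all add: at0_def)
    from difference_local[OF this, of pt] obtain S g where S: "S \<in> opens (Rn 0)" "pt \<in> S" "g \<in> gplots G (open_sub (Rn 0) S)"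
      "\<forall>u\<in>S. at0 b u = act_L (at0 a u, g u)" using ab by (auto simp: at0_def)
    then show ?thesis using gplot_carrier[OF S(3), of pt] by force
  qed
  note ex = this
  show "shear_L ` (C \<times> carrier G) = fibre_L"
  proof
    show "shear_L ` (C \<times> carrier G) \<subseteq> fibre_L" using act_L_C proj_act_L by auto
    show "fibre_L \<subseteq> shear_L ` (C \<times> carrier G)"
    proof clarify
      fix a b assume ab: "a \<in> C" "b \<in> C" "proj_L a = proj_L b"
      from ex[OF this] obtain g where "g \<in> carrier G" "b = act_L (a, g)" by blast
      then show "(a, b) \<in> shear_L ` (C \<times> carrier G)" using ab by (intro image_eqI[of _ _ "(a, g)"]) simp_all
    qed
  qed
qed

text \<open>For the inverse, the group coordinate is determined pointwise. Freeness identifies it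
  locally with the smooth difference from \<open>difference_local\<close>, so it is a plot.\<close>

lemma diffeo_shear_L: "diffeo (dprod L (dspace G)) (dfibre_prod L proj_L) shear_L"
  unfolding diffeo_def
proof (intro conjI)
  have car: "carrier (dprod L (dspace G)) = C \<times> carrier G" "carrier (dfibre_prod L proj_L) = fibre_L"
    by (simp_all add: dfibre_prod_def)
  show "bij_betw shear_L (carrier (dprod L (dspace G))) (carrier (dfibre_prod L proj_L))" unfolding car by (rule shear_L_bij)
  show "dsmooth (dprod L (dspace G)) (dfibre_prod L proj_L) shear_L"
    unfolding dsmooth_def car
  proof (intro conjI allI ballI)
    show "shear_L \<in> C \<times> carrier G \<rightarrow>\<^sub>E fibre_L" using act_L_C proj_act_L by auto
    fix U r assume r: "r \<in> plots (dprod L (dspace G)) U"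
    then have rP: "r \<in> points U \<rightarrow>\<^sub>E C \<times> carrier G" and r1: "compose (points U) fst r \<in> plots L U" by (simp_all add: dprod_def)
    have "compose (points U) fst (compose (points U) shear_L r) = compose (points U) fst r"
      "compose (points U) snd (compose (points U) shear_L r) = compose (points U) act_L r"
      using rP by (auto simp: compose_def fun_eq_iff PiE_iff split: prod.splits)
    moreover have "compose (points U) shear_L r \<in> points U \<rightarrow>\<^sub>E fibre_L"
      using rP act_L_C proj_act_L by (auto simp: compose_def PiE_iff split: prod.splits)
    ultimately show "compose (points U) shear_L r \<in> plots (dfibre_prod L proj_L) U"
      using r1 dsmoothD(2)[OF dsmooth_act_L r] by (simp add: dfibre_prod_def)
  qed
  show "dsmooth (dfibre_prod L proj_L) (dprod L (dspace G))
      (restrict (inv_into (carrier (dprod L (dspace G))) shear_L) (carrier (dfibre_prod L proj_L)))"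
    unfolding dsmooth_def car
  proof (intro conjI allI ballI)
    let ?F = "restrict (inv_into (C \<times> carrier G) shear_L) fibre_L"
    have F: "?F y \<in> C \<times> carrier G \<and> shear_L (?F y) = y" if "y \<in> fibre_L" for y
    proof -
      have y: "y \<in> shear_L ` (C \<times> carrier G)" unfolding bij_betw_imp_surj_on[OF shear_L_bij] by (rule that)
      show ?thesis unfolding restrict_apply'[OF that] by (intro conjI inv_into_into[OF y] f_inv_into_f[OF y])
    qed
    show "?F \<in> fibre_L \<rightarrow>\<^sub>E C \<times> carrier G"
    proof (rule PiE_I)
      show "?F y \<in> C \<times> carrier G" if "y \<in> fibre_L" for y by (rule conjunct1[OF F[OF that]])
      show "?F y = undefined" if "y \<notin> fibre_L" for y unfolding restrict_apply if_not_P[OF that] ..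
    qed
    fix U r assume r: "r \<in> plots (dfibre_prod L proj_L) U"
    define p q where "p = compose (points U) fst r" and "q = compose (points U) snd r"
    have rP: "r \<in> points U \<rightarrow>\<^sub>E fibre_L" and p: "p \<in> plots L U" and q: "q \<in> plots L U"
      using r by (simp_all add: dfibre_prod_def p_def q_def)
    have U: "U \<in> Cart" using p by (simp add: plots_L_iff)
    have rpq: "r u = (p u, q u)" "(p u, q u) \<in> fibre_L" if "u \<in> points U" for u
      using that PiE_mem[OF rP that] by (simp_all add: p_def q_def compose_eq)
    define g where "g = compose (points U) (\<lambda>y. snd (?F y)) r"
    have Fg: "?F (p u, q u) = (p u, g u)" "g u \<in> carrier G" "q u = act_L (p u, g u)" if u: "u \<in> points U" for u
    proof -
      obtain a h where ah: "?F (p u, q u) = (a, h)" by fastforce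
      have "a \<in> C \<and> h \<in> carrier G \<and> (a, act_L (a, h)) = (p u, q u)" using F[OF rpq(2)[OF u]] unfolding ah by auto
      moreover have "g u = h" using u ah rpq(1)[OF u] by (simp add: g_def compose_eq del: restrict_apply)
      ultimately show "?F (p u, q u) = (p u, g u)" "g u \<in> carrier G" "q u = act_L (p u, g u)" using ah by auto
    qed
    have "g \<in> plots (dspace G) U"
    proof (rule plots_local[OF Gd U])
      show "g \<in> points U \<rightarrow>\<^sub>E carrier (dspace G)" using Fg(2) by (auto simp: g_def compose_def)
      fix x assume x: "x \<in> points U"
      obtain S h where S: "S \<in> opens U" "x \<in> S" and h: "h \<in> gplots G (open_sub U S)" "\<And>u. u \<in> S \<Longrightarrow> q u = act_L (p u, h u)"
        using difference_local[OF p q _ x] rpq(2) by auto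
      \<comment> \<open>Both functions translate \<open>p u\<close> to \<open>q u\<close>, so
        freeness of the action makes them equal.\<close>
      have "restrict g S = h"
      proof (rule extensionalityI[of _ S])
        show "h \<in> extensional S" using plots_PiE[OF Gd, of h "open_sub U S"] h(1) by (simp add: PiE_iff)
        fix u assume u: "u \<in> S"
        then have uU: "u \<in> points U" using opens_subset[OF S(1)] by auto
        have "g u = h u"
          using Fg(2,3)[OF uU] h(2)[OF u] rpq(2)[OF uU] gplot_carrier[OF h(1), of u] u by (intro act_L_free[of "p u"]) simp_all
        then show "restrict g S u = h u" using u by simp
      qed simp
      then show "\<exists>S\<in>opens U. x \<in> S \<and> restrict g S \<in> plots (dspace G) (open_sub U S)" using S h(1) by auto
    qed
    from dprod_plotI[OF diffeological_space_L Gd p this]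
    have "(\<lambda>u\<in>points U. (p u, g u)) \<in> plots (dprod L (dspace G)) U" .
    moreover have "compose (points U) ?F r = (\<lambda>u\<in>points U. (p u, g u))"
      unfolding compose_def by (rule restrict_ext) (simp only: rpq(1) Fg(1))
    ultimately show "compose (points U) ?F r \<in> plots (dprod L (dspace G)) U" by simp
  qed
qed

definition LE :: "('u, 'g, 'x) dbundle" where
  "LE = \<lparr>dtotal = L, dproj = proj_L, dact = act_L\<rparr>"

lemma LE_simps [simp]: "dtotal LE = L" "dproj LE = proj_L" "dact LE = act_L"
  by (simp_all add: LE_def)

lemma LE_Ob: "LE \<in> Ob (DiffPrin X G)"
  using diffeological_space_L subduction_L dsmooth_act_L act_L_one act_L_mult diffeo_shear_L
  by (simp add: diff_principal_bundle_def Let_def)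

end

section \<open>The universal property\<close>

context component_bundle
begin

text \<open>A simplex is sent to the evaluation of its initial vertex. Any other vertex would give
  the same function, as all vertices of a simplex lie in one component.\<close>

definition unit :: "manifold \<Rightarrow> nat \<Rightarrow> 'u \<Rightarrow> 'u" where
  "unit = (\<lambda>U\<in>Cart. srestrict (val P U) (\<lambda>n x. e (\<lambda>u\<in>points U. ev U (vert (val P U) n x) u)))"

lemma unit_apply: "U \<in> Cart \<Longrightarrow> x \<in> cells (val P U) n \<Longrightarrow> unit U n x = e (\<lambda>u\<in>points U. ev U (vert (val P U) n x) u)"
  by (simp add: unit_def srestrict_def)

lemma vert_psh_map:
  assumes f: "psh_map P B \<phi>" and U: "U \<in> Cart" and x: "x \<in> cells (val P U) n"
  shows "\<phi> U 0 (vert (val P U) n x) = vert (val B U) n (\<phi> U n x)"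
  unfolding vert_def by (rule simplicial_map_sop[OF psh_mapD(2)[OF f U] vtx_Delta[OF le0] x])

lemma vert_sdiscrete: "x \<in> A \<Longrightarrow> vert (sdiscrete A) n x = x"
  by (simp add: vert_def vtx_Delta)

lemma vert_P: "U \<in> Cart \<Longrightarrow> x \<in> cells (val P U) n \<Longrightarrow> vert (val P U) n x \<in> cells (val P U) 0"
  by (rule vert_cells[OF presheaf_sset[OF P]])

lemma unit_mor: "unit \<in> Mor InfB E (Ro LE)"
  unfolding Mor_PrinInf_iff itotal_Ro LE_simps
proof (intro conjI ballI allI)
  show "psh_map P (emb L) unit"
  proof (rule psh_mapI)
    show "unit \<in> extensional Cart" by (simp add: unit_def)
    show "simplicial_map (val P U) (val (emb L) U) (unit U)" if U: "U \<in> Cart" for U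
    proof (rule simplicial_mapI)
      show "unit U n \<in> extensional (cells (val P U) n)" for n using U by (simp add: unit_def srestrict_def)
      show cl: "unit U n x \<in> cells (val (emb L) U) n" if "x \<in> cells (val P U) n" for n x
        using ev_plot[OF U vert_P[OF U that]] by (simp add: unit_apply[OF U that] U)
      fix m n \<alpha> x assume a: "\<alpha> \<in> Delta m n" and x: "x \<in> cells (val P U) n"
      note ax = sop_cells[OF presheaf_sset[OF P U] a x]
      have "unit U m (sop (val P U) m n \<alpha> x) = unit U n x"
        unfolding unit_apply[OF U x] unit_apply[OF U ax] e_eq
        by (rule restrict_ext, rule ev_conn[OF U _ conn_sym[OF conn_vert_sop[OF presheaf_sset[OF P U] x a]]])
      then show "unit U m (sop (val P U) m n \<alpha> x) = sop (val (emb L) U) m n \<alpha> (unit U n x)"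
        using cl[OF x] a U by simp
    qed
    fix V U f n x assume f: "f \<in> cart_hom V U" and x: "x \<in> cells (val P U) n"
    note VU = cart_hom_Cart[OF f] and v = vert_P[OF cart_hom_Cart(2)[OF f] x]
    have "vert (val P V) n (res P V U f n x) = res P V U f 0 (vert (val P U) n x)"
      unfolding vert_def by (rule simplicial_map_sop[OF presheaf_res[OF P f] vtx_Delta[OF le0] x, symmetric])
    moreover have "(\<lambda>w\<in>points V. ev V (res P V U f 0 (vert (val P U) n x)) w) =
        compose (points V) (\<lambda>u\<in>points U. ev U (vert (val P U) n x) u) f"
      unfolding compose_def by (rule restrict_ext) (simp add: ev_res[OF f v] PiE_mem[OF cart_hom_PiE[OF f]])
    ultimately show "unit V n (res P V U f n x) = res (emb L) V U f n (unit U n x)"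
      unfolding unit_apply[OF VU(2) x] unit_apply[OF VU(1) presheaf_cells[OF P f x]] res_emb[OF f ev_plot[OF VU(2) v]]
      by simp
  qed
  fix U n x assume U: "U \<in> Cart" and x: "x \<in> cells (val P U) n"
  note v = vert_P[OF U x] and pl = ev_plot[OF U vert_P[OF U x]]
  have "compose (points U) proj_L (\<lambda>u\<in>points U. ev U (vert (val P U) n x) u) = \<pi> U 0 (vert (val P U) n x)"
    by (rule extensionalityI[of _ "points U"])
      (use plots_PiE[OF X proj_plot[OF U v]] proj_ev[OF U _ v] in \<open>auto simp: compose_eq PiE_iff\<close>)
  also have "\<dots> = \<pi> U n x"
    unfolding vert_psh_map[OF proj U x] using proj_plot[OF U x] U by (simp add: vert_sdiscrete)
  finally show "iproj (Ro LE) U n (unit U n x) = \<pi> U n x"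
    unfolding unit_apply[OF U x] using U pl by simp
  fix g assume "g \<in> carrier (grp (group_discrete G) U n)"
  then have g: "g \<in> gplots G U" by simp
  have z: "(x, g) \<in> cells (val (psh_prod P (underlying (group_discrete G))) U) n" using x g U by simp
  have "vert (val P U) n (\<rho> U n (x, g)) = \<rho> U 0 (vert (val P U) n x, g)"
    unfolding vert_def using simplicial_map_sop[OF psh_mapD(2)[OF act U] vtx_Delta[OF le0] z] x g U
    by (simp add: vtx_Delta)
  moreover have "(\<lambda>u\<in>points U. ev U (\<rho> U 0 (vert (val P U) n x, g)) u) =
      (\<lambda>u\<in>points U. act_L ((\<lambda>u\<in>points U. ev U (vert (val P U) n x) u) u, g u))"
    by (rule restrict_ext) (simp add: act_ev[OF U _ v g])
  ultimately show "unit U n (\<rho> U n (x, g)) = iact (Ro LE) U n (unit U n x, g)"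
    using unit_apply[OF U x] unit_apply[OF U act_cells[OF U x, of g]] iact_Ro[OF U, of _ LE g n] pl g by simp
qed

text \<open>The target is simplicially discrete, so \<open>\<phi>\<close> is constant on components;
  its values over R^0 define \<open>m\<close> on representatives. On a section over
  \<open>V\<close>, naturality at the points of \<open>V\<close> shows that \<open>\<phi>\<close> is
  \<open>m\<close> applied to the evaluation, which makes \<open>m\<close> smooth on the local
  sections defining the plots of \<open>L\<close>.\<close>

lemma universal:
  assumes d: "d \<in> Ob DiffB" and f: "\<phi> \<in> Mor InfB E (Ro d)"
  shows "\<exists>!m. m \<in> Mor DiffB LE d \<and> \<phi> = Comp InfB E (Ro LE) (Ro d) (Ra LE d m) unit"
proof (rule ex1I)
  interpret d: embedded_bundle X G e d by (rule embedded[OF d])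
  have \<phi>: "psh_map P (emb d.P) \<phi>" using mor_map[OF f] by simp
  define m where "m = (\<lambda>a\<in>C. dec (\<phi> (Rn 0) 0 a) pt)"
  have \<phi>0: "simplicial_map K (sdiscrete (e ` plots d.P (Rn 0))) (\<phi> (Rn 0))"
    using psh_mapD(2)[OF \<phi> Rn_Cart] Rn_Cart by simp
  have mrep: "\<phi> (Rn 0) 0 a = e (at0 (m (rep a))) \<and> m (rep a) \<in> carrier d.P" if a: "a \<in> cells K 0" for a
  proof -
    have "\<phi> (Rn 0) 0 a = \<phi> (Rn 0) 0 (rep a)"
      by (rule conn_discrete[OF conn_map[OF \<phi>0 conn_rep]])
    moreover obtain q where q: "\<phi> (Rn 0) 0 (rep a) = e q" "q \<in> plots d.P (Rn 0)"
      using simplicial_map_cells[OF \<phi>0 rep_cells[OF a]] by auto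
    moreover note at0_expand[OF plots_PiE[OF d.P q(2)]] PiE_mem[OF plots_PiE[OF d.P q(2)] pt_R0]
    ultimately show ?thesis using rep_C[OF a] by (simp add: m_def)
  qed
  have mC: "\<phi> (Rn 0) 0 a = e (at0 (m a))" "m a \<in> carrier d.P" if a: "a \<in> C" for a
    using mrep[OF C_cells[OF a]] C_rep[OF a] by simp_all
  have mev: "\<phi> V 0 s = e (\<lambda>u\<in>points V. m (ev V s u)) \<and> (\<lambda>u\<in>points V. m (ev V s u)) \<in> plots d.P V"
    if V: "V \<in> Cart" and s: "s \<in> cells (val P V) 0" for V s
  proof -
    obtain q where q: "\<phi> V 0 s = e q" "q \<in> plots d.P V" using psh_map_cells[OF \<phi> V s] V by auto
    have "m (ev V s u) = q u" if u: "u \<in> points V" for u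
    proof -
      note h = at0_cart_hom[OF V u]
      have "e (at0 (m (ev V s u))) = e (at0 (q u))"
        using psh_mapD(3)[OF \<phi> h s] mrep[OF presheaf_cells[OF P h s]] q h by (simp add: ev_def)
      then show ?thesis by simp
    qed
    then have "(\<lambda>u\<in>points V. m (ev V s u)) = q"
      using plots_PiE[OF d.P q(2)] by (intro extensionalityI[of _ "points V"]) (auto simp: PiE_iff)
    then show ?thesis using q by simp
  qed
  have m: "m \<in> Mor DiffB LE d"
    unfolding Mor_DiffPrin_iff LE_simps carrier_L
  proof (intro conjI ballI)
    show "dsmooth L d.P m"
      unfolding dsmooth_def
    proof (intro conjI allI ballI)
      show "m \<in> carrier L \<rightarrow>\<^sub>E carrier d.P" using mC(2) by (auto simp: m_def)
      fix U p assume "p \<in> plots L U"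
      then have p: "p \<in> points U \<rightarrow>\<^sub>E C" "U \<in> Cart" "\<And>x. x \<in> points U \<Longrightarrow> local_section p U x" by (simp_all add: plots_L_iff)
      show "compose (points U) m p \<in> plots d.P U"
      proof (rule plots_local[OF d.P p(2)])
        show "compose (points U) m p \<in> points U \<rightarrow>\<^sub>E carrier d.P" using p(1) mC(2) by (auto simp: compose_def PiE_iff)
        fix x assume "x \<in> points U"
        from p(3)[OF this] obtain S s where S: "S \<in> opens U" "x \<in> S"
          and s: "s \<in> cells (val P (open_sub U S)) 0" "\<forall>u\<in>S. p u = ev (open_sub U S) s u"
          unfolding local_section_def by blast
        note V = opens_Cart[OF S(1)]
        have "restrict (compose (points U) m p) S = (\<lambda>u\<in>points (open_sub U S). m (ev (open_sub U S) s u))"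
          unfolding open_sub_simps by (rule restrict_ext) (use s(2) opens_subset[OF S(1)] in \<open>auto simp: compose_eq\<close>)
        then show "\<exists>S\<in>opens U. x \<in> S \<and> restrict (compose (points U) m p) S \<in> plots d.P (open_sub U S)"
          using S mev[OF V s(1)] by (intro bexI[of _ S]) simp_all
      qed
    qed
    fix a assume a: "a \<in> C"
    note ac = C_cells[OF a]
    have ma: "at0 (m a) \<in> plots d.P (Rn 0)" unfolding at0_def by (rule const_plot[OF d.P Rn_Cart mC(2)[OF a]])
    have "iproj (Ro d) (Rn 0) 0 (\<phi> (Rn 0) 0 a) = \<pi> (Rn 0) 0 a"
      using f Rn_Cart ac unfolding Mor_PrinInf_iff by blast
    then have "at0 (d.\<pi> (m a)) = \<pi> (Rn 0) 0 a" unfolding mC(1)[OF a] iproj_Ro[OF Rn_Cart ma] by simp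
    from fun_cong[OF this, of pt] show "d.\<pi> (m a) = proj_L a" using a by (simp add: proj_L_def)
    fix g assume g: "g \<in> carrier G"
    note gp = at0_gplot[OF g]
    have "\<phi> (Rn 0) 0 (\<rho> (Rn 0) 0 (a, at0 g)) = iact (Ro d) (Rn 0) 0 (\<phi> (Rn 0) 0 a, at0 g)"
      using f Rn_Cart ac gp unfolding Mor_PrinInf_iff group_discrete_simps by blast
    moreover have "\<rho> (Rn 0) 0 (a, at0 g) \<in> cells K 0" using act_cells[OF Rn_Cart ac] gp by simp
    ultimately show "m (act_L (a, g)) = d.\<rho> (m a, g)"
      using mrep[of "\<rho> (Rn 0) 0 (a, at0 g)"] iact_Ro[OF Rn_Cart ma gp, of 0] a g
      by (simp add: mC(1)[OF a] act_L_def restrict_points_R0)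
  qed
  have "\<phi> = Comp InfB E (Ro LE) (Ro d) (Ra LE d m) unit"
  proof (rule psh_map_eqI[OF mor_map[OF f] mor_map[OF mor_comp[OF unit_mor Ra_mor[OF LE_Ob d m]]]])
    fix U n x assume U: "U \<in> Cart" and x: "x \<in> cells (val P U) n"
    note v = vert_P[OF U x]
    have "\<phi> U n x = \<phi> U 0 (vert (val P U) n x)"
      unfolding vert_psh_map[OF \<phi> U x] using psh_map_cells[OF \<phi> U x] U by (simp add: vert_sdiscrete)
    also have "\<dots> = e (compose (points U) m (\<lambda>u\<in>points U. ev U (vert (val P U) n x) u))"
      using mev[OF U v] by (simp add: compose_def cong: restrict_cong)
    finally show "\<phi> U n x = Comp InfB E (Ro LE) (Ro d) (Ra LE d m) unit U n x"
      using U x ev_plot[OF U v] by (simp add: scomp_def compose_eq unit_apply)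
  qed
  then show "m \<in> Mor DiffB LE d \<and> \<phi> = Comp InfB E (Ro LE) (Ro d) (Ra LE d m) unit" using m by simp
  fix k assume k: "k \<in> Mor DiffB LE d \<and> \<phi> = Comp InfB E (Ro LE) (Ro d) (Ra LE d k) unit"
  show "k = m"
  proof (rule extensionalityI[of _ C])
    show "k \<in> extensional C" using k by (auto simp: Mor_DiffPrin_iff dsmooth_def PiE_iff)
    show "m \<in> extensional C" by (simp add: m_def)
    fix a assume a: "a \<in> C"
    note ac = C_cells[OF a]
    \<comment> \<open>Over R^0 the unit sends each representative to its own one-point plot, so the
      factorization determines \<open>k\<close> on all of \<open>C\<close>.\<close>
    have u: "unit (Rn 0) 0 a = e (at0 a)"
      unfolding unit_apply[OF Rn_Cart ac] restrict_points_R0 vert_0[OF K ac] ev_R0[OF ac] C_rep[OF a] ..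
    have "at0 a \<in> plots L (Rn 0)" unfolding at0_def by (rule const_plot[OF diffeological_space_L Rn_Cart]) (simp add: a)
    then have "\<phi> (Rn 0) 0 a = e (at0 (k a))"
      using conjunct2[OF k] ac u Rn_Cart by (simp add: scomp_def compose_eq)
    then show "k a = m a" using mC(1)[OF a] by simp
  qed
qed

end

theorem theorem6p8:
  fixes X :: "'u diffspace" and G :: "'u dgroup"
  assumes "closed_under_plots TYPE('u)"
    and "diffeological_space X" and "diffeological_group G"
  shows "weakly_homotopy_equivalent
    (nerve (PrinInf (psh_discrete X) (group_discrete G)
              :: (('u, point \<Rightarrow> 'u, point \<Rightarrow> 'u) ibundle, _) cat))
    (nerve (DiffPrin X G :: (('u, 'u, 'u) dbundle, _) cat))"
proof -
  obtain e :: "(point \<Rightarrow> 'u) \<Rightarrow> 'u" where e: "inj e" using assms(1) by (auto simp: closed_under_plots_def)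
  interpret plot_embedding X G e by (rule plot_embedding.intro[OF assms(2,3) e])
  let ?C = "InfB :: (('u, point \<Rightarrow> 'u, point \<Rightarrow> 'u) ibundle, _) cat"
  interpret reflective_subcategory ?C DiffB Ro Ra
  proof
    show "category ?C" by (rule category_PrinInf) simp
    show "category DiffB" by (rule category_DiffPrin[OF X G])
    fix c assume c: "c \<in> Ob ?C"
    interpret component_bundle X G e c
      by (intro component_bundle.intro plot_embedding_axioms inf_bundle_discrete[OF c])
    show "\<exists>d\<in>Ob DiffB. \<exists>\<eta>\<in>Mor ?C c (Ro d). \<forall>e\<in>Ob DiffB. \<forall>f\<in>Mor ?C c (Ro e).
      \<exists>!m. m \<in> Mor DiffB d e \<and> f = Comp ?C c (Ro d) (Ro e) (Ra d e m) \<eta>"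
      using LE_Ob unit_mor universal by blast
  qed (fact Ro_Ob Ro_inj Ra_mor Ra_id Ra_comp Ra_full Ra_faithful)+
  show ?thesis by (rule nerve_weakly_homotopy_equivalent)
qed

end
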